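(* There exist an open cover $\{U_1,U_2\}$ of the circle $S^1$ and two morphisms $f,g:\{S^1\rightrightarrows S^1\}\to\{\mathbb{Z}/2\rightrightarrows *\}$ in the localized category $\mathsf{Gp}[W^{-1}]$ such that $f|_{U_i}=g|_{U_i}$ for $i=1,2$, but $f\neq g$.
   Context: Lie groupoids. A groupoid is a small category in which all morphisms are invertible. A Lie groupoid $G=\{G_1\rightrightarrows G_0\}$ is a groupoid whose set of objects $G_0$ and set of arrows $G_1$ are Hausdorff paracompact smooth manifolds, whose source and target maps $s,t:G_1\to G_0$ are submersions, and whose remaining structure maps (unit, multiplication, inverse) are smooth. A smooth functor between Lie groupoids is a functor that is smooth on objects and on arrows. Two smooth functors $f,g:G\to H$ are isomorphic if there is a smooth natural transformation $\alpha:G_0\to H_1$ from $f$ to $g$ (automatically a natural isomorphism). A manifold $M$ is regarded as the Lie groupoid $\{M\rightrightarrows M\}$ with only identity arrows. $\{\mathbb{Z}/2\rightrightarrows *\}$ is the (discrete) group $\mathbb{Z}/2$ regarded as a Lie groupoid with one object. A smooth functor $F:G\to H$ of Lie groupoids is an equivalence of Lie groupoids if (1) the map $G_1\to (G_0\times G_0)\times_{(F,F),\,H_0\times H_0,\,(s,t)}H_1$, $\gamma\mapsto (s(\gamma),t(\gamma),F(\gamma))$, is a diffeomorphism, and (2) the map $G_0\times_{F,H_0,t}H_1\to H_0$, $(x,h)\mapsto s(h)$, is a surjective submersion. (Fiber products: $X\times_{f,Z,g}Y=\{(x,y): f(x)=g(y)\}$.) $\mathsf{Gp}$ is the category whose objects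 are Lie groupoids and whose arrows are the isomorphism classes $[f]$ of smooth functors. $W$ is the class of arrows $[w]$ of $\mathsf{Gp}$ with $w$ an equivalence of Lie groupoids. Localization. For a category $C$ and a class $W$ of arrows of $C$, the localization is a category $C[W^{-1}]$ with a functor $\pi_W:C\to C[W^{-1}]$ such that $\pi_W(w)$ is invertible for all $w\in W$ and such that for every functor $\phi:C\to E$ with $\phi(w)$ invertible for all $w\in W$ there is a unique functor $\psi:C[W^{-1}]\to E$ with $\psi\circ\pi_W=\phi$. It exists and is unique up to isomorphism. Restriction: for an open subset $U\subset S^1$ with inclusion $\iota_U:U\hookrightarrow S^1$, viewed as a functor $\{U\rightrightarrows U\}\to\{S^1\rightrightarrows S^1\}$, and a morphism $f$ out of $\{S^1\rightrightarrows S^1\}$ in $\mathsf{Gp}[W^{-1}]$, $f|_U:=f\circ\pi_W([\iota_U])$. *)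

theory Defs
  imports "HOL-Analysis.Analysis" "HOL-Algebra.Elementary_Groups"
begin

section \<open>Smooth maps between open subsets of Euclidean spaces\<close>

text \<open>
  The dimension of a manifold is a natural number varying within one category, so \<open>\<real>\<^sup>n\<close> is
  \<^term>\<open>Euclidean_space n\<close>, whose points are the \<^typ>\<open>nat \<Rightarrow> real\<close> vanishing from index \<open>n\<close> on.
  \<open>Ck n k W g\<close>: the partial derivatives of \<open>g\<close> of order at most \<open>k\<close> exist and are continuous on
  \<open>W\<close>; it is only used for \<open>W\<close> open in \<^term>\<open>Euclidean_space n\<close>.
\<close>

primrec Ck :: "nat \<Rightarrow> nat \<Rightarrow> (nat \<Rightarrow> real) set \<Rightarrow> ((nat \<Rightarrow> real) \<Rightarrow> real) \<Rightarrow> bool" where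
  "Ck n 0 W g \<longleftrightarrow> continuous_map (subtopology (Euclidean_space n) W) euclideanreal g"
| "Ck n (Suc k) W g \<longleftrightarrow>
     continuous_map (subtopology (Euclidean_space n) W) euclideanreal g \<and>
     (\<forall>i<n. \<exists>g'. (\<forall>x\<in>W. ((\<lambda>t. g (x(i := t))) has_real_derivative g' x) (at (x i))) \<and>
                  Ck n k W g')"

definition smooth_on :: "nat \<Rightarrow> (nat \<Rightarrow> real) set \<Rightarrow> nat \<Rightarrow> ((nat \<Rightarrow> real) \<Rightarrow> nat \<Rightarrow> real) \<Rightarrow> bool"
  where "smooth_on n W m g \<longleftrightarrow> (\<forall>i<m. \<forall>k. Ck n k W (\<lambda>x. g x i))"

definition partial_deriv :: "nat \<Rightarrow> ((nat \<Rightarrow> real) \<Rightarrow> real) \<Rightarrow> (nat \<Rightarrow> real) \<Rightarrow> real"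
  where "partial_deriv i g x = deriv (\<lambda>t. g (x(i := t))) (x i)"

definition surjective_differential ::
    "nat \<Rightarrow> nat \<Rightarrow> ((nat \<Rightarrow> real) \<Rightarrow> nat \<Rightarrow> real) \<Rightarrow> (nat \<Rightarrow> real) \<Rightarrow> bool"
  where "surjective_differential n m g x \<longleftrightarrow>
    (\<forall>v::nat \<Rightarrow> real. \<exists>u::nat \<Rightarrow> real. \<forall>i<m. (\<Sum>j<n. partial_deriv j (\<lambda>y. g y i) x * u j) = v i)"


section \<open>Smooth manifolds\<close>

definition paracompact_space :: "'a topology \<Rightarrow> bool"
  where "paracompact_space X \<longleftrightarrow>
    (\<forall>\<U>. (\<forall>U\<in>\<U>. openin X U) \<and> \<Union>\<U> = topspace X \<longrightarrow>
      (\<exists>\<V>. (\<forall>V\<in>\<V>. openin X V \<and> (\<exists>U\<in>\<U>. V \<subseteq> U)) \<and> \<Union>\<V> = topspace X \<and>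
            locally_finite_in X \<V>))"

text \<open>
  A chart is a triple: dimension, domain, coordinate map. The values of the coordinate map outside
  the domain are irrelevant; a maximal atlas contains all the variants of a chart that differ there.
\<close>

type_synonym 'a chart = "nat \<times> 'a set \<times> ('a \<Rightarrow> nat \<Rightarrow> real)"

definition is_chart :: "'a topology \<Rightarrow> 'a chart \<Rightarrow> bool"
  where "is_chart X = (\<lambda>(n, U, \<phi>). openin X U \<and> openin (Euclidean_space n) (\<phi> ` U) \<and>
    homeomorphic_map (subtopology X U) (subtopology (Euclidean_space n) (\<phi> ` U)) \<phi>)"

definition compatible_charts :: "'a chart \<Rightarrow> 'a chart \<Rightarrow> bool"
  where "compatible_charts = (\<lambda>(n, U, \<phi>) (m, V, \<psi>).
    smooth_on n (\<phi> ` (U \<inter> V)) m (\<psi> \<circ> inv_into U \<phi>) \<and>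
    smooth_on m (\<psi> ` (U \<inter> V)) n (\<phi> \<circ> inv_into V \<psi>))"

record 'a manifold =
  mtop :: "'a topology"
  charts :: "'a chart set"

abbreviation pts :: "'a manifold \<Rightarrow> 'a set"
  where "pts M \<equiv> topspace (mtop M)"

text \<open>Different components of a manifold may have different dimensions.\<close>

definition smooth_manifold :: "'a manifold \<Rightarrow> bool"
  where "smooth_manifold M \<longleftrightarrow>
    Hausdorff_space (mtop M) \<and> paracompact_space (mtop M) \<and>
    (\<forall>c\<in>charts M. is_chart (mtop M) c) \<and>
    (\<Union>(n, U, \<phi>)\<in>charts M. U) = pts M \<and>
    (\<forall>c\<in>charts M. \<forall>d\<in>charts M. compatible_charts c d) \<and>
    (\<forall>c. is_chart (mtop M) c \<and> (\<forall>d\<in>charts M. compatible_charts c d) \<longrightarrow> c \<in> charts M)"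

definition smooth_map :: "'a manifold \<Rightarrow> 'b manifold \<Rightarrow> ('a \<Rightarrow> 'b) \<Rightarrow> bool"
  where "smooth_map M N f \<longleftrightarrow>
    (\<forall>p\<in>pts M. \<exists>(n, U, \<phi>)\<in>charts M. \<exists>(m, V, \<psi>)\<in>charts N.
       p \<in> U \<and> f ` U \<subseteq> V \<and> smooth_on n (\<phi> ` U) m (\<psi> \<circ> f \<circ> inv_into U \<phi>))"

definition submersion :: "'a manifold \<Rightarrow> 'b manifold \<Rightarrow> ('a \<Rightarrow> 'b) \<Rightarrow> bool"
  where "submersion M N f \<longleftrightarrow> smooth_map M N f \<and>
    (\<forall>p\<in>pts M. \<exists>(n, U, \<phi>)\<in>charts M. \<exists>(m, V, \<psi>)\<in>charts N.
       p \<in> U \<and> f ` U \<subseteq> V \<and> surjective_differential n m (\<psi> \<circ> f \<circ> inv_into U \<phi>) (\<phi> p))"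

definition diffeomorphism :: "'a manifold \<Rightarrow> 'b manifold \<Rightarrow> ('a \<Rightarrow> 'b) \<Rightarrow> bool"
  where "diffeomorphism M N f \<longleftrightarrow> bij_betw f (pts M) (pts N) \<and>
    smooth_map M N f \<and> smooth_map N M (inv_into (pts M) f)"


subsection \<open>Constructions\<close>

text \<open>If the charts in \<open>A\<close> are compatible and cover, this is the maximal atlas containing \<open>A\<close>.\<close>

definition manifold_of_atlas :: "'a topology \<Rightarrow> 'a chart set \<Rightarrow> 'a manifold"
  where "manifold_of_atlas X A =
    \<lparr>mtop = X, charts = {c. is_chart X c \<and> (\<forall>d\<in>A. compatible_charts c d)}\<rparr>"

definition discrete_manifold :: "'a set \<Rightarrow> 'a manifold"
  where "discrete_manifold A =
    manifold_of_atlas (discrete_topology A) ((\<lambda>a. (0, {a}, \<lambda>_ _. 0)) ` A)"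

definition open_submanifold :: "'a manifold \<Rightarrow> 'a set \<Rightarrow> 'a manifold"
  where "open_submanifold M U =
    \<lparr>mtop = subtopology (mtop M) U, charts = {(n, V, \<phi>) \<in> charts M. V \<subseteq> U}\<rparr>"

definition prod_manifold :: "'a manifold \<Rightarrow> 'b manifold \<Rightarrow> ('a \<times> 'b) manifold"
  where "prod_manifold M N =
    manifold_of_atlas (prod_topology (mtop M) (mtop N))
      {(n + m, U \<times> V, \<lambda>(x, y) i. if i < n then \<phi> x i else \<psi> y (i - n)) | n U \<phi> m V \<psi>.
         (n, U, \<phi>) \<in> charts M \<and> (m, V, \<psi>) \<in> charts N}"

text \<open>
  Embedded submanifolds via the local slice condition: near each of its points, \<open>P\<close> is the zero set
  of the last \<open>n - k\<close> coordinates of a chart of \<open>M\<close>. The restriction of such a chart to \<open>P\<close> takes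
  values in \<^term>\<open>Euclidean_space k\<close> and is a chart of \<open>P\<close>.
\<close>

definition slice_charts :: "'a manifold \<Rightarrow> 'a set \<Rightarrow> 'a chart set"
  where "slice_charts M P =
    {(k, U \<inter> P, \<phi>) | k n U \<phi>. (n, U, \<phi>) \<in> charts M \<and> k \<le> n \<and>
       \<phi> ` (U \<inter> P) = {x \<in> \<phi> ` U. \<forall>i\<ge>k. x i = 0}}"

definition embedded_submanifold :: "'a manifold \<Rightarrow> 'a set \<Rightarrow> bool"
  where "embedded_submanifold M P \<longleftrightarrow> P \<subseteq> pts M \<and> P \<subseteq> (\<Union>(k, V, \<phi>)\<in>slice_charts M P. V)"

definition submanifold :: "'a manifold \<Rightarrow> 'a set \<Rightarrow> 'a manifold"
  where "submanifold M P = manifold_of_atlas (subtopology (mtop M) P) (slice_charts M P)"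

definition fibre_set ::
    "'a manifold \<Rightarrow> ('a \<Rightarrow> 'c) \<Rightarrow> ('b \<Rightarrow> 'c) \<Rightarrow> 'b manifold \<Rightarrow> ('a \<times> 'b) set"
  where "fibre_set M f g N = {(x, y). x \<in> pts M \<and> y \<in> pts N \<and> f x = g y}"

text \<open>
  A fibre product is a manifold when it is embedded in the product. For smooth maps this is automatic
  if one of them is a submersion, as in all uses below except the first condition of
  \<open>lie_equivalence\<close>, where it is part of the claim.
\<close>

definition fibre_product_exists ::
    "'a manifold \<Rightarrow> ('a \<Rightarrow> 'c) \<Rightarrow> ('b \<Rightarrow> 'c) \<Rightarrow> 'b manifold \<Rightarrow> bool"
  where "fibre_product_exists M f g N \<longleftrightarrow>
    embedded_submanifold (prod_manifold M N) (fibre_set M f g N)"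

definition fibre_product ::
    "'a manifold \<Rightarrow> ('a \<Rightarrow> 'c) \<Rightarrow> ('b \<Rightarrow> 'c) \<Rightarrow> 'b manifold \<Rightarrow> ('a \<times> 'b) manifold"
  where "fibre_product M f g N = submanifold (prod_manifold M N) (fibre_set M f g N)"


section \<open>Lie groupoids\<close>

text \<open>
  Objects and arrows are taken from a type \<open>'u\<close>, which plays the role of a universe.
  An arrow \<open>\<gamma>\<close> goes from \<open>src G \<gamma>\<close> to \<open>tgt G \<gamma>\<close>, and \<open>mul G \<gamma> \<delta>\<close> is \<open>\<gamma> \<circ> \<delta>\<close>,
  relevant only if \<open>src G \<gamma> = tgt G \<delta>\<close>.
\<close>

record 'u lie_groupoid =
  G0 :: "'u manifold"
  G1 :: "'u manifold"
  src :: "'u \<Rightarrow> 'u"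
  tgt :: "'u \<Rightarrow> 'u"
  unt :: "'u \<Rightarrow> 'u"
  ivs :: "'u \<Rightarrow> 'u"
  mul :: "'u \<Rightarrow> 'u \<Rightarrow> 'u"

definition groupoid :: "'u lie_groupoid \<Rightarrow> bool"
  where "groupoid G \<longleftrightarrow>
    (\<forall>\<gamma>\<in>pts (G1 G). src G \<gamma> \<in> pts (G0 G) \<and> tgt G \<gamma> \<in> pts (G0 G)) \<and>
    (\<forall>x\<in>pts (G0 G). unt G x \<in> pts (G1 G) \<and> src G (unt G x) = x \<and> tgt G (unt G x) = x) \<and>
    (\<forall>\<gamma>\<in>pts (G1 G). mul G \<gamma> (unt G (src G \<gamma>)) = \<gamma> \<and> mul G (unt G (tgt G \<gamma>)) \<gamma> = \<gamma>) \<and>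
    (\<forall>\<gamma>\<in>pts (G1 G). \<forall>\<delta>\<in>pts (G1 G). src G \<gamma> = tgt G \<delta> \<longrightarrow>
       mul G \<gamma> \<delta> \<in> pts (G1 G) \<and> src G (mul G \<gamma> \<delta>) = src G \<delta> \<and> tgt G (mul G \<gamma> \<delta>) = tgt G \<gamma>) \<and>
    (\<forall>\<gamma>\<in>pts (G1 G). \<forall>\<delta>\<in>pts (G1 G). \<forall>\<epsilon>\<in>pts (G1 G).
       src G \<gamma> = tgt G \<delta> \<and> src G \<delta> = tgt G \<epsilon> \<longrightarrow>
       mul G (mul G \<gamma> \<delta>) \<epsilon> = mul G \<gamma> (mul G \<delta> \<epsilon>)) \<and>
    (\<forall>\<gamma>\<in>pts (G1 G). ivs G \<gamma> \<in> pts (G1 G) \<and>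
       src G (ivs G \<gamma>) = tgt G \<gamma> \<and> tgt G (ivs G \<gamma>) = src G \<gamma> \<and>
       mul G (ivs G \<gamma>) \<gamma> = unt G (src G \<gamma>) \<and> mul G \<gamma> (ivs G \<gamma>) = unt G (tgt G \<gamma>))"

definition lie_groupoid :: "'u lie_groupoid \<Rightarrow> bool"
  where "lie_groupoid G \<longleftrightarrow>
    groupoid G \<and> smooth_manifold (G0 G) \<and> smooth_manifold (G1 G) \<and>
    submersion (G1 G) (G0 G) (src G) \<and> submersion (G1 G) (G0 G) (tgt G) \<and>
    smooth_map (G0 G) (G1 G) (unt G) \<and> smooth_map (G1 G) (G1 G) (ivs G) \<and>
    fibre_product_exists (G1 G) (src G) (tgt G) (G1 G) \<and>
    smooth_map (fibre_product (G1 G) (src G) (tgt G) (G1 G)) (G1 G) (\<lambda>(\<gamma>, \<delta>). mul G \<gamma> \<delta>)"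

text \<open>A functor is a pair of maps, on objects and on arrows.\<close>

type_synonym 'u gfunctor = "('u \<Rightarrow> 'u) \<times> ('u \<Rightarrow> 'u)"

definition smooth_functor :: "'u lie_groupoid \<Rightarrow> 'u lie_groupoid \<Rightarrow> 'u gfunctor \<Rightarrow> bool"
  where "smooth_functor G H F \<longleftrightarrow>
    smooth_map (G0 G) (G0 H) (fst F) \<and> smooth_map (G1 G) (G1 H) (snd F) \<and>
    (\<forall>\<gamma>\<in>pts (G1 G). src H (snd F \<gamma>) = fst F (src G \<gamma>) \<and> tgt H (snd F \<gamma>) = fst F (tgt G \<gamma>)) \<and>
    (\<forall>x\<in>pts (G0 G). snd F (unt G x) = unt H (fst F x)) \<and>
    (\<forall>\<gamma>\<in>pts (G1 G). \<forall>\<delta>\<in>pts (G1 G). src G \<gamma> = tgt G \<delta> \<longrightarrow>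
       snd F (mul G \<gamma> \<delta>) = mul H (snd F \<gamma>) (snd F \<delta>))"

definition smooth_nat_trans ::
    "'u lie_groupoid \<Rightarrow> 'u lie_groupoid \<Rightarrow> 'u gfunctor \<Rightarrow> 'u gfunctor \<Rightarrow> ('u \<Rightarrow> 'u) \<Rightarrow> bool"
  where "smooth_nat_trans G H f g \<alpha> \<longleftrightarrow>
    smooth_map (G0 G) (G1 H) \<alpha> \<and>
    (\<forall>x\<in>pts (G0 G). src H (\<alpha> x) = fst f x \<and> tgt H (\<alpha> x) = fst g x) \<and>
    (\<forall>\<gamma>\<in>pts (G1 G). mul H (\<alpha> (tgt G \<gamma>)) (snd f \<gamma>) = mul H (snd g \<gamma>) (\<alpha> (src G \<gamma>)))"

definition isomorphic_functors ::
    "'u lie_groupoid \<Rightarrow> 'u lie_groupoid \<Rightarrow> 'u gfunctor \<Rightarrow> 'u gfunctor \<Rightarrow> bool"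
  where "isomorphic_functors G H f g \<longleftrightarrow>
    smooth_functor G H f \<and> smooth_functor G H g \<and> (\<exists>\<alpha>. smooth_nat_trans G H f g \<alpha>)"

definition lie_equivalence :: "'u lie_groupoid \<Rightarrow> 'u lie_groupoid \<Rightarrow> 'u gfunctor \<Rightarrow> bool"
  where "lie_equivalence G H F \<longleftrightarrow> smooth_functor G H F \<and>
    (let GG = prod_manifold (G0 G) (G0 G); FF = map_prod (fst F) (fst F);
         st = (\<lambda>h. (src H h, tgt H h))
     in fibre_product_exists GG FF st (G1 H) \<and>
        diffeomorphism (G1 G) (fibre_product GG FF st (G1 H))
          (\<lambda>\<gamma>. ((src G \<gamma>, tgt G \<gamma>), snd F \<gamma>))) \<and>
    fibre_product_exists (G0 G) (fst F) (tgt H) (G1 H) \<and>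
    submersion (fibre_product (G0 G) (fst F) (tgt H) (G1 H)) (G0 H) (\<lambda>(x, h). src H h) \<and>
    (\<lambda>(x, h). src H h) ` pts (fibre_product (G0 G) (fst F) (tgt H) (G1 H)) = pts (G0 H)"

definition manifold_groupoid :: "'u manifold \<Rightarrow> 'u lie_groupoid"
  where "manifold_groupoid M =
    \<lparr>G0 = M, G1 = M, src = id, tgt = id, unt = id, ivs = id, mul = (\<lambda>x y. x)\<rparr>"

text \<open>
  A discrete group \<open>K\<close> as a Lie groupoid with one object. The map \<open>c\<close>, assumed injective on \<open>K\<close>,
  places the group in the universe \<open>'u\<close>.
\<close>

definition group_groupoid :: "('g \<Rightarrow> 'u) \<Rightarrow> ('g, 'm) monoid_scheme \<Rightarrow> 'u lie_groupoid"
  where "group_groupoid c K =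
    (let d = inv_into (carrier K) c; pt = c \<one>\<^bsub>K\<^esub>
     in \<lparr>G0 = discrete_manifold {pt}, G1 = discrete_manifold (c ` carrier K),
         src = (\<lambda>_. pt), tgt = (\<lambda>_. pt), unt = (\<lambda>_. pt),
         ivs = (\<lambda>x. c (inv\<^bsub>K\<^esub> (d x))), mul = (\<lambda>x y. c (d x \<otimes>\<^bsub>K\<^esub> d y))\<rparr>)"


section \<open>Categories and localization\<close>

record ('o, 'a) category =
  Obj :: "'o set"
  Arr :: "'a set"
  Dom :: "'a \<Rightarrow> 'o"
  Cod :: "'a \<Rightarrow> 'o"
  Ide :: "'o \<Rightarrow> 'a"
  Cmp :: "'a \<Rightarrow> 'a \<Rightarrow> 'a"

text \<open>\<open>Cmp C b a\<close> is \<open>b \<circ> a\<close>, relevant only if \<open>Cod C a = Dom C b\<close>.\<close>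

definition is_category :: "('o, 'a) category \<Rightarrow> bool"
  where "is_category C \<longleftrightarrow>
    (\<forall>X\<in>Obj C. Ide C X \<in> Arr C \<and> Dom C (Ide C X) = X \<and> Cod C (Ide C X) = X) \<and>
    (\<forall>a\<in>Arr C. Dom C a \<in> Obj C \<and> Cod C a \<in> Obj C \<and>
       Cmp C a (Ide C (Dom C a)) = a \<and> Cmp C (Ide C (Cod C a)) a = a) \<and>
    (\<forall>a\<in>Arr C. \<forall>b\<in>Arr C. Cod C a = Dom C b \<longrightarrow>
       Cmp C b a \<in> Arr C \<and> Dom C (Cmp C b a) = Dom C a \<and> Cod C (Cmp C b a) = Cod C b) \<and>
    (\<forall>a\<in>Arr C. \<forall>b\<in>Arr C. \<forall>c\<in>Arr C. Cod C a = Dom C b \<and> Cod C b = Dom C c \<longrightarrow>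
       Cmp C c (Cmp C b a) = Cmp C (Cmp C c b) a)"

definition is_hom :: "('o, 'a) category \<Rightarrow> 'o \<Rightarrow> 'o \<Rightarrow> 'a \<Rightarrow> bool"
  where "is_hom C X Y a \<longleftrightarrow> a \<in> Arr C \<and> Dom C a = X \<and> Cod C a = Y"

definition inverse_arrows :: "('o, 'a) category \<Rightarrow> 'a \<Rightarrow> 'a \<Rightarrow> bool"
  where "inverse_arrows C a b \<longleftrightarrow> a \<in> Arr C \<and> b \<in> Arr C \<and>
    Dom C b = Cod C a \<and> Cod C b = Dom C a \<and>
    Cmp C b a = Ide C (Dom C a) \<and> Cmp C a b = Ide C (Cod C a)"

definition invertible_arrow :: "('o, 'a) category \<Rightarrow> 'a \<Rightarrow> bool"
  where "invertible_arrow C a \<longleftrightarrow> (\<exists>b. inverse_arrows C a b)"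

type_synonym ('o, 'a, 'p, 'b) cfunctor = "('o \<Rightarrow> 'p) \<times> ('a \<Rightarrow> 'b)"

definition is_functor ::
    "('o, 'a) category \<Rightarrow> ('p, 'b) category \<Rightarrow> ('o, 'a, 'p, 'b) cfunctor \<Rightarrow> bool"
  where "is_functor C D F \<longleftrightarrow>
    (\<forall>X\<in>Obj C. fst F X \<in> Obj D \<and> snd F (Ide C X) = Ide D (fst F X)) \<and>
    (\<forall>a\<in>Arr C. is_hom D (fst F (Dom C a)) (fst F (Cod C a)) (snd F a)) \<and>
    (\<forall>a\<in>Arr C. \<forall>b\<in>Arr C. Cod C a = Dom C b \<longrightarrow>
       snd F (Cmp C b a) = Cmp D (snd F b) (snd F a))"

text \<open>Equality of functors: the values of the underlying functions outside \<open>C\<close> do not matter.\<close>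

definition functor_eq ::
    "('o, 'a) category \<Rightarrow> ('o, 'a, 'p, 'b) cfunctor \<Rightarrow> ('o, 'a, 'p, 'b) cfunctor \<Rightarrow> bool"
  where "functor_eq C F F' \<longleftrightarrow>
    (\<forall>X\<in>Obj C. fst F X = fst F' X) \<and> (\<forall>a\<in>Arr C. snd F a = snd F' a)"

definition functor_comp ::
    "('p, 'b, 'q, 'c) cfunctor \<Rightarrow> ('o, 'a, 'p, 'b) cfunctor \<Rightarrow> ('o, 'a, 'q, 'c) cfunctor"
  where "functor_comp K F = (fst K \<circ> fst F, snd K \<circ> snd F)"

text \<open>A zigzag: start object, a list of arrows to be traversed forwards or backwards, end object.\<close>

type_synonym ('o, 'a) zigzag = "'o \<times> ('a + 'a) list \<times> 'o"

text \<open>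
  The universal property of the localization. HOL cannot quantify over types inside a formula, so
  the test categories \<open>E\<close> range over the types given by the first argument. If these are the types
  of \<open>L\<close>, and a localization exists in them, then \<open>(L, P)\<close> is determined up to
  isomorphism, so no generality is lost; \<open>is_localization_zigzag\<close> below exhibits a localization in
  the types \<^typ>\<open>('o, ('o, 'a) zigzag set) category\<close> that is universal for
  test categories of all types.
\<close>

definition is_localization ::
    "('p, 'b) category itself \<Rightarrow> ('o, 'a) category \<Rightarrow> 'a set \<Rightarrow>
     ('q, 'c) category \<Rightarrow> ('o, 'a, 'q, 'c) cfunctor \<Rightarrow> bool"
  where "is_localization T C W L P \<longleftrightarrow>
    is_category L \<and> is_functor C L P \<and> (\<forall>w\<in>W. invertible_arrow L (snd P w)) \<and>
    (\<forall>(E :: ('p, 'b) category) \<Phi>.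
       is_category E \<and> is_functor C E \<Phi> \<and> (\<forall>w\<in>W. invertible_arrow E (snd \<Phi> w)) \<longrightarrow>
       (\<exists>\<Psi>. is_functor L E \<Psi> \<and> functor_eq C (functor_comp \<Psi> P) \<Phi> \<and>
          (\<forall>\<Psi>'. is_functor L E \<Psi>' \<and> functor_eq C (functor_comp \<Psi>' P) \<Phi> \<longrightarrow>
             functor_eq L \<Psi>' \<Psi>)))"


subsection \<open>Existence of localizations\<close>

inductive zigzag_path :: "('o, 'a) category \<Rightarrow> 'a set \<Rightarrow> 'o \<Rightarrow> ('a + 'a) list \<Rightarrow> 'o \<Rightarrow> bool"
  for C W where
  nil: "X \<in> Obj C \<Longrightarrow> zigzag_path C W X [] X"
| fwd: "a \<in> Arr C \<Longrightarrow> zigzag_path C W (Cod C a) u Y \<Longrightarrow> zigzag_path C W (Dom C a) (Inl a # u) Y"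
| bwd: "w \<in> W \<Longrightarrow> zigzag_path C W (Dom C w) u Y \<Longrightarrow> zigzag_path C W (Cod C w) (Inr w # u) Y"

inductive zigzag_rel :: "('o, 'a) category \<Rightarrow> 'a set \<Rightarrow> ('a + 'a) list \<Rightarrow> ('a + 'a) list \<Rightarrow> bool"
  for C W where
  "X \<in> Obj C \<Longrightarrow> zigzag_rel C W [Inl (Ide C X)] []"
| "a \<in> Arr C \<Longrightarrow> b \<in> Arr C \<Longrightarrow> Cod C a = Dom C b \<Longrightarrow> zigzag_rel C W [Inl a, Inl b] [Inl (Cmp C b a)]"
| "w \<in> W \<Longrightarrow> zigzag_rel C W [Inl w, Inr w] []"
| "w \<in> W \<Longrightarrow> zigzag_rel C W [Inr w, Inl w] []"

inductive zigzag_step :: "('o, 'a) category \<Rightarrow> 'a set \<Rightarrow> ('o, 'a) zigzag \<Rightarrow> ('o, 'a) zigzag \<Rightarrow> bool"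
  for C W where
  "zigzag_rel C W m m' \<Longrightarrow> zigzag_path C W X (l @ m @ r) Y \<Longrightarrow> zigzag_path C W X (l @ m' @ r) Y \<Longrightarrow>
     zigzag_step C W (X, l @ m @ r, Y) (X, l @ m' @ r, Y)"

inductive_cases zigzag_path_NilE: "zigzag_path C W X [] Y"
inductive_cases zigzag_path_InlE: "zigzag_path C W X (Inl a # u) Y"
inductive_cases zigzag_path_InrE: "zigzag_path C W X (Inr a # u) Y"
lemmas zigzag_path_elims = zigzag_path_NilE zigzag_path_InlE zigzag_path_InrE

definition zigzag_class :: "('o, 'a) category \<Rightarrow> 'a set \<Rightarrow> ('o, 'a) zigzag \<Rightarrow> ('o, 'a) zigzag set"
  where "zigzag_class C W p = {q. equivclp (zigzag_step C W) p q}"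

definition zigzag_category :: "('o, 'a) category \<Rightarrow> 'a set \<Rightarrow> ('o, ('o, 'a) zigzag set) category"
  where "zigzag_category C W =
    \<lparr>Obj = Obj C, Arr = {zigzag_class C W (X, u, Y) | X u Y. zigzag_path C W X u Y},
     Dom = (\<lambda>A. fst (SOME p. p \<in> A)), Cod = (\<lambda>A. snd (snd (SOME p. p \<in> A))),
     Ide = (\<lambda>X. zigzag_class C W (X, [], X)),
     Cmp = (\<lambda>B A. let p = SOME p. p \<in> A; q = SOME q. q \<in> B
                 in zigzag_class C W (fst p, fst (snd p) @ fst (snd q), snd (snd q)))\<rparr>"

definition zigzag_functor ::
    "('o, 'a) category \<Rightarrow> 'a set \<Rightarrow> ('o, 'a, 'o, ('o, 'a) zigzag set) cfunctor"
  where "zigzag_functor C W = (id, \<lambda>a. zigzag_class C W (Dom C a, [Inl a], Cod C a))"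

lemma zigzag_class_eq_iff:
  "zigzag_class C W p = zigzag_class C W q \<longleftrightarrow> equivclp (zigzag_step C W) p q"
  unfolding zigzag_class_def
  by (metis (mono_tags, lifting) Collect_cong equivclp_refl equivclp_sym equivclp_trans mem_Collect_eq)

lemma zigzag_path_app:
  assumes "zigzag_path C W X u Y" "zigzag_path C W Y v Z"
  shows "zigzag_path C W X (u @ v) Z"
  using assms by (induction) (auto intro: zigzag_path.intros)

lemma zigzag_step_appR:
  assumes "zigzag_step C W (X, u, Y) (X', u', Y')" "zigzag_path C W Y v Z"
  shows "zigzag_step C W (X, u @ v, Z) (X', u' @ v, Z)"
  using assms(1)
proof cases
  case (1 m m' l r)
  have "zigzag_path C W X ((l @ m @ r) @ v) Z" "zigzag_path C W X ((l @ m' @ r) @ v) Z"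
    using 1 assms(2) by (metis zigzag_path_app)+
  then show ?thesis using 1 zigzag_step.intros[of C W m m' X l "r @ v" Z] by simp
qed

lemma zigzag_step_appL:
  assumes "zigzag_step C W (X, u, Y) (X', u', Y')" "zigzag_path C W Z v X"
  shows "zigzag_step C W (Z, v @ u, Y) (Z, v @ u', Y')"
  using assms(1)
proof cases
  case (1 m m' l r)
  have "zigzag_path C W Z (v @ (l @ m @ r)) Y" "zigzag_path C W Z (v @ (l @ m' @ r)) Y"
    using 1 assms(2) by (metis zigzag_path_app)+
  then show ?thesis using 1 zigzag_step.intros[of C W m m' Z "v @ l" r Y] by simp
qed

lemma zigzag_equiv_path:
  assumes "equivclp (zigzag_step C W) p q"
  shows "(case p of (X, u, Y) \<Rightarrow> zigzag_path C W X u Y) \<Longrightarrow>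
    fst q = fst p \<and> snd (snd q) = snd (snd p) \<and> (case q of (X, u, Y) \<Rightarrow> zigzag_path C W X u Y)"
  using assms
proof (induction rule: equivclp_induct)
  case (step y z)
  then show ?case by (auto elim!: zigzag_step.cases)
qed auto

lemma zigzag_equiv_appR:
  assumes "equivclp (zigzag_step C W) p q" "zigzag_path C W (fst p) (fst (snd p)) (snd (snd p))"
    "zigzag_path C W (snd (snd p)) v Z"
  shows "equivclp (zigzag_step C W) (fst p, fst (snd p) @ v, Z) (fst q, fst (snd q) @ v, Z)"
  using assms
proof (induction rule: equivclp_induct)
  case (step y z)
  obtain X u Y X' u' Y' where yz: "y = (X, u, Y)" "z = (X', u', Y')" by (metis prod_cases3)
  have "Y = snd (snd p)"
    using zigzag_equiv_path[OF step(1)] step.prems yz by (cases p) auto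
  moreover have "Y' = Y" using step(2) yz by (auto elim!: zigzag_step.cases)
  ultimately have "zigzag_step C W (X, u @ v, Z) (X', u' @ v, Z) \<or> zigzag_step C W (X', u' @ v, Z) (X, u @ v, Z)"
    using step(2) step.prems(2) zigzag_step_appR[of C W] unfolding yz by auto
  then show ?case using step.IH[OF step.prems] yz
    by (auto intro: equivclp_into_equivclp)
qed auto

lemma zigzag_equiv_appL:
  assumes "equivclp (zigzag_step C W) p q" "zigzag_path C W (fst p) (fst (snd p)) (snd (snd p))"
    "zigzag_path C W Z v (fst p)"
  shows "equivclp (zigzag_step C W) (Z, v @ fst (snd p), snd (snd p)) (Z, v @ fst (snd q), snd (snd q))"
  using assms
proof (induction rule: equivclp_induct)
  case (step y z)
  obtain X u Y X' u' Y' where yz: "y = (X, u, Y)" "z = (X', u', Y')" by (metis prod_cases3)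
  have "X = fst p"
    using zigzag_equiv_path[OF step(1)] step.prems yz by (cases p) auto
  moreover have "X' = X" using step(2) yz by (auto elim!: zigzag_step.cases)
  ultimately have "zigzag_step C W (Z, v @ u, Y) (Z, v @ u', Y') \<or> zigzag_step C W (Z, v @ u', Y') (Z, v @ u, Y)"
    using step(2) step.prems(2) zigzag_step_appL[of C W] unfolding yz by auto
  then show ?case using step.IH[OF step.prems] yz
    by (auto intro: equivclp_into_equivclp)
qed auto

lemma zigzag_some:
  assumes "zigzag_path C W X u Y"
  obtains u' where "(SOME p. p \<in> zigzag_class C W (X, u, Y)) = (X, u', Y)"
    "zigzag_path C W X u' Y" "equivclp (zigzag_step C W) (X, u, Y) (X, u', Y)"
proof -
  define p where "p = (SOME p. p \<in> zigzag_class C W (X, u, Y))"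
  have "(X, u, Y) \<in> zigzag_class C W (X, u, Y)" by (simp add: zigzag_class_def)
  then have "p \<in> zigzag_class C W (X, u, Y)" unfolding p_def by (rule someI)
  then have "equivclp (zigzag_step C W) (X, u, Y) p" by (simp add: zigzag_class_def)
  with zigzag_equiv_path[OF this] assms that show thesis
    unfolding p_def[symmetric] by (cases p) auto
qed

lemma zigzag_category_simps:
  assumes "zigzag_path C W X u Y"
  shows "zigzag_class C W (X, u, Y) \<in> Arr (zigzag_category C W)"
    "Dom (zigzag_category C W) (zigzag_class C W (X, u, Y)) = X"
    "Cod (zigzag_category C W) (zigzag_class C W (X, u, Y)) = Y"
    "zigzag_path C W Y v Z \<Longrightarrow>
       Cmp (zigzag_category C W) (zigzag_class C W (Y, v, Z)) (zigzag_class C W (X, u, Y)) =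
       zigzag_class C W (X, u @ v, Z)"
proof -
  obtain u' where u': "(SOME p. p \<in> zigzag_class C W (X, u, Y)) = (X, u', Y)"
    "zigzag_path C W X u' Y" "equivclp (zigzag_step C W) (X, u, Y) (X, u', Y)"
    using zigzag_some[OF assms] .
  show "zigzag_class C W (X, u, Y) \<in> Arr (zigzag_category C W)"
    "Dom (zigzag_category C W) (zigzag_class C W (X, u, Y)) = X"
    "Cod (zigzag_category C W) (zigzag_class C W (X, u, Y)) = Y"
    using assms by (auto simp: zigzag_category_def u')
  assume v: "zigzag_path C W Y v Z"
  obtain v' where v': "(SOME p. p \<in> zigzag_class C W (Y, v, Z)) = (Y, v', Z)"
    "zigzag_path C W Y v' Z" "equivclp (zigzag_step C W) (Y, v, Z) (Y, v', Z)"
    using zigzag_some[OF v] .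
  have "equivclp (zigzag_step C W) (X, u @ v, Z) (X, u' @ v, Z)"
    using zigzag_equiv_appR[OF u'(3)] assms v by simp
  moreover have "equivclp (zigzag_step C W) (X, u' @ v, Z) (X, u' @ v', Z)"
    using zigzag_equiv_appL[OF v'(3)] u' v by simp
  ultimately have "equivclp (zigzag_step C W) (X, u @ v, Z) (X, u' @ v', Z)"
    by (rule equivclp_trans)
  then have "zigzag_class C W (X, u @ v, Z) = zigzag_class C W (X, u' @ v', Z)"
    by (simp add: zigzag_class_eq_iff)
  then show "Cmp (zigzag_category C W) (zigzag_class C W (Y, v, Z)) (zigzag_class C W (X, u, Y)) =
       zigzag_class C W (X, u @ v, Z)"
    by (simp add: zigzag_category_def u' v')
qed

lemma zigzag_ArrE:
  assumes "A \<in> Arr (zigzag_category C W)"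
  obtains X u Y where "A = zigzag_class C W (X, u, Y)" "zigzag_path C W X u Y"
  using assms by (auto simp: zigzag_category_def)

lemma zigzag_Obj_Ide:
  "Obj (zigzag_category C W) = Obj C"
  "Ide (zigzag_category C W) X = zigzag_class C W (X, [], X)"
  by (auto simp: zigzag_category_def)

lemma zigzag_path_Obj:
  assumes "is_category C" "W \<subseteq> Arr C" "zigzag_path C W X u Y"
  shows "X \<in> Obj C" "Y \<in> Obj C"
  using assms(3,1,2) by (induction) (auto simp: is_category_def)

lemma zigzag_is_category:
  assumes "is_category C" "W \<subseteq> Arr C"
  shows "is_category (zigzag_category C W)"
  unfolding is_category_def
proof (intro conjI ballI impI; (elim zigzag_ArrE)?)
  fix X assume "X \<in> Obj (zigzag_category C W)"
  then have "zigzag_path C W X [] X" by (simp add: zigzag_Obj_Ide zigzag_path.nil)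
  from zigzag_category_simps(1-3)[OF this]
  show "Ide (zigzag_category C W) X \<in> Arr (zigzag_category C W)"
    "Dom (zigzag_category C W) (Ide (zigzag_category C W) X) = X"
    "Cod (zigzag_category C W) (Ide (zigzag_category C W) X) = X"
    by (simp_all add: zigzag_Obj_Ide)
next
  fix a X u Y assume a: "a = zigzag_class C W (X, u, Y)" "zigzag_path C W X u Y"
  note XY = zigzag_path_Obj[OF assms a(2)]
  show "Dom (zigzag_category C W) a \<in> Obj (zigzag_category C W)"
    "Cod (zigzag_category C W) a \<in> Obj (zigzag_category C W)"
    using XY a by (simp_all add: zigzag_category_simps zigzag_Obj_Ide)
  have "zigzag_path C W X [] X" "zigzag_path C W Y [] Y"
    using XY by (auto intro: zigzag_path.nil)
  then show "Cmp (zigzag_category C W) a (Ide (zigzag_category C W) (Dom (zigzag_category C W) a)) = a"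
    "Cmp (zigzag_category C W) (Ide (zigzag_category C W) (Cod (zigzag_category C W) a)) a = a"
    using a by (simp_all add: zigzag_category_simps zigzag_Obj_Ide)
next
  fix a b X u Y Y' v Z
  assume "Cod (zigzag_category C W) a = Dom (zigzag_category C W) b"
    and ab: "a = zigzag_class C W (X, u, Y)" "zigzag_path C W X u Y"
    "b = zigzag_class C W (Y', v, Z)" "zigzag_path C W Y' v Z"
  then have "Y' = Y" by (simp add: zigzag_category_simps)
  moreover from this ab have "zigzag_path C W X (u @ v) Z" by (blast intro: zigzag_path_app)
  ultimately show "Cmp (zigzag_category C W) b a \<in> Arr (zigzag_category C W)"
    "Dom (zigzag_category C W) (Cmp (zigzag_category C W) b a) = Dom (zigzag_category C W) a"
    "Cod (zigzag_category C W) (Cmp (zigzag_category C W) b a) = Cod (zigzag_category C W) b"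
    using ab by (simp_all add: zigzag_category_simps)
next
  fix a b c X u Y Y' v Z Z' w V
  assume *: "Cod (zigzag_category C W) a = Dom (zigzag_category C W) b \<and>
      Cod (zigzag_category C W) b = Dom (zigzag_category C W) c"
    and abc: "a = zigzag_class C W (X, u, Y)" "zigzag_path C W X u Y"
    "b = zigzag_class C W (Y', v, Z)" "zigzag_path C W Y' v Z"
    "c = zigzag_class C W (Z', w, V)" "zigzag_path C W Z' w V"
  then have [simp]: "Y' = Y" "Z' = Z" by (simp_all add: zigzag_category_simps)
  have "zigzag_path C W X (u @ v) Z" "zigzag_path C W Y (v @ w) V"
    using abc by (auto intro: zigzag_path_app)
  then show "Cmp (zigzag_category C W) c (Cmp (zigzag_category C W) b a) =
      Cmp (zigzag_category C W) (Cmp (zigzag_category C W) c b) a"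
    using abc by (simp add: zigzag_category_simps)
qed

lemma zigzag_rel_class_eq:
  assumes "zigzag_rel C W m m'" "zigzag_path C W X m Y" "zigzag_path C W X m' Y"
  shows "zigzag_class C W (X, m, Y) = zigzag_class C W (X, m', Y)"
  using zigzag_step.intros[of C W m m' X "[]" "[]" Y] assms
  by (simp add: zigzag_class_eq_iff r_into_equivclp)

lemma zigzag_path_Inl:
  assumes "is_category C" "a \<in> Arr C"
  shows "zigzag_path C W (Dom C a) [Inl a] (Cod C a)"
  using assms by (auto intro!: zigzag_path.intros simp: is_category_def)

lemma zigzag_path_Inr:
  assumes "is_category C" "W \<subseteq> Arr C" "w \<in> W"
  shows "zigzag_path C W (Cod C w) [Inr w] (Dom C w)"
  using assms by (auto intro!: zigzag_path.intros simp: is_category_def)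

lemma zigzag_is_functor:
  assumes C: "is_category C"
  shows "is_functor C (zigzag_category C W) (zigzag_functor C W)"
  unfolding is_functor_def is_hom_def
proof (intro conjI ballI impI)
  fix X assume X: "X \<in> Obj C"
  then have I: "Ide C X \<in> Arr C" "Dom C (Ide C X) = X" "Cod C (Ide C X) = X"
    using C by (auto simp: is_category_def)
  show "fst (zigzag_functor C W) X \<in> Obj (zigzag_category C W)"
    using X by (simp add: zigzag_functor_def zigzag_Obj_Ide)
  have "zigzag_class C W (X, [Inl (Ide C X)], X) = zigzag_class C W (X, [], X)"
    using zigzag_path_Inl[OF C I(1)] X I
    by (intro zigzag_rel_class_eq) (auto intro: zigzag_rel.intros zigzag_path.nil)
  then show "snd (zigzag_functor C W) (Ide C X) =
      Ide (zigzag_category C W) (fst (zigzag_functor C W) X)"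
    by (simp add: zigzag_functor_def zigzag_Obj_Ide I)
next
  fix a assume "a \<in> Arr C"
  note p = zigzag_path_Inl[OF C this]
  show "snd (zigzag_functor C W) a \<in> Arr (zigzag_category C W)"
    "Dom (zigzag_category C W) (snd (zigzag_functor C W) a) = fst (zigzag_functor C W) (Dom C a)"
    "Cod (zigzag_category C W) (snd (zigzag_functor C W) a) = fst (zigzag_functor C W) (Cod C a)"
    using p by (simp_all add: zigzag_functor_def zigzag_category_simps)
next
  fix a b assume ab: "a \<in> Arr C" "b \<in> Arr C" "Cod C a = Dom C b"
  then have c: "Cmp C b a \<in> Arr C" "Dom C (Cmp C b a) = Dom C a" "Cod C (Cmp C b a) = Cod C b"
    using C by (auto simp: is_category_def)
  have p: "zigzag_path C W (Dom C a) [Inl a] (Dom C b)" "zigzag_path C W (Dom C b) [Inl b] (Cod C b)"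
    "zigzag_path C W (Dom C a) [Inl (Cmp C b a)] (Cod C b)"
    using zigzag_path_Inl[OF C] ab c by metis+
  then have "zigzag_path C W (Dom C a) [Inl a, Inl b] (Cod C b)"
    using zigzag_path_app by fastforce
  then have "zigzag_class C W (Dom C a, [Inl a, Inl b], Cod C b) =
      zigzag_class C W (Dom C a, [Inl (Cmp C b a)], Cod C b)"
    using p ab by (intro zigzag_rel_class_eq) (auto intro: zigzag_rel.intros)
  then show "snd (zigzag_functor C W) (Cmp C b a) =
      Cmp (zigzag_category C W) (snd (zigzag_functor C W) b) (snd (zigzag_functor C W) a)"
    using p c ab by (simp add: zigzag_functor_def zigzag_category_simps)
qed

lemma zigzag_inverse_arrows:
  assumes C: "is_category C" "W \<subseteq> Arr C" and w: "w \<in> W"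
  shows "inverse_arrows (zigzag_category C W) (zigzag_class C W (Dom C w, [Inl w], Cod C w))
    (zigzag_class C W (Cod C w, [Inr w], Dom C w))"
proof -
  have p: "zigzag_path C W (Dom C w) [Inl w] (Cod C w)" "zigzag_path C W (Cod C w) [Inr w] (Dom C w)"
    by (rule zigzag_path_Inl[OF C(1) subsetD[OF C(2) w]], rule zigzag_path_Inr[OF C w])
  have q: "zigzag_path C W (Dom C w) [Inl w, Inr w] (Dom C w)" "zigzag_path C W (Dom C w) [] (Dom C w)"
    "zigzag_path C W (Cod C w) [Inr w, Inl w] (Cod C w)" "zigzag_path C W (Cod C w) [] (Cod C w)"
    using zigzag_path_app[OF p] zigzag_path_app[OF p(2,1)] zigzag_path_Obj[OF C p(1)]
    by (simp_all add: zigzag_path.nil)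
  have "zigzag_class C W (Dom C w, [Inl w, Inr w], Dom C w) = zigzag_class C W (Dom C w, [], Dom C w)"
    by (rule zigzag_rel_class_eq[OF zigzag_rel.intros(3)[OF w] q(1,2)])
  moreover have "zigzag_class C W (Cod C w, [Inr w, Inl w], Cod C w) = zigzag_class C W (Cod C w, [], Cod C w)"
    by (rule zigzag_rel_class_eq[OF zigzag_rel.intros(4)[OF w] q(3,4)])
  ultimately show ?thesis
    using p by (simp add: inverse_arrows_def zigzag_category_simps zigzag_Obj_Ide)
qed

lemma inverse_arrows_unique:
  assumes E: "is_category E" and i: "inverse_arrows E a b" "inverse_arrows E a b'"
  shows "b = b'"
proof -
  have "b = Cmp E (Ide E (Cod E b)) b" "b' = Cmp E b' (Ide E (Dom E b'))"
    using E i by (auto simp: is_category_def inverse_arrows_def)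
  moreover have "Cmp E b' (Cmp E a b) = Cmp E (Cmp E b' a) b"
    using E i unfolding is_category_def inverse_arrows_def by metis
  ultimately show ?thesis using i unfolding inverse_arrows_def by metis
qed

lemma functor_inverse_arrows:
  assumes F: "is_functor L E F" and i: "inverse_arrows L a b" and L: "is_category L"
  shows "inverse_arrows E (snd F a) (snd F b)"
proof -
  have ab: "a \<in> Arr L" "b \<in> Arr L" "Dom L b = Cod L a" "Cod L b = Dom L a"
    "Cmp L b a = Ide L (Dom L a)" "Cmp L a b = Ide L (Cod L a)"
    using i by (auto simp: inverse_arrows_def)
  moreover have "Dom L a \<in> Obj L" "Cod L a \<in> Obj L" using L ab by (auto simp: is_category_def)
  moreover have "snd F (Cmp L b a) = Cmp E (snd F b) (snd F a)" "snd F (Cmp L a b) = Cmp E (snd F a) (snd F b)"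
    using F ab unfolding is_functor_def by metis+
  ultimately show ?thesis using F unfolding is_functor_def is_hom_def inverse_arrows_def by metis
qed

fun zigzag_eval :: "('o, 'a) category \<Rightarrow> ('p, 'b) category \<Rightarrow> ('o, 'a, 'p, 'b) cfunctor \<Rightarrow>
    'o \<Rightarrow> ('a + 'a) list \<Rightarrow> 'b" where
  "zigzag_eval C E \<Phi> X [] = Ide E (fst \<Phi> X)"
| "zigzag_eval C E \<Phi> X (Inl a # u) = Cmp E (zigzag_eval C E \<Phi> (Cod C a) u) (snd \<Phi> a)"
| "zigzag_eval C E \<Phi> X (Inr w # u) =
     Cmp E (zigzag_eval C E \<Phi> (Dom C w) u) (SOME b. inverse_arrows E (snd \<Phi> w) b)"

context
  fixes C :: "('o, 'a) category" and W and E :: "('p, 'b) category" and \<Phi>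
  assumes C: "is_category C" "W \<subseteq> Arr C" and E: "is_category E" and \<Phi>: "is_functor C E \<Phi>"
    and inv: "\<forall>w\<in>W. invertible_arrow E (snd \<Phi> w)"
begin

lemma zigzag_some_inverse:
  assumes "w \<in> W"
  shows "inverse_arrows E (snd \<Phi> w) (SOME b. inverse_arrows E (snd \<Phi> w) b)"
  using inv assms unfolding invertible_arrow_def by (metis someI_ex)

lemma zigzag_inverse_hom:
  assumes "w \<in> W"
  shows "is_hom E (fst \<Phi> (Cod C w)) (fst \<Phi> (Dom C w)) (SOME b. inverse_arrows E (snd \<Phi> w) b)"
proof -
  have "is_hom E (fst \<Phi> (Dom C w)) (fst \<Phi> (Cod C w)) (snd \<Phi> w)"
    using \<Phi> C assms by (auto simp: is_functor_def)
  then show ?thesis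
    using zigzag_some_inverse[OF assms] by (auto simp: inverse_arrows_def is_hom_def)
qed

lemma hom_comp: "is_hom E X Y a \<Longrightarrow> is_hom E Y Z b \<Longrightarrow> is_hom E X Z (Cmp E b a)"
  using E by (auto simp: is_category_def is_hom_def)

lemma hom_assoc: "is_hom E X Y a \<Longrightarrow> is_hom E Y Z b \<Longrightarrow> is_hom E Z V c \<Longrightarrow>
   Cmp E c (Cmp E b a) = Cmp E (Cmp E c b) a"
  using E by (auto simp: is_category_def is_hom_def)

lemma hom_unit: "is_hom E X Y a \<Longrightarrow> Cmp E a (Ide E X) = a" "is_hom E X Y a \<Longrightarrow> Cmp E (Ide E Y) a = a"
  using E by (auto simp: is_category_def is_hom_def)

lemma functor_hom: "a \<in> Arr C \<Longrightarrow> is_hom E (fst \<Phi> (Dom C a)) (fst \<Phi> (Cod C a)) (snd \<Phi> a)"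
  using \<Phi> by (auto simp: is_functor_def)

lemma zigzag_eval_hom:
  assumes "zigzag_path C W X u Y"
  shows "is_hom E (fst \<Phi> X) (fst \<Phi> Y) (zigzag_eval C E \<Phi> X u)"
  using assms
proof induction
  case (nil X)
  then show ?case using E \<Phi> by (auto simp: is_category_def is_functor_def is_hom_def)
next
  case (fwd a u Y)
  then show ?case using functor_hom hom_comp by simp blast
next
  case (bwd w u Y)
  then show ?case using zigzag_inverse_hom hom_comp by simp blast
qed

lemma zigzag_eval_app:
  assumes "zigzag_path C W X u Y" "zigzag_path C W Y v Z"
  shows "zigzag_eval C E \<Phi> X (u @ v) = Cmp E (zigzag_eval C E \<Phi> Y v) (zigzag_eval C E \<Phi> X u)"
  using assms
proof induction
  case (nil X)
  then show ?case using zigzag_eval_hom hom_unit(1) by simp metis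
next
  case (fwd a u Y)
  then show ?case using hom_assoc[OF functor_hom zigzag_eval_hom zigzag_eval_hom] by simp
next
  case (bwd w u Y)
  then show ?case using hom_assoc[OF zigzag_inverse_hom zigzag_eval_hom zigzag_eval_hom] by simp
qed

lemma zigzag_path_splitE:
  assumes "zigzag_path C W X (u @ v) Z"
  obtains Y where "zigzag_path C W X u Y" "zigzag_path C W Y v Z"
  using assms
proof (induction u arbitrary: X thesis)
  case Nil
  then show ?case using zigzag_path_Obj[OF C] zigzag_path.nil by (metis append_Nil)
next
  case (Cons a u)
  from Cons.prems(2) show ?case
    by (cases rule: zigzag_path.cases) (auto intro: Cons.prems(1) zigzag_path.intros elim!: Cons.IH[rotated])
qed

lemma zigzag_path_unique:
  assumes "zigzag_path C W X u Y" "zigzag_path C W X u Y'"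
  shows "Y = Y'"
  using assms by (induction) (auto elim: zigzag_path_elims)

lemma zigzag_eval_rel:
  assumes "zigzag_rel C W m m'" "zigzag_path C W X m Y" "zigzag_path C W X m' Y"
  shows "zigzag_eval C E \<Phi> X m = zigzag_eval C E \<Phi> X m'"
  using assms(1)
proof cases
  case (1 Z)
  have "X = Z" using assms(2) 1 C by (auto elim!: zigzag_path_elims simp: is_category_def)
  moreover have "Cod C (Ide C Z) = Z" "is_hom E (fst \<Phi> Z) (fst \<Phi> Z) (Ide E (fst \<Phi> Z))"
    using 1 C E \<Phi> by (auto simp: is_category_def is_functor_def is_hom_def)
  moreover have "snd \<Phi> (Ide C Z) = Ide E (fst \<Phi> Z)" using 1 \<Phi> by (simp add: is_functor_def)
  ultimately show ?thesis using 1 hom_unit by simp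
next
  case (2 a b)
  have "snd \<Phi> (Cmp C b a) = Cmp E (snd \<Phi> b) (snd \<Phi> a)" "Cod C (Cmp C b a) = Cod C b"
    using 2 \<Phi> C by (auto simp: is_functor_def is_category_def)
  moreover have "is_hom E (fst \<Phi> (Dom C a)) (fst \<Phi> (Dom C b)) (snd \<Phi> a)" 
     "is_hom E (fst \<Phi> (Dom C b)) (fst \<Phi> (Cod C b)) (snd \<Phi> b)"
     "is_hom E (fst \<Phi> (Cod C b)) (fst \<Phi> (Cod C b)) (Ide E (fst \<Phi> (Cod C b)))"
    using functor_hom 2 zigzag_eval_hom[OF zigzag_path.nil, of "Cod C b"] C
    by (metis, metis, auto simp: is_category_def)
  ultimately show ?thesis using 2 hom_assoc by simp
next
  case (3 w)
  have X: "X = Dom C w" using assms(2) 3 by (auto elim!: zigzag_path_elims)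
  have i: "inverse_arrows E (snd \<Phi> w) (SOME b. inverse_arrows E (snd \<Phi> w) b)"
    using 3 zigzag_some_inverse by blast
  have h: "is_hom E (fst \<Phi> (Dom C w)) (fst \<Phi> (Cod C w)) (snd \<Phi> w)" using 3 C functor_hom by blast
  define b where "b = (SOME b. inverse_arrows E (snd \<Phi> w) b)"
  show ?thesis using 3 X i h hom_unit(2)[OF zigzag_inverse_hom[of w]]
    unfolding b_def[symmetric] by (simp add: inverse_arrows_def is_hom_def flip: b_def)
next
  case (4 w)
  have X: "X = Cod C w" using assms(2) 4 by (auto elim!: zigzag_path_elims)
  have i: "inverse_arrows E (snd \<Phi> w) (SOME b. inverse_arrows E (snd \<Phi> w) b)"
    using 4 zigzag_some_inverse by blast
  have h: "is_hom E (fst \<Phi> (Dom C w)) (fst \<Phi> (Cod C w)) (snd \<Phi> w)" using 4 C functor_hom by blast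
  define b where "b = (SOME b. inverse_arrows E (snd \<Phi> w) b)"
  show ?thesis using 4 X i h hom_unit(2)[OF h]
    unfolding b_def[symmetric] by (simp add: inverse_arrows_def is_hom_def flip: b_def)
qed

lemma zigzag_eval_step:
  assumes "zigzag_step C W p q"
  shows "zigzag_eval C E \<Phi> (fst p) (fst (snd p)) = zigzag_eval C E \<Phi> (fst q) (fst (snd q))"
  using assms
proof cases
  case (1 m m' X l r Y)
  obtain A B where p: "zigzag_path C W X l A" "zigzag_path C W A m B" "zigzag_path C W B r Y"
    using 1 by (metis zigzag_path_splitE)
  obtain A' B' where p': "zigzag_path C W X l A'" "zigzag_path C W A' m' B'" "zigzag_path C W B' r Y"
    using 1 by (metis zigzag_path_splitE)
  have A: "A' = A" using p(1) p'(1) by (rule zigzag_path_unique[symmetric])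
  have B: "B' = B"
    using 1(3)
  proof cases
    case (1 Z)
    then show ?thesis using p(2) p'(2) A C by (auto elim!: zigzag_path_elims simp: is_category_def)
  next
    case (2 a b)
    then have "Cod C (Cmp C b a) = Cod C b" using C by (simp add: is_category_def)
    then show ?thesis using 2 p(2) p'(2) A by (auto elim!: zigzag_path_elims)
  qed (use p(2) p'(2) A in \<open>auto elim!: zigzag_path_elims\<close>)
  note p' = p'[unfolded A B]
  have "zigzag_eval C E \<Phi> A m = zigzag_eval C E \<Phi> A m'"
    by (rule zigzag_eval_rel[OF 1(3) p(2) p'(2)])
  then have "zigzag_eval C E \<Phi> A (m @ r) = zigzag_eval C E \<Phi> A (m' @ r)"
    using zigzag_eval_app[OF p(2,3)] zigzag_eval_app[OF p'(2,3)] by simp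
  then have "zigzag_eval C E \<Phi> X (l @ m @ r) = zigzag_eval C E \<Phi> X (l @ m' @ r)"
    using zigzag_eval_app[OF p(1) zigzag_path_app[OF p(2,3)]]
      zigzag_eval_app[OF p'(1) zigzag_path_app[OF p'(2,3)]] by simp
  then show ?thesis using 1 by simp
qed

lemma zigzag_eval_equiv:
  assumes "equivclp (zigzag_step C W) p q"
  shows "zigzag_eval C E \<Phi> (fst p) (fst (snd p)) = zigzag_eval C E \<Phi> (fst q) (fst (snd q))"
  using assms by (induction rule: equivclp_induct) (auto dest: zigzag_eval_step)

definition zigzag_lift :: "('o, ('o, 'a) zigzag set, 'p, 'b) cfunctor"
  where "zigzag_lift = (fst \<Phi>, \<lambda>A. let p = SOME p. p \<in> A in zigzag_eval C E \<Phi> (fst p) (fst (snd p)))"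

lemma zigzag_lift_class:
  assumes "zigzag_path C W X u Y"
  shows "snd zigzag_lift (zigzag_class C W (X, u, Y)) = zigzag_eval C E \<Phi> X u"
proof -
  obtain u' where u': "(SOME p. p \<in> zigzag_class C W (X, u, Y)) = (X, u', Y)"
    "zigzag_path C W X u' Y" "equivclp (zigzag_step C W) (X, u, Y) (X, u', Y)"
    using zigzag_some[OF assms] .
  show ?thesis using zigzag_eval_equiv[OF u'(3)] by (simp add: zigzag_lift_def u'(1))
qed

lemma zigzag_lift_functor: "is_functor (zigzag_category C W) E zigzag_lift"
  unfolding is_functor_def
proof (intro conjI ballI impI; (elim zigzag_ArrE)?)
  fix X assume "X \<in> Obj (zigzag_category C W)"
  then show "fst zigzag_lift X \<in> Obj E"
    "snd zigzag_lift (Ide (zigzag_category C W) X) = Ide E (fst zigzag_lift X)"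
    using \<Phi> zigzag_lift_class[OF zigzag_path.nil]
    by (auto simp: zigzag_Obj_Ide is_functor_def) (simp_all add: zigzag_lift_def)
next
  fix a X u Y assume "a = zigzag_class C W (X, u, Y)" "zigzag_path C W X u Y"
  then show "is_hom E (fst zigzag_lift (Dom (zigzag_category C W) a))
      (fst zigzag_lift (Cod (zigzag_category C W) a)) (snd zigzag_lift a)"
    using zigzag_eval_hom by (simp add: zigzag_category_simps zigzag_lift_class) (simp add: zigzag_lift_def)
next
  fix a b X u Y Y' v Z
  assume "Cod (zigzag_category C W) a = Dom (zigzag_category C W) b"
    and ab: "a = zigzag_class C W (X, u, Y)" "zigzag_path C W X u Y"
    "b = zigzag_class C W (Y', v, Z)" "zigzag_path C W Y' v Z"
  then have "Y' = Y" by (simp add: zigzag_category_simps)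
  moreover from this ab have "zigzag_path C W X (u @ v) Z" by (blast intro: zigzag_path_app)
  ultimately show "snd zigzag_lift (Cmp (zigzag_category C W) b a) =
      Cmp E (snd zigzag_lift b) (snd zigzag_lift a)"
    using ab by (simp add: zigzag_category_simps zigzag_lift_class zigzag_eval_app)
qed

lemma zigzag_lift_comp: "functor_eq C (functor_comp zigzag_lift (zigzag_functor C W)) \<Phi>"
  unfolding functor_eq_def functor_comp_def
proof (intro conjI ballI)
  fix a assume a: "a \<in> Arr C"
  then have "snd zigzag_lift (zigzag_class C W (Dom C a, [Inl a], Cod C a)) = snd \<Phi> a"
    using zigzag_lift_class[OF zigzag_path_Inl[OF C(1) a]] hom_unit(2)[OF functor_hom] by simp
  then show "snd (fst zigzag_lift \<circ> fst (zigzag_functor C W), snd zigzag_lift \<circ> snd (zigzag_functor C W)) a = snd \<Phi> a"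
    by (simp add: zigzag_functor_def)
qed (simp add: zigzag_functor_def zigzag_lift_def)

lemma zigzag_lift_unique:
  assumes F: "is_functor (zigzag_category C W) E F"
    and eq: "functor_eq C (functor_comp F (zigzag_functor C W)) \<Phi>"
  shows "functor_eq (zigzag_category C W) F zigzag_lift"
proof -
  have o: "fst F X = fst \<Phi> X" if "X \<in> Obj C" for X
    using eq that by (auto simp: functor_eq_def functor_comp_def zigzag_functor_def)
  have l: "snd F (zigzag_class C W (Dom C a, [Inl a], Cod C a)) = snd \<Phi> a" if "a \<in> Arr C" for a
    using eq that by (auto simp: functor_eq_def functor_comp_def zigzag_functor_def)
  have r: "snd F (zigzag_class C W (Cod C w, [Inr w], Dom C w)) = (SOME b. inverse_arrows E (snd \<Phi> w) b)"
    if "w \<in> W" for w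
  proof (rule inverse_arrows_unique[OF E _ zigzag_some_inverse[OF that]])
    show "inverse_arrows E (snd \<Phi> w) (snd F (zigzag_class C W (Cod C w, [Inr w], Dom C w)))"
      using functor_inverse_arrows[OF F zigzag_inverse_arrows[OF C that] zigzag_is_category[OF C]]
        l C that by auto
  qed
  have c: "snd F (zigzag_class C W (X, u @ v, Z)) =
      Cmp E (snd F (zigzag_class C W (Y, v, Z))) (snd F (zigzag_class C W (X, u, Y)))"
    if "zigzag_path C W X u Y" "zigzag_path C W Y v Z" for X u Y v Z
  proof -
    have "snd F (Cmp (zigzag_category C W) b a) = Cmp E (snd F b) (snd F a)"
      if "a \<in> Arr (zigzag_category C W)" "b \<in> Arr (zigzag_category C W)"
        "Cod (zigzag_category C W) a = Dom (zigzag_category C W) b" for a b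
      using F that by (simp add: is_functor_def)
    from this[of "zigzag_class C W (X, u, Y)" "zigzag_class C W (Y, v, Z)"]
    show ?thesis using that by (simp add: zigzag_category_simps)
  qed
  have *: "snd F (zigzag_class C W (X, u, Y)) = zigzag_eval C E \<Phi> X u" if "zigzag_path C W X u Y" for X u Y
    using that
  proof induction
    case (nil X)
    then show ?case using F o by (simp add: is_functor_def zigzag_Obj_Ide)
  next
    case (fwd a u Y)
    then show ?case using c[OF zigzag_path_Inl[OF C(1)] fwd(2)] l by simp
  next
    case (bwd w u Y)
    then show ?case using c[OF zigzag_path_Inr[OF C] bwd(2)] r by simp
  qed
  show ?thesis
    unfolding functor_eq_def
  proof (intro conjI ballI; (elim zigzag_ArrE)?)
    fix X assume "X \<in> Obj (zigzag_category C W)"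
    then show "fst F X = fst zigzag_lift X" using o by (simp add: zigzag_Obj_Ide zigzag_lift_def)
  next
    fix a X u Y assume "a = zigzag_class C W (X, u, Y)" "zigzag_path C W X u Y"
    then show "snd F a = snd zigzag_lift a" using * zigzag_lift_class by simp
  qed
qed

end

theorem is_localization_zigzag:
  assumes C: "is_category C" "W \<subseteq> Arr C"
  shows "is_localization T C W (zigzag_category C W) (zigzag_functor C W)"
  unfolding is_localization_def
proof (intro conjI allI impI ballI)
  show "is_category (zigzag_category C W)" using zigzag_is_category[OF C] .
  show "is_functor C (zigzag_category C W) (zigzag_functor C W)" using zigzag_is_functor[OF C(1)] .
  show "invertible_arrow (zigzag_category C W) (snd (zigzag_functor C W) w)" if "w \<in> W" for w
    using zigzag_inverse_arrows[OF C that] by (auto simp: invertible_arrow_def zigzag_functor_def)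
  fix E :: "('c, 'd) category" and \<Phi>
  assume "is_category E \<and> is_functor C E \<Phi> \<and> (\<forall>w\<in>W. invertible_arrow E (snd \<Phi> w))"
  then have "is_category E" "is_functor C E \<Phi>" "\<forall>w\<in>W. invertible_arrow E (snd \<Phi> w)" by auto
  note * = C this
  show "\<exists>\<Psi>. is_functor (zigzag_category C W) E \<Psi> \<and>
      functor_eq C (functor_comp \<Psi> (zigzag_functor C W)) \<Phi> \<and>
      (\<forall>\<Psi>'. is_functor (zigzag_category C W) E \<Psi>' \<and>
         functor_eq C (functor_comp \<Psi>' (zigzag_functor C W)) \<Phi> \<longrightarrow>
         functor_eq (zigzag_category C W) \<Psi>' \<Psi>)"
    by (intro exI[of _ "zigzag_lift C E \<Phi>"] conjI allI impI zigzag_lift_functor[OF *]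
        zigzag_lift_comp[OF *]) (auto intro: zigzag_lift_unique[OF *])
qed


section \<open>The category of Lie groupoids and isomorphism classes of smooth functors\<close>

definition functor_class ::
    "'u lie_groupoid \<Rightarrow> 'u lie_groupoid \<Rightarrow> 'u gfunctor \<Rightarrow> 'u gfunctor set"
  where "functor_class G H F = {F'. isomorphic_functors G H F F'}"

type_synonym 'u gp_arrow = "'u lie_groupoid \<times> 'u lie_groupoid \<times> 'u gfunctor set"

definition gp_arrow :: "'u lie_groupoid \<Rightarrow> 'u lie_groupoid \<Rightarrow> 'u gfunctor \<Rightarrow> 'u gp_arrow"
  where "gp_arrow G H F = (G, H, functor_class G H F)"

definition Gp :: "('u lie_groupoid, 'u gp_arrow) category"
  where "Gp =
    \<lparr>Obj = {G. lie_groupoid G},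
     Arr = {gp_arrow G H F | G H F. lie_groupoid G \<and> lie_groupoid H \<and> smooth_functor G H F},
     Dom = fst, Cod = fst \<circ> snd,
     Ide = (\<lambda>G. gp_arrow G G (id, id)),
     Cmp = (\<lambda>(G', K, B) (G, H, A).
       (G, K, \<Union>f\<in>A. \<Union>g\<in>B. functor_class G K (fst g \<circ> fst f, snd g \<circ> snd f)))\<rparr>"

definition gp_equivalences :: "'u gp_arrow set"
  where "gp_equivalences =
    {gp_arrow G H F | G H F. lie_groupoid G \<and> lie_groupoid H \<and> lie_equivalence G H F}"


section \<open>The circle and the group of order two\<close>

text \<open>
  Any injection \<open>e\<close> of \<open>\<complex>\<close> into the universe \<open>'u\<close> provides copies of the circle and of
  \<open>\<int>/2\<close>; such an \<open>e\<close> exists whenever \<open>'u\<close> is at least as large as the continuum.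
\<close>

definition plane :: "(complex \<Rightarrow> 'u) \<Rightarrow> 'u manifold"
  where "plane e = manifold_of_atlas
    (pullback_topology (range e) (inv_into UNIV e) euclidean)
    {(2, range e, \<lambda>x i. if i = 0 then Re (inv_into UNIV e x)
                       else if i = 1 then Im (inv_into UNIV e x) else 0)}"

definition circle :: "(complex \<Rightarrow> 'u) \<Rightarrow> 'u manifold"
  where "circle e = submanifold (plane e) (e ` sphere 0 1)"

definition Z2_groupoid :: "(complex \<Rightarrow> 'u) \<Rightarrow> 'u lie_groupoid"
  where "Z2_groupoid e = group_groupoid (e \<circ> of_int) (integer_mod_group 2)"

text \<open>For \<open>(L, P)\<close> a localization of \<^const>\<open>Gp\<close>, this is \<open>f|\<^sub>U\<close> for \<open>f\<close> out of \<open>M\<close> and \<open>U\<close> open in \<open>M\<close>.\<close>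

definition restrict_arrow ::
    "('q, 'c) category \<Rightarrow> ('u lie_groupoid, 'u gp_arrow, 'q, 'c) cfunctor \<Rightarrow>
     'u manifold \<Rightarrow> 'u set \<Rightarrow> 'c \<Rightarrow> 'c"
  where "restrict_arrow L P M U f = Cmp L f (snd P
    (gp_arrow (manifold_groupoid (open_submanifold M U)) (manifold_groupoid M) (id, id)))"

end

theory Submission
  imports Defs
begin

text \<open>
  The two morphisms are the trivial map and the classifying map of the connected double cover of the circle.
  Squaring is an equivalence \<open>q\<close> from the action groupoid \<open>H\<close> of the antipodal map to the circle, and the
  projection \<open>p\<close> of \<open>H\<close> to \<open>\<int>/2\<close> gives the morphism \<open>p q\<inverse>\<close>. Over the complement of a point there is a
  continuous square root; it is a smooth functor \<open>\<sigma>\<close> into \<open>H\<close> with \<open>q \<sigma>\<close> the inclusion and \<open>p \<sigma>\<close>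
  trivial, so the two morphisms agree there.

  They are separated by the functor \<open>G \<mapsto> H\<^sup>1(S\<^sup>1; G)\<close> of Cech cocycles with values in a Lie groupoid,
  which inverts equivalences because surjective submersions have local sections. The functors from
  \<open>H\<close> to \<open>\<int>/2\<close> given by \<open>p\<close> and by the trivial map act differently on the tautological cocycle of
  local square roots, since there is no continuous square root on the whole circle. Cocycles are
  treated up to coboundary by using relations instead of quotients.
\<close>

section \<open>Differential calculus in Euclidean spaces of varying dimension\<close>

subsection \<open>The topology of Euclidean space\<close>

text \<open>Arrows of a localization are told apart from outside, by a functor on \<open>Gp\<close>
  that inverts equivalences and separates them. As q becomes invertible, p composed with the inverse
  of q differs from the trivial morphism as soon as p and the trivial functor on H have different
  images; so only actual smooth functors out of H are compared. The obvious invariant, isomorphism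
  classes of smooth functors from the circle to G, does not invert q: the identity of the circle
  would have to lift to H, which is a global square root. Cocycles cure this by lifting only
  locally. They are taken to be merely continuous, so that from a submersion one wants a continuous
  right inverse, and a contraction estimate provides it. The other obstacle is the number of
  smoothness conditions in the concrete groupoids, fibre products included. Objects and arrows of H
  are etale over the circle, and a continuous map between manifolds etale over one base is smooth if
  it respects the projections; so each of these conditions becomes one of continuity.\<close>

lemma Euclidean_space_eq: "Euclidean_space n = top_of_set {x. \<forall>i\<ge>n. x i = 0}"
  by (simp add: Euclidean_space_def euclidean_product_topology)

lemma openin_Euclidean_space_subset: "openin (Euclidean_space n) W \<Longrightarrow> x \<in> W \<Longrightarrow> n \<le> i \<Longrightarrow> x i = 0"
  using openin_subset[of "Euclidean_space n" W] by (auto simp: topspace_Euclidean_space)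

text \<open>Cubes around \<open>x\<close> in the first \<open>n\<close> coordinates. They form the
  neighbourhood basis in which all estimates below are made; being products of intervals, they allow
  one coordinate to be changed at a time.\<close>

definition ebox :: "nat \<Rightarrow> (nat \<Rightarrow> real) \<Rightarrow> real \<Rightarrow> (nat \<Rightarrow> real) set"
  where "ebox n x \<delta> = {y. (\<forall>i\<ge>n. y i = 0) \<and> (\<forall>i<n. \<bar>y i - x i\<bar> < \<delta>)}"

lemma openin_Euclidean_space_ebox:
  assumes "openin (Euclidean_space n) W" "x \<in> W"
  obtains \<delta> where "\<delta> > 0" "ebox n x \<delta> \<subseteq> W"
proof -
  obtain T where T: "open T" "W = {x. \<forall>i\<ge>n. x i = 0} \<inter> T"
    using assms(1) by (auto simp: Euclidean_space_eq openin_open)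
  have "openin (powertop_real UNIV) T" using T(1) by (simp add: open_fun_def)
  then obtain X where X: "x \<in> PiE UNIV X" "\<And>i. open (X i)" "finite {i. X i \<noteq> UNIV}" "PiE UNIV X \<subseteq> T"
    using product_topology_open_contains_basis[of "\<lambda>_. euclideanreal" UNIV T x] assms(2) T(2) by auto
  have "\<exists>d. d > 0 \<and> (\<forall>t. \<bar>t - x i\<bar> < d \<longrightarrow> t \<in> X i)" for i
    using X(2)[of i] PiE_mem[OF X(1), of i] unfolding open_dist dist_real_def by blast
  then have "\<exists>d. \<forall>i. d i > 0 \<and> (\<forall>t. \<bar>t - x i\<bar> < d i \<longrightarrow> t \<in> X i)"
    by (intro choice allI)
  then obtain d where d: "\<And>i. d i > 0" "\<And>i t. \<bar>t - x i\<bar> < d i \<Longrightarrow> t \<in> X i" by blast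
  \<comment> \<open>Only the finitely many coordinates below \<open>n\<close> have to be bounded, as
    the others vanish for both points. The extra 1 keeps the minimum defined when \<open>n\<close>
    is 0.\<close>
  define \<delta> where "\<delta> = Min (insert 1 (d ` {..<n}))"
  have le: "\<delta> \<le> d i" if "i < n" for i using that by (auto simp: \<delta>_def)
  have "y \<in> W" if y: "y \<in> ebox n x \<delta>" for y
  proof -
    have "y i \<in> X i" for i
    proof (cases "i < n")
      case True then show ?thesis using d(2) le[of i] y by (force simp: ebox_def)
    next
      case False
      then have "y i = x i" using y assms(2) T(2) by (auto simp: ebox_def)
      then show ?thesis using X(1) by auto
    qed
    then have "y \<in> T" using X(4) by auto
    then show ?thesis using y T(2) by (auto simp: ebox_def)
  qed
  moreover have "\<delta> > 0" using d(1) by (auto simp: \<delta>_def)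
  ultimately show thesis using that by blast
qed

text \<open>This makes partial derivatives local: an equality on an open set holds along a
  coordinate line near each of its points and hence passes to derivatives.\<close>

lemma eventually_line_in_open:
  assumes "openin (Euclidean_space n) W" "x \<in> W" "i < n"
  shows "\<forall>\<^sub>F t in nhds (x i). x(i := t) \<in> W"
proof -
  obtain \<delta> where \<delta>: "\<delta> > 0" "ebox n x \<delta> \<subseteq> W" using openin_Euclidean_space_ebox[OF assms(1,2)] .
  have "\<forall>\<^sub>F t in nhds (x i). \<bar>t - x i\<bar> < \<delta>"
    using eventually_nhds_in_open[of "ball (x i) \<delta>" "x i"] \<delta>(1)
    by (simp add: dist_real_def abs_minus_commute)
  then show ?thesis
  proof eventually_elim
    case (elim t)
    then have "x(i := t) \<in> ebox n x \<delta>"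
      using assms openin_Euclidean_space_subset[OF assms(1,2)] \<delta>(1) by (auto simp: ebox_def)
    then show ?case using \<delta>(2) by blast
  qed
qed


subsection \<open>Strict differentiability of functions with continuous partial derivatives\<close>

text \<open>Going from \<open>w\<close> to \<open>v\<close> one coordinate at a time, through the
  hybrid points \<open>z j\<close>, stays inside the box. Each move costs at most
  \<open>\<epsilon>\<close> times its length by the mean value inequality in one variable.\<close>

lemma partials_bounded_imp_lipschitz:
  fixes k :: "(nat \<Rightarrow> real) \<Rightarrow> real"
  assumes D: "\<And>y i. y \<in> ebox n c \<delta> \<Longrightarrow> i < n \<Longrightarrow> ((\<lambda>t. k (y(i := t))) has_real_derivative D i y) (at (y i))"
    and bound: "\<And>y i. y \<in> ebox n c \<delta> \<Longrightarrow> i < n \<Longrightarrow> \<bar>D i y\<bar> \<le> \<epsilon>"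
    and v: "v \<in> ebox n c \<delta>" and w: "w \<in> ebox n c \<delta>"
  shows "\<bar>k v - k w\<bar> \<le> \<epsilon> * (\<Sum>j<n. \<bar>v j - w j\<bar>)"
proof -
  define z where "z = (\<lambda>j i. if i < j then v i else w i)"
  have z: "(z j)(j := t) \<in> ebox n c \<delta>" if "j < n" "\<bar>t - c j\<bar> < \<delta>" for j t
    using v w that by (auto simp: z_def ebox_def)
  have "\<bar>k (z j) - k w\<bar> \<le> \<epsilon> * (\<Sum>i<j. \<bar>v i - w i\<bar>)" if "j \<le> n" for j
    using that
  proof (induction j)
    case 0 then show ?case by (simp add: z_def)
  next
    case (Suc j)
    have eq: "z (Suc j) = (z j)(j := v j)" "z j = (z j)(j := w j)"
      by (auto simp: z_def fun_eq_iff less_Suc_eq)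
    have "norm (k ((z j)(j := v j)) - k ((z j)(j := w j))) \<le> \<epsilon> * norm (v j - w j)"
    proof (rule field_differentiable_bound[where S = "{c j - \<delta><..<c j + \<delta>}" and f' = "\<lambda>t. D j ((z j)(j := t))"])
      fix t assume t: "t \<in> {c j - \<delta><..<c j + \<delta>}"
      have "(z j)(j := t) \<in> ebox n c \<delta>" using t Suc by (intro z) auto
      from D[OF this, of j] bound[OF this, of j] Suc
      show "((\<lambda>t. k ((z j)(j := t))) has_real_derivative D j ((z j)(j := t))) (at t within {c j - \<delta><..<c j + \<delta>})"
        "norm (D j ((z j)(j := t))) \<le> \<epsilon>"
        by (auto intro: has_field_derivative_at_within)
    qed (use v w Suc in \<open>auto simp: ebox_def abs_less_iff algebra_simps\<close>)
    then have "\<bar>k (z (Suc j)) - k (z j)\<bar> \<le> \<epsilon> * \<bar>v j - w j\<bar>"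
      using eq by (metis real_norm_def)
    moreover have "\<bar>k (z j) - k w\<bar> \<le> \<epsilon> * (\<Sum>i<j. \<bar>v i - w i\<bar>)" using Suc by simp
    ultimately show ?case by (simp add: algebra_simps)
  qed
  moreover have "z n = v" using v w by (auto simp: z_def ebox_def fun_eq_iff)
  ultimately show ?thesis by (metis order_refl)
qed

lemma continuous_map_Euclidean_open:
  assumes "openin (Euclidean_space n) W"
    and "continuous_map (subtopology (Euclidean_space n) W) euclideanreal g" "x \<in> W" "\<epsilon> > 0"
  shows "\<exists>\<delta>>0. ebox n x \<delta> \<subseteq> W \<and> (\<forall>y\<in>ebox n x \<delta>. \<bar>g y - g x\<bar> < \<epsilon>)"
proof -
  let ?V = "{y \<in> topspace (subtopology (Euclidean_space n) W). g y \<in> ball (g x) \<epsilon>}"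
  have "openin (subtopology (Euclidean_space n) W) ?V"
    by (rule openin_continuous_map_preimage[OF assms(2)]) auto
  then have "openin (Euclidean_space n) ?V" using assms(1) openin_trans_full by blast
  moreover have "x \<in> ?V" using assms openin_subset[OF assms(1)] by auto
  ultimately obtain \<delta> where "\<delta> > 0" "ebox n x \<delta> \<subseteq> ?V" by (rule openin_Euclidean_space_ebox)
  then show ?thesis by (intro exI[of _ \<delta>]) (auto simp: dist_real_def)
qed

text \<open>Subtracting the linear map with coefficients \<open>D j x\<close> leaves a function
  whose partial derivatives are small near \<open>x\<close> by continuity, so the Lipschitz bound
  applies to it. The estimate compares two arbitrary points of the box, not just a point with
  \<open>x\<close>; the contraction behind the local sections uses it in this uniform form.\<close>

lemma strictly_differentiable:
  assumes W: "openin (Euclidean_space n) W"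
    and D: "\<And>y i. y \<in> W \<Longrightarrow> i < n \<Longrightarrow> ((\<lambda>t. g (y(i := t))) has_real_derivative D i y) (at (y i))"
    and cont: "\<And>i. i < n \<Longrightarrow> continuous_map (subtopology (Euclidean_space n) W) euclideanreal (D i)"
    and x: "x \<in> W" and \<epsilon>: "\<epsilon> > 0"
  shows "\<exists>\<delta>>0. ebox n x \<delta> \<subseteq> W \<and> (\<forall>v\<in>ebox n x \<delta>. \<forall>w\<in>ebox n x \<delta>.
       \<bar>g v - g w - (\<Sum>j<n. D j x * (v j - w j))\<bar> \<le> \<epsilon> * (\<Sum>j<n. \<bar>v j - w j\<bar>))"
proof -
  have "\<exists>d. i < n \<longrightarrow> d > 0 \<and> (\<forall>y\<in>ebox n x d. \<bar>D i y - D i x\<bar> < \<epsilon>)" for i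
    using continuous_map_Euclidean_open[OF W cont x \<epsilon>, of i] by auto
  then have "\<exists>d. \<forall>i. i < n \<longrightarrow> d i > 0 \<and> (\<forall>y\<in>ebox n x (d i). \<bar>D i y - D i x\<bar> < \<epsilon>)"
    by (intro choice allI)
  then obtain d where d: "\<And>i. i < n \<Longrightarrow> d i > 0" "\<And>i y. i < n \<Longrightarrow> y \<in> ebox n x (d i) \<Longrightarrow> \<bar>D i y - D i x\<bar> < \<epsilon>"
    by blast
  obtain \<delta>0 where \<delta>0: "\<delta>0 > 0" "ebox n x \<delta>0 \<subseteq> W" using openin_Euclidean_space_ebox[OF W x] .
  define \<delta> where "\<delta> = Min (insert \<delta>0 (d ` {..<n}))"
  have pos: "\<delta> > 0" using d(1) \<delta>0(1) by (auto simp: \<delta>_def)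
  have le: "\<delta> \<le> \<delta>0" "\<And>i. i < n \<Longrightarrow> \<delta> \<le> d i" by (auto simp: \<delta>_def)
  have mono: "ebox n x \<delta> \<subseteq> ebox n x \<eta>" if "\<delta> \<le> \<eta>" for \<eta>
    using that by (force simp: ebox_def)
  show ?thesis
  proof (intro exI[of _ \<delta>] conjI ballI pos)
    show W': "ebox n x \<delta> \<subseteq> W" using mono[OF le(1)] \<delta>0(2) by blast
    fix v w assume vw: "v \<in> ebox n x \<delta>" "w \<in> ebox n x \<delta>"
    define k where "k = (\<lambda>y. g y - (\<Sum>j<n. D j x * y j))"
    have "\<bar>k v - k w\<bar> \<le> \<epsilon> * (\<Sum>j<n. \<bar>v j - w j\<bar>)"
    proof (rule partials_bounded_imp_lipschitz[where D = "\<lambda>i y. D i y - D i x"])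
      fix y i assume yi: "y \<in> ebox n x \<delta>" "i < n"
      have "(\<Sum>j<n. D j x * (y(i := t)) j) = D i x * t + (\<Sum>j\<in>{..<n} - {i}. D j x * y j)" for t
        using yi(2) by (subst sum.remove[of _ i]) auto
      then have "(\<lambda>t. k (y(i := t))) = (\<lambda>t. g (y(i := t)) - (D i x * t + (\<Sum>j\<in>{..<n} - {i}. D j x * y j)))"
        by (simp add: k_def)
      then show "((\<lambda>t. k (y(i := t))) has_real_derivative D i y - D i x) (at (y i))"
        using D[of y i] yi W' by (auto intro!: derivative_eq_intros)
      show "\<bar>D i y - D i x\<bar> \<le> \<epsilon>" using d(2)[OF yi(2), of y] mono[OF le(2)[OF yi(2)]] yi(1) by force
    qed (use vw in auto)
    moreover have "k v - k w = g v - g w - (\<Sum>j<n. D j x * (v j - w j))"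
      by (simp add: k_def sum_subtractf algebra_simps)
    ultimately show "\<bar>g v - g w - (\<Sum>j<n. D j x * (v j - w j))\<bar> \<le> \<epsilon> * (\<Sum>j<n. \<bar>v j - w j\<bar>)"
      by simp
  qed
qed

text \<open>The difference quotient of \<open>g (c t)\<close> minus the linear combination of the
  quotients \<open>q j\<close> is the error of strict differentiability divided by
  \<open>t - t0\<close>. It is at most \<open>e / S\<close> times the sum of the moduli of the
  \<open>q j\<close>, which stays below \<open>S\<close> near \<open>t0\<close>.\<close>

lemma chain_rule_curve:
  fixes c :: "real \<Rightarrow> nat \<Rightarrow> real"
  assumes W: "openin (Euclidean_space n) W"
    and D: "\<And>y i. y \<in> W \<Longrightarrow> i < n \<Longrightarrow> ((\<lambda>t. g (y(i := t))) has_real_derivative D i y) (at (y i))"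
    and cont: "\<And>i. i < n \<Longrightarrow> continuous_map (subtopology (Euclidean_space n) W) euclideanreal (D i)"
    and c: "\<And>j. j < n \<Longrightarrow> ((\<lambda>t. c t j) has_real_derivative c' j) (at t0)"
    and cW: "\<forall>\<^sub>F t in nhds t0. c t \<in> W"
  shows "((\<lambda>t. g (c t)) has_real_derivative (\<Sum>j<n. D j (c t0) * c' j)) (at t0)"
proof -
  have c0: "c t0 \<in> W" using eventually_nhds_x_imp_x[OF cW] .
  define q where "q = (\<lambda>j t. (c t j - c t0 j) / (t - t0))"
  have q: "(q j \<longlongrightarrow> c' j) (at t0)" if "j < n" for j
    using c[OF that] by (simp add: has_field_derivative_iff q_def)
  define r where "r = (\<lambda>t. (g (c t) - g (c t0)) / (t - t0) - (\<Sum>j<n. D j (c t0) * q j t))"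
  have "(r \<longlongrightarrow> 0) (at t0)"
  proof (rule tendstoI)
    fix e :: real assume e: "e > 0"
    \<comment> \<open>One more than the limit of the sum of the \<open>\<bar>q j t\<bar>\<close>, so
      that this sum is eventually below \<open>S\<close>, and \<open>S\<close> is positive even if
      all derivatives vanish.\<close>
    define S where "S = (\<Sum>j<n. \<bar>c' j\<bar>) + 1"
    have S: "S > 0" unfolding S_def by (intro add_nonneg_pos sum_nonneg) auto
    obtain \<delta> where \<delta>: "\<delta> > 0" "ebox n (c t0) \<delta> \<subseteq> W"
      "\<forall>v\<in>ebox n (c t0) \<delta>. \<forall>w\<in>ebox n (c t0) \<delta>.
         \<bar>g v - g w - (\<Sum>j<n. D j (c t0) * (v j - w j))\<bar> \<le> e / S * (\<Sum>j<n. \<bar>v j - w j\<bar>)"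
      using strictly_differentiable[where g = g, OF W D cont c0 divide_pos_pos[OF e S]] by auto
    have "((\<lambda>t. \<Sum>j<n. \<bar>q j t\<bar>) \<longlongrightarrow> (\<Sum>j<n. \<bar>c' j\<bar>)) (at t0)"
      using q by (intro tendsto_sum tendsto_rabs) auto
    then have 1: "\<forall>\<^sub>F t in at t0. (\<Sum>j<n. \<bar>q j t\<bar>) < S"
      by (rule order_tendstoD) (simp add: S_def)
    have 2: "\<forall>\<^sub>F t in at t0. c t \<in> W" using cW by (simp add: eventually_at_filter eventually_mono)
    have "\<forall>\<^sub>F t in at t0. \<forall>j\<in>{..<n}. \<bar>c t j - c t0 j\<bar> < \<delta>"
    proof (intro eventually_ball_finite ballI)
      fix j assume "j \<in> {..<n}"
      then have "isCont (\<lambda>t. c t j) t0" using c DERIV_isCont by blast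
      then have "((\<lambda>t. c t j) \<longlongrightarrow> c t0 j) (at t0)" by (simp add: isCont_def)
      from tendstoD[OF this \<delta>(1)] show "\<forall>\<^sub>F t in at t0. \<bar>c t j - c t0 j\<bar> < \<delta>"
        by (simp add: dist_real_def)
    qed simp
    with 1 2 eventually_neq_at_within[of t0 t0 UNIV] show "\<forall>\<^sub>F t in at t0. dist (r t) 0 < e"
    proof eventually_elim
      case (elim t)
      have in_ebox: "c t \<in> ebox n (c t0) \<delta>" "c t0 \<in> ebox n (c t0) \<delta>"
        using elim openin_Euclidean_space_subset[OF W elim(2)] openin_Euclidean_space_subset[OF W c0] \<delta>(1)
        by (auto simp: ebox_def)
      have "r t = (g (c t) - g (c t0) - (\<Sum>j<n. D j (c t0) * (c t j - c t0 j))) / (t - t0)"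
        by (simp add: r_def q_def diff_divide_distrib[of _ "sum _ _"] sum_divide_distrib)
      then have "\<bar>r t\<bar> \<le> e / S * (\<Sum>j<n. \<bar>c t j - c t0 j\<bar>) / \<bar>t - t0\<bar>"
        using divide_right_mono[OF \<delta>(3)[rule_format, OF in_ebox], of "\<bar>t - t0\<bar>"] by (simp only: abs_divide abs_ge_zero simp_thms)
      also have "\<dots> = e / S * (\<Sum>j<n. \<bar>q j t\<bar>)" by (simp add: q_def flip: sum_divide_distrib)
      also have "\<dots> < e / S * S" using elim(1) e S by (intro mult_strict_left_mono) auto
      finally show ?case using S by simp
    qed
  qed
  moreover have "((\<lambda>t. \<Sum>j<n. D j (c t0) * q j t) \<longlongrightarrow> (\<Sum>j<n. D j (c t0) * c' j)) (at t0)"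
    using q by (intro tendsto_sum tendsto_mult tendsto_const) auto
  ultimately have "((\<lambda>t. r t + (\<Sum>j<n. D j (c t0) * q j t)) \<longlongrightarrow> 0 + (\<Sum>j<n. D j (c t0) * c' j)) (at t0)"
    by (rule tendsto_add)
  then show ?thesis by (simp add: has_field_derivative_iff r_def)
qed


subsection \<open>Functions of class \<open>C\<^sup>k\<close>\<close>

lemma Ck_imp_continuous: "Ck n k W g \<Longrightarrow> continuous_map (subtopology (Euclidean_space n) W) euclideanreal g"
  by (cases k) auto

lemma Ck_cong:
  assumes "openin (Euclidean_space n) W" "\<And>x. x \<in> W \<Longrightarrow> g x = h x" "Ck n k W g"
  shows "Ck n k W h"
proof (cases k)
  case 0
  then show ?thesis using assms by (auto intro: continuous_map_eq)
next
  case (Suc l)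
  have "((\<lambda>t. h (x(i := t))) has_real_derivative d) (at (x i))"
    if d: "((\<lambda>t. g (x(i := t))) has_real_derivative d) (at (x i))" and x: "x \<in> W" "i < n" for x i d
  proof -
    have "\<forall>\<^sub>F t in nhds (x i). g (x(i := t)) = h (x(i := t))"
      using eventually_line_in_open[OF assms(1) x] by eventually_elim (rule assms(2))
    from DERIV_cong_ev[OF refl this refl, of d] d show ?thesis by simp
  qed
  moreover have "continuous_map (subtopology (Euclidean_space n) W) euclideanreal h"
    using assms Suc by (auto intro: continuous_map_eq)
  ultimately show ?thesis using assms(3) unfolding Suc by (simp, meson)
qed

lemma Ck_subset:
  assumes "W' \<subseteq> W"
  shows "Ck n k W g \<Longrightarrow> Ck n k W' g"
proof (induction k arbitrary: g)
  case 0
  then show ?case using continuous_map_from_subtopology_mono[OF _ assms] by simp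
next
  case (Suc k)
  then show ?case using continuous_map_from_subtopology_mono[OF _ assms] assms
    unfolding Ck.simps by (meson subsetD)
qed

text \<open>Replaces the existential witness in \<open>Ck\<close> by a canonical one. Witnesses
  found on different open sets are then the same function, which is what lets
  \<open>Ck_local\<close> glue them.\<close>

lemma Ck_Suc_partial_deriv:
  assumes "openin (Euclidean_space n) W"
  shows "Ck n (Suc k) W g \<longleftrightarrow> continuous_map (subtopology (Euclidean_space n) W) euclideanreal g \<and>
     (\<forall>i<n. (\<forall>x\<in>W. ((\<lambda>t. g (x(i := t))) has_real_derivative partial_deriv i g x) (at (x i))) \<and>
        Ck n k W (partial_deriv i g))"
proof -
  have *: "(\<forall>x\<in>W. ((\<lambda>t. g (x(i := t))) has_real_derivative partial_deriv i g x) (at (x i))) \<and>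
      Ck n k W (partial_deriv i g)"
    if g': "\<forall>x\<in>W. ((\<lambda>t. g (x(i := t))) has_real_derivative g' x) (at (x i))" "Ck n k W g'" for i g'
  proof -
    have "g' x = partial_deriv i g x" if "x \<in> W" for x
      using DERIV_imp_deriv[OF g'(1)[rule_format, OF that]] by (simp add: partial_deriv_def)
    then show ?thesis using g' Ck_cong[OF assms _ g'(2)] by simp
  qed
  show ?thesis unfolding Ck.simps using * by blast
qed

lemma Ck_Suc_imp: "Ck n (Suc k) W g \<Longrightarrow> Ck n k W g"
proof (induction k arbitrary: g)
  case (Suc k)
  show ?case unfolding Ck.simps(2)[of n k]
  proof (intro conjI allI impI)
    show "continuous_map (subtopology (Euclidean_space n) W) euclideanreal g" using Suc.prems by simp
    fix i assume "i < n"
    then obtain g' where "\<forall>x\<in>W. ((\<lambda>t. g (x(i := t))) has_real_derivative g' x) (at (x i))" "Ck n (Suc k) W g'"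
      using Suc.prems unfolding Ck.simps(2)[of n "Suc k"] by blast
    then show "\<exists>g'. (\<forall>x\<in>W. ((\<lambda>t. g (x(i := t))) has_real_derivative g' x) (at (x i))) \<and> Ck n k W g'"
      using Suc.IH by blast
  qed
qed simp

lemma Ck_local:
  assumes "openin (Euclidean_space n) W"
    and "\<And>x. x \<in> W \<Longrightarrow> \<exists>W'. openin (Euclidean_space n) W' \<and> x \<in> W' \<and> Ck n k W' g"
  shows "Ck n k W g"
  using assms(2)
proof (induction k arbitrary: g)
  case 0
  show ?case unfolding Ck.simps continuous_map_def
  proof (intro conjI allI impI)
    fix U :: "real set" assume U: "openin euclideanreal U"
    let ?V = "{x \<in> topspace (subtopology (Euclidean_space n) W). g x \<in> U}"
    have "openin (Euclidean_space n) ?V"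
    proof (subst openin_subopen, intro ballI)
      fix x assume x: "x \<in> ?V"
      then obtain W' where W': "openin (Euclidean_space n) W'" "x \<in> W'" "Ck n 0 W' g"
        using 0 by auto
      have "openin (subtopology (Euclidean_space n) W') {y \<in> topspace (subtopology (Euclidean_space n) W'). g y \<in> U}"
        using W'(3) U by (intro openin_continuous_map_preimage[of _ euclideanreal]) simp_all
      then have "openin (Euclidean_space n) ({y \<in> topspace (subtopology (Euclidean_space n) W'). g y \<in> U} \<inter> W)"
        using W'(1) assms(1) openin_trans_full by blast
      then show "\<exists>T. openin (Euclidean_space n) T \<and> x \<in> T \<and> T \<subseteq> ?V"
        using x W' by (intro exI[of _ "{y \<in> topspace (subtopology (Euclidean_space n) W'). g y \<in> U} \<inter> W"]) auto
    qed
    then show "openin (subtopology (Euclidean_space n) W) ?V"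
      by (metis (no_types, lifting) Int_iff mem_Collect_eq openin_open_subtopology assms(1) subsetI topspace_subtopology)
  qed auto
next
  case (Suc k)
  have loc: "\<exists>W'. openin (Euclidean_space n) W' \<and> x \<in> W' \<and> Ck n k W' g \<and>
      (\<forall>i<n. ((\<lambda>t. g (x(i := t))) has_real_derivative partial_deriv i g x) (at (x i)) \<and>
         Ck n k W' (partial_deriv i g))" if "x \<in> W" for x
  proof -
    obtain W' where W': "openin (Euclidean_space n) W'" "x \<in> W'" "Ck n (Suc k) W' g"
      using Suc.prems \<open>x \<in> W\<close> by blast
    then show ?thesis using Ck_Suc_imp[OF W'(3)] Ck_Suc_partial_deriv[OF W'(1), of k g] by auto
  qed
  have "Ck n k W g" "\<And>i. i < n \<Longrightarrow> Ck n k W (partial_deriv i g)"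
    by (rule Suc.IH, use loc in meson)+
  moreover have "continuous_map (subtopology (Euclidean_space n) W) euclideanreal g"
    by (rule Ck_imp_continuous) fact
  ultimately show ?case using loc unfolding Ck_Suc_partial_deriv[OF assms(1)] by meson
qed

lemma Ck_const: "Ck n k W (\<lambda>_. c)"
  by (induction k arbitrary: c) (auto intro!: exI[of _ "\<lambda>_. 0"])

lemma continuous_map_Euclidean_coord: "continuous_map (Euclidean_space n) euclideanreal (\<lambda>x. x j)"
  by (auto simp: Euclidean_space_eq intro: continuous_on_subset[OF continuous_on_product_coordinates])

lemma Ck_coord: "Ck n k W (\<lambda>x. x j)"
proof (cases k)
  case 0 then show ?thesis
    using continuous_map_from_subtopology[OF continuous_map_Euclidean_coord] by simp
next
  case (Suc l)
  have "((\<lambda>t. (x(i := t)) j) has_real_derivative (if i = j then 1 else 0)) (at (x i))" for i and x :: "nat \<Rightarrow> real"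
    by auto
  then show ?thesis unfolding Suc
    using Ck_const continuous_map_from_subtopology[OF continuous_map_Euclidean_coord]
    unfolding Ck.simps by (intro conjI allI impI exI[of _ "\<lambda>_. if i = j then 1 else 0" for i] ballI) blast+
qed

lemma Ck_add: "Ck n k W g \<Longrightarrow> Ck n k W h \<Longrightarrow> Ck n k W (\<lambda>x. g x + h x)"
proof (induction k arbitrary: g h)
  case 0 then show ?case by (auto intro: continuous_map_add)
next
  case (Suc k)
  show ?case unfolding Ck.simps
  proof (intro conjI allI impI)
    show "continuous_map (subtopology (Euclidean_space n) W) euclideanreal (\<lambda>x. g x + h x)"
      using Suc.prems by (auto intro: continuous_map_add)
    fix i assume "i < n"
    then obtain g' h' where
      "\<forall>x\<in>W. ((\<lambda>t. g (x(i := t))) has_real_derivative g' x) (at (x i))" "Ck n k W g'"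
      "\<forall>x\<in>W. ((\<lambda>t. h (x(i := t))) has_real_derivative h' x) (at (x i))" "Ck n k W h'"
      using Suc.prems unfolding Ck.simps by blast
    then show "\<exists>g'. (\<forall>x\<in>W. ((\<lambda>t. g (x(i := t)) + h (x(i := t))) has_real_derivative g' x) (at (x i))) \<and> Ck n k W g'"
      by (intro exI[of _ "\<lambda>x. g' x + h' x"] conjI ballI DERIV_add Suc.IH) simp_all
  qed
qed

lemma Ck_mult: "Ck n k W g \<Longrightarrow> Ck n k W h \<Longrightarrow> Ck n k W (\<lambda>x. g x * h x)"
proof (induction k arbitrary: g h)
  case 0 then show ?case by (auto intro: continuous_map_real_mult)
next
  case (Suc k)
  show ?case unfolding Ck.simps
  proof (intro conjI allI impI)
    show "continuous_map (subtopology (Euclidean_space n) W) euclideanreal (\<lambda>x. g x * h x)"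
      using Suc.prems by (auto intro: continuous_map_real_mult)
    fix i assume "i < n"
    then obtain g' h' where *:
      "\<forall>x\<in>W. ((\<lambda>t. g (x(i := t))) has_real_derivative g' x) (at (x i))" "Ck n k W g'"
      "\<forall>x\<in>W. ((\<lambda>t. h (x(i := t))) has_real_derivative h' x) (at (x i))" "Ck n k W h'"
      using Suc.prems unfolding Ck.simps by blast
    have "((\<lambda>t. g (x(i := t)) * h (x(i := t))) has_real_derivative g' x * h x + h' x * g x) (at (x i))" if "x \<in> W" for x
      using DERIV_mult[OF *(1)[rule_format, OF that] *(3)[rule_format, OF that]] by simp
    then show "\<exists>g'. (\<forall>x\<in>W. ((\<lambda>t. g (x(i := t)) * h (x(i := t))) has_real_derivative g' x) (at (x i))) \<and> Ck n k W g'"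
      using * Suc.prems[THEN Ck_Suc_imp]
      by (intro exI[of _ "\<lambda>x. g' x * h x + h' x * g x"] conjI ballI Suc.IH Ck_add) simp_all
  qed
qed

lemma Ck_sum: "finite I \<Longrightarrow> (\<And>i. i \<in> I \<Longrightarrow> Ck n k W (g i)) \<Longrightarrow> Ck n k W (\<lambda>x. \<Sum>i\<in>I. g i x)"
  by (induction rule: finite_induct) (auto intro: Ck_const Ck_add)

lemma Ck_uminus: "Ck n k W g \<Longrightarrow> Ck n k W (\<lambda>x. - g x)"
  using Ck_mult[OF Ck_const, of n k W g "-1"] by simp

lemma Ck_diff: "Ck n k W g \<Longrightarrow> Ck n k W h \<Longrightarrow> Ck n k W (\<lambda>x. g x - h x)"
  using Ck_add[OF _ Ck_uminus, of n k W g h] by simp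

lemma Ck_inverse: "Ck n k W g \<Longrightarrow> (\<And>x. x \<in> W \<Longrightarrow> g x \<noteq> 0) \<Longrightarrow> Ck n k W (\<lambda>x. inverse (g x))"
proof (induction k arbitrary: g)
  case 0 then show ?case by (auto intro: continuous_map_real_inverse)
next
  case (Suc k)
  show ?case unfolding Ck.simps
  proof (intro conjI allI impI)
    show "continuous_map (subtopology (Euclidean_space n) W) euclideanreal (\<lambda>x. inverse (g x))"
      using Suc.prems by (auto intro: continuous_map_real_inverse)
    fix i assume "i < n"
    then obtain g' where *:
      "\<forall>x\<in>W. ((\<lambda>t. g (x(i := t))) has_real_derivative g' x) (at (x i))" "Ck n k W g'"
      using Suc.prems by auto
    have "((\<lambda>t. inverse (g (x(i := t)))) has_real_derivative - (inverse (g x) * g' x * inverse (g x))) (at (x i))" if "x \<in> W" for x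
      using DERIV_inverse'[OF *(1)[rule_format, OF that]] Suc.prems(2)[OF that] by simp
    then show "\<exists>g'. (\<forall>x\<in>W. ((\<lambda>t. inverse (g (x(i := t)))) has_real_derivative g' x) (at (x i))) \<and> Ck n k W g'"
      using * Suc.prems(1)[THEN Ck_Suc_imp] Suc.prems(2)
      by (intro exI[of _ "\<lambda>x. - (inverse (g x) * g' x * inverse (g x))"] conjI ballI Ck_uminus Ck_mult Suc.IH)
        simp_all
  qed
qed

lemma continuous_map_into_Euclidean:
  assumes "\<And>j. j < m \<Longrightarrow> continuous_map X euclideanreal (\<lambda>x. f x j)" "f ` topspace X \<subseteq> topspace (Euclidean_space m)"
  shows "continuous_map X (Euclidean_space m) f"
proof -
  have "continuous_map X euclideanreal (\<lambda>x. f x j)" for j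
  proof (cases "j < m")
    case False
    have "0 = f x j" if "x \<in> topspace X" for x
      using subsetD[OF assms(2) imageI[OF that]] False by (simp add: topspace_Euclidean_space)
    moreover have "continuous_map X euclideanreal (\<lambda>_. 0)" by simp
    ultimately show ?thesis using continuous_map_eq[of X euclideanreal "\<lambda>_. 0" "\<lambda>x. f x j"] by simp
  qed (rule assms(1))
  then have "continuous_map X (powertop_real UNIV) f"
    by (simp add: continuous_map_componentwise_UNIV)
  then show ?thesis using assms(2)
    unfolding Euclidean_space_def by (simp add: continuous_map_in_subtopology image_subset_iff Pi_iff)
qed

text \<open>By the chain rule, a partial derivative of the composite is a sum of products of partial
  derivatives of \<open>f\<close> with partial derivatives of \<open>g\<close> composed with
  \<open>f\<close>. The latter fall under the induction hypothesis, for which \<open>g\<close> is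
  kept general.\<close>

lemma Ck_comp:
  assumes W: "openin (Euclidean_space n) W" and T: "openin (Euclidean_space m) T"
    and g: "Ck m k T g" and f: "\<And>j. j < m \<Longrightarrow> Ck n k W (\<lambda>x. f x j)" and fT: "f ` W \<subseteq> T"
  shows "Ck n k W (\<lambda>x. g (f x))"
  using g f
proof (induction k arbitrary: g)
  have cont: "continuous_map (subtopology (Euclidean_space n) W) euclideanreal (\<lambda>x. g (f x))"
    if g: "Ck m k T g" and f: "\<And>j. j < m \<Longrightarrow> Ck n k W (\<lambda>x. f x j)" for k g
  proof -
    have "continuous_map (subtopology (Euclidean_space n) W) (Euclidean_space m) f"
    proof (rule continuous_map_into_Euclidean)
      show "f ` topspace (subtopology (Euclidean_space n) W) \<subseteq> topspace (Euclidean_space m)"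
        using fT openin_subset[OF T] by auto
    qed (rule Ck_imp_continuous[OF f])
    then have "continuous_map (subtopology (Euclidean_space n) W) (subtopology (Euclidean_space m) T) f"
      using fT by (simp add: continuous_map_in_subtopology image_subset_iff Pi_iff)
    from continuous_map_compose[OF this Ck_imp_continuous[OF g]] show ?thesis by (simp add: o_def)
  qed
  {
    case 0 then show ?case using cont[of 0] by simp
  next
    case (Suc k)
    have fk: "\<And>j. j < m \<Longrightarrow> Ck n k W (\<lambda>x. f x j)" using Suc.prems(2) Ck_Suc_imp by blast
    have dg: "((\<lambda>t. g (y(j := t))) has_real_derivative partial_deriv j g y) (at (y j))"
      "Ck m k T (partial_deriv j g)" if "y \<in> T" "j < m" for y j
      using Suc.prems(1) that unfolding Ck_Suc_partial_deriv[OF T] by auto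
    show ?case unfolding Ck.simps
    proof (intro conjI allI impI)
      show "continuous_map (subtopology (Euclidean_space n) W) euclideanreal (\<lambda>x. g (f x))"
        using cont[OF Suc.prems] by simp
      fix i assume i: "i < n"
      define h where "h = (\<lambda>x. \<Sum>j<m. partial_deriv j g (f x) * partial_deriv i (\<lambda>x. f x j) x)"
      have df: "((\<lambda>t. f (x(i := t)) j) has_real_derivative partial_deriv i (\<lambda>x. f x j) x) (at (x i))"
        "Ck n k W (partial_deriv i (\<lambda>x. f x j))" if "x \<in> W" "j < m" for x j
        using Suc.prems(2)[OF that(2)] that i unfolding Ck_Suc_partial_deriv[OF W] by auto
      have "((\<lambda>t. g (f (x(i := t)))) has_real_derivative h x) (at (x i))" if x: "x \<in> W" for x
      proof -
        have "\<forall>\<^sub>F t in nhds (x i). f (x(i := t)) \<in> T"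
          using eventually_line_in_open[OF W x i] by eventually_elim (use fT in auto)
        then show ?thesis
          using chain_rule_curve[OF T, where g = g and D = "\<lambda>j. partial_deriv j g" and c = "\<lambda>t. f (x(i := t))"
              and c' = "\<lambda>j. partial_deriv i (\<lambda>x. f x j) x" and ?t0.0 = "x i"] dg df x fT
          by (simp add: h_def Ck_imp_continuous[OF dg(2)[of "f x"]] image_subset_iff)
      qed
      \<comment> \<open>The regularity parts of \<open>dg\<close> and \<open>df\<close> are only
        available in the presence of a point of \<open>T\<close> or of \<open>W\<close>, so an empty
        \<open>W\<close> is treated apart.\<close>
      moreover have "Ck n k W h"
      proof (cases "W = {}")
        case True then show ?thesis using Ck_cong[OF W _ Ck_const[of n k W 0], of h] by simp
      next
        case False
        then obtain x0 where x0: "x0 \<in> W" by blast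
        then have y0: "f x0 \<in> T" using fT by blast
        have "Ck n k W (\<lambda>x. partial_deriv j g (f x))" if "j < m" for j
          by (rule Suc.IH[OF dg(2)[OF y0 that] fk])
        then show ?thesis unfolding h_def using df(2)[OF x0]
          by (intro Ck_sum Ck_mult finite_lessThan) simp_all
      qed
      ultimately show "\<exists>g'. (\<forall>x\<in>W. ((\<lambda>t. g (f (x(i := t)))) has_real_derivative g' x) (at (x i))) \<and> Ck n k W g'"
        by blast
    qed
  }
qed

section \<open>Smooth structures\<close>

subsection \<open>Functions that are smooth in a chart\<close>

text \<open>The set \<open>S\<close> is kept separate from the chart domain \<open>U\<close>:
  functions are often smooth on a smaller open set only, and shrinking \<open>S\<close> leaves the
  inverse \<open>inv_into U \<phi>\<close> as it is.\<close>

definition smooth_fun :: "'a chart \<Rightarrow> 'a set \<Rightarrow> ('a \<Rightarrow> real) \<Rightarrow> bool"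
  where "smooth_fun = (\<lambda>(n, U, \<phi>) S h. \<forall>k. Ck n k (\<phi> ` S) (\<lambda>x. h (inv_into U \<phi> x)))"

definition chart_smooth :: "'a chart \<Rightarrow> 'a set \<Rightarrow> nat \<Rightarrow> ('a \<Rightarrow> nat \<Rightarrow> real) \<Rightarrow> bool"
  where "chart_smooth c S m g \<longleftrightarrow> (\<forall>i<m. smooth_fun c S (\<lambda>x. g x i))"

lemma smooth_on_chart_smooth:
  "smooth_on n (\<phi> ` S) m (g \<circ> inv_into U \<phi>) \<longleftrightarrow> chart_smooth (n, U, \<phi>) S m g"
  by (simp add: smooth_on_def chart_smooth_def smooth_fun_def)

lemma compatible_charts_iff:
  "compatible_charts (n, U, \<phi>) (m, V, \<psi>) \<longleftrightarrow>
     chart_smooth (n, U, \<phi>) (U \<inter> V) m \<psi> \<and> chart_smooth (m, V, \<psi>) (U \<inter> V) n \<phi>"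
  by (simp add: compatible_charts_def smooth_on_chart_smooth)

lemma is_chart_inj: "is_chart X (n, U, \<phi>) \<Longrightarrow> inj_on \<phi> U"
  using homeomorphic_imp_injective_map[of "subtopology X U"] openin_subset[of X U]
  by (auto simp: is_chart_def Int_absorb1)

lemma is_chart_open: "is_chart X (n, U, \<phi>) \<Longrightarrow> openin X U"
  by (simp add: is_chart_def)

lemma is_chart_subset: "is_chart X (n, U, \<phi>) \<Longrightarrow> U \<subseteq> topspace X"
  by (simp add: is_chart_def openin_subset)

lemma is_chart_image_open:
  assumes c: "is_chart X (n, U, \<phi>)" and S: "S \<subseteq> U"
  shows "openin (Euclidean_space n) (\<phi> ` S) \<longleftrightarrow> openin X S"
proof -
  have h: "homeomorphic_map (subtopology X U) (subtopology (Euclidean_space n) (\<phi> ` U)) \<phi>"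
    and U: "openin X U" "openin (Euclidean_space n) (\<phi> ` U)"
    using c by (auto simp: is_chart_def)
  have "openin X S \<longleftrightarrow> openin (subtopology X U) S"
    using U(1) S by (simp add: openin_open_subtopology)
  also have "\<dots> \<longleftrightarrow> openin (subtopology (Euclidean_space n) (\<phi> ` U)) (\<phi> ` S)"
    using homeomorphic_map_openness[OF h, of S] S openin_subset[OF U(1)] by auto
  also have "\<dots> \<longleftrightarrow> openin (Euclidean_space n) (\<phi> ` S)"
    using U(2) S by (simp add: openin_open_subtopology image_mono)
  finally show ?thesis by simp
qed

lemma is_chart_continuous:
  "is_chart X (n, U, \<phi>) \<Longrightarrow> continuous_map (subtopology X U) (Euclidean_space n) \<phi>"
  by (auto simp: is_chart_def dest!: homeomorphic_imp_continuous_map intro: continuous_map_into_fulltopology)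

lemma is_chart_continuous_inv:
  assumes "is_chart X (n, U, \<phi>)"
  shows "continuous_map (subtopology (Euclidean_space n) (\<phi> ` U)) X (inv_into U \<phi>)"
proof -
  have U: "openin X U" "openin (Euclidean_space n) (\<phi> ` U)" "inj_on \<phi> U"
    using assms is_chart_inj by (auto simp: is_chart_def)
  show ?thesis unfolding continuous_map_def
  proof (intro conjI allI impI)
    show "inv_into U \<phi> \<in> topspace (subtopology (Euclidean_space n) (\<phi> ` U)) \<rightarrow> topspace X"
      by (auto intro!: subsetD[OF openin_subset[OF U(1)]] inv_into_into)
    fix S assume S: "openin X S"
    have "{x \<in> topspace (subtopology (Euclidean_space n) (\<phi> ` U)). inv_into U \<phi> x \<in> S} = \<phi> ` (U \<inter> S)"
      using U openin_subset[OF U(2)] by (auto simp: image_iff)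
    moreover have "openin (Euclidean_space n) (\<phi> ` (U \<inter> S))"
      using is_chart_image_open[OF assms, of "U \<inter> S"] S U(1) by auto
    ultimately show "openin (subtopology (Euclidean_space n) (\<phi> ` U))
        {x \<in> topspace (subtopology (Euclidean_space n) (\<phi> ` U)). inv_into U \<phi> x \<in> S}"
      using U(2) by (simp add: openin_open_subtopology) blast
  qed
qed

lemma is_chart_Euclidean: "is_chart X (n, U, \<phi>) \<Longrightarrow> x \<in> U \<Longrightarrow> n \<le> i \<Longrightarrow> \<phi> x i = 0"
  using openin_Euclidean_space_subset[of n "\<phi> ` U" "\<phi> x" i] by (auto simp: is_chart_def)

lemma is_chart_restrict:
  assumes c: "is_chart X (n, U, \<phi>)" and W: "W \<subseteq> U" "openin X W"
  shows "is_chart X (n, W, \<phi>)"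
proof -
  have h: "homeomorphic_map (subtopology X U) (subtopology (Euclidean_space n) (\<phi> ` U)) \<phi>"
    using c by (auto simp: is_chart_def)
  have im: "openin (Euclidean_space n) (\<phi> ` W)" using is_chart_image_open[OF c W(1)] W(2) by simp
  have "\<phi> ` (topspace (subtopology X U) \<inter> W) = topspace (subtopology (Euclidean_space n) (\<phi> ` U)) \<inter> \<phi> ` W"
    using W openin_subset[OF W(2)] openin_subset[OF im] by auto
  from homeomorphic_map_subtopologies[OF h this]
  show ?thesis using W im by (simp add: is_chart_def subtopology_subtopology Int_absorb1 image_mono)
qed

lemma is_chart_cong:
  assumes "is_chart X (n, U, \<phi>)" "\<And>x. x \<in> U \<Longrightarrow> \<phi> x = \<psi> x"
  shows "is_chart X (n, U, \<psi>)"
proof -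
  have "\<psi> ` U = \<phi> ` U" using assms(2) by (metis image_cong)
  moreover have "homeomorphic_map (subtopology X U) (subtopology (Euclidean_space n) (\<phi> ` U)) \<psi>"
    using assms by (auto simp: is_chart_def intro: homeomorphic_map_eq)
  ultimately show ?thesis using assms(1) by (simp add: is_chart_def)
qed

context
  fixes X :: "'a topology" and n U \<phi>
  assumes c: "is_chart X (n, U, \<phi>)"
begin

lemma smooth_fun_cong:
  assumes "S \<subseteq> U" "openin X S" "\<And>x. x \<in> S \<Longrightarrow> g x = h x" "smooth_fun (n, U, \<phi>) S g"
  shows "smooth_fun (n, U, \<phi>) S h"
proof -
  have "g (inv_into U \<phi> y) = h (inv_into U \<phi> y)" if "y \<in> \<phi> ` S" for y
    using that assms(1,3) is_chart_inj[OF c] by (auto simp: subset_iff)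
  moreover have "openin (Euclidean_space n) (\<phi> ` S)"
    using is_chart_image_open[OF c assms(1)] assms(2) by simp
  ultimately show ?thesis using assms(4)
    unfolding smooth_fun_def prod.case by (metis Ck_cong)
qed

lemma smooth_fun_local:
  assumes "S \<subseteq> U" "openin X S"
    "\<And>p. p \<in> S \<Longrightarrow> \<exists>S'. openin X S' \<and> p \<in> S' \<and> S' \<subseteq> U \<and> smooth_fun (n, U, \<phi>) S' h"
  shows "smooth_fun (n, U, \<phi>) S h"
  unfolding smooth_fun_def prod.case
proof
  fix k
  show "Ck n k (\<phi> ` S) (\<lambda>x. h (inv_into U \<phi> x))"
  proof (rule Ck_local)
    show "openin (Euclidean_space n) (\<phi> ` S)"
      using is_chart_image_open[OF c assms(1)] assms(2) by simp
    fix x assume "x \<in> \<phi> ` S"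
    then obtain p where p: "p \<in> S" "x = \<phi> p" by blast
    from assms(3)[OF p(1)] obtain S' where S': "openin X S'" "p \<in> S'" "S' \<subseteq> U" "smooth_fun (n, U, \<phi>) S' h"
      by blast
    show "\<exists>W'. openin (Euclidean_space n) W' \<and> x \<in> W' \<and> Ck n k W' (\<lambda>x. h (inv_into U \<phi> x))"
      using S' p is_chart_image_open[OF c S'(3)]
      by (intro exI[of _ "\<phi> ` S'"]) (auto simp: smooth_fun_def)
  qed
qed

text \<open>The inverses \<open>inv_into W \<phi>\<close> and \<open>inv_into U \<phi>\<close> agree
  on the image of \<open>S\<close>, since \<open>\<phi>\<close> is injective on
  \<open>U\<close>.\<close>

lemma smooth_fun_restrict:
  assumes "W \<subseteq> U" "openin X W" "S \<subseteq> W" "openin X S"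
  shows "smooth_fun (n, W, \<phi>) S h \<longleftrightarrow> smooth_fun (n, U, \<phi>) S h"
proof -
  have inj: "inj_on \<phi> U" "inj_on \<phi> W" using is_chart_inj[OF c] assms(1) by (auto intro: inj_on_subset)
  have "h (inv_into W \<phi> y) = h (inv_into U \<phi> y)" if "y \<in> \<phi> ` S" for y
    using that assms inj by (auto simp: subset_iff)
  moreover have "openin (Euclidean_space n) (\<phi> ` S)"
    using is_chart_image_open[OF c, of S] assms by auto
  ultimately have "Ck n k (\<phi> ` S) (\<lambda>x. h (inv_into W \<phi> x)) = Ck n k (\<phi> ` S) (\<lambda>x. h (inv_into U \<phi> x))" for k
    using Ck_cong[of n "\<phi> ` S" "\<lambda>x. h (inv_into W \<phi> x)" "\<lambda>x. h (inv_into U \<phi> x)" k]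
      Ck_cong[of n "\<phi> ` S" "\<lambda>x. h (inv_into U \<phi> x)" "\<lambda>x. h (inv_into W \<phi> x)" k] by auto
  then show ?thesis by (simp add: smooth_fun_def)
qed

lemma smooth_fun_coord:
  assumes "S \<subseteq> U" "openin X S"
  shows "smooth_fun (n, U, \<phi>) S (\<lambda>x. \<phi> x i)"
proof -
  have "openin (Euclidean_space n) (\<phi> ` S)"
    using is_chart_image_open[OF c assms(1)] assms(2) by simp
  moreover have "y i = \<phi> (inv_into U \<phi> y) i" if "y \<in> \<phi> ` S" for y
    using that assms is_chart_inj[OF c] by (auto simp: subset_iff)
  ultimately have "Ck n k (\<phi> ` S) (\<lambda>x. \<phi> (inv_into U \<phi> x) i)" for k
    using Ck_cong[of n "\<phi> ` S" "\<lambda>y. y i" "\<lambda>x. \<phi> (inv_into U \<phi> x) i" k] Ck_coord[of n k] by simp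
  then show ?thesis by (simp add: smooth_fun_def)
qed

lemma smooth_fun_comp:
  assumes d: "is_chart Y (m, V, \<psi>)" and S: "S \<subseteq> U" "openin X S" and T: "T \<subseteq> V" "openin Y T"
    and f: "f ` S \<subseteq> T" "chart_smooth (n, U, \<phi>) S m (\<lambda>x. \<psi> (f x))"
    and h: "smooth_fun (m, V, \<psi>) T h"
  shows "smooth_fun (n, U, \<phi>) S (\<lambda>x. h (f x))"
  unfolding smooth_fun_def prod.case
proof
  fix k
  have SE: "openin (Euclidean_space n) (\<phi> ` S)" using is_chart_image_open[OF c S(1)] S(2) by simp
  have TE: "openin (Euclidean_space m) (\<psi> ` T)" using is_chart_image_open[OF d T(1)] T(2) by simp
  have inj: "inj_on \<phi> U" "inj_on \<psi> V" using is_chart_inj c d by blast+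
  have "Ck n k (\<phi> ` S) (\<lambda>x. h (inv_into V \<psi> (\<psi> (f (inv_into U \<phi> x)))))"
  proof (rule Ck_comp[OF SE TE, where g = "\<lambda>x. h (inv_into V \<psi> x)" and f = "\<lambda>x. \<psi> (f (inv_into U \<phi> x))"])
    show "Ck m k (\<psi> ` T) (\<lambda>x. h (inv_into V \<psi> x))" using h by (simp add: smooth_fun_def)
    show "Ck n k (\<phi> ` S) (\<lambda>x. \<psi> (f (inv_into U \<phi> x)) j)" if "j < m" for j
      using f(2) that by (simp add: chart_smooth_def smooth_fun_def)
    show "(\<lambda>x. \<psi> (f (inv_into U \<phi> x))) ` \<phi> ` S \<subseteq> \<psi> ` T"
      using f(1) inj S(1) by (auto simp: subset_iff image_iff)
  qed
  then show "Ck n k (\<phi> ` S) (\<lambda>x. h (f (inv_into U \<phi> x)))"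
    using f(1) inj S(1) T(1) by (elim Ck_cong[OF SE, rotated]) (auto simp: subset_iff image_iff)
qed

end

lemma smooth_fun_subset: "smooth_fun c S h \<Longrightarrow> S' \<subseteq> S \<Longrightarrow> smooth_fun c S' h"
  by (cases c) (auto simp: smooth_fun_def intro: Ck_subset[OF image_mono])

lemma chart_smooth_subset: "chart_smooth c S m g \<Longrightarrow> S' \<subseteq> S \<Longrightarrow> chart_smooth c S' m g"
  by (auto simp: chart_smooth_def intro: smooth_fun_subset)

lemma chart_smooth_mono: "chart_smooth c S m g \<Longrightarrow> l \<le> m \<Longrightarrow> chart_smooth c S l g"
  by (simp add: chart_smooth_def)

lemma chart_smooth_comp:
  assumes "is_chart X (n, U, \<phi>)" "is_chart Y (m, V, \<psi>)" "S \<subseteq> U" "openin X S" "T \<subseteq> V" "openin Y T"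
    "f ` S \<subseteq> T" "chart_smooth (n, U, \<phi>) S m (\<lambda>x. \<psi> (f x))" "chart_smooth (m, V, \<psi>) T l g"
  shows "chart_smooth (n, U, \<phi>) S l (\<lambda>x. g (f x))"
  using smooth_fun_comp[OF assms(1-8), of "\<lambda>x. g x i" for i] assms(9) by (simp add: chart_smooth_def)

lemma chart_smooth_cong:
  assumes "is_chart X (n, U, \<phi>)" "S \<subseteq> U" "openin X S" "\<And>x i. x \<in> S \<Longrightarrow> i < m \<Longrightarrow> g x i = h x i"
    "chart_smooth (n, U, \<phi>) S m g"
  shows "chart_smooth (n, U, \<phi>) S m h"
  unfolding chart_smooth_def
proof (intro allI impI)
  fix i assume i: "i < m"
  show "smooth_fun (n, U, \<phi>) S (\<lambda>x. h x i)"
    by (rule smooth_fun_cong[OF assms(1-3), of "\<lambda>x. g x i"])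
       (use assms(4,5) i in \<open>simp_all add: chart_smooth_def\<close>)
qed

lemma chart_smooth_coord:
  assumes "is_chart X (n, U, \<phi>)" "S \<subseteq> U" "openin X S"
  shows "chart_smooth (n, U, \<phi>) S m \<phi>"
  using smooth_fun_coord[OF assms] by (simp add: chart_smooth_def)

lemma chart_smooth_restrict:
  assumes "is_chart X (n, U, \<phi>)" "W \<subseteq> U" "openin X W" "S \<subseteq> W" "openin X S"
  shows "chart_smooth (n, W, \<phi>) S m g \<longleftrightarrow> chart_smooth (n, U, \<phi>) S m g"
  using smooth_fun_restrict[OF assms] by (simp add: chart_smooth_def)

lemma chart_smooth_local:
  assumes "is_chart X (n, U, \<phi>)" "S \<subseteq> U" "openin X S"
    "\<And>p. p \<in> S \<Longrightarrow> \<exists>S'. openin X S' \<and> p \<in> S' \<and> S' \<subseteq> U \<and> chart_smooth (n, U, \<phi>) S' m g"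
  shows "chart_smooth (n, U, \<phi>) S m g"
  unfolding chart_smooth_def
proof (intro allI impI)
  fix i assume i: "i < m"
  show "smooth_fun (n, U, \<phi>) S (\<lambda>x. g x i)"
  proof (rule smooth_fun_local[OF assms(1-3)])
    fix p assume "p \<in> S"
    with assms(4) obtain S' where "openin X S'" "p \<in> S'" "S' \<subseteq> U" "chart_smooth (n, U, \<phi>) S' m g" by blast
    then show "\<exists>S'. openin X S' \<and> p \<in> S' \<and> S' \<subseteq> U \<and> smooth_fun (n, U, \<phi>) S' (\<lambda>x. g x i)"
      using i unfolding chart_smooth_def by blast
  qed
qed

lemma chart_smooth_change_cong:
  assumes "is_chart X (n, U, \<phi>)" "\<And>x. x \<in> U \<Longrightarrow> \<phi> x = \<phi>' x" "S \<subseteq> U" "openin X S"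
    "chart_smooth (n, U, \<phi>) S m g"
  shows "chart_smooth (n, U, \<phi>') S m g"
proof -
  note c' = is_chart_cong[OF assms(1,2)]
  have "chart_smooth (n, U, \<phi>') S n \<phi>"
    by (rule chart_smooth_cong[OF c' assms(3,4) _ chart_smooth_coord[OF c' assms(3,4)]])
       (use assms(2,3) in auto)
  then show ?thesis
    using chart_smooth_comp[OF c' assms(1) assms(3,4) assms(3,4), where f = "\<lambda>x. x"] assms(5) by simp
qed

lemma chart_smooth_imp_continuous:
  assumes c: "is_chart X (n, U, \<phi>)" and S: "S \<subseteq> U" "openin X S" and g: "chart_smooth (n, U, \<phi>) S m g"
    and E: "g ` S \<subseteq> topspace (Euclidean_space m)"
  shows "continuous_map (subtopology X S) (Euclidean_space m) g"
proof (rule continuous_map_into_Euclidean)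
  fix j assume j: "j < m"
  have ST: "S \<subseteq> topspace X" using S(2) openin_subset by blast
  have "Ck n 0 (\<phi> ` S) (\<lambda>x. g (inv_into U \<phi> x) j)"
    using g j unfolding chart_smooth_def smooth_fun_def prod.case by blast
  then have 1: "continuous_map (subtopology (Euclidean_space n) (\<phi> ` S)) euclideanreal (\<lambda>x. g (inv_into U \<phi> x) j)"
    by simp
  have "continuous_map (subtopology X S) (subtopology (Euclidean_space n) (\<phi> ` S)) \<phi>"
    using is_chart_continuous[OF is_chart_restrict[OF c S]] by (simp add: continuous_map_in_subtopology ST image_subset_iff Pi_iff)
  from continuous_map_compose[OF this 1]
  have "continuous_map (subtopology X S) euclideanreal (\<lambda>x. g (inv_into U \<phi> (\<phi> x)) j)" by (simp add: o_def)
  then show "continuous_map (subtopology X S) euclideanreal (\<lambda>x. g x j)"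
    by (rule continuous_map_eq) (use is_chart_inj[OF c] S(1) in \<open>auto simp: subset_iff\<close>)
next
  show "g ` topspace (subtopology X S) \<subseteq> topspace (Euclidean_space m)" using E by auto
qed


subsection \<open>Maximal atlases\<close>

text \<open>The conditions on a smooth manifold apart from separation and paracompactness; unlike
  paracompactness, they pass to products and submanifolds.\<close>

definition smooth_structure :: "'a manifold \<Rightarrow> bool"
  where "smooth_structure M \<longleftrightarrow>
    (\<forall>c\<in>charts M. is_chart (mtop M) c) \<and> (\<Union>(n, U, \<phi>)\<in>charts M. U) = pts M \<and>
    (\<forall>c\<in>charts M. \<forall>d\<in>charts M. compatible_charts c d) \<and>
    (\<forall>c. is_chart (mtop M) c \<and> (\<forall>d\<in>charts M. compatible_charts c d) \<longrightarrow> c \<in> charts M)"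

lemma smooth_manifold_iff:
  "smooth_manifold M \<longleftrightarrow> Hausdorff_space (mtop M) \<and> paracompact_space (mtop M) \<and> smooth_structure M"
  by (simp add: smooth_manifold_def smooth_structure_def)

text \<open>Near each point of the overlap there is a chart \<open>\<xi>\<close> of the atlas
  \<open>A\<close>, and the transition from \<open>\<phi>\<close> to \<open>\<psi>\<close> factors
  through \<open>\<xi>\<close>. Hence two charts compatible with \<open>A\<close> are compatible
  with each other, which is why a maximal atlas is an atlas.\<close>

lemma smooth_on_common_atlas:
  assumes A: "\<And>a. a \<in> A \<Longrightarrow> is_chart X a" "topspace X \<subseteq> (\<Union>(n, U, \<phi>)\<in>A. U)"
    and c: "is_chart X (n, U, \<phi>)" "\<And>a. a \<in> A \<Longrightarrow> compatible_charts (n, U, \<phi>) a"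
    and d: "is_chart X (m, V, \<psi>)" "\<And>a. a \<in> A \<Longrightarrow> compatible_charts (m, V, \<psi>) a"
  shows "chart_smooth (n, U, \<phi>) (U \<inter> V) m \<psi>"
proof (rule chart_smooth_local[OF c(1)])
  show "openin X (U \<inter> V)" using c(1) d(1) is_chart_open by blast
  fix p assume p: "p \<in> U \<inter> V"
  then have "p \<in> topspace X" using is_chart_subset[OF c(1)] by blast
  with A(2) obtain l Q \<xi> where a: "(l, Q, \<xi>) \<in> A" "p \<in> Q" by blast
  note Q = A(1)[OF a(1)]
  let ?S = "U \<inter> V \<inter> Q"
  have S: "openin X ?S" using c(1) d(1) Q is_chart_open by blast
  have 1: "chart_smooth (n, U, \<phi>) ?S l \<xi>"
    using c(2)[OF a(1)] by (auto simp: compatible_charts_iff elim: chart_smooth_subset)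
  have 2: "chart_smooth (l, Q, \<xi>) ?S m \<psi>"
    using d(2)[OF a(1)] by (auto simp: compatible_charts_iff elim: chart_smooth_subset)
  have "chart_smooth (n, U, \<phi>) ?S m \<psi>"
    using chart_smooth_comp[OF c(1) Q _ S _ S, where f = "\<lambda>x. x"] 1 2 by auto
  then show "\<exists>S'. openin X S' \<and> p \<in> S' \<and> S' \<subseteq> U \<and> chart_smooth (n, U, \<phi>) S' m \<psi>"
    using S p a(2) by (intro exI[of _ ?S]) auto
qed simp

lemma compatible_charts_common_atlas:
  assumes A: "\<And>a. a \<in> A \<Longrightarrow> is_chart X a" "topspace X \<subseteq> (\<Union>(n, U, \<phi>)\<in>A. U)"
    and c: "is_chart X c" "\<And>a. a \<in> A \<Longrightarrow> compatible_charts c a"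
    and d: "is_chart X d" "\<And>a. a \<in> A \<Longrightarrow> compatible_charts d a"
  shows "compatible_charts c d"
proof -
  obtain n U \<phi> m V \<psi> where cd: "c = (n, U, \<phi>)" "d = (m, V, \<psi>)" by (metis prod_cases3)
  show ?thesis
    using smooth_on_common_atlas[OF A c[unfolded cd] d[unfolded cd]]
      smooth_on_common_atlas[OF A d[unfolded cd] c[unfolded cd]]
    by (simp add: cd compatible_charts_iff Int_commute)
qed

lemma smooth_structure_manifold_of_atlas:
  assumes A: "\<And>a. a \<in> A \<Longrightarrow> is_chart X a" "topspace X \<subseteq> (\<Union>(n, U, \<phi>)\<in>A. U)"
    and compat: "\<And>a b. a \<in> A \<Longrightarrow> b \<in> A \<Longrightarrow> compatible_charts a b"
  shows "smooth_structure (manifold_of_atlas X A)" "A \<subseteq> charts (manifold_of_atlas X A)"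
proof -
  show sub: "A \<subseteq> charts (manifold_of_atlas X A)"
    using A compat by (auto simp: manifold_of_atlas_def)
  have ch: "charts (manifold_of_atlas X A) = {c. is_chart X c \<and> (\<forall>d\<in>A. compatible_charts c d)}"
    "mtop (manifold_of_atlas X A) = X" by (simp_all add: manifold_of_atlas_def)
  show "smooth_structure (manifold_of_atlas X A)"
    unfolding smooth_structure_def
  proof (intro conjI ballI allI impI)
    show "is_chart (mtop (manifold_of_atlas X A)) c" if "c \<in> charts (manifold_of_atlas X A)" for c
      using that by (simp add: ch)
    have "U \<subseteq> topspace X" if "(n, U, \<phi>) \<in> charts (manifold_of_atlas X A)" for n U \<phi>
      using that is_chart_subset[of X n U \<phi>] by (simp add: ch)
    moreover have "topspace X \<subseteq> (\<Union>(n, U, \<phi>)\<in>charts (manifold_of_atlas X A). U)"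
      using A(2) sub by blast
    ultimately show "(\<Union>(n, U, \<phi>)\<in>charts (manifold_of_atlas X A). U) = pts (manifold_of_atlas X A)"
      by (auto simp: ch(2))
    show "compatible_charts c d" if "c \<in> charts (manifold_of_atlas X A)" "d \<in> charts (manifold_of_atlas X A)" for c d
      by (rule compatible_charts_common_atlas[OF A]) (use that in \<open>auto simp: ch\<close>)
    show "c \<in> charts (manifold_of_atlas X A)"
      if "is_chart (mtop (manifold_of_atlas X A)) c \<and> (\<forall>d\<in>charts (manifold_of_atlas X A). compatible_charts c d)" for c
      using that sub by (auto simp: ch)
  qed
qed

lemma mtop_manifold_of_atlas [simp]: "mtop (manifold_of_atlas X A) = X"
  by (simp add: manifold_of_atlas_def)

context
  fixes M :: "'a manifold"
  assumes M: "smooth_structure M"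
begin

lemma chart_is_chart: "c \<in> charts M \<Longrightarrow> is_chart (mtop M) c"
  using M by (simp add: smooth_structure_def)

lemma chart_at:
  assumes "p \<in> pts M"
  obtains n U \<phi> where "(n, U, \<phi>) \<in> charts M" "p \<in> U"
proof -
  have "p \<in> (\<Union>(n, U, \<phi>)\<in>charts M. U)" using M assms by (simp add: smooth_structure_def)
  then show thesis using that by blast
qed

lemma chart_change:
  assumes "(n, U, \<phi>) \<in> charts M" "(m, V, \<psi>) \<in> charts M" "S \<subseteq> U \<inter> V"
  shows "chart_smooth (n, U, \<phi>) S m \<psi>"
proof -
  have "compatible_charts (n, U, \<phi>) (m, V, \<psi>)" using M assms unfolding smooth_structure_def by blast
  then show ?thesis using assms(3) by (auto simp: compatible_charts_iff elim: chart_smooth_subset)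
qed

text \<open>The source of new charts throughout: on the domain of a known chart, coordinates that
  are smooth functions of the old ones and conversely. Smoothness in both directions makes
  \<open>\<zeta>\<close> a homeomorphism onto its image, factoring through \<open>\<theta>\<close>
  makes it compatible with every chart, and maximality of the atlas does the rest.\<close>

lemma chart_transport:
  assumes c: "(N, W, \<theta>) \<in> charts M" and inj: "inj_on \<zeta> W" and op: "openin (Euclidean_space n) (\<zeta> ` W)"
    and fwd: "chart_smooth (N, W, \<theta>) W n \<zeta>" and bwd: "chart_smooth (n, W, \<zeta>) W N \<theta>"
  shows "(n, W, \<zeta>) \<in> charts M"
proof -
  note c' = chart_is_chart[OF c]
  note W = is_chart_open[OF c'] is_chart_subset[OF c']
  have \<zeta>: "continuous_map (subtopology (mtop M) W) (Euclidean_space n) \<zeta>"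
    by (rule chart_smooth_imp_continuous[OF c' order_refl W(1) fwd]) (rule openin_subset[OF op])
  have "continuous_map (subtopology (Euclidean_space n) (\<zeta> ` W)) (Euclidean_space N) (\<lambda>y. \<theta> (inv_into W \<zeta> y))"
  proof (rule continuous_map_into_Euclidean)
    fix j assume "j < N"
    then have "Ck n 0 (\<zeta> ` W) (\<lambda>x. \<theta> (inv_into W \<zeta> x) j)"
      using bwd unfolding chart_smooth_def smooth_fun_def prod.case by blast
    then show "continuous_map (subtopology (Euclidean_space n) (\<zeta> ` W)) euclideanreal (\<lambda>x. \<theta> (inv_into W \<zeta> x) j)"
      by simp
  next
    show "(\<lambda>y. \<theta> (inv_into W \<zeta> y)) ` topspace (subtopology (Euclidean_space n) (\<zeta> ` W)) \<subseteq> topspace (Euclidean_space N)"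
      using is_chart_Euclidean[OF c'] inj by (auto simp: topspace_Euclidean_space)
  qed
  then have "continuous_map (subtopology (Euclidean_space n) (\<zeta> ` W)) (subtopology (Euclidean_space N) (\<theta> ` W)) (\<lambda>y. \<theta> (inv_into W \<zeta> y))"
    using inj by (auto simp: continuous_map_in_subtopology)
  from continuous_map_compose[OF this is_chart_continuous_inv[OF c']]
  have "continuous_map (subtopology (Euclidean_space n) (\<zeta> ` W)) (mtop M) (inv_into W \<zeta>)"
    by (rule continuous_map_eq) (use inj is_chart_inj[OF c'] in \<open>auto simp: o_def\<close>)
  then have inv: "continuous_map (subtopology (Euclidean_space n) (\<zeta> ` W)) (subtopology (mtop M) W) (inv_into W \<zeta>)"
    using inj by (auto simp: continuous_map_in_subtopology)
  have "homeomorphic_maps (subtopology (mtop M) W) (subtopology (Euclidean_space n) (\<zeta> ` W)) \<zeta> (inv_into W \<zeta>)"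
    unfolding homeomorphic_maps_def
    using \<zeta> inv inj by (auto simp: continuous_map_in_subtopology)
  then have new: "is_chart (mtop M) (n, W, \<zeta>)"
    using op W(1) by (auto simp: is_chart_def homeomorphic_map_maps)
  have "compatible_charts (n, W, \<zeta>) d" if d: "d \<in> charts M" for d
  proof -
    obtain m V \<psi> where dd: "d = (m, V, \<psi>)" by (metis prod_cases3)
    note d' = chart_is_chart[OF d, unfolded dd]
    have WV: "openin (mtop M) (W \<inter> V)" using W(1) is_chart_open[OF d'] by blast
    have "chart_smooth (n, W, \<zeta>) (W \<inter> V) m \<psi>"
      using chart_smooth_comp[OF new c' _ WV _ WV, where f = "\<lambda>x. x"]
        chart_smooth_subset[OF bwd] chart_change[OF c d[unfolded dd]] by auto
    moreover have "chart_smooth (m, V, \<psi>) (W \<inter> V) n \<zeta>"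
      using chart_smooth_comp[OF d' c' _ WV _ WV, where f = "\<lambda>x. x"]
        chart_smooth_subset[OF fwd] chart_change[OF d[unfolded dd] c] by auto
    ultimately show ?thesis by (simp add: dd compatible_charts_iff)
  qed
  then show ?thesis using M new unfolding smooth_structure_def by blast
qed

lemma chart_restrict:
  assumes c: "(n, U, \<phi>) \<in> charts M" and W: "W \<subseteq> U" "openin (mtop M) W"
  shows "(n, W, \<phi>) \<in> charts M"
proof -
  note c' = chart_is_chart[OF c]
  note r = is_chart_restrict[OF c' W]
  have "compatible_charts (n, W, \<phi>) d" if d: "d \<in> charts M" for d
  proof -
    obtain m V \<psi> where dd: "d = (m, V, \<psi>)" by (metis prod_cases3)
    note d' = chart_is_chart[OF d, unfolded dd]
    have WV: "openin (mtop M) (W \<inter> V)" using W(2) is_chart_open[OF d'] by blast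
    have "chart_smooth (n, U, \<phi>) (W \<inter> V) m \<psi>" "chart_smooth (m, V, \<psi>) (W \<inter> V) n \<phi>"
      using chart_change[OF c d[unfolded dd], of "W \<inter> V"] chart_change[OF d[unfolded dd] c, of "W \<inter> V"] W(1) by auto
    then show ?thesis using chart_smooth_restrict[OF c' W _ WV] by (simp add: dd compatible_charts_iff)
  qed
  then show ?thesis using M r unfolding smooth_structure_def by blast
qed

lemma chart_cong:
  assumes c: "(n, U, \<phi>) \<in> charts M" and eq: "\<And>x. x \<in> U \<Longrightarrow> \<phi> x = \<psi> x"
  shows "(n, U, \<psi>) \<in> charts M"
proof -
  note c' = chart_is_chart[OF c]
  note U = is_chart_open[OF c']
  have "\<psi> ` U = \<phi> ` U" "inj_on \<psi> U" using eq is_chart_inj[OF c'] by (metis image_cong, metis inj_on_cong)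
  moreover have "chart_smooth (n, U, \<phi>) U n \<psi>"
    by (rule chart_smooth_cong[OF c' order_refl U _ chart_smooth_coord[OF c' order_refl U]]) (simp add: eq)
  moreover have "chart_smooth (n, U, \<psi>) U n \<phi>"
    by (rule chart_smooth_change_cong[OF c' eq order_refl U chart_smooth_coord[OF c' order_refl U]])
  ultimately show ?thesis using c' by (intro chart_transport[OF c]) (auto simp: is_chart_def)
qed

lemma chart_in_open:
  assumes "p \<in> W" "openin (mtop M) W"
  obtains n U \<phi> where "(n, U, \<phi>) \<in> charts M" "p \<in> U" "U \<subseteq> W"
proof -
  have "p \<in> pts M" using assms openin_subset by blast
  then obtain n U \<phi> where U: "(n, U, \<phi>) \<in> charts M" "p \<in> U" by (rule chart_at)
  have "openin (mtop M) (U \<inter> W)" using is_chart_open[OF chart_is_chart[OF U(1)]] assms(2) by blast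
  then show thesis using that[of n "U \<inter> W" \<phi>] chart_restrict[OF U(1), of "U \<inter> W"] U(2) assms(1) by auto
qed

end

lemma open_submanifold_simps [simp]:
  "mtop (open_submanifold M U) = subtopology (mtop M) U"
  "(n, V, \<phi>) \<in> charts (open_submanifold M U) \<longleftrightarrow> (n, V, \<phi>) \<in> charts M \<and> V \<subseteq> U"
  by (auto simp: open_submanifold_def)

subsection \<open>Smooth maps\<close>

lemma smooth_mapI:
  assumes "\<And>p. p \<in> pts M \<Longrightarrow> \<exists>n U \<phi> m V \<psi>. (n, U, \<phi>) \<in> charts M \<and> (m, V, \<psi>) \<in> charts N \<and>
    p \<in> U \<and> f ` U \<subseteq> V \<and> chart_smooth (n, U, \<phi>) U m (\<lambda>x. \<psi> (f x))"
  shows "smooth_map M N f"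
  unfolding smooth_map_def
proof
  fix p assume "p \<in> pts M"
  from assms[OF this] obtain n U \<phi> m V \<psi> where
    *: "(n, U, \<phi>) \<in> charts M" "(m, V, \<psi>) \<in> charts N" "p \<in> U" "f ` U \<subseteq> V"
      "chart_smooth (n, U, \<phi>) U m (\<lambda>x. \<psi> (f x))" by blast
  have "smooth_on n (\<phi> ` U) m (\<psi> \<circ> f \<circ> inv_into U \<phi>)"
    unfolding smooth_on_chart_smooth using *(5) by (simp add: o_def)
  then show "\<exists>(n, U, \<phi>)\<in>charts M. \<exists>(m, V, \<psi>)\<in>charts N.
      p \<in> U \<and> f ` U \<subseteq> V \<and> smooth_on n (\<phi> ` U) m (\<psi> \<circ> f \<circ> inv_into U \<phi>)"
    using * by (intro bexI[of _ "(n, U, \<phi>)"]) (auto intro!: bexI[of _ "(m, V, \<psi>)"])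
qed

lemma smooth_map_at:
  assumes "smooth_map M N f" "p \<in> pts M"
  obtains n U \<phi> m V \<psi> where "(n, U, \<phi>) \<in> charts M" "(m, V, \<psi>) \<in> charts N" "p \<in> U" "f ` U \<subseteq> V"
    "chart_smooth (n, U, \<phi>) U m (\<lambda>x. \<psi> (f x))"
proof -
  from assms obtain n U \<phi> m V \<psi> where
    *: "(n, U, \<phi>) \<in> charts M" "(m, V, \<psi>) \<in> charts N" "p \<in> U" "f ` U \<subseteq> V"
      "smooth_on n (\<phi> ` U) m (\<psi> \<circ> f \<circ> inv_into U \<phi>)"
    unfolding smooth_map_def by blast
  show thesis using that[OF *(1-4)] *(5)[unfolded smooth_on_chart_smooth] by (simp add: o_def)
qed

lemma continuous_map_openI:
  assumes "f \<in> topspace X \<rightarrow> topspace Y"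
    and "\<And>p. p \<in> topspace X \<Longrightarrow> \<exists>U. openin X U \<and> p \<in> U \<and> continuous_map (subtopology X U) Y f"
  shows "continuous_map X Y f"
  unfolding continuous_map_def
proof (intro conjI allI impI assms(1))
  fix V assume V: "openin Y V"
  let ?W = "{x \<in> topspace X. f x \<in> V}"
  show "openin X ?W"
  proof (subst openin_subopen, intro ballI)
    fix p assume p: "p \<in> ?W"
    then obtain U where U: "openin X U" "p \<in> U" "continuous_map (subtopology X U) Y f" using assms(2) by auto
    have "openin (subtopology X U) {x \<in> topspace (subtopology X U). f x \<in> V}"
      by (rule openin_continuous_map_preimage[OF U(3) V])
    then have "openin X {x \<in> topspace (subtopology X U). f x \<in> V}" using U(1) openin_trans_full by blast
    then show "\<exists>T. openin X T \<and> p \<in> T \<and> T \<subseteq> ?W"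
      using p U(2) by (intro exI[of _ "{x \<in> topspace (subtopology X U). f x \<in> V}"]) auto
  qed
qed

context
  fixes M :: "'a manifold" and N :: "'b manifold" and f
  assumes M: "smooth_structure M" and N: "smooth_structure N" and f: "smooth_map M N f"
begin

lemma smooth_map_funcset: "f \<in> pts M \<rightarrow> pts N"
proof
  fix p assume "p \<in> pts M"
  with f obtain n U \<phi> m V \<psi> where *: "(n, U, \<phi>) \<in> charts M" "(m, V, \<psi>) \<in> charts N" "p \<in> U" "f ` U \<subseteq> V"
    "chart_smooth (n, U, \<phi>) U m (\<lambda>x. \<psi> (f x))" by (rule smooth_map_at)
  then show "f p \<in> pts N" using is_chart_subset[OF chart_is_chart[OF N *(2)]] by blast
qed

lemma smooth_map_continuous: "continuous_map (mtop M) (mtop N) f"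
proof (rule continuous_map_openI[OF smooth_map_funcset])
  fix p assume "p \<in> pts M"
  with f obtain n U \<phi> m V \<psi> where *: "(n, U, \<phi>) \<in> charts M" "(m, V, \<psi>) \<in> charts N" "p \<in> U" "f ` U \<subseteq> V"
    "chart_smooth (n, U, \<phi>) U m (\<lambda>x. \<psi> (f x))" by (rule smooth_map_at)
  note c = chart_is_chart[OF M *(1)] and d = chart_is_chart[OF N *(2)]
  have "(\<lambda>x. \<psi> (f x)) ` U \<subseteq> topspace (Euclidean_space m)"
    using *(4) is_chart_Euclidean[OF d] by (auto simp: topspace_Euclidean_space)
  from chart_smooth_imp_continuous[OF c order_refl is_chart_open[OF c] *(5) this]
  have "continuous_map (subtopology (mtop M) U) (subtopology (Euclidean_space m) (\<psi> ` V)) (\<lambda>x. \<psi> (f x))"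
    using *(4) by (auto simp: continuous_map_in_subtopology)
  from continuous_map_compose[OF this is_chart_continuous_inv[OF d]]
  have "continuous_map (subtopology (mtop M) U) (mtop N) f"
    by (rule continuous_map_eq) (use *(4) is_chart_inj[OF d] in \<open>auto simp: o_def\<close>)
  then show "\<exists>U. openin (mtop M) U \<and> p \<in> U \<and> continuous_map (subtopology (mtop M) U) (mtop N) f"
    using *(3) is_chart_open[OF c] by blast
qed

lemma smooth_map_open_vimage: "openin (mtop M) U \<Longrightarrow> openin (mtop N) V \<Longrightarrow> openin (mtop M) {x \<in> U. f x \<in> V}"
proof -
  assume U: "openin (mtop M) U" and V: "openin (mtop N) V"
  have "{x \<in> U. f x \<in> V} = U \<inter> {x \<in> pts M. f x \<in> V}" using openin_subset[OF U] by blast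
  then show ?thesis using U openin_continuous_map_preimage[OF smooth_map_continuous V] by auto
qed

text \<open>The definition of \<open>smooth_map\<close> provides one suitable pair of charts at each
  point. Changing charts on both sides near each point turns this into a statement about any given
  pair.\<close>

lemma smooth_map_in_charts:
  assumes c: "(n, U, \<phi>) \<in> charts M" and d: "(m, V, \<psi>) \<in> charts N"
    and S: "S \<subseteq> U" "openin (mtop M) S" "f ` S \<subseteq> V"
  shows "chart_smooth (n, U, \<phi>) S m (\<lambda>x. \<psi> (f x))"
proof (rule chart_smooth_local[OF chart_is_chart[OF M c] S(1,2)])
  fix p assume p: "p \<in> S"
  then have "p \<in> pts M" using openin_subset[OF S(2)] by blast
  with f obtain n' U' \<phi>' m' V' \<psi>' where *: "(n', U', \<phi>') \<in> charts M" "(m', V', \<psi>') \<in> charts N"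
    "p \<in> U'" "f ` U' \<subseteq> V'" "chart_smooth (n', U', \<phi>') U' m' (\<lambda>x. \<psi>' (f x))" by (rule smooth_map_at)
  note c' = chart_is_chart[OF M *(1)] and d' = chart_is_chart[OF N *(2)]
  let ?S = "S \<inter> U'" and ?T = "V \<inter> V'"
  have op: "openin (mtop M) ?S" "openin (mtop N) ?T"
    using S(2) is_chart_open[OF c'] is_chart_open[OF d'] is_chart_open[OF chart_is_chart[OF N d]] by auto
  have "chart_smooth (n', U', \<phi>') ?S m (\<lambda>x. \<psi> (f x))"
    by (rule chart_smooth_comp[OF c' d' _ op(1) _ op(2)])
       (use S(3) *(4) chart_smooth_subset[OF *(5)] chart_change[OF N *(2) d] in auto)
  from chart_smooth_comp[OF chart_is_chart[OF M c] c' _ op(1) _ op(1), where f = "\<lambda>x. x", OF _ _ _ _ this]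
  have "chart_smooth (n, U, \<phi>) ?S m (\<lambda>x. \<psi> (f x))"
    using S(1) chart_change[OF M c *(1), of ?S] by auto
  then show "\<exists>S'. openin (mtop M) S' \<and> p \<in> S' \<and> S' \<subseteq> U \<and> chart_smooth (n, U, \<phi>) S' m (\<lambda>x. \<psi> (f x))"
    using op(1) p *(3) S(1) by (intro exI[of _ ?S]) auto
qed

end

lemma smooth_map_in_open:
  assumes "smooth_structure M" "smooth_structure N" "smooth_map M N f" "p \<in> W" "openin (mtop M) W"
    "f p \<in> Q" "openin (mtop N) Q"
  obtains n U \<phi> m V \<psi> where "(n, U, \<phi>) \<in> charts M" "(m, V, \<psi>) \<in> charts N" "p \<in> U" "U \<subseteq> W" "V \<subseteq> Q" "f ` U \<subseteq> V"
    "chart_smooth (n, U, \<phi>) U m (\<lambda>x. \<psi> (f x))"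
proof -
  obtain m V \<psi> where V: "(m, V, \<psi>) \<in> charts N" "f p \<in> V" "V \<subseteq> Q" by (rule chart_in_open[OF assms(2,6,7)])
  have "openin (mtop M) {x \<in> W. f x \<in> V}"
    using smooth_map_open_vimage[OF assms(1-3,5)] is_chart_open[OF chart_is_chart[OF assms(2) V(1)]] by blast
  then obtain n U \<phi> where U: "(n, U, \<phi>) \<in> charts M" "p \<in> U" "U \<subseteq> {x \<in> W. f x \<in> V}"
    using chart_in_open[OF assms(1), of p "{x \<in> W. f x \<in> V}"] V(2) assms(4) by blast
  then have fU: "f ` U \<subseteq> V" by blast
  show thesis
    by (rule that[OF U(1) V(1) U(2) _ V(3) fU smooth_map_in_charts[OF assms(1-3) U(1) V(1) order_refl _ fU]])
       (use U(3) is_chart_open[OF chart_is_chart[OF assms(1) U(1)]] in auto)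
qed

lemma smooth_map_id: "smooth_structure M \<Longrightarrow> smooth_map M M (\<lambda>x. x)"
proof (rule smooth_mapI)
  fix p assume M: "smooth_structure M" and "p \<in> pts M"
  then obtain n U \<phi> where U: "(n, U, \<phi>) \<in> charts M" "p \<in> U" by (rule chart_at)
  then show "\<exists>n U \<phi> m V \<psi>. (n, U, \<phi>) \<in> charts M \<and> (m, V, \<psi>) \<in> charts M \<and>
    p \<in> U \<and> (\<lambda>x. x) ` U \<subseteq> V \<and> chart_smooth (n, U, \<phi>) U m \<psi>"
    using chart_change[OF M U(1) U(1), of U] by blast
qed

lemma smooth_map_cong:
  assumes M: "smooth_structure M" and f: "smooth_map M N f" and eq: "\<And>x. x \<in> pts M \<Longrightarrow> f x = g x"
  shows "smooth_map M N g"
proof (rule smooth_mapI)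
  fix p assume "p \<in> pts M"
  with f obtain n U \<phi> m V \<psi> where *: "(n, U, \<phi>) \<in> charts M" "(m, V, \<psi>) \<in> charts N" "p \<in> U" "f ` U \<subseteq> V"
    "chart_smooth (n, U, \<phi>) U m (\<lambda>x. \<psi> (f x))" by (rule smooth_map_at)
  note c = chart_is_chart[OF M *(1)]
  have "f x = g x" if "x \<in> U" for x using eq that is_chart_subset[OF c] by blast
  then have "g ` U \<subseteq> V" "chart_smooth (n, U, \<phi>) U m (\<lambda>x. \<psi> (g x))"
    using *(4) chart_smooth_cong[OF c order_refl is_chart_open[OF c] _ *(5)] by (auto simp: image_subset_iff)
  then show "\<exists>n U \<phi> m V \<psi>. (n, U, \<phi>) \<in> charts M \<and> (m, V, \<psi>) \<in> charts N \<and>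
    p \<in> U \<and> g ` U \<subseteq> V \<and> chart_smooth (n, U, \<phi>) U m (\<lambda>x. \<psi> (g x))" using * by blast
qed

lemma smooth_map_comp:
  assumes K: "smooth_structure K" and M: "smooth_structure M" and N: "smooth_structure N"
    and f: "smooth_map K M f" and g: "smooth_map M N g"
  shows "smooth_map K N (\<lambda>x. g (f x))"
proof (rule smooth_mapI)
  fix p assume p: "p \<in> pts K"
  then have fp: "f p \<in> pts M" using smooth_map_funcset[OF K M f] by auto
  from g this obtain m V \<psi> l Q \<xi> where g': "(m, V, \<psi>) \<in> charts M" "(l, Q, \<xi>) \<in> charts N" "f p \<in> V" "g ` V \<subseteq> Q"
    "chart_smooth (m, V, \<psi>) V l (\<lambda>x. \<xi> (g x))" by (rule smooth_map_at)
  note d = chart_is_chart[OF M g'(1)]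
  obtain n U \<phi> m' V' \<psi>' where f': "(n, U, \<phi>) \<in> charts K" "(m', V', \<psi>') \<in> charts M" "p \<in> U" "U \<subseteq> pts K" "V' \<subseteq> V" "f ` U \<subseteq> V'"
    "chart_smooth (n, U, \<phi>) U m' (\<lambda>x. \<psi>' (f x))"
    using smooth_map_in_open[OF K M f p openin_topspace g'(3) is_chart_open[OF d]] .
  note c = chart_is_chart[OF K f'(1)] and d' = chart_is_chart[OF M f'(2)]
  have "chart_smooth (m', V', \<psi>') V' l (\<lambda>x. \<xi> (g x))"
    by (rule smooth_map_in_charts[OF M N g f'(2) g'(2) order_refl is_chart_open[OF d']]) (use f'(5) g'(4) in auto)
  then have "chart_smooth (n, U, \<phi>) U l (\<lambda>x. \<xi> (g (f x)))"
    using chart_smooth_comp[OF c d' order_refl is_chart_open[OF c] order_refl is_chart_open[OF d'] f'(6,7),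
        where g = "\<lambda>x. \<xi> (g x)"] by simp
  moreover have "(\<lambda>x. g (f x)) ` U \<subseteq> Q" using f'(5,6) g'(4) by auto
  ultimately show "\<exists>n U \<phi> m V \<psi>. (n, U, \<phi>) \<in> charts K \<and> (m, V, \<psi>) \<in> charts N \<and>
    p \<in> U \<and> (\<lambda>x. g (f x)) ` U \<subseteq> V \<and> chart_smooth (n, U, \<phi>) U m (\<lambda>x. \<psi> (g (f x)))"
    using f'(1,3) g'(2) by meson
qed


subsection \<open>Products\<close>

definition prod_coord :: "nat \<Rightarrow> ('a \<Rightarrow> nat \<Rightarrow> real) \<Rightarrow> ('b \<Rightarrow> nat \<Rightarrow> real) \<Rightarrow> 'a \<times> 'b \<Rightarrow> nat \<Rightarrow> real"
  where "prod_coord n \<phi> \<psi> = (\<lambda>(x, y) i. if i < n then \<phi> x i else \<psi> y (i - n))"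

lemma prod_manifold_eq:
  "prod_manifold M N = manifold_of_atlas (prod_topology (mtop M) (mtop N))
      {(n + m, U \<times> V, prod_coord n \<phi> \<psi>) | n U \<phi> m V \<psi>. (n, U, \<phi>) \<in> charts M \<and> (m, V, \<psi>) \<in> charts N}"
  by (simp add: prod_manifold_def prod_coord_def)

lemma mtop_prod_manifold [simp]: "mtop (prod_manifold M N) = prod_topology (mtop M) (mtop N)"
  by (simp add: prod_manifold_def)

lemma prod_coord_is_chart:
  assumes c: "is_chart X (n, U, \<phi>)" and d: "is_chart Y (m, V, \<psi>)"
  shows "is_chart (prod_topology X Y) (n + m, U \<times> V, prod_coord n \<phi> \<psi>)"
proof -
  \<comment> \<open>\<open>a\<close> truncates to the first \<open>n\<close> coordinates and
    \<open>b\<close> shifts the remaining ones down to start at 0. The image of the product chart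
    consists of the points that \<open>a\<close> and \<open>b\<close> send into the images of the
    two factors.\<close>
  define a where "a = (\<lambda>(z::nat \<Rightarrow> real) i. if i < n then z i else 0)"
  define b where "b = (\<lambda>(z::nat \<Rightarrow> real) i. z (i + n))"
  have cont: "continuous_map (Euclidean_space (n + m)) (Euclidean_space n) a"
    "continuous_map (Euclidean_space (n + m)) (Euclidean_space m) b"
    by (rule continuous_map_into_Euclidean;
        auto simp: a_def b_def topspace_Euclidean_space continuous_map_Euclidean_coord)+
  have U: "openin X U" "openin Y V" using c d is_chart_open by blast+
  have UE: "openin (Euclidean_space n) (\<phi> ` U)" "openin (Euclidean_space m) (\<psi> ` V)"
    using c d by (auto simp: is_chart_def)
  let ?E = "Euclidean_space (n + m)" and ?p = "prod_coord n \<phi> \<psi>"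
  let ?I = "{z \<in> topspace ?E. a z \<in> \<phi> ` U \<and> b z \<in> \<psi> ` V}"
  have z0: "\<phi> x i = 0" if "x \<in> U" "n \<le> i" for x i using is_chart_Euclidean[OF c that] .
  have z1: "\<psi> y i = 0" if "y \<in> V" "m \<le> i" for y i using is_chart_Euclidean[OF d that] .
  have a: "a (?p (x, y)) = \<phi> x" if "x \<in> U" for x y
    using z0[OF that] by (auto simp: a_def prod_coord_def)
  have b: "b (?p (x, y)) = \<psi> y" for x y by (auto simp: b_def prod_coord_def)
  have pE: "?p (x, y) \<in> topspace ?E" if "x \<in> U" "y \<in> V" for x y
    using z1[OF that(2)] by (auto simp: prod_coord_def topspace_Euclidean_space)
  have ab: "?p (x, y) = z" if "z \<in> topspace ?E" "a z = \<phi> x" "b z = \<psi> y" for x y z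
  proof
    fix i
    have "\<phi> x i = a z i" "\<psi> y (i - n) = b z (i - n)" using that by simp_all
    then show "?p (x, y) i = z i" by (auto simp: prod_coord_def a_def b_def)
  qed
  have im: "?p ` (U \<times> V) = ?I"
  proof (intro subset_antisym subsetI)
    fix z assume "z \<in> ?I"
    then obtain x y where "x \<in> U" "y \<in> V" "a z = \<phi> x" "b z = \<psi> y" "z \<in> topspace ?E" by auto
    then have "(x, y) \<in> U \<times> V" "?p (x, y) = z" using ab by auto
    then show "z \<in> ?p ` (U \<times> V)" by blast
  qed (use a b pE in auto)
  have "?I = {z \<in> topspace ?E. a z \<in> \<phi> ` U} \<inter> {z \<in> topspace ?E. b z \<in> \<psi> ` V}" by auto
  then have opI: "openin ?E ?I"
    using openin_continuous_map_preimage[OF cont(1) UE(1)] openin_continuous_map_preimage[OF cont(2) UE(2)] by auto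
  let ?q = "\<lambda>z. (inv_into U \<phi> (a z), inv_into V \<psi> (b z))"
  have UV: "subtopology (prod_topology X Y) (U \<times> V) = prod_topology (subtopology X U) (subtopology Y V)"
    by (simp add: subtopology_Times)
  have fwd: "continuous_map (subtopology (prod_topology X Y) (U \<times> V)) ?E ?p"
  proof (rule continuous_map_into_Euclidean)
    fix j
    have 1: "continuous_map (subtopology X U) euclideanreal (\<lambda>x. \<phi> x j)"
      using continuous_map_compose[OF is_chart_continuous[OF c] continuous_map_Euclidean_coord[of n j]] by (simp add: o_def)
    have 2: "continuous_map (subtopology Y V) euclideanreal (\<lambda>x. \<psi> x (j - n))"
      using continuous_map_compose[OF is_chart_continuous[OF d] continuous_map_Euclidean_coord[of m "j - n"]] by (simp add: o_def)
    show "continuous_map (subtopology (prod_topology X Y) (U \<times> V)) euclideanreal (\<lambda>w. ?p w j)"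
      unfolding UV using continuous_map_compose[OF continuous_map_fst 1] continuous_map_compose[OF continuous_map_snd 2]
      by (cases "j < n") (auto simp: prod_coord_def case_prod_beta o_def)
  qed (use pE in auto)
  have "continuous_map (subtopology ?E ?I) (subtopology (Euclidean_space n) (\<phi> ` U)) a"
    "continuous_map (subtopology ?E ?I) (subtopology (Euclidean_space m) (\<psi> ` V)) b"
    using cont by (auto simp: continuous_map_in_subtopology continuous_map_from_subtopology)
  then have "continuous_map (subtopology ?E ?I) X (\<lambda>z. inv_into U \<phi> (a z))"
    "continuous_map (subtopology ?E ?I) Y (\<lambda>z. inv_into V \<psi> (b z))"
    using continuous_map_compose[OF _ is_chart_continuous_inv[OF c]] continuous_map_compose[OF _ is_chart_continuous_inv[OF d]]
    by (auto simp: o_def)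
  then have bwd: "continuous_map (subtopology ?E ?I) (prod_topology X Y) ?q"
    by (simp add: continuous_map_pairwise o_def)
  have inj: "inj_on \<phi> U" "inj_on \<psi> V" using is_chart_inj c d by blast+
  have q: "?q z \<in> U \<times> V" if "z \<in> ?I" for z using that by (auto intro!: inv_into_into)
  have "homeomorphic_maps (subtopology (prod_topology X Y) (U \<times> V)) (subtopology ?E ?I) ?p ?q"
    unfolding homeomorphic_maps_def
  proof (intro conjI ballI)
    show "continuous_map (subtopology (prod_topology X Y) (U \<times> V)) (subtopology ?E ?I) ?p"
      using fwd im by (auto simp: continuous_map_in_subtopology)
    show "continuous_map (subtopology ?E ?I) (subtopology (prod_topology X Y) (U \<times> V)) ?q"
      using bwd q by (auto simp: continuous_map_in_subtopology)
    fix w assume "w \<in> topspace (subtopology (prod_topology X Y) (U \<times> V))"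
    then show "?q (?p w) = w" using a b inj by (cases w) auto
  next
    fix z assume "z \<in> topspace (subtopology ?E ?I)"
    then have z: "z \<in> ?I" by simp
    show "?p (?q z) = z" by (rule ab) (use z in \<open>auto simp: f_inv_into_f\<close>)
  qed
  then show ?thesis using im opI U by (auto simp: is_chart_def homeomorphic_map_maps openin_prod_Times_iff)
qed

lemma prod_coord_fst_smooth:
  assumes c: "is_chart X (n, U, \<phi>)" and d: "is_chart Y (m, V, \<psi>)" and S: "S \<subseteq> U \<times> V" "openin (prod_topology X Y) S"
  shows "chart_smooth (n + m, U \<times> V, prod_coord n \<phi> \<psi>) S n (\<lambda>w. \<phi> (fst w))"
  by (rule chart_smooth_cong[OF prod_coord_is_chart[OF c d] S _ chart_smooth_coord[OF prod_coord_is_chart[OF c d] S]])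
     (auto simp: prod_coord_def)

lemma prod_coord_snd_smooth:
  assumes c: "is_chart X (n, U, \<phi>)" and d: "is_chart Y (m, V, \<psi>)" and S: "S \<subseteq> U \<times> V" "openin (prod_topology X Y) S"
  shows "chart_smooth (n + m, U \<times> V, prod_coord n \<phi> \<psi>) S m (\<lambda>w. \<psi> (snd w))"
  unfolding chart_smooth_def
proof (intro allI impI)
  fix i
  show "smooth_fun (n + m, U \<times> V, prod_coord n \<phi> \<psi>) S (\<lambda>w. \<psi> (snd w) i)"
    by (rule smooth_fun_cong[OF prod_coord_is_chart[OF c d] S _ smooth_fun_coord[OF prod_coord_is_chart[OF c d] S, of "n + i"]])
       (auto simp: prod_coord_def)
qed

lemma chart_smooth_prod_coord:
  assumes "chart_smooth c S n (\<lambda>x. \<phi> (f x))" "chart_smooth c S m (\<lambda>x. \<psi> (g x))"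
  shows "chart_smooth c S (n + m) (\<lambda>x. prod_coord n \<phi> \<psi> (f x, g x))"
  unfolding chart_smooth_def
proof (intro allI impI)
  fix i assume "i < n + m"
  then show "smooth_fun c S (\<lambda>x. prod_coord n \<phi> \<psi> (f x, g x) i)"
    using assms by (cases "i < n") (auto simp: prod_coord_def chart_smooth_def)
qed

context
  fixes M :: "'a manifold" and N :: "'b manifold"
  assumes M: "smooth_structure M" and N: "smooth_structure N"
begin

lemma prod_compatible:
  assumes "(n, U, \<phi>) \<in> charts M" "(m, V, \<psi>) \<in> charts N" "(n', U', \<phi>') \<in> charts M" "(m', V', \<psi>') \<in> charts N"
  shows "chart_smooth (n + m, U \<times> V, prod_coord n \<phi> \<psi>) ((U \<times> V) \<inter> (U' \<times> V')) (n' + m') (prod_coord n' \<phi>' \<psi>')"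
proof -
  note c = chart_is_chart[OF M assms(1)] and d = chart_is_chart[OF N assms(2)]
    and c' = chart_is_chart[OF M assms(3)] and d' = chart_is_chart[OF N assms(4)]
  let ?S = "(U \<times> V) \<inter> (U' \<times> V')"
  have op: "openin (mtop M) (U \<inter> U')" "openin (mtop N) (V \<inter> V')"
    using is_chart_open[OF c] is_chart_open[OF c'] is_chart_open[OF d] is_chart_open[OF d'] by auto
  have S: "?S \<subseteq> U \<times> V" "openin (prod_topology (mtop M) (mtop N)) ?S"
    using op by (auto simp: Times_Int_Times openin_prod_Times_iff)
  note p = prod_coord_is_chart[OF c d]
  have "chart_smooth (n + m, U \<times> V, prod_coord n \<phi> \<psi>) ?S n' (\<lambda>w. \<phi>' (fst w))"
    by (rule chart_smooth_comp[OF p c S _ op(1) _ prod_coord_fst_smooth[OF c d S] chart_change[OF M assms(1,3) order_refl]])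
       auto
  moreover have "chart_smooth (n + m, U \<times> V, prod_coord n \<phi> \<psi>) ?S m' (\<lambda>w. \<psi>' (snd w))"
    by (rule chart_smooth_comp[OF p d S _ op(2) _ prod_coord_snd_smooth[OF c d S] chart_change[OF N assms(2,4) order_refl]])
       auto
  ultimately show ?thesis using chart_smooth_prod_coord[of _ ?S n' \<phi>' fst m' \<psi>' snd] by simp
qed

lemma prod_charts_atlas:
  defines "A \<equiv> {(n + m, U \<times> V, prod_coord n \<phi> \<psi>) | n U \<phi> m V \<psi>. (n, U, \<phi>) \<in> charts M \<and> (m, V, \<psi>) \<in> charts N}"
  shows "smooth_structure (prod_manifold M N)" "A \<subseteq> charts (prod_manifold M N)"
proof -
  let ?X = "prod_topology (mtop M) (mtop N)"
  have 1: "is_chart ?X a" if "a \<in> A" for a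
    using that prod_coord_is_chart chart_is_chart[OF M] chart_is_chart[OF N] by (fastforce simp: A_def)
  have 2: "topspace ?X \<subseteq> (\<Union>(n, U, \<phi>)\<in>A. U)"
  proof
    fix w assume "w \<in> topspace ?X"
    then obtain x y where w: "w = (x, y)" "x \<in> pts M" "y \<in> pts N" by auto
    obtain n U \<phi> where c: "(n, U, \<phi>) \<in> charts M" "x \<in> U" using w(2) by (rule chart_at[OF M])
    obtain m V \<psi> where d: "(m, V, \<psi>) \<in> charts N" "y \<in> V" using w(3) by (rule chart_at[OF N])
    have "(n + m, U \<times> V, prod_coord n \<phi> \<psi>) \<in> A" unfolding A_def using c d by blast
    moreover have "w \<in> U \<times> V" using w(1) c(2) d(2) by simp
    ultimately show "w \<in> (\<Union>(n, U, \<phi>)\<in>A. U)" by (intro UN_I[of "(n + m, U \<times> V, prod_coord n \<phi> \<psi>)"]) (simp_all only: prod.case)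
  qed
  have 3: "compatible_charts a b" if ab: "a \<in> A" "b \<in> A" for a b
  proof -
    obtain n U \<phi> m V \<psi> where a: "a = (n + m, U \<times> V, prod_coord n \<phi> \<psi>)" "(n, U, \<phi>) \<in> charts M" "(m, V, \<psi>) \<in> charts N"
      using ab(1) unfolding A_def by blast
    obtain n' U' \<phi>' m' V' \<psi>' where b: "b = (n' + m', U' \<times> V', prod_coord n' \<phi>' \<psi>')" "(n', U', \<phi>') \<in> charts M" "(m', V', \<psi>') \<in> charts N"
      using ab(2) unfolding A_def by blast
    show ?thesis using prod_compatible[OF a(2,3) b(2,3)] prod_compatible[OF b(2,3) a(2,3)]
      unfolding a(1) b(1) compatible_charts_iff by (simp add: Int_commute)
  qed
  show "smooth_structure (prod_manifold M N)" "A \<subseteq> charts (prod_manifold M N)"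
    using smooth_structure_manifold_of_atlas[OF 1 2 3] unfolding prod_manifold_eq A_def[symmetric] by blast+
qed

lemma smooth_structure_prod: "smooth_structure (prod_manifold M N)"
  by (rule prod_charts_atlas)

lemma prod_chart:
  "(n, U, \<phi>) \<in> charts M \<Longrightarrow> (m, V, \<psi>) \<in> charts N \<Longrightarrow> (n + m, U \<times> V, prod_coord n \<phi> \<psi>) \<in> charts (prod_manifold M N)"
  using prod_charts_atlas(2) by blast

lemma smooth_map_Pair:
  assumes K: "smooth_structure K" and f: "smooth_map K M f" and g: "smooth_map K N g"
  shows "smooth_map K (prod_manifold M N) (\<lambda>x. (f x, g x))"
proof (rule smooth_mapI)
  fix p assume p: "p \<in> pts K"
  then have fg: "f p \<in> pts M" "g p \<in> pts N"
    using smooth_map_funcset[OF K M f] smooth_map_funcset[OF K N g] by auto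
  obtain n U \<phi> where c: "(n, U, \<phi>) \<in> charts M" "f p \<in> U" using fg(1) by (rule chart_at[OF M])
  obtain m V \<psi> where d: "(m, V, \<psi>) \<in> charts N" "g p \<in> V" using fg(2) by (rule chart_at[OF N])
  let ?W = "{x \<in> {x \<in> pts K. f x \<in> U}. g x \<in> V}"
  have "openin (mtop K) ?W"
    by (intro smooth_map_open_vimage[OF K N g] smooth_map_open_vimage[OF K M f] openin_topspace
        is_chart_open[OF chart_is_chart[OF M c(1)]] is_chart_open[OF chart_is_chart[OF N d(1)]])
  then obtain l Q \<xi> where Q: "(l, Q, \<xi>) \<in> charts K" "p \<in> Q" "Q \<subseteq> ?W"
    using chart_in_open[OF K, of p ?W] p c(2) d(2) by blast
  have Qo: "openin (mtop K) Q" by (rule is_chart_open[OF chart_is_chart[OF K Q(1)]])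
  have "chart_smooth (l, Q, \<xi>) Q (n + m) (\<lambda>x. prod_coord n \<phi> \<psi> (f x, g x))"
    by (rule chart_smooth_prod_coord)
       (use Q(3) in \<open>auto intro!: smooth_map_in_charts[OF K M f Q(1) c(1) order_refl Qo] smooth_map_in_charts[OF K N g Q(1) d(1) order_refl Qo]\<close>)
  then show "\<exists>n' U' \<phi>' m' V' \<psi>'. (n', U', \<phi>') \<in> charts K \<and> (m', V', \<psi>') \<in> charts (prod_manifold M N) \<and>
    p \<in> U' \<and> (\<lambda>x. (f x, g x)) ` U' \<subseteq> V' \<and> chart_smooth (n', U', \<phi>') U' m' (\<lambda>x. \<psi>' (f x, g x))"
    using prod_chart[OF c(1) d(1)] Q
    by (intro exI[of _ l] exI[of _ Q] exI[of _ \<xi>] exI[of _ "n + m"] exI[of _ "U \<times> V"] exI[of _ "prod_coord n \<phi> \<psi>"]) auto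
qed

end


subsection \<open>Embedded submanifolds\<close>

text \<open>On the coordinate subspace only the first \<open>k\<close> directions are
  differentiated, and the partial derivatives there are those of the ambient function; the witnesses
  are simply restricted.\<close>

lemma Ck_slice:
  assumes "k \<le> n"
  shows "Ck n l W g \<Longrightarrow> Ck k l (W \<inter> topspace (Euclidean_space k)) g"
proof (induction l arbitrary: g)
  have sub: "subtopology (Euclidean_space k) (W \<inter> topspace (Euclidean_space k)) =
      subtopology (subtopology (Euclidean_space n) W) (topspace (Euclidean_space k))"
    using assms by (auto simp: Euclidean_space_eq subtopology_subtopology intro!: arg_cong[where f = "top_of_set"])
  {
    case 0 then show ?case
      unfolding Ck.simps sub by (rule continuous_map_from_subtopology)
  next
    case (Suc l)
    then have "continuous_map (subtopology (Euclidean_space k) (W \<inter> topspace (Euclidean_space k))) euclideanreal g"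
      unfolding Ck.simps sub by (blast intro: continuous_map_from_subtopology)
    moreover have "\<exists>g'. (\<forall>x\<in>W \<inter> topspace (Euclidean_space k). ((\<lambda>t. g (x(i := t))) has_real_derivative g' x) (at (x i))) \<and>
        Ck k l (W \<inter> topspace (Euclidean_space k)) g'" if i: "i < k" for i
    proof -
      have "i < n" using i assms by simp
      with Suc.prems obtain g' where "\<forall>x\<in>W. ((\<lambda>t. g (x(i := t))) has_real_derivative g' x) (at (x i))" "Ck n l W g'"
        unfolding Ck.simps by blast
      then show ?thesis using Suc.IH[of g'] by (intro exI[of _ g']) blast
    qed
    ultimately show ?case unfolding Ck.simps by blast
  }
qed

context
  fixes M :: "'a manifold" and P n U \<phi> k
  assumes M: "smooth_structure M" and c: "(n, U, \<phi>) \<in> charts M" and k: "k \<le> n"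
    and slice: "\<phi> ` (U \<inter> P) = {x \<in> \<phi> ` U. \<forall>i\<ge>k. x i = 0}"
begin

lemma slice_image:
  assumes S: "S \<subseteq> U"
  shows "\<phi> ` (S \<inter> P) = \<phi> ` S \<inter> topspace (Euclidean_space k)"
proof -
  have inj: "inj_on \<phi> U" using is_chart_inj[OF chart_is_chart[OF M c]] .
  show ?thesis
  proof (intro subset_antisym subsetI)
    fix x assume "x \<in> \<phi> ` (S \<inter> P)"
    then have "x \<in> \<phi> ` S" "x \<in> \<phi> ` (U \<inter> P)" using S by auto
    then show "x \<in> \<phi> ` S \<inter> topspace (Euclidean_space k)" unfolding slice by (simp add: topspace_Euclidean_space)
  next
    fix x assume x: "x \<in> \<phi> ` S \<inter> topspace (Euclidean_space k)"
    then obtain s where s: "s \<in> S" "x = \<phi> s" by blast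
    have "x \<in> \<phi> ` (U \<inter> P)" unfolding slice using x S by (auto simp: topspace_Euclidean_space)
    then have "s \<in> P" using s S inj by (auto simp: inj_on_def)
    then show "x \<in> \<phi> ` (S \<inter> P)" using s by blast
  qed
qed

text \<open>By the slice condition \<open>\<phi>\<close> maps \<open>U \<inter> P\<close> onto the
  part of its image that lies in \<open>Euclidean_space k\<close>. As this is a subspace of
  \<open>Euclidean_space n\<close>, the homeomorphism restricts.\<close>

lemma slice_is_chart: "is_chart (subtopology (mtop M) P) (k, U \<inter> P, \<phi>)"
proof -
  note c' = chart_is_chart[OF M c]
  have h: "homeomorphic_map (subtopology (mtop M) U) (subtopology (Euclidean_space n) (\<phi> ` U)) \<phi>"
    and op: "openin (mtop M) U" "openin (Euclidean_space n) (\<phi> ` U)"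
    using c' by (auto simp: is_chart_def)
  have Ek: "Euclidean_space k = subtopology (Euclidean_space n) (topspace (Euclidean_space k))"
    using k by (auto simp: Euclidean_space_eq subtopology_subtopology intro!: arg_cong[where f = "top_of_set"])
  note im = slice_image[OF order_refl]
  have "openin (Euclidean_space k) (\<phi> ` (U \<inter> P))"
    unfolding im by (subst Ek) (use op(2) in \<open>auto intro: openin_subtopology_Int\<close>)
  moreover have "openin (subtopology (mtop M) P) (U \<inter> P)" using op(1) by (auto intro: openin_subtopology_Int)
  moreover have "homeomorphic_map (subtopology (subtopology (mtop M) P) (U \<inter> P)) (subtopology (Euclidean_space k) (\<phi> ` (U \<inter> P))) \<phi>"
  proof -
    have "\<phi> ` (topspace (subtopology (mtop M) U) \<inter> P) = topspace (subtopology (Euclidean_space n) (\<phi> ` U)) \<inter> topspace (Euclidean_space k)"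
      using im openin_subset[OF op(1)] openin_subset[OF op(2)] by (simp add: Int_absorb1)
    from homeomorphic_map_subtopologies[OF h this]
    have "homeomorphic_map (subtopology (mtop M) (U \<inter> P)) (subtopology (Euclidean_space n) (\<phi> ` U \<inter> topspace (Euclidean_space k))) \<phi>"
      by (simp add: subtopology_subtopology)
    moreover have "subtopology (subtopology (mtop M) P) (U \<inter> P) = subtopology (mtop M) (U \<inter> P)"
      by (simp add: subtopology_subtopology Int_ac)
    moreover have "subtopology (Euclidean_space k) (\<phi> ` (U \<inter> P)) = subtopology (Euclidean_space n) (\<phi> ` U \<inter> topspace (Euclidean_space k))"
      unfolding im by (subst Ek) (simp add: subtopology_subtopology Int_ac)
    ultimately show ?thesis by simp
  qed
  ultimately show ?thesis by (simp add: is_chart_def)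
qed

lemma slice_smooth_fun:
  assumes S: "S \<subseteq> U" "openin (mtop M) S" and h: "smooth_fun (n, U, \<phi>) S h"
  shows "smooth_fun (k, U \<inter> P, \<phi>) (S \<inter> P) h"
  unfolding smooth_fun_def prod.case
proof
  fix l
  note c' = chart_is_chart[OF M c]
  have "Ck k l (\<phi> ` (S \<inter> P)) (\<lambda>x. h (inv_into U \<phi> x))"
    unfolding slice_image[OF S(1)] using h by (intro Ck_slice[OF k]) (simp add: smooth_fun_def)
  moreover have "openin (Euclidean_space k) (\<phi> ` (S \<inter> P))"
  proof -
    have "openin (subtopology (mtop M) P) (S \<inter> P)" using S(2) by (rule openin_subtopology_Int)
    moreover have "S \<inter> P \<subseteq> U \<inter> P" using S(1) by blast
    ultimately show ?thesis using is_chart_image_open[OF slice_is_chart] by blast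
  qed
  moreover have "h (inv_into U \<phi> x) = h (inv_into (U \<inter> P) \<phi> x)" if "x \<in> \<phi> ` (S \<inter> P)" for x
    using that S(1) is_chart_inj[OF c'] is_chart_inj[OF slice_is_chart] by (auto simp: subset_iff)
  ultimately show "Ck k l (\<phi> ` (S \<inter> P)) (\<lambda>x. h (inv_into (U \<inter> P) \<phi> x))"
    by (rule_tac g = "\<lambda>x. h (inv_into U \<phi> x)" in Ck_cong)
qed

lemma slice_chart_smooth:
  "S \<subseteq> U \<Longrightarrow> openin (mtop M) S \<Longrightarrow> chart_smooth (n, U, \<phi>) S m g \<Longrightarrow> chart_smooth (k, U \<inter> P, \<phi>) (S \<inter> P) m g"
  using slice_smooth_fun[of S "\<lambda>x. g x i" for i] by (simp add: chart_smooth_def)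

end

lemma slice_chartsE:
  assumes "d \<in> slice_charts M P"
  obtains k n U \<phi> where "d = (k, U \<inter> P, \<phi>)" "(n, U, \<phi>) \<in> charts M" "k \<le> n"
    "\<phi> ` (U \<inter> P) = {x \<in> \<phi> ` U. \<forall>i\<ge>k. x i = 0}"
  using assms unfolding slice_charts_def by blast

lemma mtop_submanifold [simp]: "mtop (submanifold M P) = subtopology (mtop M) P"
  by (simp add: submanifold_def)

context
  fixes M :: "'a manifold" and P
  assumes M: "smooth_structure M" and P: "embedded_submanifold M P"
begin

text \<open>A transition map between slice charts is the restriction of a transition map of
  \<open>M\<close>, of which only the first \<open>l\<close> components are kept.\<close>

lemma submanifold_atlas:
  shows "smooth_structure (submanifold M P)" "slice_charts M P \<subseteq> charts (submanifold M P)"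
proof -
  have 1: "is_chart (subtopology (mtop M) P) d" if "d \<in> slice_charts M P" for d
    using that by (elim slice_chartsE) (simp add: slice_is_chart[OF M])
  have 2: "topspace (subtopology (mtop M) P) \<subseteq> (\<Union>(n, U, \<phi>)\<in>slice_charts M P. U)"
    using P by (auto simp: embedded_submanifold_def)
  have half: "chart_smooth (k, U \<inter> P, \<phi>) ((U \<inter> P) \<inter> (V \<inter> P)) l \<psi>"
    if "(n, U, \<phi>) \<in> charts M" "k \<le> n" "\<phi> ` (U \<inter> P) = {x \<in> \<phi> ` U. \<forall>i\<ge>k. x i = 0}"
      "(m, V, \<psi>) \<in> charts M" "l \<le> m" for k n U \<phi> l m V \<psi>
  proof -
    have "openin (mtop M) (U \<inter> V)"
      using is_chart_open[OF chart_is_chart[OF M that(1)]] is_chart_open[OF chart_is_chart[OF M that(4)]] by blast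
    from slice_chart_smooth[OF M that(1-3) _ this chart_change[OF M that(1,4)]]
    have "chart_smooth (k, U \<inter> P, \<phi>) ((U \<inter> V) \<inter> P) m \<psi>" by blast
    from chart_smooth_mono[OF this that(5)] show ?thesis by (simp add: Int_ac)
  qed
  have 3: "compatible_charts d d'" if dd': "d \<in> slice_charts M P" "d' \<in> slice_charts M P" for d d'
  proof -
    obtain k n U \<phi> where d: "d = (k, U \<inter> P, \<phi>)" "(n, U, \<phi>) \<in> charts M" "k \<le> n"
      "\<phi> ` (U \<inter> P) = {x \<in> \<phi> ` U. \<forall>i\<ge>k. x i = 0}" using dd'(1) by (rule slice_chartsE)
    obtain l m V \<psi> where d': "d' = (l, V \<inter> P, \<psi>)" "(m, V, \<psi>) \<in> charts M" "l \<le> m"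
      "\<psi> ` (V \<inter> P) = {x \<in> \<psi> ` V. \<forall>i\<ge>l. x i = 0}" using dd'(2) by (rule slice_chartsE)
    show ?thesis using half[OF d(2-4) d'(2,3)] half[OF d'(2-4) d(2,3)]
      unfolding d(1) d'(1) compatible_charts_iff by (simp add: Int_ac)
  qed
  show "smooth_structure (submanifold M P)" "slice_charts M P \<subseteq> charts (submanifold M P)"
    using smooth_structure_manifold_of_atlas[OF 1 2 3] unfolding submanifold_def by blast+
qed

lemma smooth_structure_submanifold: "smooth_structure (submanifold M P)"
  by (rule submanifold_atlas)

lemma slice_chart_at:
  assumes "p \<in> P"
  obtains k n U \<phi> where "(k, U \<inter> P, \<phi>) \<in> charts (submanifold M P)" "(n, U, \<phi>) \<in> charts M" "k \<le> n"
    "\<phi> ` (U \<inter> P) = {x \<in> \<phi> ` U. \<forall>i\<ge>k. x i = 0}" "p \<in> U"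
proof -
  have "p \<in> (\<Union>(k, V, \<phi>)\<in>slice_charts M P. V)" using P assms unfolding embedded_submanifold_def by blast
  then obtain d where d: "d \<in> slice_charts M P" "p \<in> fst (snd d)" by (auto split: prod.splits)
  from d(1) obtain k n U \<phi> where "d = (k, U \<inter> P, \<phi>)" "(n, U, \<phi>) \<in> charts M" "k \<le> n"
    "\<phi> ` (U \<inter> P) = {x \<in> \<phi> ` U. \<forall>i\<ge>k. x i = 0}" by (rule slice_chartsE)
  then show thesis using that[of k U \<phi> n] d submanifold_atlas(2) by auto
qed

text \<open>In a slice chart the coordinates of \<open>f\<close> are the first \<open>k\<close> of
  its coordinates in \<open>M\<close>. Products of varying arrows are handled this way, because
  multiplication lives on an embedded fibre product.\<close>

lemma smooth_map_into_submanifold: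
  assumes K: "smooth_structure K" and f: "smooth_map K M f" and fP: "f ` pts K \<subseteq> P"
  shows "smooth_map K (submanifold M P) f"
proof (rule smooth_mapI)
  fix p assume p: "p \<in> pts K"
  then have "f p \<in> P" using fP by blast
  then obtain k n U \<phi> where d: "(k, U \<inter> P, \<phi>) \<in> charts (submanifold M P)" "(n, U, \<phi>) \<in> charts M" "k \<le> n"
    "\<phi> ` (U \<inter> P) = {x \<in> \<phi> ` U. \<forall>i\<ge>k. x i = 0}" "f p \<in> U" by (rule slice_chart_at)
  let ?W = "{x \<in> pts K. f x \<in> U}"
  have "openin (mtop K) ?W"
    by (rule smooth_map_open_vimage[OF K M f openin_topspace is_chart_open[OF chart_is_chart[OF M d(2)]]])
  then obtain l Q \<xi> where Q: "(l, Q, \<xi>) \<in> charts K" "p \<in> Q" "Q \<subseteq> ?W"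
    using chart_in_open[OF K, of p ?W] p d(5) by blast
  have "chart_smooth (l, Q, \<xi>) Q n (\<lambda>x. \<phi> (f x))"
    by (rule smooth_map_in_charts[OF K M f Q(1) d(2) order_refl is_chart_open[OF chart_is_chart[OF K Q(1)]]])
       (use Q(3) in auto)
  from chart_smooth_mono[OF this d(3)]
  show "\<exists>n' U' \<phi>' m' V' \<psi>'. (n', U', \<phi>') \<in> charts K \<and> (m', V', \<psi>') \<in> charts (submanifold M P) \<and>
    p \<in> U' \<and> f ` U' \<subseteq> V' \<and> chart_smooth (n', U', \<phi>') U' m' (\<lambda>x. \<psi>' (f x))"
    using d(1) Q fP
    by (intro exI[of _ l] exI[of _ Q] exI[of _ \<xi>] exI[of _ k] exI[of _ "U \<inter> P"] exI[of _ \<phi>]) auto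
qed

end

subsection \<open>Local sections of submersions\<close>

text \<open>The bound is a continuous function of \<open>v\<close> in the product topology and
  vanishes at \<open>v'\<close>, so the difference of the values of \<open>h\<close> tends to
  0.\<close>

lemma l1_lipschitz_continuous_on:
  fixes h :: "(nat \<Rightarrow> real) \<Rightarrow> real"
  assumes "\<And>v v'. v \<in> K \<Longrightarrow> v' \<in> K \<Longrightarrow> \<bar>h v - h v'\<bar> \<le> c * (\<Sum>i<m. \<bar>v i - v' i\<bar>)"
  shows "continuous_on K h"
  unfolding continuous_on_def
proof
  fix v' assume v': "v' \<in> K"
  have "continuous_on UNIV (\<lambda>v :: nat \<Rightarrow> real. v i)" for i by (rule continuous_on_product_coordinates)
  then have "continuous_on UNIV (\<lambda>v. c * (\<Sum>i<m. \<bar>v i - v' i\<bar>))"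
    by (intro continuous_on_mult continuous_on_const continuous_on_sum continuous_on_rabs continuous_on_diff)
  then have "((\<lambda>v. c * (\<Sum>i<m. \<bar>v i - v' i\<bar>)) \<longlongrightarrow> c * (\<Sum>i<m. \<bar>v' i - v' i\<bar>)) (at v' within K)"
    unfolding continuous_on_def by (meson UNIV_I subset_UNIV tendsto_within_subset)
  then have lim: "((\<lambda>v. c * (\<Sum>i<m. \<bar>v i - v' i\<bar>)) \<longlongrightarrow> 0) (at v' within K)" by simp
  have "((\<lambda>v. h v - h v') \<longlongrightarrow> 0) (at v' within K)"
  proof (rule Lim_null_comparison[OF _ lim])
    show "\<forall>\<^sub>F v in at v' within K. norm (h v - h v') \<le> c * (\<Sum>i<m. \<bar>v i - v' i\<bar>)"
      unfolding eventually_at_filter using assms[OF _ v'] by (intro always_eventually) simp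
  qed
  then show "(h \<longlongrightarrow> h v') (at v' within K)" by (simp add: LIM_zero_iff)
qed

text \<open>A closed subset of a cube that is compact by Tychonoff's theorem. All coordinates are
  bounded by \<open>r\<close>, those from \<open>m\<close> on because they vanish.\<close>

lemma compact_l1_ball: "compact {v :: nat \<Rightarrow> real. (\<forall>j\<ge>m. v j = 0) \<and> (\<Sum>j<m. \<bar>v j\<bar>) \<le> r}" (is "compact ?K")
proof -
  have 1: "continuous_on UNIV (\<lambda>v :: nat \<Rightarrow> real. v i)" for i by (rule continuous_on_product_coordinates)
  have "closed {v :: nat \<Rightarrow> real. v j = 0}" for j
    by (rule closed_Collect_eq[OF 1 continuous_on_const])
  then have "closed (\<Inter>j\<in>{m..}. {v :: nat \<Rightarrow> real. v j = 0})" by (intro closed_INT) auto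
  moreover have "closed {v :: nat \<Rightarrow> real. (\<Sum>j<m. \<bar>v j\<bar>) \<le> r}"
    by (intro closed_Collect_le continuous_on_sum continuous_on_rabs 1 continuous_on_const)
  moreover have "?K = (\<Inter>j\<in>{m..}. {v. v j = 0}) \<inter> {v. (\<Sum>j<m. \<bar>v j\<bar>) \<le> r}" by auto
  ultimately have cl: "closed ?K" by (simp only: closed_Int)
  have "compactin (powertop_real UNIV) (PiE UNIV (\<lambda>_. {-r..r}))"
    by (subst compactin_PiE) auto
  then have cp: "compact (PiE UNIV (\<lambda>_. {-r..r}) :: (nat \<Rightarrow> real) set)"
    by (simp add: euclidean_product_topology)
  have "v j \<in> {-r..r}" if "v \<in> ?K" for v j
  proof -
    have "0 \<le> (\<Sum>j<m. \<bar>v j\<bar>)" by (intro sum_nonneg) auto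
    also have "\<dots> \<le> r" using that by simp
    finally have r: "r \<ge> 0" .
    have "\<bar>v j\<bar> \<le> r"
    proof (cases "j < m")
      case True
      then have "\<bar>v j\<bar> \<le> (\<Sum>j<m. \<bar>v j\<bar>)" by (intro member_le_sum) auto
      then show ?thesis using that by simp
    qed (use that r in simp)
    then show ?thesis by (simp add: abs_le_iff)
  qed
  then have "?K \<subseteq> PiE UNIV (\<lambda>_. {-r..r})" by auto
  then have "?K = PiE UNIV (\<lambda>_. {-r..r}) \<inter> ?K" by (simp add: Int_absorb1)
  then show ?thesis using compact_Int_closed[OF cp cl] by simp
qed

text \<open>
  The equation \<open>F v = u\<close> for an \<open>F\<close> that differs from the identity by a contraction is solved by
  minimising the displacement of \<open>v \<mapsto> v + u - F v\<close> on a compact ball.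
\<close>

lemma near_identity_onto:
  fixes F :: "(nat \<Rightarrow> real) \<Rightarrow> nat \<Rightarrow> real" and m :: nat and r :: real
  defines "D \<equiv> \<lambda>v v'. \<Sum>i<m. \<bar>v i - v' i :: real\<bar>"
  assumes contr: "\<And>v v'. v \<in> K \<Longrightarrow> v' \<in> K \<Longrightarrow> D (\<lambda>i. F v i - v i) (\<lambda>i. F v' i - v' i) \<le> D v v' / 2"
    and K: "K = {v. (\<forall>j\<ge>m. v j = 0) \<and> (\<Sum>j<m. \<bar>v j\<bar>) \<le> r}"
    and F0: "\<And>i. i < m \<Longrightarrow> F (\<lambda>_. 0) i = 0" and r: "r \<ge> 0" and u: "(\<Sum>i<m. \<bar>u i\<bar>) \<le> r / 2"
  shows "\<exists>v\<in>K. \<forall>i<m. F v i = u i"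
proof -
  \<comment> \<open>A fixed point of \<open>T\<close> solves the equation. The value 0 from index
    \<open>m\<close> on keeps \<open>T v\<close> inside \<open>K\<close>.\<close>
  define T where "T = (\<lambda>v i. if i < m then v i + u i - F v i else 0)"
  have zero: "(\<lambda>_. 0) \<in> K" using r by (simp add: K)
  have TK: "T v \<in> K" if v: "v \<in> K" for v
  proof -
    have "(\<Sum>j<m. \<bar>T v j\<bar>) \<le> (\<Sum>j<m. \<bar>u j\<bar> + \<bar>(F v j - v j) - (F (\<lambda>_. 0) j - 0)\<bar>)"
      by (intro sum_mono) (simp add: T_def F0)
    also have "\<dots> = (\<Sum>j<m. \<bar>u j\<bar>) + D (\<lambda>i. F v i - v i) (\<lambda>i. F (\<lambda>_. 0) i - (\<lambda>_. 0) i)"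
      by (simp add: D_def sum.distrib)
    also have "\<dots> \<le> r / 2 + D v (\<lambda>_. 0) / 2" by (intro add_mono u contr v zero)
    also have "\<dots> \<le> r" using v by (simp add: K D_def)
    finally show ?thesis by (simp add: K T_def)
  qed
  have DT: "D (T v) (T v') \<le> D v v' / 2" if "v \<in> K" "v' \<in> K" for v v'
  proof -
    have "D (T v) (T v') = D (\<lambda>i. F v i - v i) (\<lambda>i. F v' i - v' i)"
      unfolding D_def T_def by (intro sum.cong) auto
    then show ?thesis using contr[OF that] by simp
  qed
  have tri: "D a c \<le> D a b + D b c" for a b c
    unfolding D_def sum.distrib[symmetric] by (intro sum_mono) auto
  have sym: "D a b = D b a" for a b by (simp add: D_def abs_minus_commute)
  have "continuous_on K (\<lambda>v. D (T v) v)"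
  proof (rule l1_lipschitz_continuous_on[where c = 2 and m = m])
    fix v v' assume vv: "v \<in> K" "v' \<in> K"
    have "D (T v) v \<le> D (T v) (T v') + D (T v') v' + D v' v"
      using tri[of "T v" v "T v'"] tri[of "T v'" v v'] by linarith
    moreover have "D (T v') v' \<le> D (T v') (T v) + D (T v) v + D v v'"
      using tri[of "T v'" v' "T v"] tri[of "T v" v' v] by linarith
    moreover have "D v v' \<ge> 0" by (simp add: D_def sum_nonneg)
    ultimately have "\<bar>D (T v) v - D (T v') v'\<bar> \<le> 2 * D v v'"
      using DT[OF vv] sym[of v v'] sym[of "T v" "T v'"] by linarith
    then show "\<bar>D (T v) v - D (T v') v'\<bar> \<le> 2 * (\<Sum>i<m. \<bar>v i - v' i\<bar>)"
      by (simp only: D_def)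
  qed
  moreover have "compact K" unfolding K by (rule compact_l1_ball)
  ultimately obtain v where v: "v \<in> K" "\<And>w. w \<in> K \<Longrightarrow> D (T v) v \<le> D (T w) w"
    using continuous_attains_inf[of K "\<lambda>v. D (T v) v"] zero by blast
  \<comment> \<open>The point \<open>T v\<close> competes for the minimum, and by contraction its
    displacement is at most half that of \<open>v\<close>; so the minimum is 0.\<close>
  have "D (T v) v \<le> D (T v) v / 2" using v(2)[OF TK[OF v(1)]] DT[OF TK[OF v(1)] v(1)] by linarith
  then have "D (T v) v \<le> 0" by simp
  moreover have "\<bar>T v i - v i\<bar> \<le> D (T v) v" if "i < m" for i
    unfolding D_def using that by (intro member_le_sum) auto
  ultimately have "T v i = v i" if "i < m" for i using that by fastforce
  then show ?thesis using v(1) by (intro bexI[of _ v]) (simp_all add: T_def)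
qed

text \<open>The preimages of the unit vectors under the differential at \<open>x0\<close> form a
  linear right inverse \<open>A\<close>. Along the affine map \<open>y v = x0 + A v\<close> the
  function \<open>g\<close> becomes, up to a translation, the identity plus a contraction near 0, so
  \<open>near_identity_onto\<close> solves for \<open>v\<close> when \<open>w\<close> is close to
  \<open>g x0\<close>. The solution \<open>S w\<close> is an arbitrary choice, yet Lipschitz in
  \<open>w\<close> by the same estimate, hence continuous.\<close>

lemma continuous_right_inverse:
  assumes W: "openin (Euclidean_space n) W" and x0: "x0 \<in> W" and g: "smooth_on n W m g"
    and surj: "surjective_differential n m g x0" and gx0: "\<forall>i\<ge>m. g x0 i = 0"
  obtains T \<sigma> where "openin (Euclidean_space m) T" "g x0 \<in> T"
    "continuous_map (subtopology (Euclidean_space m) T) (Euclidean_space n) \<sigma>" "\<sigma> ` T \<subseteq> W" "\<sigma> (g x0) = x0"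
    "\<And>w i. w \<in> T \<Longrightarrow> i < m \<Longrightarrow> g (\<sigma> w) i = w i"
proof -
  define d where "d = (\<lambda>i l. partial_deriv l (\<lambda>y. g y i) x0)"
  have "\<exists>u::nat \<Rightarrow> real. \<forall>i<m. (\<Sum>l<n. d i l * u l) = (if i = j then 1 else 0)" for j
    using surj[unfolded surjective_differential_def, rule_format, of "\<lambda>i. if i = j then 1 else 0"] by (simp add: d_def)
  then obtain A where A: "\<And>i j. i < m \<Longrightarrow> (\<Sum>l<n. d i l * A j l) = (if i = j then 1 else 0)"
    by metis
  define y where "y = (\<lambda>v l. if l < n then x0 l + (\<Sum>j<m. A j l * v j) else 0)"
  define D where "D = (\<lambda>v v'. \<Sum>i<m. \<bar>v i - v' i :: real\<bar>)"
  define \<alpha> where "\<alpha> = (\<Sum>j<m. \<Sum>l<n. \<bar>A j l\<bar>) + 1"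
  have \<alpha>: "\<alpha> > 0" unfolding \<alpha>_def by (intro add_nonneg_pos sum_nonneg) auto
  have ydiff: "(\<Sum>l<n. \<bar>y v l - y v' l\<bar>) \<le> \<alpha> * D v v'" for v v'
  proof -
    have "(\<Sum>l<n. \<bar>y v l - y v' l\<bar>) \<le> (\<Sum>l<n. \<Sum>j<m. \<bar>A j l\<bar> * \<bar>v j - v' j\<bar>)"
    proof (intro sum_mono)
      fix l assume "l \<in> {..<n}"
      then have "y v l - y v' l = (\<Sum>j<m. A j l * (v j - v' j))"
        by (simp add: y_def sum_subtractf algebra_simps)
      then show "\<bar>y v l - y v' l\<bar> \<le> (\<Sum>j<m. \<bar>A j l\<bar> * \<bar>v j - v' j\<bar>)"
        using sum_abs[of "\<lambda>j. A j l * (v j - v' j)" "{..<m}"] by (simp add: abs_mult)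
    qed
    also have "\<dots> = (\<Sum>j<m. (\<Sum>l<n. \<bar>A j l\<bar>) * \<bar>v j - v' j\<bar>)"
      by (subst sum.swap) (simp add: sum_distrib_right)
    also have "\<dots> \<le> (\<Sum>j<m. \<alpha> * \<bar>v j - v' j\<bar>)"
    proof (intro sum_mono mult_right_mono)
      fix j assume "j \<in> {..<m}"
      then have "(\<Sum>l<n. \<bar>A j l\<bar>) \<le> (\<Sum>j<m. \<Sum>l<n. \<bar>A j l\<bar>)"
        by (intro member_le_sum[of j "{..<m}" "\<lambda>j. \<Sum>l<n. \<bar>A j l\<bar>"]) (auto intro: sum_nonneg)
      then show "(\<Sum>l<n. \<bar>A j l\<bar>) \<le> \<alpha>" by (simp add: \<alpha>_def)
    qed simp
    finally show ?thesis by (simp add: D_def sum_distrib_left)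
  qed
  have y0: "y (\<lambda>_. 0) = x0"
    using openin_Euclidean_space_subset[OF W x0] by (auto simp: y_def fun_eq_iff)
  \<comment> \<open>The error in each of the \<open>m\<close> components is at most
    \<open>\<epsilon> * \<alpha> * D v v'\<close>. With this value the errors add up to at most
    \<open>m / (m + 1)\<close> times half of \<open>D v v'\<close>; dividing by \<open>m + 1\<close>
    instead of \<open>m\<close> also covers \<open>m = 0\<close>.\<close>
  define \<epsilon> where "\<epsilon> = 1 / (2 * (real m + 1) * \<alpha>)"
  have \<epsilon>: "\<epsilon> > 0" using \<alpha> by (simp add: \<epsilon>_def)
  have "\<exists>\<delta>. i < m \<longrightarrow> \<delta> > 0 \<and> ebox n x0 \<delta> \<subseteq> W \<and> (\<forall>v\<in>ebox n x0 \<delta>. \<forall>w\<in>ebox n x0 \<delta>.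
      \<bar>g v i - g w i - (\<Sum>l<n. d i l * (v l - w l))\<bar> \<le> \<epsilon> * (\<Sum>l<n. \<bar>v l - w l\<bar>))" for i
  proof (cases "i < m")
    case True
    then have "Ck n (Suc 0) W (\<lambda>x. g x i)" using g unfolding smooth_on_def by blast
    then have *: "((\<lambda>t. g (x(l := t)) i) has_real_derivative partial_deriv l (\<lambda>x. g x i) x) (at (x l))"
      "continuous_map (subtopology (Euclidean_space n) W) euclideanreal (partial_deriv l (\<lambda>x. g x i))"
      if "x \<in> W" "l < n" for x l
      using that unfolding Ck_Suc_partial_deriv[OF W] by auto
    have "\<exists>\<delta>>0. ebox n x0 \<delta> \<subseteq> W \<and> (\<forall>v\<in>ebox n x0 \<delta>. \<forall>w\<in>ebox n x0 \<delta>.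
        \<bar>g v i - g w i - (\<Sum>l<n. partial_deriv l (\<lambda>x. g x i) x0 * (v l - w l))\<bar> \<le> \<epsilon> * (\<Sum>l<n. \<bar>v l - w l\<bar>))"
      by (rule strictly_differentiable[OF W *(1) *(2)[OF x0] x0 \<epsilon>])
    then show ?thesis by (simp add: d_def)
  qed simp
  then have "\<exists>\<delta>. \<forall>i. i < m \<longrightarrow> \<delta> i > 0 \<and> ebox n x0 (\<delta> i) \<subseteq> W \<and> (\<forall>v\<in>ebox n x0 (\<delta> i). \<forall>w\<in>ebox n x0 (\<delta> i).
      \<bar>g v i - g w i - (\<Sum>l<n. d i l * (v l - w l))\<bar> \<le> \<epsilon> * (\<Sum>l<n. \<bar>v l - w l\<bar>))"
    by (intro choice allI)
  then obtain \<delta>' where \<delta>'': "\<forall>i. i < m \<longrightarrow> \<delta>' i > 0 \<and> ebox n x0 (\<delta>' i) \<subseteq> W \<and>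
      (\<forall>v\<in>ebox n x0 (\<delta>' i). \<forall>w\<in>ebox n x0 (\<delta>' i).
        \<bar>g v i - g w i - (\<Sum>l<n. d i l * (v l - w l))\<bar> \<le> \<epsilon> * (\<Sum>l<n. \<bar>v l - w l\<bar>))"
    by (rule exE)
  have \<delta>': "\<delta>' i > 0" "v \<in> ebox n x0 (\<delta>' i) \<Longrightarrow> w \<in> ebox n x0 (\<delta>' i) \<Longrightarrow>
      \<bar>g v i - g w i - (\<Sum>l<n. d i l * (v l - w l))\<bar> \<le> \<epsilon> * (\<Sum>l<n. \<bar>v l - w l\<bar>)" if "i < m" for i v w
    using \<delta>''[rule_format, OF that] by simp_all
  obtain \<delta>0 where \<delta>0: "\<delta>0 > 0" "ebox n x0 \<delta>0 \<subseteq> W" using openin_Euclidean_space_ebox[OF W x0] .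
  define \<delta> where "\<delta> = Min (insert \<delta>0 (\<delta>' ` {..<m}))"
  have \<delta>: "\<delta> > 0" "\<delta> \<le> \<delta>0" "\<And>i. i < m \<Longrightarrow> \<delta> \<le> \<delta>' i" using \<delta>0(1) \<delta>'(1) by (auto simp: \<delta>_def)
  have mono: "v \<in> ebox n x0 \<eta>" if "v \<in> ebox n x0 \<delta>" "\<delta> \<le> \<eta>" for v \<eta>
    using that by (force simp: ebox_def)
  \<comment> \<open>With this radius \<open>\<alpha> * r\<close> is half of \<open>\<delta>\<close>,
    so \<open>y\<close> maps the ball \<open>K\<close> into the box of strict
    differentiability.\<close>
  define r where "r = \<delta> / (2 * \<alpha>)"
  have r: "r > 0" "\<alpha> * r < \<delta>" using \<delta>(1) \<alpha> by (auto simp: r_def)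
  define K where "K = {v :: nat \<Rightarrow> real. (\<forall>j\<ge>m. v j = 0) \<and> (\<Sum>j<m. \<bar>v j\<bar>) \<le> r}"
  have yK: "y v \<in> ebox n x0 \<delta>" if "v \<in> K" for v
  proof -
    have "\<bar>y v l - x0 l\<bar> < \<delta>" if l: "l < n" for l
    proof -
      have "\<bar>y v l - x0 l\<bar> \<le> (\<Sum>l<n. \<bar>y v l - y (\<lambda>_. 0) l\<bar>)"
        unfolding y0 using l by (intro member_le_sum[of l "{..<n}" "\<lambda>l. \<bar>y v l - x0 l\<bar>"]) auto
      also have "\<dots> \<le> \<alpha> * D v (\<lambda>_. 0)" by (rule ydiff)
      also have "\<dots> \<le> \<alpha> * r" using \<open>v \<in> K\<close> \<alpha> by (intro mult_left_mono) (auto simp: D_def K_def)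
      finally show ?thesis using r(2) by simp
    qed
    then show ?thesis by (simp add: ebox_def y_def)
  qed
  define F where "F = (\<lambda>v i. g (y v) i - g x0 i)"
  have contr: "D (\<lambda>i. F v i - v i) (\<lambda>i. F v' i - v' i) \<le> D v v' / 2" if vv: "v \<in> K" "v' \<in> K" for v v'
  proof -
    have "\<bar>F v i - v i - (F v' i - v' i)\<bar> \<le> \<epsilon> * (\<alpha> * D v v')" if i: "i < m" for i
    proof -
      have "(\<Sum>l<n. d i l * (y v l - y v' l)) = (\<Sum>l<n. d i l * (\<Sum>j<m. A j l * (v j - v' j)))"
        by (intro sum.cong) (auto simp: y_def sum_subtractf algebra_simps)
      also have "\<dots> = (\<Sum>j<m. (\<Sum>l<n. d i l * A j l) * (v j - v' j))"
        by (simp add: sum_distrib_left sum_distrib_right sum.swap[of _ "{..<n}"] mult.assoc)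
      also have "\<dots> = (\<Sum>j<m. if i = j then v j - v' j else 0)"
        by (intro sum.cong) (auto simp: A[OF i])
      also have "\<dots> = v i - v' i" using i by simp
      finally have "F v i - v i - (F v' i - v' i) = g (y v) i - g (y v') i - (\<Sum>l<n. d i l * (y v l - y v' l))"
        by (simp add: F_def)
      also have "\<bar>\<dots>\<bar> \<le> \<epsilon> * (\<Sum>l<n. \<bar>y v l - y v' l\<bar>)"
        by (intro \<delta>'(2)[OF i] mono[OF yK \<delta>(3)[OF i]] vv)
      also have "\<dots> \<le> \<epsilon> * (\<alpha> * D v v')" using \<epsilon> by (intro mult_left_mono ydiff) auto
      finally show ?thesis .
    qed
    then have "(\<Sum>i<m. \<bar>F v i - v i - (F v' i - v' i)\<bar>) \<le> (\<Sum>i<m. \<epsilon> * (\<alpha> * D v v'))"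
      by (intro sum_mono) auto
    then have "D (\<lambda>i. F v i - v i) (\<lambda>i. F v' i - v' i) \<le> (\<Sum>i<m. \<epsilon> * (\<alpha> * D v v'))"
      by (simp only: D_def)
    also have "\<dots> = real m * ((\<epsilon> * \<alpha>) * D v v')" by simp
    also have "\<epsilon> * \<alpha> = inverse (real m + 1) / 2" using \<alpha> by (simp add: \<epsilon>_def divide_simps)
    also have "real m * (inverse (real m + 1) / 2 * D v v') = (real m / (real m + 1)) * (D v v' / 2)"
      by (simp only: divide_inverse mult_ac)
    also have "\<dots> \<le> 1 * (D v v' / 2)" by (intro mult_right_mono) (auto simp: D_def sum_nonneg)
    finally show ?thesis by simp
  qed
  \<comment> \<open>As \<open>F\<close> differs from the identity by a contraction with factor 1/2,
    it shrinks distances by at most one half. This forces the chosen solutions \<open>S w\<close> to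
    depend on \<open>w\<close> in a Lipschitz way and to return \<open>x0\<close> at
    \<open>g x0\<close>.\<close>
  have expand: "D v v' \<le> 2 * D (F v) (F v')" if "v \<in> K" "v' \<in> K" for v v'
  proof -
    have "D v v' \<le> D (F v) (F v') + D (\<lambda>i. F v i - v i) (\<lambda>i. F v' i - v' i)"
      unfolding D_def sum.distrib[symmetric] by (intro sum_mono) auto
    then show ?thesis using contr[OF that] by simp
  qed
  define T where "T = {w. (\<forall>i\<ge>m. w i = 0) \<and> (\<Sum>i<m. \<bar>w i - g x0 i\<bar>) < r / 2}"
  have "\<exists>v\<in>K. \<forall>i<m. F v i = w i - g x0 i" if "w \<in> T" for w
  proof (rule near_identity_onto[where r = r])
    show "(\<Sum>i<m. \<bar>F v i - v i - (F v' i - v' i)\<bar>) \<le> (\<Sum>i<m. \<bar>v i - v' i\<bar>) / 2" if "v \<in> K" "v' \<in> K" for v v'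
      using contr[OF that] by (simp add: D_def)
  qed (use that r(1) y0 in \<open>auto simp: K_def F_def T_def\<close>)
  then obtain S where S: "\<And>w. w \<in> T \<Longrightarrow> S w \<in> K" "\<And>w i. w \<in> T \<Longrightarrow> i < m \<Longrightarrow> F (S w) i = w i - g x0 i"
    by metis
  have lip: "D (S w) (S w') \<le> 2 * D w w'" if "w \<in> T" "w' \<in> T" for w w'
  proof -
    have "D (F (S w)) (F (S w')) = D w w'"
      unfolding D_def by (intro sum.cong) (auto simp: S(2) that)
    then show ?thesis using expand[OF S(1)[OF that(1)] S(1)[OF that(2)]] by simp
  qed
  show thesis
  proof (rule that[of T "\<lambda>w. y (S w)"])
    have "continuous_on UNIV (\<lambda>v :: nat \<Rightarrow> real. v i)" for i by (rule continuous_on_product_coordinates)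
    then have "open {w :: nat \<Rightarrow> real. (\<Sum>i<m. \<bar>w i - g x0 i\<bar>) < r / 2}"
      by (intro open_Collect_less continuous_on_sum continuous_on_rabs continuous_on_diff continuous_on_const)
    moreover have "T = {w. \<forall>i\<ge>m. w i = 0} \<inter> {w. (\<Sum>i<m. \<bar>w i - g x0 i\<bar>) < r / 2}" by (auto simp: T_def)
    ultimately show "openin (Euclidean_space m) T" by (auto simp: Euclidean_space_eq openin_open)
    show gT: "g x0 \<in> T" using gx0 r(1) by (simp add: T_def)
    show "continuous_map (subtopology (Euclidean_space m) T) (Euclidean_space n) (\<lambda>w. y (S w))"
    proof (rule continuous_map_into_Euclidean)
      fix l assume l: "l < n"
      have "continuous_on T (\<lambda>w. y (S w) l)"
      proof (rule l1_lipschitz_continuous_on[where c = "2 * \<alpha>" and m = m])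
        fix w w' assume ww: "w \<in> T" "w' \<in> T"
        have "\<bar>y (S w) l - y (S w') l\<bar> \<le> (\<Sum>l<n. \<bar>y (S w) l - y (S w') l\<bar>)"
          using l by (intro member_le_sum[of l "{..<n}" "\<lambda>l. \<bar>y (S w) l - y (S w') l\<bar>"]) auto
        also have "\<dots> \<le> \<alpha> * D (S w) (S w')" by (rule ydiff)
        also have "\<dots> \<le> \<alpha> * (2 * D w w')" using \<alpha> by (intro mult_left_mono lip ww) auto
        finally show "\<bar>y (S w) l - y (S w') l\<bar> \<le> 2 * \<alpha> * (\<Sum>i<m. \<bar>w i - w' i\<bar>)" by (simp add: D_def)
      qed
      moreover have "subtopology (Euclidean_space m) T = top_of_set T"
        by (auto simp: Euclidean_space_eq subtopology_subtopology T_def intro!: arg_cong[where f = "top_of_set"])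
      ultimately show "continuous_map (subtopology (Euclidean_space m) T) euclideanreal (\<lambda>w. y (S w) l)" by simp
    qed (auto simp: topspace_Euclidean_space y_def)
    show "(\<lambda>w. y (S w)) ` T \<subseteq> W" using yK[OF S(1)] mono[OF _ \<delta>(2)] \<delta>0(2) by blast
    have 0: "(\<lambda>_. 0) \<in> K" using r(1) by (simp add: K_def)
    have "D (F (S (g x0))) (F (\<lambda>_. 0)) = 0"
      unfolding D_def by (intro sum.neutral) (auto simp: S(2)[OF gT], auto simp: F_def y0)
    then have "D (S (g x0)) (\<lambda>_. 0) \<le> 0" using expand[OF S(1)[OF gT] 0] by simp
    moreover have "\<bar>S (g x0) i\<bar> \<le> D (S (g x0)) (\<lambda>_. 0)" if "i < m" for i
      using that member_le_sum[of i "{..<m}" "\<lambda>i. \<bar>S (g x0) i\<bar>"] by (simp add: D_def)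
    ultimately have "S (g x0) i = 0" for i using S(1)[OF gT] by (cases "i < m") (fastforce simp: K_def)+
    then show "y (S (g x0)) = x0" using y0 by (metis ext)
    fix w i assume "w \<in> T" "i < m"
    then show "g (y (S w)) i = w i" using S(2)[of w i] by (simp add: F_def)
  qed
qed

text \<open>In charts this is \<open>continuous_right_inverse\<close>. The charts in which the
  differential is surjective are given separately from those in which \<open>f\<close> is known to
  be smooth; \<open>smooth_map_in_charts\<close> brings the two together.\<close>

lemma submersion_local_section:
  assumes M: "smooth_structure M" and N: "smooth_structure N" and f: "submersion M N f" and p: "p \<in> pts M"
  obtains V \<sigma> where "openin (mtop N) V" "f p \<in> V" "continuous_map (subtopology (mtop N) V) (mtop M) \<sigma>"
    "\<sigma> (f p) = p" "\<And>y. y \<in> V \<Longrightarrow> f (\<sigma> y) = y"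
proof -
  have smooth: "smooth_map M N f" using f by (simp add: submersion_def)
  obtain n U \<phi> m V \<psi> where *: "(n, U, \<phi>) \<in> charts M" "(m, V, \<psi>) \<in> charts N" "p \<in> U" "f ` U \<subseteq> V"
    "surjective_differential n m (\<psi> \<circ> f \<circ> inv_into U \<phi>) (\<phi> p)"
    using f p unfolding submersion_def by fast
  note c = chart_is_chart[OF M *(1)] and d = chart_is_chart[OF N *(2)]
  have inj: "inj_on \<phi> U" "inj_on \<psi> V" using is_chart_inj c d by blast+
  define g where "g = \<psi> \<circ> f \<circ> inv_into U \<phi>"
  have g: "smooth_on n (\<phi> ` U) m g"
    unfolding g_def smooth_on_chart_smooth
    using smooth_map_in_charts[OF M N smooth *(1,2) order_refl is_chart_open[OF c] *(4)] by (simp add: o_def)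
  have gp: "g (\<phi> p) = \<psi> (f p)" using *(3) inj by (simp add: g_def)
  have fp: "f p \<in> V" using *(3,4) by blast
  have W: "openin (Euclidean_space n) (\<phi> ` U)" using c by (simp add: is_chart_def)
  have "\<phi> p \<in> \<phi> ` U" "\<forall>i\<ge>m. g (\<phi> p) i = 0" "surjective_differential n m g (\<phi> p)"
    using *(3) is_chart_Euclidean[OF d fp] *(5) unfolding gp unfolding g_def by simp_all
  then obtain T \<sigma> where T: "openin (Euclidean_space m) T" "g (\<phi> p) \<in> T"
    "continuous_map (subtopology (Euclidean_space m) T) (Euclidean_space n) \<sigma>" "\<sigma> ` T \<subseteq> \<phi> ` U" "\<sigma> (g (\<phi> p)) = \<phi> p"
    "\<And>w i. w \<in> T \<Longrightarrow> i < m \<Longrightarrow> g (\<sigma> w) i = w i"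
    using continuous_right_inverse[OF W _ g] by metis
  let ?V = "{y \<in> topspace (subtopology (mtop N) V). \<psi> y \<in> T}"
  have VN: "V \<subseteq> pts N" by (rule is_chart_subset[OF d])
  have "openin (subtopology (mtop N) V) ?V"
    by (rule openin_continuous_map_preimage[OF is_chart_continuous[OF d] T(1)])
  then have V: "openin (mtop N) ?V" using is_chart_open[OF d] openin_trans_full by blast
  have "continuous_map (subtopology (subtopology (mtop N) V) ?V) (subtopology (Euclidean_space m) T) \<psi>"
    using continuous_map_from_subtopology[OF is_chart_continuous[OF d]] by (auto simp: continuous_map_in_subtopology)
  moreover have "continuous_map (subtopology (Euclidean_space m) T) (subtopology (Euclidean_space n) (\<phi> ` U)) \<sigma>"
    using T(3,4) by (auto simp: continuous_map_in_subtopology)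
  ultimately have "continuous_map (subtopology (subtopology (mtop N) V) ?V) (mtop M) (inv_into U \<phi> \<circ> (\<sigma> \<circ> \<psi>))"
    using is_chart_continuous_inv[OF c] by (intro continuous_map_compose)
  moreover have "subtopology (subtopology (mtop N) V) ?V = subtopology (mtop N) ?V"
    by (simp add: subtopology_subtopology) (metis (no_types, lifting) Int_absorb1 VN mem_Collect_eq subsetI)
  ultimately have cont: "continuous_map (subtopology (mtop N) ?V) (mtop M) (\<lambda>y. inv_into U \<phi> (\<sigma> (\<psi> y)))"
    by (simp add: o_def)
  show thesis
  proof (rule that[OF V _ cont])
    show "f p \<in> ?V" using fp VN T(2) by (auto simp: gp)
    show "inv_into U \<phi> (\<sigma> (\<psi> (f p))) = p" using T(5) *(3) inj by (simp add: gp)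
    fix y assume y: "y \<in> ?V"
    let ?x = "inv_into U \<phi> (\<sigma> (\<psi> y))"
    have xU: "?x \<in> U" using y T(4) by (auto intro!: inv_into_into)
    then have fx: "f ?x \<in> V" using *(4) by blast
    \<comment> \<open>The right inverse controls the first \<open>m\<close> coordinates; the others
      vanish on both sides because both points lie in the chart domain \<open>V\<close>.\<close>
    have "\<psi> (f ?x) i = \<psi> y i" for i
    proof (cases "i < m")
      case True then show ?thesis using T(6)[of "\<psi> y" i] y by (simp add: g_def)
    next
      case False then show ?thesis using is_chart_Euclidean[OF d fx] is_chart_Euclidean[OF d, of y] y by simp
    qed
    then have "\<psi> (f ?x) = \<psi> y" by (rule ext)
    then show "f ?x = y" using inj(2) fx y by (auto simp: inj_on_def)
  qed
qed

section \<open>The category of Lie groupoids\<close>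

context
  fixes G :: "'u lie_groupoid"
  assumes G: "groupoid G"
begin

lemma groupoid_src: "\<gamma> \<in> pts (G1 G) \<Longrightarrow> src G \<gamma> \<in> pts (G0 G)"
  and groupoid_tgt: "\<gamma> \<in> pts (G1 G) \<Longrightarrow> tgt G \<gamma> \<in> pts (G0 G)"
  and groupoid_unt: "x \<in> pts (G0 G) \<Longrightarrow> unt G x \<in> pts (G1 G)"
    "x \<in> pts (G0 G) \<Longrightarrow> src G (unt G x) = x" "x \<in> pts (G0 G) \<Longrightarrow> tgt G (unt G x) = x"
  and groupoid_unit_right: "\<gamma> \<in> pts (G1 G) \<Longrightarrow> src G \<gamma> = x \<Longrightarrow> mul G \<gamma> (unt G x) = \<gamma>"
  and groupoid_unit_left: "\<gamma> \<in> pts (G1 G) \<Longrightarrow> tgt G \<gamma> = x \<Longrightarrow> mul G (unt G x) \<gamma> = \<gamma>"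
  and groupoid_mul: "\<gamma> \<in> pts (G1 G) \<Longrightarrow> \<delta> \<in> pts (G1 G) \<Longrightarrow> src G \<gamma> = tgt G \<delta> \<Longrightarrow> mul G \<gamma> \<delta> \<in> pts (G1 G)"
    "\<gamma> \<in> pts (G1 G) \<Longrightarrow> \<delta> \<in> pts (G1 G) \<Longrightarrow> src G \<gamma> = tgt G \<delta> \<Longrightarrow> src G (mul G \<gamma> \<delta>) = src G \<delta>"
    "\<gamma> \<in> pts (G1 G) \<Longrightarrow> \<delta> \<in> pts (G1 G) \<Longrightarrow> src G \<gamma> = tgt G \<delta> \<Longrightarrow> tgt G (mul G \<gamma> \<delta>) = tgt G \<gamma>"
  and groupoid_assoc: "\<gamma> \<in> pts (G1 G) \<Longrightarrow> \<delta> \<in> pts (G1 G) \<Longrightarrow> \<epsilon> \<in> pts (G1 G) \<Longrightarrow> src G \<gamma> = tgt G \<delta> \<Longrightarrow>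
      src G \<delta> = tgt G \<epsilon> \<Longrightarrow> mul G (mul G \<gamma> \<delta>) \<epsilon> = mul G \<gamma> (mul G \<delta> \<epsilon>)"
  and groupoid_ivs: "\<gamma> \<in> pts (G1 G) \<Longrightarrow> ivs G \<gamma> \<in> pts (G1 G)"
    "\<gamma> \<in> pts (G1 G) \<Longrightarrow> src G (ivs G \<gamma>) = tgt G \<gamma>" "\<gamma> \<in> pts (G1 G) \<Longrightarrow> tgt G (ivs G \<gamma>) = src G \<gamma>"
    "\<gamma> \<in> pts (G1 G) \<Longrightarrow> mul G (ivs G \<gamma>) \<gamma> = unt G (src G \<gamma>)"
    "\<gamma> \<in> pts (G1 G) \<Longrightarrow> mul G \<gamma> (ivs G \<gamma>) = unt G (tgt G \<gamma>)"
  using G by (auto simp: groupoid_def)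

lemmas groupoid_simps = groupoid_src groupoid_tgt groupoid_unt groupoid_mul groupoid_ivs
  groupoid_unit_left groupoid_unit_right

lemma groupoid_cancel_left:
  assumes "a \<in> pts (G1 G)" "x \<in> pts (G1 G)" "y \<in> pts (G1 G)" "src G a = tgt G x" "src G a = tgt G y"
    "mul G a x = mul G a y"
  shows "x = y"
proof -
  have "mul G (ivs G a) (mul G a z) = z" if "z \<in> pts (G1 G)" "src G a = tgt G z" for z
    using assms(1) that by (simp add: groupoid_assoc[symmetric] groupoid_simps)
  then show ?thesis using assms by metis
qed

text \<open>A commuting square read backwards along its sides \<open>a\<close> and \<open>b\<close>.
  Naturality of an inverse transformation and the equation of an inverse coboundary both have this
  form.\<close>

lemma groupoid_inverse_square:
  assumes "a \<in> pts (G1 G)" "b \<in> pts (G1 G)" "x \<in> pts (G1 G)" "y \<in> pts (G1 G)"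
    "src G a = tgt G x" "src G y = tgt G b" "tgt G a = tgt G y" "src G b = src G x" "mul G a x = mul G y b"
  shows "mul G (ivs G a) y = mul G x (ivs G b)"
proof (rule groupoid_cancel_left[of a])
  have "mul G a (mul G x (ivs G b)) = mul G (mul G y b) (ivs G b)"
    using assms by (simp add: groupoid_assoc[symmetric] groupoid_simps)
  also have "\<dots> = y" using assms by (simp add: groupoid_assoc groupoid_simps)
  also have "\<dots> = mul G a (mul G (ivs G a) y)"
    using assms by (simp add: groupoid_assoc[symmetric] groupoid_simps)
  finally show "mul G a (mul G (ivs G a) y) = mul G a (mul G x (ivs G b))" by simp
qed (use assms in \<open>simp_all add: groupoid_simps\<close>)

end

context
  fixes G :: "'u lie_groupoid"
  assumes G: "lie_groupoid G"
begin

lemma lie_groupoidD: "groupoid G" "smooth_structure (G0 G)" "smooth_structure (G1 G)"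
  "smooth_map (G1 G) (G0 G) (src G)" "smooth_map (G1 G) (G0 G) (tgt G)"
  "smooth_map (G0 G) (G1 G) (unt G)" "smooth_map (G1 G) (G1 G) (ivs G)"
  using G by (auto simp: lie_groupoid_def smooth_manifold_iff submersion_def)

lemma smooth_map_mul:
  assumes K: "smooth_structure K" and a: "smooth_map K (G1 G) a" and b: "smooth_map K (G1 G) b"
    and ab: "\<And>x. x \<in> pts K \<Longrightarrow> src G (a x) = tgt G (b x)"
  shows "smooth_map K (G1 G) (\<lambda>x. mul G (a x) (b x))"
proof -
  let ?P = "prod_manifold (G1 G) (G1 G)" and ?S = "fibre_set (G1 G) (src G) (tgt G) (G1 G)"
  have P: "smooth_structure ?P" using smooth_structure_prod lie_groupoidD(3) by blast
  have S: "embedded_submanifold ?P ?S" and m: "smooth_map (submanifold ?P ?S) (G1 G) (\<lambda>(\<gamma>, \<delta>). mul G \<gamma> \<delta>)"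
    using G by (auto simp: lie_groupoid_def fibre_product_exists_def fibre_product_def)
  have "smooth_map K ?P (\<lambda>x. (a x, b x))"
    by (rule smooth_map_Pair[OF lie_groupoidD(3,3) K a b])
  moreover have "(\<lambda>x. (a x, b x)) ` pts K \<subseteq> ?S"
    using smooth_map_funcset[OF K lie_groupoidD(3) a] smooth_map_funcset[OF K lie_groupoidD(3) b] ab
    by (auto simp: fibre_set_def)
  ultimately have "smooth_map K (submanifold ?P ?S) (\<lambda>x. (a x, b x))"
    by (rule smooth_map_into_submanifold[OF P S K])
  from smooth_map_comp[OF K smooth_structure_submanifold[OF P S] lie_groupoidD(3) this m]
  show ?thesis by simp
qed

end

lemma smooth_functorD:
  assumes "smooth_functor G H F"
  shows "smooth_map (G0 G) (G0 H) (fst F)" "smooth_map (G1 G) (G1 H) (snd F)"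
    "\<gamma> \<in> pts (G1 G) \<Longrightarrow> src H (snd F \<gamma>) = fst F (src G \<gamma>)"
    "\<gamma> \<in> pts (G1 G) \<Longrightarrow> tgt H (snd F \<gamma>) = fst F (tgt G \<gamma>)"
    "x \<in> pts (G0 G) \<Longrightarrow> snd F (unt G x) = unt H (fst F x)"
    "\<gamma> \<in> pts (G1 G) \<Longrightarrow> \<delta> \<in> pts (G1 G) \<Longrightarrow> src G \<gamma> = tgt G \<delta> \<Longrightarrow> snd F (mul G \<gamma> \<delta>) = mul H (snd F \<gamma>) (snd F \<delta>)"
  using assms by (simp_all add: smooth_functor_def)

lemma smooth_nat_transD:
  assumes "smooth_nat_trans G H f g \<alpha>"
  shows "smooth_map (G0 G) (G1 H) \<alpha>" "x \<in> pts (G0 G) \<Longrightarrow> src H (\<alpha> x) = fst f x"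
    "x \<in> pts (G0 G) \<Longrightarrow> tgt H (\<alpha> x) = fst g x"
    "\<gamma> \<in> pts (G1 G) \<Longrightarrow> mul H (\<alpha> (tgt G \<gamma>)) (snd f \<gamma>) = mul H (snd g \<gamma>) (\<alpha> (src G \<gamma>))"
  using assms by (simp_all add: smooth_nat_trans_def)

lemma smooth_functor_id: "lie_groupoid G \<Longrightarrow> smooth_functor G G (id, id)"
  by (simp add: smooth_functor_def id_def smooth_map_id lie_groupoidD)

section \<open>Isomorphism of smooth functors\<close>

context
  fixes G H :: "'u lie_groupoid"
  assumes G: "lie_groupoid G" and H: "lie_groupoid H"
begin

lemma smooth_functor_funcset:
  assumes "smooth_functor G H F"
  shows "x \<in> pts (G0 G) \<Longrightarrow> fst F x \<in> pts (G0 H)" "\<gamma> \<in> pts (G1 G) \<Longrightarrow> snd F \<gamma> \<in> pts (G1 H)"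
  using smooth_map_funcset[OF lie_groupoidD(2)[OF G] lie_groupoidD(2)[OF H] smooth_functorD(1)[OF assms]]
    smooth_map_funcset[OF lie_groupoidD(3)[OF G] lie_groupoidD(3)[OF H] smooth_functorD(2)[OF assms]] by auto

lemma smooth_nat_trans_funcset:
  assumes "smooth_nat_trans G H f g \<alpha>" "x \<in> pts (G0 G)"
  shows "\<alpha> x \<in> pts (G1 H)"
  using smooth_map_funcset[OF lie_groupoidD(2)[OF G] lie_groupoidD(3)[OF H] smooth_nat_transD(1)[OF assms(1)]]
    assms(2) by auto

text \<open>Functors are pairs of total functions, so functors that are equal in substance may
  differ off the points of \<open>G\<close>; units form a natural transformation between them. This
  turns pointwise computations into equalities of arrows of \<open>Gp\<close>.\<close>

lemma isomorphic_functors_if_eq: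
  assumes F: "smooth_functor G H F"
    and eq: "\<And>x. x \<in> pts (G0 G) \<Longrightarrow> fst F x = fst F' x" "\<And>\<gamma>. \<gamma> \<in> pts (G1 G) \<Longrightarrow> snd F \<gamma> = snd F' \<gamma>"
  shows "isomorphic_functors G H F F'"
proof -
  note sG = lie_groupoidD[OF G] and sH = lie_groupoidD[OF H]
  have "smooth_map (G0 G) (G0 H) (fst F')" "smooth_map (G1 G) (G1 H) (snd F')"
    using smooth_map_cong[OF sG(2) smooth_functorD(1)[OF F] eq(1)] smooth_map_cong[OF sG(3) smooth_functorD(2)[OF F] eq(2)] by auto
  then have "smooth_functor G H F'"
    using F eq groupoid_simps[OF sG(1)] unfolding smooth_functor_def by simp
  moreover have "smooth_nat_trans G H F F' (\<lambda>x. unt H (fst F x))"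
    unfolding smooth_nat_trans_def
  proof (intro conjI ballI)
    show "smooth_map (G0 G) (G1 H) (\<lambda>x. unt H (fst F x))"
      by (rule smooth_map_comp[OF sG(2) sH(2) sH(3) smooth_functorD(1)[OF F] sH(6)])
  qed (use smooth_functor_funcset[OF F] groupoid_simps[OF sG(1)] groupoid_simps[OF sH(1)] smooth_functorD[OF F] eq in simp_all)
  ultimately show ?thesis using F by (auto simp: isomorphic_functors_def)
qed

lemma isomorphic_functors_refl: "smooth_functor G H F \<Longrightarrow> isomorphic_functors G H F F"
  by (rule isomorphic_functors_if_eq) auto

lemma isomorphic_functors_sym:
  assumes "isomorphic_functors G H f g"
  shows "isomorphic_functors G H g f"
proof -
  note sG = lie_groupoidD[OF G] and sH = lie_groupoidD[OF H]
  obtain \<alpha> where f: "smooth_functor G H f" and g: "smooth_functor G H g" and \<alpha>: "smooth_nat_trans G H f g \<alpha>"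
    using assms by (auto simp: isomorphic_functors_def)
  have "smooth_nat_trans G H g f (\<lambda>x. ivs H (\<alpha> x))"
    unfolding smooth_nat_trans_def
  proof (intro conjI ballI)
    show "smooth_map (G0 G) (G1 H) (\<lambda>x. ivs H (\<alpha> x))"
      by (rule smooth_map_comp[OF sG(2) sH(3) sH(3) smooth_nat_transD(1)[OF \<alpha>] sH(7)])
    fix \<gamma> assume \<gamma>: "\<gamma> \<in> pts (G1 G)"
    then have st: "src G \<gamma> \<in> pts (G0 G)" "tgt G \<gamma> \<in> pts (G0 G)" using groupoid_simps[OF sG(1)] by auto
    show "mul H (ivs H (\<alpha> (tgt G \<gamma>))) (snd g \<gamma>) = mul H (snd f \<gamma>) (ivs H (\<alpha> (src G \<gamma>)))"
      by (rule groupoid_inverse_square[OF sH(1)])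
         (use \<gamma> st smooth_nat_trans_funcset[OF \<alpha>] smooth_functor_funcset(2)[OF f \<gamma>] smooth_functor_funcset(2)[OF g \<gamma>]
           smooth_nat_transD[OF \<alpha>] smooth_functorD[OF f] smooth_functorD[OF g] in simp_all)
  qed (use smooth_nat_trans_funcset[OF \<alpha>] smooth_nat_transD[OF \<alpha>] groupoid_simps[OF sH(1)] in simp_all)
  then show ?thesis using f g by (auto simp: isomorphic_functors_def)
qed

lemma isomorphic_functors_trans:
  assumes "isomorphic_functors G H f g" "isomorphic_functors G H g h"
  shows "isomorphic_functors G H f h"
proof -
  note sG = lie_groupoidD[OF G] and sH = lie_groupoidD[OF H]
  obtain \<alpha> \<beta> where f: "smooth_functor G H f" and g: "smooth_functor G H g" and h: "smooth_functor G H h"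
    and \<alpha>: "smooth_nat_trans G H f g \<alpha>" and \<beta>: "smooth_nat_trans G H g h \<beta>"
    using assms by (auto simp: isomorphic_functors_def)
  have "smooth_nat_trans G H f h (\<lambda>x. mul H (\<beta> x) (\<alpha> x))"
    unfolding smooth_nat_trans_def
  proof (intro conjI ballI)
    show "smooth_map (G0 G) (G1 H) (\<lambda>x. mul H (\<beta> x) (\<alpha> x))"
      by (rule smooth_map_mul[OF H sG(2) smooth_nat_transD(1)[OF \<beta>] smooth_nat_transD(1)[OF \<alpha>]])
         (simp add: smooth_nat_transD[OF \<alpha>] smooth_nat_transD[OF \<beta>])
    fix \<gamma> assume \<gamma>: "\<gamma> \<in> pts (G1 G)"
    then have st: "src G \<gamma> \<in> pts (G0 G)" "tgt G \<gamma> \<in> pts (G0 G)" using groupoid_simps[OF sG(1)] by auto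
    note facts = \<gamma> st smooth_nat_trans_funcset[OF \<alpha>] smooth_nat_trans_funcset[OF \<beta>]
      smooth_functor_funcset(2)[OF f \<gamma>] smooth_functor_funcset(2)[OF g \<gamma>] smooth_functor_funcset(2)[OF h \<gamma>]
      smooth_nat_transD(2,3)[OF \<alpha>] smooth_nat_transD(2,3)[OF \<beta>] smooth_functorD[OF f] smooth_functorD[OF g] smooth_functorD[OF h]
    have "mul H (mul H (\<beta> (tgt G \<gamma>)) (\<alpha> (tgt G \<gamma>))) (snd f \<gamma>) = mul H (\<beta> (tgt G \<gamma>)) (mul H (snd g \<gamma>) (\<alpha> (src G \<gamma>)))"
      using facts by (simp add: groupoid_assoc[OF sH(1)] smooth_nat_transD(4)[OF \<alpha> \<gamma>])
    also have "\<dots> = mul H (mul H (snd h \<gamma>) (\<beta> (src G \<gamma>))) (\<alpha> (src G \<gamma>))"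
      using facts by (simp add: groupoid_assoc[OF sH(1), symmetric] smooth_nat_transD(4)[OF \<beta> \<gamma>])
    also have "\<dots> = mul H (snd h \<gamma>) (mul H (\<beta> (src G \<gamma>)) (\<alpha> (src G \<gamma>)))"
      using facts by (simp add: groupoid_assoc[OF sH(1)])
    finally show "mul H (mul H (\<beta> (tgt G \<gamma>)) (\<alpha> (tgt G \<gamma>))) (snd f \<gamma>) = mul H (snd h \<gamma>) (mul H (\<beta> (src G \<gamma>)) (\<alpha> (src G \<gamma>)))" .
  qed (use smooth_nat_trans_funcset[OF \<alpha>] smooth_nat_trans_funcset[OF \<beta>] smooth_nat_transD[OF \<alpha>] smooth_nat_transD[OF \<beta>]
      groupoid_simps[OF sH(1)] in simp_all)
  then show ?thesis using f h by (auto simp: isomorphic_functors_def)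
qed

lemma functor_class_eq_iff:
  assumes "smooth_functor G H f"
  shows "functor_class G H f = functor_class G H g \<longleftrightarrow> isomorphic_functors G H f g"
proof
  assume "functor_class G H f = functor_class G H g"
  then have "isomorphic_functors G H g f" using isomorphic_functors_refl[OF assms] by (auto simp: functor_class_def)
  then show "isomorphic_functors G H f g" by (rule isomorphic_functors_sym)
next
  assume fg: "isomorphic_functors G H f g"
  show "functor_class G H f = functor_class G H g"
    unfolding functor_class_def using isomorphic_functors_trans[OF fg] isomorphic_functors_trans[OF isomorphic_functors_sym[OF fg]]
    by blast
qed

lemma gp_arrow_eq_iff:
  "smooth_functor G H f \<Longrightarrow> gp_arrow G H f = gp_arrow G H g \<longleftrightarrow> isomorphic_functors G H f g"
  by (simp add: gp_arrow_def functor_class_eq_iff)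

end

section \<open>Composition in the category of Lie groupoids\<close>

lemma smooth_functor_comp:
  assumes G: "lie_groupoid G" and H: "lie_groupoid H" and K: "lie_groupoid K"
    and f: "smooth_functor G H f" and g: "smooth_functor H K g"
  shows "smooth_functor G K (fst g \<circ> fst f, snd g \<circ> snd f)"
proof -
  have "smooth_map (G0 G) (G0 K) (\<lambda>x. fst g (fst f x))" "smooth_map (G1 G) (G1 K) (\<lambda>x. snd g (snd f x))"
    using smooth_map_comp[OF lie_groupoidD(2)[OF G] lie_groupoidD(2)[OF H] lie_groupoidD(2)[OF K] smooth_functorD(1)[OF f] smooth_functorD(1)[OF g]]
      smooth_map_comp[OF lie_groupoidD(3)[OF G] lie_groupoidD(3)[OF H] lie_groupoidD(3)[OF K] smooth_functorD(2)[OF f] smooth_functorD(2)[OF g]] .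
  then show ?thesis
    unfolding smooth_functor_def
    using smooth_functor_funcset[OF G H f] smooth_functorD(3-6)[OF f] smooth_functorD(3-6)[OF g]
    by (simp add: o_def)
qed

text \<open>The horizontal composite: \<open>g\<close> applied to \<open>\<alpha> x\<close>,
  followed by \<open>\<beta>\<close> at \<open>fst f' x\<close>. Its naturality is that of
  \<open>\<alpha>\<close>, transported by \<open>g\<close>, and then that of \<open>\<beta>\<close>
  at the arrow \<open>snd f' \<gamma>\<close>.\<close>

lemma isomorphic_functors_comp:
  assumes G: "lie_groupoid G" and H: "lie_groupoid H" and K: "lie_groupoid K"
    and ff: "isomorphic_functors G H f f'" and gg: "isomorphic_functors H K g g'"
  shows "isomorphic_functors G K (fst g \<circ> fst f, snd g \<circ> snd f) (fst g' \<circ> fst f', snd g' \<circ> snd f')"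
proof -
  note sG = lie_groupoidD[OF G] and sH = lie_groupoidD[OF H] and sK = lie_groupoidD[OF K]
  obtain \<alpha> \<beta> where f: "smooth_functor G H f" and f': "smooth_functor G H f'" and \<alpha>: "smooth_nat_trans G H f f' \<alpha>"
    and g: "smooth_functor H K g" and g': "smooth_functor H K g'" and \<beta>: "smooth_nat_trans H K g g' \<beta>"
    using ff gg by (auto simp: isomorphic_functors_def)
  note facts = smooth_nat_trans_funcset[OF G H \<alpha>] smooth_nat_trans_funcset[OF H K \<beta>]
    smooth_functor_funcset[OF G H f] smooth_functor_funcset[OF G H f'] smooth_functor_funcset[OF H K g] smooth_functor_funcset[OF H K g']
    smooth_nat_transD(2,3)[OF \<alpha>] smooth_nat_transD(2,3)[OF \<beta>]
    smooth_functorD(3,4)[OF f] smooth_functorD(3,4)[OF f'] smooth_functorD(3,4)[OF g] smooth_functorD(3,4)[OF g']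
  have "smooth_nat_trans G K (fst g \<circ> fst f, snd g \<circ> snd f) (fst g' \<circ> fst f', snd g' \<circ> snd f')
      (\<lambda>x. mul K (\<beta> (fst f' x)) (snd g (\<alpha> x)))"
    unfolding smooth_nat_trans_def
  proof (intro conjI ballI)
    show "smooth_map (G0 G) (G1 K) (\<lambda>x. mul K (\<beta> (fst f' x)) (snd g (\<alpha> x)))"
    proof (rule smooth_map_mul[OF K sG(2)])
      show "smooth_map (G0 G) (G1 K) (\<lambda>x. \<beta> (fst f' x))"
        by (rule smooth_map_comp[OF sG(2) sH(2) sK(3) smooth_functorD(1)[OF f'] smooth_nat_transD(1)[OF \<beta>]])
      show "smooth_map (G0 G) (G1 K) (\<lambda>x. snd g (\<alpha> x))"
        by (rule smooth_map_comp[OF sG(2) sH(3) sK(3) smooth_nat_transD(1)[OF \<alpha>] smooth_functorD(2)[OF g]])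
    qed (use facts in simp)
    fix \<gamma> assume \<gamma>: "\<gamma> \<in> pts (G1 G)"
    then have st: "src G \<gamma> \<in> pts (G0 G)" "tgt G \<gamma> \<in> pts (G0 G)" using groupoid_simps[OF sG(1)] by auto
    let ?s = "src G \<gamma>" and ?t = "tgt G \<gamma>"
    have "mul K (mul K (\<beta> (fst f' ?t)) (snd g (\<alpha> ?t))) (snd g (snd f \<gamma>)) =
        mul K (\<beta> (fst f' ?t)) (mul K (snd g (\<alpha> ?t)) (snd g (snd f \<gamma>)))"
      using facts st \<gamma> by (simp add: groupoid_assoc[OF sK(1)])
    also have "mul K (snd g (\<alpha> ?t)) (snd g (snd f \<gamma>)) = snd g (mul H (snd f' \<gamma>) (\<alpha> ?s))"
      using facts st \<gamma> by (simp add: smooth_functorD(6)[OF g, symmetric] smooth_nat_transD(4)[OF \<alpha> \<gamma>])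
    also have "\<dots> = mul K (snd g (snd f' \<gamma>)) (snd g (\<alpha> ?s))"
      using facts st \<gamma> by (simp add: smooth_functorD(6)[OF g])
    also have "mul K (\<beta> (fst f' ?t)) \<dots> = mul K (mul K (\<beta> (tgt H (snd f' \<gamma>))) (snd g (snd f' \<gamma>))) (snd g (\<alpha> ?s))"
      using facts st \<gamma> by (simp add: groupoid_assoc[OF sK(1)])
    also have "mul K (\<beta> (tgt H (snd f' \<gamma>))) (snd g (snd f' \<gamma>)) = mul K (snd g' (snd f' \<gamma>)) (\<beta> (src H (snd f' \<gamma>)))"
      by (rule smooth_nat_transD(4)[OF \<beta>]) (use facts \<gamma> in simp)
    also have "mul K \<dots> (snd g (\<alpha> ?s)) = mul K (snd g' (snd f' \<gamma>)) (mul K (\<beta> (fst f' ?s)) (snd g (\<alpha> ?s)))"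
      using facts st \<gamma> by (simp add: groupoid_assoc[OF sK(1)])
    finally show "mul K (mul K (\<beta> (fst f' ?t)) (snd g (\<alpha> ?t))) (snd (fst g \<circ> fst f, snd g \<circ> snd f) \<gamma>) =
        mul K (snd (fst g' \<circ> fst f', snd g' \<circ> snd f') \<gamma>) (mul K (\<beta> (fst f' ?s)) (snd g (\<alpha> ?s)))" by simp
  qed (use facts groupoid_simps[OF sK(1)] in simp_all)
  then show ?thesis using smooth_functor_comp[OF G H K f g] smooth_functor_comp[OF G H K f' g']
    by (auto simp: isomorphic_functors_def)
qed

text \<open>The union in \<open>Cmp\<close> runs over the composites of all pairs of
  representatives. These are isomorphic to each other, so it is a union of equal classes over
  nonempty index sets and collapses to one class.\<close>

lemma Gp_Cmp:
  assumes G: "lie_groupoid G" and H: "lie_groupoid H" and K: "lie_groupoid K"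
    and f: "smooth_functor G H f" and g: "smooth_functor H K g"
  shows "Cmp Gp (gp_arrow H K g) (gp_arrow G H f) = gp_arrow G K (fst g \<circ> fst f, snd g \<circ> snd f)"
proof -
  have "functor_class G K (fst g' \<circ> fst f', snd g' \<circ> snd f') = functor_class G K (fst g \<circ> fst f, snd g \<circ> snd f)"
    if "f' \<in> functor_class G H f" "g' \<in> functor_class H K g" for f' g'
  proof -
    have "isomorphic_functors G K (fst g \<circ> fst f, snd g \<circ> snd f) (fst g' \<circ> fst f', snd g' \<circ> snd f')"
      using that by (intro isomorphic_functors_comp[OF G H K]) (auto simp: functor_class_def)
    then show ?thesis using functor_class_eq_iff[OF G K smooth_functor_comp[OF G H K f g]] by metis
  qed
  then have "(\<Union>f'\<in>functor_class G H f. \<Union>g'\<in>functor_class H K g. functor_class G K (fst g' \<circ> fst f', snd g' \<circ> snd f')) =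
      (\<Union>f'\<in>functor_class G H f. \<Union>g'\<in>functor_class H K g. functor_class G K (fst g \<circ> fst f, snd g \<circ> snd f))"
    by (intro SUP_cong refl)
  moreover have "f \<in> functor_class G H f" "g \<in> functor_class H K g"
    using isomorphic_functors_refl[OF G H f] isomorphic_functors_refl[OF H K g] by (auto simp: functor_class_def)
  then have "functor_class G H f \<noteq> {}" "functor_class H K g \<noteq> {}" by blast+
  ultimately have "(\<Union>f'\<in>functor_class G H f. \<Union>g'\<in>functor_class H K g. functor_class G K (fst g' \<circ> fst f', snd g' \<circ> snd f')) =
      functor_class G K (fst g \<circ> fst f, snd g \<circ> snd f)" by simp
  then show ?thesis by (simp add: Gp_def gp_arrow_def)
qed

lemma Gp_simps [simp]:
  "Dom Gp (gp_arrow G H F) = G" "Cod Gp (gp_arrow G H F) = H" "Ide Gp G = gp_arrow G G (id, id)"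
  "Obj Gp = {G. lie_groupoid G}"
  by (simp_all add: Gp_def gp_arrow_def)

lemma Gp_ArrE:
  assumes "a \<in> Arr Gp"
  obtains G H F where "a = gp_arrow G H F" "lie_groupoid G" "lie_groupoid H" "smooth_functor G H F"
  using assms by (auto simp: Gp_def)

lemma Gp_ArrI: "lie_groupoid G \<Longrightarrow> lie_groupoid H \<Longrightarrow> smooth_functor G H F \<Longrightarrow> gp_arrow G H F \<in> Arr Gp"
  unfolding Gp_def category.simps by blast

lemma Gp_is_category: "is_category Gp"
  unfolding is_category_def
proof (intro conjI ballI impI; (elim Gp_ArrE)?)
  fix G :: "'u lie_groupoid" assume "G \<in> Obj Gp"
  then show "Ide Gp G \<in> Arr Gp" "Dom Gp (Ide Gp G) = G" "Cod Gp (Ide Gp G) = G"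
    by (simp_all add: Gp_ArrI smooth_functor_id)
next
  fix a G H F assume "a = gp_arrow G H F" and GHF: "lie_groupoid G" "lie_groupoid H" "smooth_functor G H F"
  then show "Dom Gp a \<in> Obj Gp" "Cod Gp a \<in> Obj Gp" "Cmp Gp a (Ide Gp (Dom Gp a)) = a" "Cmp Gp (Ide Gp (Cod Gp a)) a = a"
    by (simp_all add: Gp_Cmp smooth_functor_id)
next
  fix a b G H F H' K F'
  assume "Cod Gp a = Dom Gp b" "a = gp_arrow G H F" "lie_groupoid G" "lie_groupoid H" "smooth_functor G H F"
    "b = gp_arrow H' K F'" "lie_groupoid H'" "lie_groupoid K" "smooth_functor H' K F'"
  then show "Cmp Gp b a \<in> Arr Gp" "Dom Gp (Cmp Gp b a) = Dom Gp a" "Cod Gp (Cmp Gp b a) = Cod Gp b"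
    by (simp_all add: Gp_Cmp Gp_ArrI smooth_functor_comp)
next
  fix a b c G H F H' K F' K' L F''
  assume "Cod Gp a = Dom Gp b \<and> Cod Gp b = Dom Gp c" "a = gp_arrow G H F" "lie_groupoid G" "lie_groupoid H" "smooth_functor G H F"
    "b = gp_arrow H' K F'" "lie_groupoid H'" "lie_groupoid K" "smooth_functor H' K F'"
    "c = gp_arrow K' L F''" "lie_groupoid K'" "lie_groupoid L" "smooth_functor K' L F''"
  then show "Cmp Gp c (Cmp Gp b a) = Cmp Gp (Cmp Gp c b) a"
    by (simp add: Gp_Cmp smooth_functor_comp o_assoc)
qed

section \<open>Nonabelian Cech cohomology as an invariant of the localization\<close>

text \<open>
  A cocycle on the space \<open>X\<close> with values in \<open>G\<close> is given on an open cover indexed by the points of \<open>X\<close>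
  (so that refinements need no index maps) by local maps to the objects of \<open>G\<close> and transition arrows.
\<close>

type_synonym ('x, 'u) cocycle = "('x \<Rightarrow> 'x set) \<times> ('x \<Rightarrow> 'x \<Rightarrow> 'u) \<times> ('x \<Rightarrow> 'x \<Rightarrow> 'x \<Rightarrow> 'u)"

definition cocycle :: "'x topology \<Rightarrow> 'u lie_groupoid \<Rightarrow> ('x, 'u) cocycle \<Rightarrow> bool"
  where "cocycle X G = (\<lambda>(U, m, \<tau>).
    (\<forall>x\<in>topspace X. openin X (U x) \<and> x \<in> U x \<and> continuous_map (subtopology X (U x)) (mtop (G0 G)) (m x)) \<and>
    (\<forall>x\<in>topspace X. \<forall>y\<in>topspace X. continuous_map (subtopology X (U x \<inter> U y)) (mtop (G1 G)) (\<tau> x y) \<and>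
       (\<forall>z\<in>U x \<inter> U y. src G (\<tau> x y z) = m x z \<and> tgt G (\<tau> x y z) = m y z)) \<and>
    (\<forall>x\<in>topspace X. \<forall>y\<in>topspace X. \<forall>w\<in>topspace X. \<forall>z\<in>U x \<inter> U y \<inter> U w.
       mul G (\<tau> y w z) (\<tau> x y z) = \<tau> x w z))"

text \<open>An isomorphism of cocycles over a cover \<open>V\<close> that refines both given ones.
  The common index set makes the refinement a plain inclusion for each index.\<close>

definition coboundary :: "'x topology \<Rightarrow> 'u lie_groupoid \<Rightarrow> ('x, 'u) cocycle \<Rightarrow> ('x, 'u) cocycle \<Rightarrow>
    ('x \<Rightarrow> 'x set) \<Rightarrow> ('x \<Rightarrow> 'x \<Rightarrow> 'u) \<Rightarrow> bool"
  where "coboundary X G = (\<lambda>(U, m, \<tau>) (U', m', \<tau>') V \<kappa>.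
    (\<forall>x\<in>topspace X. openin X (V x) \<and> x \<in> V x \<and> V x \<subseteq> U x \<inter> U' x \<and>
       continuous_map (subtopology X (V x)) (mtop (G1 G)) (\<kappa> x) \<and>
       (\<forall>z\<in>V x. src G (\<kappa> x z) = m x z \<and> tgt G (\<kappa> x z) = m' x z)) \<and>
    (\<forall>x\<in>topspace X. \<forall>y\<in>topspace X. \<forall>z\<in>V x \<inter> V y. mul G (\<kappa> y z) (\<tau> x y z) = mul G (\<tau>' x y z) (\<kappa> x z)))"

definition cohomologous :: "'x topology \<Rightarrow> 'u lie_groupoid \<Rightarrow> (('x, 'u) cocycle \<times> ('x, 'u) cocycle) set"
  where "cohomologous X G = {(c, d). cocycle X G c \<and> cocycle X G d \<and> (\<exists>V \<kappa>. coboundary X G c d V \<kappa>)}"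

definition map_cocycle :: "'u gfunctor \<Rightarrow> ('x, 'u) cocycle \<Rightarrow> ('x, 'u) cocycle"
  where "map_cocycle F = (\<lambda>(U, m, \<tau>). (U, \<lambda>x z. fst F (m x z), \<lambda>x y z. snd F (\<tau> x y z)))"

lemma cocycleD:
  assumes "cocycle X G (U, m, \<tau>)" "x \<in> topspace X"
  shows "openin X (U x)" "x \<in> U x" "continuous_map (subtopology X (U x)) (mtop (G0 G)) (m x)"
    "y \<in> topspace X \<Longrightarrow> continuous_map (subtopology X (U x \<inter> U y)) (mtop (G1 G)) (\<tau> x y)"
    "y \<in> topspace X \<Longrightarrow> z \<in> U x \<Longrightarrow> z \<in> U y \<Longrightarrow> src G (\<tau> x y z) = m x z"
    "y \<in> topspace X \<Longrightarrow> z \<in> U x \<Longrightarrow> z \<in> U y \<Longrightarrow> tgt G (\<tau> x y z) = m y z"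
    "y \<in> topspace X \<Longrightarrow> w \<in> topspace X \<Longrightarrow> z \<in> U x \<Longrightarrow> z \<in> U y \<Longrightarrow> z \<in> U w \<Longrightarrow>
       mul G (\<tau> y w z) (\<tau> x y z) = \<tau> x w z"
  using assms unfolding cocycle_def prod.case by blast+

lemma cocycle_mem:
  assumes "cocycle X G (U, m, \<tau>)" "x \<in> topspace X"
  shows "z \<in> U x \<Longrightarrow> m x z \<in> pts (G0 G)"
    "y \<in> topspace X \<Longrightarrow> z \<in> U x \<Longrightarrow> z \<in> U y \<Longrightarrow> \<tau> x y z \<in> pts (G1 G)"
proof -
  have *: "z \<in> topspace X" if "z \<in> U x" for z using openin_subset[OF cocycleD(1)[OF assms]] that by blast
  show "m x z \<in> pts (G0 G)" if "z \<in> U x"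
    using continuous_map_funspace[OF cocycleD(3)[OF assms]] that *[OF that] by (simp add: Pi_iff)
  show "\<tau> x y z \<in> pts (G1 G)" if "y \<in> topspace X" "z \<in> U x" "z \<in> U y"
    using continuous_map_funspace[OF cocycleD(4)[OF assms that(1)]] that *[OF that(2)] by (simp add: Pi_iff)
qed

lemma coboundaryD:
  assumes "coboundary X G (U, m, \<tau>) (U', m', \<tau>') V \<kappa>" "x \<in> topspace X"
  shows "openin X (V x)" "x \<in> V x" "z \<in> V x \<Longrightarrow> z \<in> U x" "z \<in> V x \<Longrightarrow> z \<in> U' x"
    "continuous_map (subtopology X (V x)) (mtop (G1 G)) (\<kappa> x)"
    "z \<in> V x \<Longrightarrow> src G (\<kappa> x z) = m x z" "z \<in> V x \<Longrightarrow> tgt G (\<kappa> x z) = m' x z"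
    "z \<in> V x \<Longrightarrow> \<kappa> x z \<in> pts (G1 G)"
    "y \<in> topspace X \<Longrightarrow> z \<in> V x \<Longrightarrow> z \<in> V y \<Longrightarrow> mul G (\<kappa> y z) (\<tau> x y z) = mul G (\<tau>' x y z) (\<kappa> x z)"
proof -
  show V: "openin X (V x)" "x \<in> V x" "z \<in> V x \<Longrightarrow> z \<in> U x" "z \<in> V x \<Longrightarrow> z \<in> U' x"
    and k: "continuous_map (subtopology X (V x)) (mtop (G1 G)) (\<kappa> x)"
    and "z \<in> V x \<Longrightarrow> src G (\<kappa> x z) = m x z" "z \<in> V x \<Longrightarrow> tgt G (\<kappa> x z) = m' x z"
    "y \<in> topspace X \<Longrightarrow> z \<in> V x \<Longrightarrow> z \<in> V y \<Longrightarrow> mul G (\<kappa> y z) (\<tau> x y z) = mul G (\<tau>' x y z) (\<kappa> x z)"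
    using assms unfolding coboundary_def prod.case by blast+
  show "z \<in> V x \<Longrightarrow> \<kappa> x z \<in> pts (G1 G)"
    using continuous_map_funspace[OF k] openin_subset[OF V(1)] by (auto simp: Pi_iff)
qed

context
  fixes X :: "'x topology" and G :: "'u lie_groupoid"
  assumes G: "lie_groupoid G"
begin

lemma continuous_map_mul:
  assumes a: "continuous_map Y (mtop (G1 G)) a" and b: "continuous_map Y (mtop (G1 G)) b"
    and ab: "\<And>y. y \<in> topspace Y \<Longrightarrow> src G (a y) = tgt G (b y)"
  shows "continuous_map Y (mtop (G1 G)) (\<lambda>y. mul G (a y) (b y))"
proof -
  let ?P = "prod_manifold (G1 G) (G1 G)" and ?S = "fibre_set (G1 G) (src G) (tgt G) (G1 G)"
  have P: "smooth_structure ?P" using smooth_structure_prod lie_groupoidD(3)[OF G] by blast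
  have S: "embedded_submanifold ?P ?S" and m: "smooth_map (submanifold ?P ?S) (G1 G) (\<lambda>(\<gamma>, \<delta>). mul G \<gamma> \<delta>)"
    using G by (auto simp: lie_groupoid_def fibre_product_exists_def fibre_product_def)
  have "continuous_map Y (subtopology (prod_topology (mtop (G1 G)) (mtop (G1 G))) ?S) (\<lambda>y. (a y, b y))"
    using a b ab continuous_map_funspace[OF a] continuous_map_funspace[OF b]
    by (auto simp: continuous_map_in_subtopology continuous_map_pairwise o_def fibre_set_def Pi_iff)
  moreover have "continuous_map (subtopology (prod_topology (mtop (G1 G)) (mtop (G1 G))) ?S) (mtop (G1 G)) (\<lambda>(\<gamma>, \<delta>). mul G \<gamma> \<delta>)"
    using smooth_map_continuous[OF smooth_structure_submanifold[OF P S] lie_groupoidD(3)[OF G] m] by simp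
  ultimately have "continuous_map Y (mtop (G1 G)) ((\<lambda>(\<gamma>, \<delta>). mul G \<gamma> \<delta>) \<circ> (\<lambda>y. (a y, b y)))"
    by (rule continuous_map_compose)
  then show ?thesis by (simp add: o_def)
qed

lemma continuous_map_ivs: "continuous_map Y (mtop (G1 G)) a \<Longrightarrow> continuous_map Y (mtop (G1 G)) (\<lambda>y. ivs G (a y))"
  using continuous_map_compose[OF _ smooth_map_continuous[OF lie_groupoidD(3,3,7)[OF G]]] by (simp add: o_def)

lemma cohomologous_cocycle: "(c, d) \<in> cohomologous X G \<Longrightarrow> cocycle X G c" "(c, d) \<in> cohomologous X G \<Longrightarrow> cocycle X G d"
  by (auto simp: cohomologous_def)

lemma cohomologous_refl:
  assumes c: "cocycle X G c"
  shows "(c, c) \<in> cohomologous X G"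
proof -
  obtain U m \<tau> where cc: "c = (U, m, \<tau>)" by (metis prod_cases3)
  note c' = c[unfolded cc]
  note g = lie_groupoidD[OF G]
  have "coboundary X G c c U (\<lambda>x z. unt G (m x z))"
    unfolding coboundary_def cc prod.case
  proof (intro conjI ballI)
    fix x assume x: "x \<in> topspace X"
    show "continuous_map (subtopology X (U x)) (mtop (G1 G)) (\<lambda>z. unt G (m x z))"
      using continuous_map_compose[OF cocycleD(3)[OF c' x] smooth_map_continuous[OF g(2,3,6)]] by (simp add: o_def)
  qed (use cocycleD[OF c'] cocycle_mem[OF c'] groupoid_simps[OF g(1)] in simp_all)
  then show ?thesis using c by (auto simp: cohomologous_def)
qed

lemma cohomologous_sym:
  assumes "(c, d) \<in> cohomologous X G"
  shows "(d, c) \<in> cohomologous X G"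
proof -
  obtain U m \<tau> where cc: "c = (U, m, \<tau>)" by (metis prod_cases3)
  obtain U' m' \<tau>' where dd: "d = (U', m', \<tau>')" by (metis prod_cases3)
  obtain V \<kappa> where c: "cocycle X G (U, m, \<tau>)" and d: "cocycle X G (U', m', \<tau>')"
    and k: "coboundary X G (U, m, \<tau>) (U', m', \<tau>') V \<kappa>"
    using assms by (auto simp: cohomologous_def cc dd)
  note g = lie_groupoidD[OF G]
  have "coboundary X G (U', m', \<tau>') (U, m, \<tau>) V (\<lambda>x z. ivs G (\<kappa> x z))"
    unfolding coboundary_def prod.case
  proof (intro conjI ballI)
    fix x assume x: "x \<in> topspace X"
    show "continuous_map (subtopology X (V x)) (mtop (G1 G)) (\<lambda>z. ivs G (\<kappa> x z))"
      by (rule continuous_map_ivs[OF coboundaryD(5)[OF k x]])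
    fix y z assume y: "y \<in> topspace X" and z: "z \<in> V x \<inter> V y"
    show "mul G (ivs G (\<kappa> y z)) (\<tau>' x y z) = mul G (\<tau> x y z) (ivs G (\<kappa> x z))"
      by (rule groupoid_inverse_square[OF g(1)])
         (use x y z coboundaryD[OF k] cocycleD(5,6)[OF c] cocycleD(5,6)[OF d] cocycle_mem[OF c] cocycle_mem[OF d] in simp_all)
  qed (use coboundaryD[OF k] groupoid_simps[OF g(1)] in auto)
  then show ?thesis using c d by (auto simp: cohomologous_def cc dd)
qed

lemma cohomologous_trans:
  assumes "(c, d) \<in> cohomologous X G" "(d, e) \<in> cohomologous X G"
  shows "(c, e) \<in> cohomologous X G"
proof -
  obtain U m \<tau> where cc: "c = (U, m, \<tau>)" by (metis prod_cases3)
  obtain U' m' \<tau>' where dd: "d = (U', m', \<tau>')" by (metis prod_cases3)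
  obtain U'' m'' \<tau>'' where ee: "e = (U'', m'', \<tau>'')" by (metis prod_cases3)
  obtain V \<kappa> W \<mu> where c: "cocycle X G (U, m, \<tau>)" and d: "cocycle X G (U', m', \<tau>')" and e: "cocycle X G (U'', m'', \<tau>'')"
    and k: "coboundary X G (U, m, \<tau>) (U', m', \<tau>') V \<kappa>" and l: "coboundary X G (U', m', \<tau>') (U'', m'', \<tau>'') W \<mu>"
    using assms by (auto simp: cohomologous_def cc dd ee)
  note g = lie_groupoidD[OF G]
  have "coboundary X G (U, m, \<tau>) (U'', m'', \<tau>'') (\<lambda>x. V x \<inter> W x) (\<lambda>x z. mul G (\<mu> x z) (\<kappa> x z))"
    unfolding coboundary_def prod.case
  proof (intro conjI ballI)
    fix x assume x: "x \<in> topspace X"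
    show "continuous_map (subtopology X (V x \<inter> W x)) (mtop (G1 G)) (\<lambda>z. mul G (\<mu> x z) (\<kappa> x z))"
    proof (rule continuous_map_mul)
      show "continuous_map (subtopology X (V x \<inter> W x)) (mtop (G1 G)) (\<mu> x)"
        "continuous_map (subtopology X (V x \<inter> W x)) (mtop (G1 G)) (\<kappa> x)"
        using continuous_map_from_subtopology_mono[OF coboundaryD(5)[OF l x]]
          continuous_map_from_subtopology_mono[OF coboundaryD(5)[OF k x]] by auto
    qed (use x coboundaryD(6,7)[OF k] coboundaryD(6,7)[OF l] in simp)
    fix y z assume y: "y \<in> topspace X" and z: "z \<in> (V x \<inter> W x) \<inter> (V y \<inter> W y)"
    note facts = x y z coboundaryD[OF k] coboundaryD[OF l] cocycleD(5,6)[OF c] cocycleD(5,6)[OF d] cocycleD(5,6)[OF e]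
      cocycle_mem[OF c] cocycle_mem[OF d] cocycle_mem[OF e]
    have "mul G (mul G (\<mu> y z) (\<kappa> y z)) (\<tau> x y z) = mul G (\<mu> y z) (mul G (\<kappa> y z) (\<tau> x y z))"
      by (rule groupoid_assoc[OF g(1)]) (use facts in simp_all)
    also have "mul G (\<kappa> y z) (\<tau> x y z) = mul G (\<tau>' x y z) (\<kappa> x z)" using facts by simp
    also have "mul G (\<mu> y z) \<dots> = mul G (mul G (\<mu> y z) (\<tau>' x y z)) (\<kappa> x z)"
      by (rule groupoid_assoc[OF g(1), symmetric]) (use facts in simp_all)
    also have "mul G (\<mu> y z) (\<tau>' x y z) = mul G (\<tau>'' x y z) (\<mu> x z)" using facts by simp
    also have "mul G \<dots> (\<kappa> x z) = mul G (\<tau>'' x y z) (mul G (\<mu> x z) (\<kappa> x z))"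
      by (rule groupoid_assoc[OF g(1)]) (use facts in simp_all)
    finally show "mul G (mul G (\<mu> y z) (\<kappa> y z)) (\<tau> x y z) = mul G (\<tau>'' x y z) (mul G (\<mu> x z) (\<kappa> x z))" .
  qed (use coboundaryD[OF k] coboundaryD[OF l] groupoid_simps[OF g(1)] in auto)
  then show ?thesis using c e by (auto simp: cohomologous_def cc ee)
qed

text \<open>\<open>cohomologous\<close> is reflexive on cocycles only. Idempotence is what lets it
  act as an identity for the composition of relations.\<close>

lemma cohomologous_idem: "cohomologous X G O cohomologous X G = cohomologous X G"
proof (intro subset_antisym subrelI)
  fix c d assume "(c, d) \<in> cohomologous X G"
  then show "(c, d) \<in> cohomologous X G O cohomologous X G"
    using cohomologous_refl cohomologous_cocycle(1) by blast
qed (use cohomologous_trans in blast)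

lemma cohomologous_converse: "(cohomologous X G)\<inverse> = cohomologous X G"
  by (intro subset_antisym subrelI) (use cohomologous_sym in blast)+

end

section \<open>The action of functors on cocycles\<close>

context
  fixes X :: "'x topology" and G H :: "'u lie_groupoid" and F
  assumes G: "lie_groupoid G" and H: "lie_groupoid H" and F: "smooth_functor G H F"
begin

lemma continuous_functor: "continuous_map (mtop (G0 G)) (mtop (G0 H)) (fst F)" "continuous_map (mtop (G1 G)) (mtop (G1 H)) (snd F)"
  using smooth_map_continuous[OF lie_groupoidD(2)[OF G] lie_groupoidD(2)[OF H] smooth_functorD(1)[OF F]]
    smooth_map_continuous[OF lie_groupoidD(3)[OF G] lie_groupoidD(3)[OF H] smooth_functorD(2)[OF F]] .

lemma map_cocycle_cocycle:
  assumes "cocycle X G c"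
  shows "cocycle X H (map_cocycle F c)"
proof -
  obtain U m \<tau> where cc: "c = (U, m, \<tau>)" by (metis prod_cases3)
  note c = assms[unfolded cc]
  note F' = smooth_functorD[OF F]
  show ?thesis unfolding cc map_cocycle_def prod.case cocycle_def
  proof (intro conjI ballI)
    fix x assume x: "x \<in> topspace X"
    show "continuous_map (subtopology X (U x)) (mtop (G0 H)) (\<lambda>z. fst F (m x z))"
      using continuous_map_compose[OF cocycleD(3)[OF c x] continuous_functor(1)] by (simp add: o_def)
    fix y assume y: "y \<in> topspace X"
    show "continuous_map (subtopology X (U x \<inter> U y)) (mtop (G1 H)) (\<lambda>z. snd F (\<tau> x y z))"
      using continuous_map_compose[OF cocycleD(4)[OF c x y] continuous_functor(2)] by (simp add: o_def)
  next
    fix x y w z assume *: "x \<in> topspace X" "y \<in> topspace X" "w \<in> topspace X" "z \<in> U x \<inter> U y \<inter> U w"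
    have "mul H (snd F (\<tau> y w z)) (snd F (\<tau> x y z)) = snd F (mul G (\<tau> y w z) (\<tau> x y z))"
      by (rule F'(6)[symmetric]) (use * cocycleD(5,6)[OF c] cocycle_mem[OF c] in simp_all)
    also have "mul G (\<tau> y w z) (\<tau> x y z) = \<tau> x w z" using * cocycleD(7)[OF c] by simp
    finally show "mul H (snd F (\<tau> y w z)) (snd F (\<tau> x y z)) = snd F (\<tau> x w z)" .
  qed (use cocycleD[OF c] cocycle_mem[OF c] F'(3,4) in auto)
qed

lemma map_cocycle_cohomologous:
  assumes "(c, d) \<in> cohomologous X G"
  shows "(map_cocycle F c, map_cocycle F d) \<in> cohomologous X H"
proof -
  obtain U m \<tau> where cc: "c = (U, m, \<tau>)" by (metis prod_cases3)
  obtain U' m' \<tau>' where dd: "d = (U', m', \<tau>')" by (metis prod_cases3)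
  obtain V \<kappa> where c: "cocycle X G (U, m, \<tau>)" and d: "cocycle X G (U', m', \<tau>')"
    and k: "coboundary X G (U, m, \<tau>) (U', m', \<tau>') V \<kappa>"
    using assms by (auto simp: cohomologous_def cc dd)
  note F' = smooth_functorD[OF F]
  have "coboundary X H (map_cocycle F c) (map_cocycle F d) V (\<lambda>x z. snd F (\<kappa> x z))"
    unfolding coboundary_def map_cocycle_def cc dd prod.case
  proof (intro conjI ballI)
    fix x assume x: "x \<in> topspace X"
    show "continuous_map (subtopology X (V x)) (mtop (G1 H)) (\<lambda>z. snd F (\<kappa> x z))"
      using continuous_map_compose[OF coboundaryD(5)[OF k x] continuous_functor(2)] by (simp add: o_def)
    fix y z assume y: "y \<in> topspace X" and z: "z \<in> V x \<inter> V y"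
    note facts = x y z coboundaryD[OF k] cocycleD(5,6)[OF c] cocycleD(5,6)[OF d] cocycle_mem[OF c] cocycle_mem[OF d]
    have "mul H (snd F (\<kappa> y z)) (snd F (\<tau> x y z)) = snd F (mul G (\<kappa> y z) (\<tau> x y z))"
      by (rule F'(6)[symmetric]) (use facts in simp_all)
    also have "mul G (\<kappa> y z) (\<tau> x y z) = mul G (\<tau>' x y z) (\<kappa> x z)" using facts by simp
    also have "snd F \<dots> = mul H (snd F (\<tau>' x y z)) (snd F (\<kappa> x z))"
      by (rule F'(6)) (use facts in simp_all)
    finally show "mul H (snd F (\<kappa> y z)) (snd F (\<tau> x y z)) = mul H (snd F (\<tau>' x y z)) (snd F (\<kappa> x z))" .
  qed (use coboundaryD[OF k] F'(3,4) in auto)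
  then show ?thesis using map_cocycle_cocycle c d by (auto simp: cohomologous_def cc dd)
qed

end

text \<open>A natural transformation evaluated along the local maps \<open>m x\<close> is a
  coboundary: naturality at the transition arrows is exactly the equation required. So cohomology is
  defined on isomorphism classes of functors.\<close>

lemma map_cocycle_isomorphic:
  assumes G: "lie_groupoid G" and H: "lie_groupoid H" and F: "smooth_functor G H F"
    and FF: "isomorphic_functors G H F F'" and c: "cocycle X G c"
  shows "(map_cocycle F c, map_cocycle F' c) \<in> cohomologous X H"
proof -
  obtain U m \<tau> where cc: "c = (U, m, \<tau>)" by (metis prod_cases3)
  note c' = c[unfolded cc]
  obtain \<alpha> where F': "smooth_functor G H F'" and \<alpha>: "smooth_nat_trans G H F F' \<alpha>"
    using FF by (auto simp: isomorphic_functors_def)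
  have "coboundary X H (map_cocycle F c) (map_cocycle F' c) U (\<lambda>x z. \<alpha> (m x z))"
    unfolding coboundary_def map_cocycle_def cc prod.case
  proof (intro conjI ballI)
    fix x assume x: "x \<in> topspace X"
    show "continuous_map (subtopology X (U x)) (mtop (G1 H)) (\<lambda>z. \<alpha> (m x z))"
      using continuous_map_compose[OF cocycleD(3)[OF c' x]
          smooth_map_continuous[OF lie_groupoidD(2)[OF G] lie_groupoidD(3)[OF H] smooth_nat_transD(1)[OF \<alpha>]]] by (simp add: o_def)
    fix y z assume y: "y \<in> topspace X" and z: "z \<in> U x \<inter> U y"
    have "src G (\<tau> x y z) = m x z" "tgt G (\<tau> x y z) = m y z" "\<tau> x y z \<in> pts (G1 G)"
      using x y z cocycleD(5,6)[OF c'] cocycle_mem[OF c'] by auto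
    then show "mul H (\<alpha> (m y z)) (snd F (\<tau> x y z)) = mul H (snd F' (\<tau> x y z)) (\<alpha> (m x z))"
      using smooth_nat_transD(4)[OF \<alpha>, of "\<tau> x y z"] by simp
  qed (use cocycleD[OF c'] cocycle_mem[OF c'] smooth_nat_transD(2,3)[OF \<alpha>] in auto)
  then show ?thesis using map_cocycle_cocycle[OF G H F c] map_cocycle_cocycle[OF G H F' c] by (auto simp: cohomologous_def)
qed

subsection \<open>Equivalences of Lie groupoids are bijective on cohomology\<close>

text \<open>The inverse of the diffeomorphism in the first condition on an equivalence: the arrow
  from \<open>x\<close> to \<open>y\<close> that \<open>F\<close> sends to \<open>h\<close>.\<close>

definition arrow_lift :: "'u lie_groupoid \<Rightarrow> 'u gfunctor \<Rightarrow> 'u \<Rightarrow> 'u \<Rightarrow> 'u \<Rightarrow> 'u"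
  where "arrow_lift G F x y h = inv_into (pts (G1 G)) (\<lambda>\<gamma>. ((src G \<gamma>, tgt G \<gamma>), snd F \<gamma>)) ((x, y), h)"

context
  fixes X :: "'x topology" and G H :: "'u lie_groupoid" and F
  assumes G: "lie_groupoid G" and H: "lie_groupoid H" and F: "lie_equivalence G H F"
begin

lemma equivalence_functor: "smooth_functor G H F"
  using F by (simp add: lie_equivalence_def)

text \<open>Full faithfulness with parameters. Existence and uniqueness of lifted arrows come from
  the bijection with the fibre product, and continuity from the smoothness of its inverse. The
  parameter space \<open>Y\<close> is arbitrary; it will be a cover set or an overlap of
  two.\<close>

lemma arrow_lift_properties:
  shows "\<And>x y h. x \<in> pts (G0 G) \<Longrightarrow> y \<in> pts (G0 G) \<Longrightarrow> h \<in> pts (G1 H) \<Longrightarrow> src H h = fst F x \<Longrightarrow> tgt H h = fst F y \<Longrightarrow>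
      arrow_lift G F x y h \<in> pts (G1 G) \<and> src G (arrow_lift G F x y h) = x \<and> tgt G (arrow_lift G F x y h) = y \<and>
      snd F (arrow_lift G F x y h) = h"
    and "\<And>\<gamma> \<delta>. \<gamma> \<in> pts (G1 G) \<Longrightarrow> \<delta> \<in> pts (G1 G) \<Longrightarrow> src G \<gamma> = src G \<delta> \<Longrightarrow> tgt G \<gamma> = tgt G \<delta> \<Longrightarrow> snd F \<gamma> = snd F \<delta> \<Longrightarrow> \<gamma> = \<delta>"
    and "\<And>(Y :: 'y topology) a b h. continuous_map Y (mtop (G0 G)) a \<Longrightarrow> continuous_map Y (mtop (G0 G)) b \<Longrightarrow> continuous_map Y (mtop (G1 H)) h \<Longrightarrow>
      (\<And>y. y \<in> topspace Y \<Longrightarrow> src H (h y) = fst F (a y) \<and> tgt H (h y) = fst F (b y)) \<Longrightarrow>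
      continuous_map Y (mtop (G1 G)) (\<lambda>y. arrow_lift G F (a y) (b y) (h y))"
proof -
  let ?GG = "prod_manifold (G0 G) (G0 G)"
  let ?P = "prod_manifold ?GG (G1 H)"
  let ?S = "fibre_set ?GG (map_prod (fst F) (fst F)) (\<lambda>h. (src H h, tgt H h)) (G1 H)"
  let ?f = "\<lambda>\<gamma>. ((src G \<gamma>, tgt G \<gamma>), snd F \<gamma>)"
  note g = lie_groupoidD[OF G] and h = lie_groupoidD[OF H]
  have P: "smooth_structure ?P" by (intro smooth_structure_prod g h)
  have S: "embedded_submanifold ?P ?S" and d: "diffeomorphism (G1 G) (submanifold ?P ?S) ?f"
    using F by (auto simp: lie_equivalence_def fibre_product_exists_def fibre_product_def Let_def)
  have "pts (submanifold ?P ?S) = ?S" by (auto simp: fibre_set_def)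
  then have bij: "bij_betw ?f (pts (G1 G)) ?S" using d by (simp add: diffeomorphism_def)
  have cont: "continuous_map (subtopology (mtop ?P) ?S) (mtop (G1 G)) (inv_into (pts (G1 G)) ?f)"
    using smooth_map_continuous[OF smooth_structure_submanifold[OF P S] g(3)] d by (simp add: diffeomorphism_def)
  show "arrow_lift G F x y h \<in> pts (G1 G) \<and> src G (arrow_lift G F x y h) = x \<and> tgt G (arrow_lift G F x y h) = y \<and>
      snd F (arrow_lift G F x y h) = h"
    if "x \<in> pts (G0 G)" "y \<in> pts (G0 G)" "h \<in> pts (G1 H)" "src H h = fst F x" "tgt H h = fst F y" for x y h
  proof -
    have "((x, y), h) \<in> ?S" using that by (simp add: fibre_set_def)
    then have "((x, y), h) \<in> ?f ` pts (G1 G)" using bij by (simp add: bij_betw_def)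
    from inv_into_into[OF this] f_inv_into_f[OF this] show ?thesis by (simp add: arrow_lift_def)
  qed
  show "\<gamma> = \<delta>" if "\<gamma> \<in> pts (G1 G)" "\<delta> \<in> pts (G1 G)" "src G \<gamma> = src G \<delta>" "tgt G \<gamma> = tgt G \<delta>" "snd F \<gamma> = snd F \<delta>" for \<gamma> \<delta>
    using inj_onD[OF bij_betw_imp_inj_on[OF bij], of \<gamma> \<delta>] that by simp
  fix Y :: "'y topology" and a b h
  assume a: "continuous_map Y (mtop (G0 G)) a" and b: "continuous_map Y (mtop (G0 G)) b"
    and hh: "continuous_map Y (mtop (G1 H)) h"
    and eq: "\<And>y. y \<in> topspace Y \<Longrightarrow> src H (h y) = fst F (a y) \<and> tgt H (h y) = fst F (b y)"
  have "continuous_map Y (mtop ?P) (\<lambda>y. ((a y, b y), h y))"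
    using a b hh by (simp add: continuous_map_pairwise o_def)
  moreover have "((a y, b y), h y) \<in> ?S" if "y \<in> topspace Y" for y
    using eq[OF that] continuous_map_funspace[OF a] continuous_map_funspace[OF b] continuous_map_funspace[OF hh] that
    by (simp add: fibre_set_def Pi_iff)
  ultimately have "continuous_map Y (subtopology (mtop ?P) ?S) (\<lambda>y. ((a y, b y), h y))"
    by (auto simp: continuous_map_in_subtopology)
  from continuous_map_compose[OF this cont]
  show "continuous_map Y (mtop (G1 G)) (\<lambda>y. arrow_lift G F (a y) (b y) (h y))"
    by (simp add: o_def arrow_lift_def)
qed

text \<open>Essential surjectivity with parameters: a local section of the surjective submersion in
  the second condition, through a point above \<open>y0\<close>. Here the analysis of submersions
  enters the cohomology.\<close>

lemma local_essential_lift: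
  assumes y0: "y0 \<in> pts (G0 H)"
  shows "\<exists>V a h. openin (mtop (G0 H)) V \<and> y0 \<in> V \<and> continuous_map (subtopology (mtop (G0 H)) V) (mtop (G0 G)) a \<and>
    continuous_map (subtopology (mtop (G0 H)) V) (mtop (G1 H)) h \<and> (\<forall>y\<in>V. src H (h y) = y \<and> tgt H (h y) = fst F (a y))"
proof -
  let ?P = "prod_manifold (G0 G) (G1 H)"
  let ?S = "fibre_set (G0 G) (fst F) (tgt H) (G1 H)"
  note g = lie_groupoidD[OF G] and hh = lie_groupoidD[OF H]
  have P: "smooth_structure ?P" by (intro smooth_structure_prod g hh)
  have S: "embedded_submanifold ?P ?S" and sub: "submersion (submanifold ?P ?S) (G0 H) (\<lambda>(x, h). src H h)"
    and im: "(\<lambda>(x, h). src H h) ` pts (submanifold ?P ?S) = pts (G0 H)"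
    using F by (auto simp: lie_equivalence_def fibre_product_exists_def fibre_product_def Let_def)
  obtain p where p: "p \<in> pts (submanifold ?P ?S)" "y0 = (\<lambda>(x, h). src H h) p" using y0 im by blast
  obtain V \<sigma> where V: "openin (mtop (G0 H)) V" "(\<lambda>(x, h). src H h) p \<in> V"
    "continuous_map (subtopology (mtop (G0 H)) V) (mtop (submanifold ?P ?S)) \<sigma>"
    "\<sigma> ((\<lambda>(x, h). src H h) p) = p" "\<And>y. y \<in> V \<Longrightarrow> (\<lambda>(x, h). src H h) (\<sigma> y) = y"
    by (rule submersion_local_section[OF smooth_structure_submanifold[OF P S] hh(2) sub p(1)]) blast
  have \<sigma>: "continuous_map (subtopology (mtop (G0 H)) V) (prod_topology (mtop (G0 G)) (mtop (G1 H))) \<sigma>"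
    and \<sigma>S: "\<sigma> \<in> topspace (subtopology (mtop (G0 H)) V) \<rightarrow> ?S"
    using V(3) by (auto simp: continuous_map_in_subtopology)
  have "tgt H (snd (\<sigma> y)) = fst F (fst (\<sigma> y))" if "y \<in> V" for y
    using \<sigma>S that openin_subset[OF V(1)] by (auto simp: fibre_set_def Pi_iff split_beta)
  moreover have "src H (snd (\<sigma> y)) = y" if "y \<in> V" for y using V(5)[OF that] by (simp add: split_beta)
  ultimately show ?thesis
    using V(1,2) p(2) continuous_map_compose[OF \<sigma> continuous_map_fst] continuous_map_compose[OF \<sigma> continuous_map_snd]
    by (intro exI[of _ V] exI[of _ "\<lambda>y. fst (\<sigma> y)"] exI[of _ "\<lambda>y. snd (\<sigma> y)"]) (simp add: o_def)
qed

text \<open>The arrows \<open>\<kappa>\<close> lift uniquely to arrows between the given local maps.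
  The lifts satisfy the coboundary equation because it holds after applying \<open>F\<close>, which
  is faithful.\<close>

lemma equivalence_cohomology_inj:
  assumes c: "cocycle X G c" and d: "cocycle X G d"
    and cd: "(map_cocycle F c, map_cocycle F d) \<in> cohomologous X H"
  shows "(c, d) \<in> cohomologous X G"
proof -
  obtain U m \<tau> where cc: "c = (U, m, \<tau>)" by (metis prod_cases3)
  obtain U' m' \<tau>' where dd: "d = (U', m', \<tau>')" by (metis prod_cases3)
  note c' = c[unfolded cc] and d' = d[unfolded dd]
  obtain V \<kappa> where k: "coboundary X H (U, \<lambda>x z. fst F (m x z), \<lambda>x y z. snd F (\<tau> x y z)) (U', \<lambda>x z. fst F (m' x z), \<lambda>x y z. snd F (\<tau>' x y z)) V \<kappa>"
    using cd by (auto simp: cohomologous_def cc dd map_cocycle_def)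
  define \<mu> where "\<mu> = (\<lambda>x z. arrow_lift G F (m x z) (m' x z) (\<kappa> x z))"
  have \<mu>: "\<mu> x z \<in> pts (G1 G)" "src G (\<mu> x z) = m x z" "tgt G (\<mu> x z) = m' x z" "snd F (\<mu> x z) = \<kappa> x z"
    if "x \<in> topspace X" "z \<in> V x" for x z
    using arrow_lift_properties(1)[of "m x z" "m' x z" "\<kappa> x z"] coboundaryD[OF k that(1)] that
      cocycle_mem[OF c' that(1)] cocycle_mem[OF d' that(1)] by (auto simp: \<mu>_def)
  note g = lie_groupoidD[OF G] and F' = smooth_functorD[OF equivalence_functor]
  have "coboundary X G (U, m, \<tau>) (U', m', \<tau>') V \<mu>"
    unfolding coboundary_def prod.case
  proof (intro conjI ballI)
    fix x assume x: "x \<in> topspace X"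
    have "V x \<subseteq> U x" "V x \<subseteq> U' x" using coboundaryD(3,4)[OF k x] by auto
    then show "continuous_map (subtopology X (V x)) (mtop (G1 G)) (\<mu> x)"
      unfolding \<mu>_def using coboundaryD(5-7)[OF k x]
      by (intro arrow_lift_properties(3) continuous_map_from_subtopology_mono[OF cocycleD(3)[OF c' x]]
          continuous_map_from_subtopology_mono[OF cocycleD(3)[OF d' x]]) auto
    fix y z assume y: "y \<in> topspace X" and z: "z \<in> V x \<inter> V y"
    note facts = x y z coboundaryD[OF k x] coboundaryD[OF k y] cocycleD(5,6)[OF c'] cocycleD(5,6)[OF d'] cocycle_mem[OF c'] cocycle_mem[OF d'] \<mu>
    show "mul G (\<mu> y z) (\<tau> x y z) = mul G (\<tau>' x y z) (\<mu> x z)"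
    proof (rule arrow_lift_properties(2))
      have "snd F (mul G (\<mu> y z) (\<tau> x y z)) = mul H (\<kappa> y z) (snd F (\<tau> x y z))"
        using facts by (subst F'(6)) simp_all
      also have "\<dots> = mul H (snd F (\<tau>' x y z)) (\<kappa> x z)" using facts by simp
      also have "\<dots> = snd F (mul G (\<tau>' x y z) (\<mu> x z))"
        using facts by (subst F'(6)) simp_all
      finally show "snd F (mul G (\<mu> y z) (\<tau> x y z)) = snd F (mul G (\<tau>' x y z) (\<mu> x z))" .
    qed (use facts groupoid_mul[OF g(1)] in simp_all)
  qed (use coboundaryD(1-4)[OF k] \<mu> in auto)
  then show ?thesis using c d by (auto simp: cohomologous_def cc dd)
qed

text \<open>Near \<open>x\<close> the map \<open>m x\<close> is replaced by a map
  \<open>m' x\<close> to the objects of \<open>G\<close>, together with arrows \<open>k x\<close>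
  from \<open>m x\<close> to the image of \<open>m' x\<close>. The transition arrows are conjugated
  by \<open>k\<close> and lifted by full faithfulness; \<open>k\<close> itself is the coboundary
  from \<open>d\<close> to the image of the new cocycle.\<close>

lemma equivalence_cohomology_surj:
  assumes d: "cocycle X H d"
  shows "\<exists>c. cocycle X G c \<and> (map_cocycle F c, d) \<in> cohomologous X H"
proof -
  obtain U m \<tau> where dd: "d = (U, m, \<tau>)" by (metis prod_cases3)
  note d' = d[unfolded dd]
  note g = lie_groupoidD[OF G] and h = lie_groupoidD[OF H] and F' = smooth_functorD[OF equivalence_functor]
  \<comment> \<open>Each index \<open>x\<close> receives one local lift, centred at the value of
    \<open>m x\<close> at \<open>x\<close> itself. The new cover set \<open>U' x\<close> is the part
    of \<open>U x\<close> that \<open>m x\<close> sends into the domain of this lift, so it still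
    contains \<open>x\<close>.\<close>
  have "\<exists>V a h. x \<in> topspace X \<longrightarrow> openin (mtop (G0 H)) V \<and> m x x \<in> V \<and> continuous_map (subtopology (mtop (G0 H)) V) (mtop (G0 G)) a \<and>
    continuous_map (subtopology (mtop (G0 H)) V) (mtop (G1 H)) h \<and> (\<forall>y\<in>V. src H (h y) = y \<and> tgt H (h y) = fst F (a y))" for x
    using local_essential_lift[of "m x x"] cocycle_mem(1)[OF d', of x x] cocycleD(2)[OF d', of x] by (cases "x \<in> topspace X") auto
  then obtain V a h where "\<forall>x. x \<in> topspace X \<longrightarrow> openin (mtop (G0 H)) (V x) \<and> m x x \<in> V x \<and>
    continuous_map (subtopology (mtop (G0 H)) (V x)) (mtop (G0 G)) (a x) \<and>
    continuous_map (subtopology (mtop (G0 H)) (V x)) (mtop (G1 H)) (h x) \<and> (\<forall>y\<in>V x. src H (h x y) = y \<and> tgt H (h x y) = fst F (a x y))"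
    using choice[of "\<lambda>x (V, a, h). x \<in> topspace X \<longrightarrow> openin (mtop (G0 H)) V \<and> m x x \<in> V \<and> continuous_map (subtopology (mtop (G0 H)) V) (mtop (G0 G)) a \<and>
    continuous_map (subtopology (mtop (G0 H)) V) (mtop (G1 H)) h \<and> (\<forall>y\<in>V. src H (h y) = y \<and> tgt H (h y) = fst F (a y))"]
    by (simp add: split_beta) (metis fst_conv snd_conv)
  then have V: "openin (mtop (G0 H)) (V x)" "m x x \<in> V x" "continuous_map (subtopology (mtop (G0 H)) (V x)) (mtop (G0 G)) (a x)"
    "continuous_map (subtopology (mtop (G0 H)) (V x)) (mtop (G1 H)) (h x)"
    "y \<in> V x \<Longrightarrow> src H (h x y) = y" "y \<in> V x \<Longrightarrow> tgt H (h x y) = fst F (a x y)" if "x \<in> topspace X" for x y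
    using that by auto
  define U' where "U' = (\<lambda>x. {z \<in> topspace (subtopology X (U x)). m x z \<in> V x})"
  define m' where "m' = (\<lambda>x z. a x (m x z))"
  define k where "k = (\<lambda>x z. h x (m x z))"
  define \<tau>' where "\<tau>' = (\<lambda>x y z. arrow_lift G F (m' x z) (m' y z) (mul H (k y z) (mul H (\<tau> x y z) (ivs H (k x z)))))"
  have U': "openin X (U' x)" "x \<in> U' x" "U' x \<subseteq> U x" if x: "x \<in> topspace X" for x
  proof -
    have "openin (subtopology X (U x)) (U' x)"
      unfolding U'_def by (rule openin_continuous_map_preimage[OF cocycleD(3)[OF d' x] V(1)[OF x]])
    then show "openin X (U' x)" using cocycleD(1)[OF d' x] openin_trans_full by blast
    show "x \<in> U' x" "U' x \<subseteq> U x" using x V(2)[OF x] cocycleD(2)[OF d' x] by (auto simp: U'_def)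
  qed
  have mV: "continuous_map (subtopology X (U' x)) (subtopology (mtop (G0 H)) (V x)) (m x)" if x: "x \<in> topspace X" for x
    using continuous_map_from_subtopology_mono[OF cocycleD(3)[OF d' x] U'(3)[OF x]]
    by (auto simp: continuous_map_in_subtopology U'_def)
  have m': "continuous_map (subtopology X (U' x)) (mtop (G0 G)) (m' x)" if x: "x \<in> topspace X" for x
    using continuous_map_compose[OF mV[OF x] V(3)[OF x]] by (simp add: o_def m'_def)
  have k: "continuous_map (subtopology X (U' x)) (mtop (G1 H)) (k x)" if x: "x \<in> topspace X" for x
    using continuous_map_compose[OF mV[OF x] V(4)[OF x]] by (simp add: o_def k_def)
  have UX: "z \<in> topspace (subtopology X (U' x))" if "x \<in> topspace X" "z \<in> U' x" for x z
    using that openin_subset[OF U'(1)[OF that(1)]] by auto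
  have mem: "m' x z \<in> pts (G0 G)" "k x z \<in> pts (G1 H)" "src H (k x z) = m x z" "tgt H (k x z) = fst F (m' x z)" "z \<in> U x"
    if "x \<in> topspace X" "z \<in> U' x" for x z
    using continuous_map_funspace[OF m'[OF that(1)]] continuous_map_funspace[OF k[OF that(1)]] UX[OF that] V(5,6)[OF that(1)] that(2)
    by (auto simp: Pi_iff k_def m'_def U'_def)
  have \<tau>H: "mul H (k y z) (mul H (\<tau> x y z) (ivs H (k x z))) \<in> pts (G1 H)"
      "src H (mul H (k y z) (mul H (\<tau> x y z) (ivs H (k x z)))) = fst F (m' x z)"
      "tgt H (mul H (k y z) (mul H (\<tau> x y z) (ivs H (k x z)))) = fst F (m' y z)"
      "mul H (mul H (k y z) (mul H (\<tau> x y z) (ivs H (k x z)))) (k x z) = mul H (k y z) (\<tau> x y z)"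
    if "x \<in> topspace X" "y \<in> topspace X" "z \<in> U' x" "z \<in> U' y" for x y z
    using that mem cocycleD(5,6)[OF d'] cocycle_mem[OF d'] groupoid_simps[OF h(1)]
    by (simp_all add: groupoid_assoc[OF h(1)])
  have \<tau>': "\<tau>' x y z \<in> pts (G1 G)" "src G (\<tau>' x y z) = m' x z" "tgt G (\<tau>' x y z) = m' y z"
      "snd F (\<tau>' x y z) = mul H (k y z) (mul H (\<tau> x y z) (ivs H (k x z)))"
    if "x \<in> topspace X" "y \<in> topspace X" "z \<in> U' x" "z \<in> U' y" for x y z
    using arrow_lift_properties(1)[OF mem(1)[OF that(1,3)] mem(1)[OF that(2,4)] \<tau>H(1,2,3)[OF that]]
    unfolding \<tau>'_def by blast+
  have F\<tau>': "mul H (snd F (\<tau>' x y z)) (k x z) = mul H (k y z) (\<tau> x y z)"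
    if "x \<in> topspace X" "y \<in> topspace X" "z \<in> U' x" "z \<in> U' y" for x y z
    using \<tau>'(4)[OF that] \<tau>H(4)[OF that] by simp
  have coc: "cocycle X G (U', m', \<tau>')"
    unfolding cocycle_def prod.case
  proof (intro conjI ballI)
    fix x y assume x: "x \<in> topspace X" and y: "y \<in> topspace X"
    have mono: "continuous_map (subtopology X (U' x \<inter> U' y)) Y f" if "continuous_map (subtopology X (U' x)) Y f" for Y :: "'u topology" and f
      by (rule continuous_map_from_subtopology_mono[OF that]) auto
    have mono2: "continuous_map (subtopology X (U' x \<inter> U' y)) Y f" if "continuous_map (subtopology X (U' y)) Y f" for Y :: "'u topology" and f
      by (rule continuous_map_from_subtopology_mono[OF that]) auto
    have t: "continuous_map (subtopology X (U' x \<inter> U' y)) (mtop (G1 H)) (\<tau> x y)"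
      by (rule continuous_map_from_subtopology_mono[OF cocycleD(4)[OF d' x y]]) (use U'(3)[OF x] U'(3)[OF y] in auto)
    note facts = x y mem cocycleD(5,6)[OF d'] cocycle_mem[OF d'] groupoid_simps[OF h(1)]
    show "continuous_map (subtopology X (U' x \<inter> U' y)) (mtop (G1 G)) (\<tau>' x y)"
      unfolding \<tau>'_def
    proof (intro arrow_lift_properties(3) mono[OF m'[OF x]] mono2[OF m'[OF y]]
        continuous_map_mul[OF H] continuous_map_ivs[OF H] mono[OF k[OF x]] mono2[OF k[OF y]] t)
    qed (use facts in simp_all)
  next
    fix x y w z assume *: "x \<in> topspace X" "y \<in> topspace X" "w \<in> topspace X" "z \<in> U' x \<inter> U' y \<inter> U' w"
    then have z: "z \<in> U' x" "z \<in> U' y" "z \<in> U' w" by auto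
    note t1 = \<tau>'[OF *(1,2) z(1,2)] and t2 = \<tau>'[OF *(2,3) z(2,3)] and t3 = \<tau>'[OF *(1,3) z(1,3)]
    note Fm = smooth_functor_funcset(2)[OF G H equivalence_functor]
    note facts = * mem[OF *(1) z(1)] mem[OF *(2) z(2)] mem[OF *(3) z(3)] cocycleD(5,6)[OF d'] cocycle_mem[OF d']
    show "mul G (\<tau>' y w z) (\<tau>' x y z) = \<tau>' x w z"
    proof (rule arrow_lift_properties(2))
      let ?A = "snd F (\<tau>' y w z)" and ?B = "snd F (\<tau>' x y z)" and ?C = "snd F (\<tau>' x w z)"
      note A = F'(3,4)[OF t2(1)] Fm[OF t2(1)] and B = F'(3,4)[OF t1(1)] Fm[OF t1(1)] and C = F'(3,4)[OF t3(1)] Fm[OF t3(1)]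
      \<comment> \<open>By faithfulness the cocycle identity may be checked in \<open>H\<close>.
        After multiplication by \<open>k x z\<close> on the right the conjugations cancel one after
        the other by \<open>F\<tau>'\<close>.\<close>
      have "mul H (mul H ?A ?B) (k x z) = mul H ?A (mul H ?B (k x z))"
        by (rule groupoid_assoc[OF h(1)]) (use A B t1 t2 facts in simp_all)
      also have "mul H ?B (k x z) = mul H (k y z) (\<tau> x y z)" by (rule F\<tau>'[OF *(1,2) z(1,2)])
      also have "mul H ?A \<dots> = mul H (mul H ?A (k y z)) (\<tau> x y z)"
        by (rule groupoid_assoc[OF h(1), symmetric]) (use A t2 facts in simp_all)
      also have "mul H ?A (k y z) = mul H (k w z) (\<tau> y w z)" by (rule F\<tau>'[OF *(2,3) z(2,3)])
      also have "mul H \<dots> (\<tau> x y z) = mul H (k w z) (mul H (\<tau> y w z) (\<tau> x y z))"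
        by (rule groupoid_assoc[OF h(1)]) (use facts in simp_all)
      also have "mul H (\<tau> y w z) (\<tau> x y z) = \<tau> x w z" using facts cocycleD(7)[OF d'] by simp
      also have "mul H (k w z) \<dots> = mul H ?C (k x z)" by (rule F\<tau>'[OF *(1,3) z(1,3), symmetric])
      finally have e: "mul H (mul H ?A ?B) (k x z) = mul H ?C (k x z)" .
      have AB: "mul H ?A ?B \<in> pts (G1 H)" "src H (mul H ?A ?B) = fst F (m' x z)"
        using A B t1 t2 groupoid_mul[OF h(1)] by simp_all
      have "D = mul H (mul H D (k x z)) (ivs H (k x z))" if "D \<in> pts (G1 H)" "src H D = fst F (m' x z)" for D
        using that facts groupoid_simps[OF h(1)] by (simp add: groupoid_assoc[OF h(1)])
      from this[OF AB] this[of ?C] C t3 e have "mul H ?A ?B = ?C" by simp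
      then show "snd F (mul G (\<tau>' y w z) (\<tau>' x y z)) = ?C"
        using t1 t2 by (subst F'(6)) simp_all
    qed (use t1 t2 t3 groupoid_mul[OF g(1)] in simp_all)
  qed (use U' m' \<tau>' in auto)
  have "coboundary X H (U, m, \<tau>) (map_cocycle F (U', m', \<tau>')) U' k"
    unfolding coboundary_def map_cocycle_def prod.case
    using U' k mem F\<tau>' by auto
  then have "((U, m, \<tau>), map_cocycle F (U', m', \<tau>')) \<in> cohomologous X H"
    using d' map_cocycle_cocycle[OF G H equivalence_functor coc] by (auto simp: cohomologous_def)
  from cohomologous_sym[OF H this] coc show ?thesis unfolding dd by blast
qed

end

subsection \<open>The functor to a category of relations\<close>

type_synonym ('x, 'u) coh_arrow = "'u lie_groupoid \<times> 'u lie_groupoid \<times> (('x, 'u) cocycle \<times> ('x, 'u) cocycle) set"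

text \<open>Relations between cocycles that are saturated under cohomology stand for relations
  between cohomology classes. Accordingly the identities are the cohomology relations, and a
  bijection of classes gives an invertible arrow.\<close>

definition coh_category :: "'x topology \<Rightarrow> ('u lie_groupoid, ('x, 'u) coh_arrow) category"
  where "coh_category X = \<lparr>Obj = {G. lie_groupoid G},
    Arr = {(G, H, R). lie_groupoid G \<and> lie_groupoid H \<and> cohomologous X G O R = R \<and> R O cohomologous X H = R},
    Dom = fst, Cod = fst \<circ> snd, Ide = (\<lambda>G. (G, G, cohomologous X G)),
    Cmp = (\<lambda>(H', K, S) (G, H, R). (G, K, R O S))\<rparr>"

text \<open>An arrow of \<open>Gp\<close> is a class of functors, so the graph is taken over all its
  members; \<open>coh_functor_arrow\<close> reduces it to a single one.\<close>

definition coh_functor :: "'x topology \<Rightarrow> ('u lie_groupoid, 'u gp_arrow, 'u lie_groupoid, ('x, 'u) coh_arrow) cfunctor"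
  where "coh_functor X = (id, \<lambda>(G, H, A).
    (G, H, {(c, d). cocycle X G c \<and> (\<exists>F\<in>A. (map_cocycle F c, d) \<in> cohomologous X H)}))"

definition coh_rel :: "'x topology \<Rightarrow> 'u lie_groupoid \<Rightarrow> 'u lie_groupoid \<Rightarrow> 'u gfunctor \<Rightarrow> (('x, 'u) cocycle \<times> ('x, 'u) cocycle) set"
  where "coh_rel X G H F = {(c, d). cocycle X G c \<and> (map_cocycle F c, d) \<in> cohomologous X H}"

lemma coh_category_is_category:
  fixes X :: "'x topology"
  shows "is_category (coh_category X :: ('u lie_groupoid, _) category)"
proof -
  have "C O (b O c) = b O c" if "C O b = b" for C b c :: "(('x, 'u) cocycle \<times> ('x, 'u) cocycle) set"
    using that by (metis O_assoc)
  then show ?thesis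
    unfolding is_category_def coh_category_def by (auto simp: cohomologous_idem O_assoc)
qed

lemma coh_functor_arrow:
  assumes G: "lie_groupoid G" and H: "lie_groupoid H" and F: "smooth_functor G H F"
  shows "snd (coh_functor X) (gp_arrow G H F) = (G, H, coh_rel X G H F)"
proof -
  have "(\<exists>F'\<in>functor_class G H F. (map_cocycle F' c, d) \<in> cohomologous X H) \<longleftrightarrow> (map_cocycle F c, d) \<in> cohomologous X H"
    if c: "cocycle X G c" for c d
  proof -
    have "F \<in> functor_class G H F" using isomorphic_functors_refl[OF G H F] by (simp add: functor_class_def)
    moreover have "(map_cocycle F c, d) \<in> cohomologous X H"
      if "F' \<in> functor_class G H F" "(map_cocycle F' c, d) \<in> cohomologous X H" for F'
      using map_cocycle_isomorphic[OF G H F _ c] that cohomologous_trans[OF H] by (simp add: functor_class_def) blast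
    ultimately show ?thesis by blast
  qed
  then have "{(c, d). cocycle X G c \<and> (\<exists>F'\<in>functor_class G H F. (map_cocycle F' c, d) \<in> cohomologous X H)} = coh_rel X G H F"
    unfolding coh_rel_def by (intro subset_antisym subrelI; unfold mem_Collect_eq prod.case; blast)
  then show ?thesis by (simp add: coh_functor_def gp_arrow_def)
qed

lemma coh_rel_arrow:
  assumes G: "lie_groupoid G" and H: "lie_groupoid H" and F: "smooth_functor G H F"
  shows "(G, H, coh_rel X G H F) \<in> Arr (coh_category X)"
proof -
  have "cohomologous X G O coh_rel X G H F = coh_rel X G H F"
  proof (intro subset_antisym subrelI)
    fix c d assume "(c, d) \<in> cohomologous X G O coh_rel X G H F"
    then obtain c' where "(c, c') \<in> cohomologous X G" "(c', d) \<in> coh_rel X G H F" by blast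
    then show "(c, d) \<in> coh_rel X G H F"
      using map_cocycle_cohomologous[OF G H F] cohomologous_trans[OF H] cohomologous_cocycle(1)[OF G]
      unfolding coh_rel_def by blast
  next
    fix c d assume "(c, d) \<in> coh_rel X G H F"
    then show "(c, d) \<in> cohomologous X G O coh_rel X G H F"
      using cohomologous_refl[OF G] unfolding coh_rel_def by blast
  qed
  moreover have "coh_rel X G H F O cohomologous X H = coh_rel X G H F"
    using cohomologous_trans[OF H] cohomologous_refl[OF H] cohomologous_cocycle(2)[OF H] unfolding coh_rel_def by blast
  ultimately show ?thesis using G H by (simp add: coh_category_def)
qed

lemma coh_functor_is_functor:
  fixes X :: "'x topology"
  shows "is_functor (Gp :: ('u lie_groupoid, _) category) (coh_category X) (coh_functor X)"
  unfolding is_functor_def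
proof (intro conjI ballI impI; (elim Gp_ArrE)?)
  fix G :: "'u lie_groupoid" assume "G \<in> Obj Gp"
  then have G: "lie_groupoid G" by simp
  then show "fst (coh_functor X) G \<in> Obj (coh_category X)" by (simp add: coh_functor_def coh_category_def)
  have "map_cocycle (id, id) c = c" for c :: "('x, 'u) cocycle" by (cases c) (simp add: map_cocycle_def)
  then have "coh_rel X G G (id, id) = cohomologous X G"
    using cohomologous_cocycle(1)[OF G, of _ _ X] by (auto simp: coh_rel_def)
  then show "snd (coh_functor X) (Ide Gp G) = Ide (coh_category X) (fst (coh_functor X) G)"
    using coh_functor_arrow[OF G G smooth_functor_id[OF G], of X] by (simp add: coh_functor_def coh_category_def)
next
  fix a and G H :: "'u lie_groupoid" and F assume a: "a = gp_arrow G H F" "lie_groupoid G" "lie_groupoid H" "smooth_functor G H F"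
  show "is_hom (coh_category X) (fst (coh_functor X) (Dom Gp a)) (fst (coh_functor X) (Cod Gp a)) (snd (coh_functor X) a)"
    using coh_rel_arrow[OF a(2-4), of X] unfolding a(1) coh_functor_arrow[OF a(2-4)] is_hom_def
    by (simp add: coh_functor_def) (simp add: coh_category_def)
next
  fix a b and G H H' K :: "'u lie_groupoid" and F F'
  assume "Cod Gp a = Dom Gp b" and a: "a = gp_arrow G H F" "lie_groupoid G" "lie_groupoid H" "smooth_functor G H F"
    and b: "b = gp_arrow H' K F'" "lie_groupoid H'" "lie_groupoid K" "smooth_functor H' K F'"
  then have [simp]: "H' = H" by simp
  note F' = b(4)[simplified] and K = b(3) and G = a(2) and H = a(3) and F = a(4)
  let ?F = "(fst F' \<circ> fst F, snd F' \<circ> snd F)"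
  have comp: "map_cocycle ?F c = map_cocycle F' (map_cocycle F c)" for c :: "('x, 'u) cocycle"
    by (cases c) (simp add: map_cocycle_def)
  have "coh_rel X G K ?F = coh_rel X G H F O coh_rel X H K F'"
  proof (intro subset_antisym subrelI)
    fix c e assume "(c, e) \<in> coh_rel X G K ?F"
    then have "cocycle X G c" "(map_cocycle F' (map_cocycle F c), e) \<in> cohomologous X K"
      by (simp_all add: coh_rel_def comp)
    then have "(c, map_cocycle F c) \<in> coh_rel X G H F" "(map_cocycle F c, e) \<in> coh_rel X H K F'"
      using cohomologous_refl[OF H] map_cocycle_cocycle[OF G H F] unfolding coh_rel_def mem_Collect_eq prod.case by blast+
    then show "(c, e) \<in> coh_rel X G H F O coh_rel X H K F'" by blast
  next
    fix c e assume "(c, e) \<in> coh_rel X G H F O coh_rel X H K F'"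
    then obtain d where "(c, d) \<in> coh_rel X G H F" "(d, e) \<in> coh_rel X H K F'" by blast
    then show "(c, e) \<in> coh_rel X G K ?F"
      using map_cocycle_cohomologous[OF H K F'] cohomologous_trans[OF K] by (simp add: coh_rel_def comp) blast
  qed
  then show "snd (coh_functor X) (Cmp Gp b a) = Cmp (coh_category X) (snd (coh_functor X) b) (snd (coh_functor X) a)"
    using coh_functor_arrow[OF G H F, of X] coh_functor_arrow[OF H K F', of X] coh_functor_arrow[OF G K smooth_functor_comp[OF G H K F F'], of X]
    by (simp add: a(1) b(1) Gp_Cmp[OF G H K F F']) (simp add: coh_category_def)
qed

text \<open>The inverse of a graph is its converse relation. One composite is the cohomology
  relation of \<open>G\<close> because \<open>F\<close> is injective on cohomology, the other is
  that of \<open>H\<close> because \<open>F\<close> is surjective.\<close>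

lemma coh_functor_inverts_equivalences:
  assumes "w \<in> gp_equivalences"
  shows "invertible_arrow (coh_category X) (snd (coh_functor X) w)"
proof -
  obtain G H F where w: "w = gp_arrow G H F" and G: "lie_groupoid G" and H: "lie_groupoid H" and F: "lie_equivalence G H F"
    using assms unfolding gp_equivalences_def by blast
  note F' = equivalence_functor[OF G H F]
  let ?R = "coh_rel X G H F"
  have arr: "cohomologous X G O ?R = ?R" "?R O cohomologous X H = ?R"
    using coh_rel_arrow[OF G H F', of X] by (simp_all add: coh_category_def)
  have arr': "cohomologous X H O ?R\<inverse> = ?R\<inverse>" "?R\<inverse> O cohomologous X G = ?R\<inverse>"
    using arr cohomologous_converse[OF G, of X] cohomologous_converse[OF H, of X] by (metis converse_relcomp)+
  have "?R O ?R\<inverse> = cohomologous X G"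
  proof (intro subset_antisym subrelI)
    fix c c' assume "(c, c') \<in> ?R O ?R\<inverse>"
    then obtain d where "(c, d) \<in> ?R" "(c', d) \<in> ?R" by blast
    then have "cocycle X G c" "cocycle X G c'" "(map_cocycle F c, map_cocycle F c') \<in> cohomologous X H"
      using cohomologous_trans[OF H] cohomologous_sym[OF H] unfolding coh_rel_def by blast+
    then show "(c, c') \<in> cohomologous X G" by (rule equivalence_cohomology_inj[OF G H F])
  next
    fix c c' assume cc: "(c, c') \<in> cohomologous X G"
    then have "(c, map_cocycle F c') \<in> ?R" "(c', map_cocycle F c') \<in> ?R"
      using map_cocycle_cohomologous[OF G H F' cc] cohomologous_cocycle[OF G cc] map_cocycle_cocycle[OF G H F'] cohomologous_refl[OF H]
      unfolding coh_rel_def mem_Collect_eq prod.case by blast+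
    then show "(c, c') \<in> ?R O ?R\<inverse>" by blast
  qed
  moreover have "?R\<inverse> O ?R = cohomologous X H"
  proof (intro subset_antisym subrelI)
    fix d d' assume "(d, d') \<in> ?R\<inverse> O ?R"
    then obtain c where "(c, d) \<in> ?R" "(c, d') \<in> ?R" by blast
    then show "(d, d') \<in> cohomologous X H"
      using cohomologous_trans[OF H] cohomologous_sym[OF H] unfolding coh_rel_def by blast
  next
    fix d d' assume dd: "(d, d') \<in> cohomologous X H"
    then obtain c where c: "cocycle X G c" "(map_cocycle F c, d) \<in> cohomologous X H"
      using equivalence_cohomology_surj[OF G H F] cohomologous_cocycle(1)[OF H] by blast
    then have "(c, d) \<in> ?R" "(c, d') \<in> ?R" using cohomologous_trans[OF H _ dd] by (simp_all add: coh_rel_def)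
    then show "(d, d') \<in> ?R\<inverse> O ?R" by blast
  qed
  ultimately have "inverse_arrows (coh_category X) (G, H, ?R) (H, G, ?R\<inverse>)"
    using arr arr' G H by (simp add: inverse_arrows_def coh_category_def)
  then show ?thesis unfolding w coh_functor_arrow[OF G H F'] invertible_arrow_def by blast
qed

section \<open>Etale maps\<close>

text \<open>A local diffeomorphism, expressed through charts: near each point some chart of
  \<open>M\<close> on the image of \<open>U\<close> pulls back to a chart on \<open>U\<close>. In
  these two charts \<open>p\<close> is the identity, so smoothness and the differential can be read
  off.\<close>

definition etale :: "'a manifold \<Rightarrow> 'b manifold \<Rightarrow> ('a \<Rightarrow> 'b) \<Rightarrow> bool"
  where "etale A M p \<longleftrightarrow> (\<forall>x\<in>pts A. \<exists>n U \<phi>. x \<in> U \<and> (n, U, \<lambda>y. \<phi> (p y)) \<in> charts A \<and> (n, p ` U, \<phi>) \<in> charts M)"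

lemma etale_at:
  assumes "etale A M p" "x \<in> pts A"
  obtains n U \<phi> where "x \<in> U" "(n, U, \<lambda>y. \<phi> (p y)) \<in> charts A" "(n, p ` U, \<phi>) \<in> charts M"
  using assms unfolding etale_def by blast

lemma etale_id: "smooth_structure M \<Longrightarrow> etale M M (\<lambda>x. x)"
  unfolding etale_def by (metis chart_at image_ident)

lemma partial_deriv_local_identity:
  assumes W: "openin (Euclidean_space n) W" and z: "z \<in> W" and j: "j < n" and g: "\<And>y. y \<in> W \<Longrightarrow> g y = y"
  shows "partial_deriv j (\<lambda>y. g y i) z = (if i = j then 1 else 0)"
proof -
  have "\<forall>\<^sub>F t in nhds (z j). g (z(j := t)) i = (z(j := t)) i"
    using eventually_line_in_open[OF W z j] by eventually_elim (simp add: g)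
  moreover have "((\<lambda>t. (z(j := t)) i) has_real_derivative (if i = j then 1 else 0)) (at (z j))" by auto
  ultimately have "((\<lambda>t. g (z(j := t)) i) has_real_derivative (if i = j then 1 else 0)) (at (z j))"
    using DERIV_cong_ev[OF refl _ refl, of "\<lambda>t. g (z(j := t)) i" "\<lambda>t. (z(j := t)) i"] by blast
  then show ?thesis unfolding partial_deriv_def by (rule DERIV_imp_deriv)
qed

context
  fixes A :: "'a manifold" and M :: "'b manifold" and p
  assumes A: "smooth_structure A" and M: "smooth_structure M" and p: "etale A M p"
begin

lemma etale_chart_inj: "(n, U, \<lambda>y. \<phi> (p y)) \<in> charts A \<Longrightarrow> inj_on p U"
  using is_chart_inj[OF chart_is_chart[OF A]] by (metis (mono_tags, lifting) inj_on_def)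

lemma etale_smooth: "smooth_map A M p"
proof (rule smooth_mapI)
  fix x assume "x \<in> pts A"
  with p obtain n U \<phi> where *: "x \<in> U" "(n, U, \<lambda>y. \<phi> (p y)) \<in> charts A" "(n, p ` U, \<phi>) \<in> charts M" by (rule etale_at)
  note c = chart_is_chart[OF A *(2)]
  show "\<exists>n U \<phi> m V \<psi>. (n, U, \<phi>) \<in> charts A \<and> (m, V, \<psi>) \<in> charts M \<and>
      x \<in> U \<and> p ` U \<subseteq> V \<and> chart_smooth (n, U, \<phi>) U m (\<lambda>x. \<psi> (p x))"
    using * chart_smooth_coord[OF c order_refl is_chart_open[OF c]] by blast
qed

lemma etale_submersion: "submersion A M p"
  unfolding submersion_def
proof (intro conjI ballI etale_smooth)
  fix x assume "x \<in> pts A"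
  with p obtain n U \<phi> where *: "x \<in> U" "(n, U, \<lambda>y. \<phi> (p y)) \<in> charts A" "(n, p ` U, \<phi>) \<in> charts M" by (rule etale_at)
  note c = chart_is_chart[OF A *(2)]
  define \<theta> where "\<theta> = (\<lambda>y. \<phi> (p y))"
  have W: "openin (Euclidean_space n) (\<theta> ` U)" using c by (simp add: is_chart_def \<theta>_def)
  define g where "g = \<phi> \<circ> p \<circ> inv_into U \<theta>"
  have "g y = y" if "y \<in> \<theta> ` U" for y
    using f_inv_into_f[OF that] by (simp add: \<theta>_def g_def)
  then have d: "partial_deriv j (\<lambda>y. g y i) (\<theta> x) = (if i = j then 1 else 0)" if "j < n" for i j
    using partial_deriv_local_identity[OF W _ that] *(1) by blast
  have "surjective_differential n n g (\<theta> x)"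
    unfolding surjective_differential_def
  proof (intro allI exI impI)
    fix v :: "nat \<Rightarrow> real" and i assume "i < n"
    have "(\<Sum>j<n. partial_deriv j (\<lambda>y. g y i) (\<theta> x) * v j) = (\<Sum>j<n. if i = j then v j else 0)"
      by (intro sum.cong refl) (simp add: d)
    then show "(\<Sum>j<n. partial_deriv j (\<lambda>y. g y i) (\<theta> x) * v j) = v i"
      using \<open>i < n\<close> by simp
  qed
  then show "\<exists>(n, U, \<phi>)\<in>charts A. \<exists>(m, V, \<psi>)\<in>charts M.
      x \<in> U \<and> p ` U \<subseteq> V \<and> surjective_differential n m (\<psi> \<circ> p \<circ> inv_into U \<phi>) (\<phi> x)"
    using * by (intro bexI[of _ "(n, U, \<theta>)"]) (auto simp: \<theta>_def g_def intro!: bexI[of _ "(n, p ` U, \<phi>)"])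
qed

lemma etale_continuous: "continuous_map (mtop A) (mtop M) p"
  by (rule smooth_map_continuous[OF A M etale_smooth])

lemma etale_open:
  assumes V: "openin (mtop A) V"
  shows "openin (mtop M) (p ` V)"
proof (subst openin_subopen, intro ballI)
  fix y assume "y \<in> p ` V"
  then obtain x where x: "x \<in> V" "y = p x" by blast
  then have "x \<in> pts A" using openin_subset[OF V] by blast
  with p obtain n U \<phi> where *: "x \<in> U" "(n, U, \<lambda>y. \<phi> (p y)) \<in> charts A" "(n, p ` U, \<phi>) \<in> charts M" by (rule etale_at)
  note c = chart_is_chart[OF A *(2)] and d = chart_is_chart[OF M *(3)]
  have "openin (mtop A) (U \<inter> V)" using V is_chart_open[OF c] by blast
  then have "openin (Euclidean_space n) (\<phi> ` p ` (U \<inter> V))"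
    using is_chart_image_open[OF c, of "U \<inter> V"] by (simp add: image_image)
  then have "openin (mtop M) (p ` (U \<inter> V))" using is_chart_image_open[OF d, of "p ` (U \<inter> V)"] by blast
  then show "\<exists>T. openin (mtop M) T \<and> y \<in> T \<and> T \<subseteq> p ` V"
    using x *(1) by (intro exI[of _ "p ` (U \<inter> V)"]) blast
qed

text \<open>The definition grants one chart of \<open>M\<close> near each point that pulls back.
  This extends to any chart on the image of a smaller open set, as the change of coordinates is the
  one in \<open>M\<close>.\<close>

lemma etale_chart_pullback:
  assumes c: "(n, U, \<lambda>y. \<phi> (p y)) \<in> charts A" "(n, p ` U, \<phi>) \<in> charts M"
    and V: "V \<subseteq> U" "openin (mtop A) V" and \<psi>: "(m, p ` V, \<psi>) \<in> charts M"
  shows "(m, V, \<lambda>y. \<psi> (p y)) \<in> charts A"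
proof (rule chart_transport[OF A chart_restrict[OF A c(1) V]])
  note cV = chart_is_chart[OF A chart_restrict[OF A c(1) V]] and d = chart_is_chart[OF M \<psi>] and c' = chart_is_chart[OF M c(2)]
  have injp: "inj_on p V" using etale_chart_inj[OF c(1)] V(1) inj_on_subset by blast
  have inj\<psi>: "inj_on \<psi> (p ` V)" by (rule is_chart_inj[OF d])
  show inj: "inj_on (\<lambda>y. \<psi> (p y)) V" using comp_inj_on[OF injp inj\<psi>] by (simp add: o_def)
  show op: "openin (Euclidean_space m) ((\<lambda>y. \<psi> (p y)) ` V)" using d by (simp add: is_chart_def image_image)
  have sub: "p ` V \<subseteq> p ` U" using V(1) by blast
  note co = chart_smooth_coord[OF cV order_refl V(2)]
  have "chart_smooth (n, p ` U, \<phi>) (p ` V) m \<psi>" by (rule chart_change[OF M c(2) \<psi>]) (use sub in blast)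
  then show "chart_smooth (n, V, \<lambda>y. \<phi> (p y)) V m (\<lambda>y. \<psi> (p y))"
    by (rule chart_smooth_comp[OF cV c' order_refl V(2) sub is_chart_open[OF d] order_refl co])
  have s: "chart_smooth (m, p ` V, \<psi>) (p ` V) n \<phi>" by (rule chart_change[OF M \<psi> c(2)]) (use sub in blast)
  show "chart_smooth (m, V, \<lambda>y. \<psi> (p y)) V n (\<lambda>y. \<phi> (p y))"
    unfolding chart_smooth_def smooth_fun_def prod.case
  proof (intro allI impI)
    fix i k assume "i < n"
    then have "Ck m k (\<psi> ` p ` V) (\<lambda>x. \<phi> (inv_into (p ` V) \<psi> x) i)"
      using s unfolding chart_smooth_def smooth_fun_def prod.case by blast
    then show "Ck m k ((\<lambda>y. \<psi> (p y)) ` V) (\<lambda>x. \<phi> (p (inv_into V (\<lambda>y. \<psi> (p y)) x)) i)"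
      unfolding image_image
    proof (rule Ck_cong[OF op, rotated])
      fix y assume "y \<in> (\<lambda>y. \<psi> (p y)) ` V"
      then obtain v where "v \<in> V" "y = \<psi> (p v)" by blast
      then show "\<phi> (inv_into (p ` V) \<psi> y) i = \<phi> (p (inv_into V (\<lambda>y. \<psi> (p y)) y)) i"
        using inv_into_f_f[OF inj] inv_into_f_f[OF inj\<psi>] by simp
    qed
  qed
qed

end

text \<open>Locally \<open>f\<close> is \<open>pA\<close> followed by the inverse of
  \<open>pB\<close> on a sheet \<open>V\<close>, so in charts pulled back from \<open>M\<close> it
  is the identity. Smoothness of a map over \<open>M\<close> is thereby reduced to
  continuity.\<close>

lemma etale_lift:
  assumes A: "smooth_structure A" and B: "smooth_structure B" and M: "smooth_structure M"
    and pA: "etale A M pA" and pB: "etale B M pB"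
    and f: "continuous_map (mtop A) (mtop B) f" and eq: "\<And>x. x \<in> pts A \<Longrightarrow> pB (f x) = pA x"
  shows "etale A B f"
  unfolding etale_def
proof
  fix x assume x: "x \<in> pts A"
  then have fx: "f x \<in> pts B" using continuous_map_funspace[OF f] by auto
  from pA x obtain n U \<phi> where c: "x \<in> U" "(n, U, \<lambda>y. \<phi> (pA y)) \<in> charts A" "(n, pA ` U, \<phi>) \<in> charts M" by (rule etale_at)
  from pB fx obtain m V \<psi> where d: "f x \<in> V" "(m, V, \<lambda>y. \<psi> (pB y)) \<in> charts B" "(m, pB ` V, \<psi>) \<in> charts M" by (rule etale_at)
  note Uo = is_chart_open[OF chart_is_chart[OF A c(2)]] and Vo = is_chart_open[OF chart_is_chart[OF B d(2)]]
  have UA: "U \<subseteq> pts A" using openin_subset[OF Uo] .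
  define W where "W = {y \<in> U. f y \<in> V}"
  have "W = U \<inter> {y \<in> pts A. f y \<in> V}" using UA by (auto simp: W_def)
  then have W: "W \<subseteq> U" "openin (mtop A) W" "x \<in> W"
    using Uo openin_continuous_map_preimage[OF f Vo] c(1) d(1) by (auto simp: W_def)
  have pW: "pB ` f ` W = pA ` W" using eq UA W(1) by (force simp: image_iff)
  have injB: "inj_on pB V" by (rule etale_chart_inj[OF B M pB d(2)])
  \<comment> \<open>The image of \<open>W\<close> is the part of the sheet \<open>V\<close> that
    lies above an open subset of \<open>M\<close>, hence open.\<close>
  have "f ` W = V \<inter> {v \<in> pts B. pB v \<in> pA ` W}"
  proof (intro subset_antisym subsetI)
    fix v assume v: "v \<in> V \<inter> {v \<in> pts B. pB v \<in> pA ` W}"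
    then obtain w where w: "w \<in> W" "pB v = pA w" by blast
    then have "pB v = pB (f w)" "f w \<in> V" using eq UA W(1) by (auto simp: W_def)
    then show "v \<in> f ` W" using injB v w(1) by (auto simp: inj_on_def)
  next
    fix v assume "v \<in> f ` W"
    then show "v \<in> V \<inter> {v \<in> pts B. pB v \<in> pA ` W}"
      using eq UA openin_subset[OF Vo] by (auto simp: W_def)
  qed
  then have fW: "openin (mtop B) (f ` W)" "f ` W \<subseteq> V"
    using Vo openin_continuous_map_preimage[OF etale_continuous[OF B M pB] etale_open[OF A M pA W(2)]] by auto
  have S: "(n, pB ` f ` W, \<phi>) \<in> charts M"
    unfolding pW by (rule chart_restrict[OF M c(3) _ etale_open[OF A M pA W(2)]]) (use W(1) in blast)
  have 1: "(n, f ` W, \<lambda>y. \<phi> (pB y)) \<in> charts B"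
    by (rule etale_chart_pullback[OF B M pB d(2,3) fW(2,1) S])
  have "(n, W, \<lambda>y. \<phi> (pB (f y))) \<in> charts A"
    by (rule chart_cong[OF A chart_restrict[OF A c(2) W(1,2)]]) (use eq UA W(1) in auto)
  then show "\<exists>n U \<phi>. x \<in> U \<and> (n, U, \<lambda>y. \<phi> (f y)) \<in> charts A \<and> (n, f ` U, \<phi>) \<in> charts B"
    using 1 W(3) by (intro exI[of _ n] exI[of _ W] exI[of _ "\<lambda>y. \<phi> (pB y)"]) simp
qed

lemma etale_comp:
  assumes A: "smooth_structure A" and B: "smooth_structure B" and M: "smooth_structure M"
    and f: "etale A B f" and p: "etale B M p"
  shows "etale A M (\<lambda>x. p (f x))"
  unfolding etale_def
proof
  fix x assume x: "x \<in> pts A"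
  then have fx: "f x \<in> pts B" using continuous_map_funspace[OF etale_continuous[OF A B f]] by auto
  from f x obtain n U \<phi> where c: "x \<in> U" "(n, U, \<lambda>y. \<phi> (f y)) \<in> charts A" "(n, f ` U, \<phi>) \<in> charts B" by (rule etale_at)
  from p fx obtain m V \<psi> where d: "f x \<in> V" "(m, V, \<lambda>y. \<psi> (p y)) \<in> charts B" "(m, p ` V, \<psi>) \<in> charts M" by (rule etale_at)
  note Uo = is_chart_open[OF chart_is_chart[OF A c(2)]] and Vo = is_chart_open[OF chart_is_chart[OF B d(2)]]
  define W where "W = {y \<in> U. f y \<in> V}"
  have W: "W \<subseteq> U" "openin (mtop A) W" "x \<in> W" "f ` W \<subseteq> V"
    using smooth_map_open_vimage[OF A B etale_smooth[OF A B f] Uo Vo] c(1) d(1) by (auto simp: W_def)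
  note fW = etale_open[OF A B f W(2)]
  have "(m, W, \<lambda>y. \<psi> (p (f y))) \<in> charts A"
    by (rule etale_chart_pullback[OF A B f c(2,3) W(1,2), of m "\<lambda>y. \<psi> (p y)"]) (rule chart_restrict[OF B d(2) W(4) fW])
  moreover have "(m, p ` f ` W, \<psi>) \<in> charts M"
    by (rule chart_restrict[OF M d(3) image_mono[OF W(4)] etale_open[OF B M p fW]])
  then have "(m, (\<lambda>x. p (f x)) ` W, \<psi>) \<in> charts M" by (simp add: image_image)
  ultimately show "\<exists>n U \<phi>. x \<in> U \<and> (n, U, \<lambda>y. \<phi> (p (f y))) \<in> charts A \<and> (n, (\<lambda>x. p (f x)) ` U, \<phi>) \<in> charts M"
    using W(3) by blast
qed

text \<open>In the pair of charts that \<open>etale\<close> provides, the inverse reads as the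
  identity too.\<close>

lemma etale_bij_diffeomorphism:
  assumes A: "smooth_structure A" and B: "smooth_structure B" and f: "etale A B f" and bij: "bij_betw f (pts A) (pts B)"
  shows "diffeomorphism A B f"
  unfolding diffeomorphism_def
proof (intro conjI bij etale_smooth[OF A B f] smooth_mapI)
  fix y assume "y \<in> pts B"
  then obtain x where x: "x \<in> pts A" "y = f x" using bij by (auto simp: bij_betw_def)
  from f x(1) obtain n U \<phi> where c: "x \<in> U" "(n, U, \<lambda>y. \<phi> (f y)) \<in> charts A" "(n, f ` U, \<phi>) \<in> charts B" by (rule etale_at)
  note d = chart_is_chart[OF B c(3)]
  have inv: "inv_into (pts A) f (f u) = u" if "u \<in> U" for u
    using bij that is_chart_subset[OF chart_is_chart[OF A c(2)]] by (intro inv_into_f_f) (auto simp: bij_betw_def)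
  have "chart_smooth (n, f ` U, \<phi>) (f ` U) n (\<lambda>y. \<phi> (f (inv_into (pts A) f y)))"
    by (rule chart_smooth_cong[OF d order_refl is_chart_open[OF d] _ chart_smooth_coord[OF d order_refl is_chart_open[OF d]]])
       (auto simp: inv)
  moreover have "inv_into (pts A) f ` f ` U \<subseteq> U" using inv by auto
  ultimately show "\<exists>n U \<phi> m V \<psi>. (n, U, \<phi>) \<in> charts B \<and> (m, V, \<psi>) \<in> charts A \<and> y \<in> U \<and>
      inv_into (pts A) f ` U \<subseteq> V \<and> chart_smooth (n, U, \<phi>) U m (\<lambda>x. \<psi> (inv_into (pts A) f x))"
    using c x(2)
    by (intro exI[of _ n] exI[of _ "f ` U"] exI[of _ \<phi>] exI[of _ n] exI[of _ U] exI[of _ "\<lambda>y. \<phi> (f y)"]) simp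
qed

lemma etale_map_prod:
  assumes A: "smooth_structure A" and M: "smooth_structure M" and B: "smooth_structure B" and N: "smooth_structure N"
    and p: "etale A M p" and q: "etale B N q"
  shows "etale (prod_manifold A B) (prod_manifold M N) (map_prod p q)"
  unfolding etale_def
proof
  fix w assume "w \<in> pts (prod_manifold A B)"
  then have w: "fst w \<in> pts A" "snd w \<in> pts B" by auto
  from p w(1) obtain n U \<phi> where c: "fst w \<in> U" "(n, U, \<lambda>y. \<phi> (p y)) \<in> charts A" "(n, p ` U, \<phi>) \<in> charts M" by (rule etale_at)
  from q w(2) obtain m V \<psi> where d: "snd w \<in> V" "(m, V, \<lambda>y. \<psi> (q y)) \<in> charts B" "(m, q ` V, \<psi>) \<in> charts N" by (rule etale_at)
  have "(\<lambda>v. prod_coord n \<phi> \<psi> (map_prod p q v)) = prod_coord n (\<lambda>y. \<phi> (p y)) (\<lambda>y. \<psi> (q y))"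
    by (auto simp: prod_coord_def fun_eq_iff)
  then have "(n + m, U \<times> V, \<lambda>v. prod_coord n \<phi> \<psi> (map_prod p q v)) \<in> charts (prod_manifold A B)"
    using prod_chart[OF A B c(2) d(2)] by simp
  moreover have "map_prod p q ` (U \<times> V) = p ` U \<times> q ` V" by force
  then have "(n + m, map_prod p q ` (U \<times> V), prod_coord n \<phi> \<psi>) \<in> charts (prod_manifold M N)"
    using prod_chart[OF M N c(3) d(3)] by simp
  moreover have "w \<in> U \<times> V" using c(1) d(1) by (simp add: mem_Times_iff)
  ultimately show "\<exists>n U \<phi>. w \<in> U \<and> (n, U, \<lambda>y. \<phi> (map_prod p q y)) \<in> charts (prod_manifold A B) \<and>
      (n, map_prod p q ` U, \<phi>) \<in> charts (prod_manifold M N)"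
    by (intro exI[of _ "n + m"] exI[of _ "U \<times> V"] exI[of _ "prod_coord n \<phi> \<psi>"] conjI)
qed


subsection \<open>Fibre products along etale maps\<close>

lemma smooth_fun_diff: "smooth_fun c S g \<Longrightarrow> smooth_fun c S h \<Longrightarrow> smooth_fun c S (\<lambda>x. g x - h x)"
  by (cases c) (simp add: smooth_fun_def Ck_diff)

context
  fixes A :: "'a manifold" and B :: "'b manifold" and C :: "'c manifold" and f g
  assumes A: "smooth_structure A" and B: "smooth_structure B" and C: "smooth_structure C"
    and f: "etale A C f" and g: "smooth_map B C g"
begin

text \<open>Straightening the graph of the smooth map \<open>f\<inverse> \<circ> g\<close>, where \<open>f\<inverse>\<close> is a local inverse.\<close>

lemma fibre_set_slice_chart:
  assumes U: "(n, U, \<lambda>x. \<xi> (f x)) \<in> charts A" "(n, f ` U, \<xi>) \<in> charts C"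
    and V: "(k, V, \<psi>) \<in> charts B" "g ` V \<subseteq> f ` U"
  defines "\<zeta> \<equiv> (\<lambda>(x, y) i. if i < k then \<psi> y i else \<xi> (f x) (i - k) - \<xi> (g y) (i - k))"
  shows "(k + n, U \<times> V, \<zeta>) \<in> charts (prod_manifold A B)"
proof (rule chart_transport[OF smooth_structure_prod[OF A B] prod_chart[OF A B U(1) V(1)]])
  let ?W = "U \<times> V" and ?E = "Euclidean_space (k + n)" and ?c0 = "prod_coord n (\<lambda>x. \<xi> (f x)) \<psi>"
  note a = chart_is_chart[OF A U(1)] and b = chart_is_chart[OF B V(1)] and c = chart_is_chart[OF C U(2)]
  note p = prod_coord_is_chart[OF a b]
  note Wo = is_chart_open[OF p]
  have inja: "inj_on (\<lambda>x. \<xi> (f x)) U" and injb: "inj_on \<psi> V" using is_chart_inj a b by blast+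
  have gs: "chart_smooth (k, V, \<psi>) V n (\<lambda>y. \<xi> (g y))"
    by (rule smooth_map_in_charts[OF B C g V(1) U(2) order_refl is_chart_open[OF b] V(2)])
  \<comment> \<open>The map \<open>g\<close> in coordinates. It recovers the old coordinates from
    the new ones \<open>z\<close>: \<open>\<psi> y\<close> is \<open>q z\<close>, and
    \<open>\<xi> (f x)\<close> is the block of \<open>z\<close> from index \<open>k\<close> on plus
    \<open>\<Gamma> (q z)\<close>.\<close>
  define \<Gamma> where "\<Gamma> = (\<lambda>u. \<xi> (g (inv_into V \<psi> u)))"
  have \<Gamma>: "Ck k l (\<psi> ` V) (\<lambda>u. \<Gamma> u i)" if "i < n" for i l
    using gs that unfolding chart_smooth_def smooth_fun_def prod.case \<Gamma>_def by blast
  have \<Gamma>\<psi>: "\<Gamma> (\<psi> y) = \<xi> (g y)" if "y \<in> V" for y using that injb by (simp add: \<Gamma>_def)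
  define q where "q = (\<lambda>(z::nat \<Rightarrow> real) i. if i < k then z i else 0)"
  have q\<zeta>: "q (\<zeta> (x, y)) = \<psi> y" if "y \<in> V" for x y
    using is_chart_Euclidean[OF b that] by (auto simp: q_def \<zeta>_def)
  have \<zeta>\<xi>: "\<xi> (f x) i = \<zeta> (x, y) (i + k) + \<Gamma> (q (\<zeta> (x, y))) i" if "y \<in> V" for x y i
    using \<Gamma>\<psi>[OF that] q\<zeta>[OF that] by (simp add: \<zeta>_def)
  have \<zeta>k: "\<zeta> (x, y) i = \<psi> y i" if "i < k" for x y i using that by (simp add: \<zeta>_def)
  show inj: "inj_on \<zeta> ?W"
  proof (rule inj_onI, clarify)
    fix x y x' y' assume xy: "x \<in> U" "y \<in> V" "x' \<in> U" "y' \<in> V" and eq: "\<zeta> (x, y) = \<zeta> (x', y')"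
    have "y = y'" using q\<zeta>[OF xy(2), of x] q\<zeta>[OF xy(4), of x'] eq injb xy by (simp add: inj_on_def)
    moreover have "\<xi> (f x) = \<xi> (f x')"
      using \<zeta>\<xi>[OF xy(2), of x] \<zeta>\<xi>[OF xy(4), of x'] eq by (intro ext) simp
    ultimately show "x = x' \<and> y = y'" using inja xy by (simp add: inj_on_def)
  qed
  have \<zeta>E: "\<zeta> (x, y) \<in> topspace ?E" if "x \<in> U" "y \<in> V" for x y
  proof -
    have "\<xi> (f x) i = 0" "\<xi> (g y) i = 0" if "n \<le> i" for i
      using is_chart_Euclidean[OF a \<open>x \<in> U\<close> that] is_chart_Euclidean[OF c _ that, of "g y"] V(2) \<open>y \<in> V\<close> by auto
    then show ?thesis by (auto simp: topspace_Euclidean_space \<zeta>_def)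
  qed
  \<comment> \<open>The image of \<open>\<zeta>\<close> is cut out by two successive open
    conditions: on \<open>O1\<close> the value \<open>\<Gamma> (q z)\<close> is taken inside the
    domain where \<open>\<Gamma>\<close> is smooth, and there \<open>\<beta>\<close>, the recovered
    coordinate of the first factor, must lie in the image of \<open>U\<close>.\<close>
  define O1 where "O1 = {z \<in> topspace ?E. q z \<in> \<psi> ` V}"
  define \<beta> where "\<beta> = (\<lambda>z i. if i < n then z (i + k) + \<Gamma> (q z) i else 0)"
  have qc: "continuous_map ?E (Euclidean_space k) q"
    by (rule continuous_map_into_Euclidean) (auto simp: q_def topspace_Euclidean_space continuous_map_Euclidean_coord)
  have \<psi>V: "openin (Euclidean_space k) (\<psi> ` V)" using b by (simp add: is_chart_def)
  have O1: "openin ?E O1" unfolding O1_def by (rule openin_continuous_map_preimage[OF qc \<psi>V])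
  have "continuous_map (subtopology ?E O1) (subtopology (Euclidean_space k) (\<psi> ` V)) q"
    using continuous_map_from_subtopology[OF qc] by (auto simp: continuous_map_in_subtopology O1_def)
  then have "continuous_map (subtopology ?E O1) euclideanreal (\<lambda>z. \<Gamma> (q z) i)" if "i < n" for i
    using continuous_map_compose[OF _ Ck_imp_continuous[OF \<Gamma>[OF that, of 0]]] by (simp add: o_def)
  then have \<beta>c: "continuous_map (subtopology ?E O1) (Euclidean_space n) \<beta>"
    by (intro continuous_map_into_Euclidean)
       (auto simp: \<beta>_def topspace_Euclidean_space intro!: continuous_map_add continuous_map_from_subtopology[OF continuous_map_Euclidean_coord])
  have "openin (Euclidean_space n) ((\<lambda>x. \<xi> (f x)) ` U)" using a by (simp add: is_chart_def)
  from openin_continuous_map_preimage[OF \<beta>c this]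
  have O2: "openin ?E {z \<in> topspace (subtopology ?E O1). \<beta> z \<in> (\<lambda>x. \<xi> (f x)) ` U}"
    using O1 openin_trans_full by blast
  have \<beta>\<zeta>: "\<beta> (\<zeta> (x, y)) = \<xi> (f x)" if "x \<in> U" "y \<in> V" for x y
    using \<zeta>\<xi>[OF that(2), of x] is_chart_Euclidean[OF a that(1)] by (auto simp: \<beta>_def fun_eq_iff)
  have "\<zeta> ` ?W = {z \<in> topspace (subtopology ?E O1). \<beta> z \<in> (\<lambda>x. \<xi> (f x)) ` U}"
  proof (intro subset_antisym subsetI)
    fix z assume "z \<in> {z \<in> topspace (subtopology ?E O1). \<beta> z \<in> (\<lambda>x. \<xi> (f x)) ` U}"
    then obtain x y where z: "z \<in> topspace ?E" "y \<in> V" "q z = \<psi> y" "x \<in> U" "\<beta> z = \<xi> (f x)"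
      by (auto simp: O1_def)
    have "\<zeta> (x, y) i = z i" for i
    proof (cases "i < k")
      case True
      then have "q z i = z i" by (simp add: q_def)
      then show ?thesis using True z(3) by (simp add: \<zeta>_def)
    next
      case False
      show ?thesis
      proof (cases "i < k + n")
        case True
        then have "\<beta> z (i - k) = z i + \<Gamma> (\<psi> y) (i - k)" using False z(3) by (simp add: \<beta>_def)
        then show ?thesis using False z(5) \<Gamma>\<psi>[OF z(2)] by (simp add: \<zeta>_def)
      next
        case False
        then show ?thesis using \<zeta>E[OF z(4,2)] z(1) by (simp add: topspace_Euclidean_space)
      qed
    qed
    then have "z = \<zeta> (x, y)" by (simp add: fun_eq_iff)
    then show "z \<in> \<zeta> ` ?W" using z by blast
  next
    fix z assume "z \<in> \<zeta> ` ?W"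
    then obtain x y where "x \<in> U" "y \<in> V" "z = \<zeta> (x, y)" by blast
    then show "z \<in> {z \<in> topspace (subtopology ?E O1). \<beta> z \<in> (\<lambda>x. \<xi> (f x)) ` U}"
      using \<zeta>E q\<zeta> \<beta>\<zeta> by (simp add: O1_def)
  qed
  with O2 show im: "openin ?E (\<zeta> ` ?W)" by simp
  show "chart_smooth (n + k, ?W, ?c0) ?W (k + n) \<zeta>"
    unfolding chart_smooth_def
  proof (intro allI impI)
    fix i assume i: "i < k + n"
    have 1: "chart_smooth (n + k, ?W, ?c0) ?W k (\<lambda>w. \<psi> (snd w))" by (rule prod_coord_snd_smooth[OF a b order_refl Wo])
    have 2: "chart_smooth (n + k, ?W, ?c0) ?W n (\<lambda>w. \<xi> (f (fst w)))" by (rule prod_coord_fst_smooth[OF a b order_refl Wo])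
    have 3: "chart_smooth (n + k, ?W, ?c0) ?W n (\<lambda>w. \<xi> (g (snd w)))"
      by (rule chart_smooth_comp[OF p b order_refl Wo order_refl is_chart_open[OF b] _ 1 gs]) auto
    show "smooth_fun (n + k, ?W, ?c0) ?W (\<lambda>w. \<zeta> w i)"
    proof (cases "i < k")
      case True
      then have "(\<lambda>w. \<zeta> w i) = (\<lambda>w. \<psi> (snd w) i)" by (auto simp: \<zeta>_def)
      then show ?thesis using 1 True by (simp add: chart_smooth_def)
    next
      case False
      then have "(\<lambda>w. \<zeta> w i) = (\<lambda>w. \<xi> (f (fst w)) (i - k) - \<xi> (g (snd w)) (i - k))" by (auto simp: \<zeta>_def)
      moreover have "i - k < n" using i False by simp
      ultimately show ?thesis using 2 3 by (simp add: chart_smooth_def smooth_fun_diff)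
    qed
  qed
  show "chart_smooth (k + n, ?W, \<zeta>) ?W (n + k) ?c0"
    unfolding chart_smooth_def smooth_fun_def prod.case
  proof (intro allI impI)
    fix i l assume i: "i < n + k"
    have inv: "inv_into ?W \<zeta> (\<zeta> (x, y)) = (x, y)" if "x \<in> U" "y \<in> V" for x y using inj that by simp
    show "Ck (k + n) l (\<zeta> ` ?W) (\<lambda>z. ?c0 (inv_into ?W \<zeta> z) i)"
    proof (cases "i < n")
      case True
      have "Ck (k + n) l (\<zeta> ` ?W) (\<lambda>z. \<Gamma> (q z) i)"
      proof (rule Ck_comp[OF im \<psi>V \<Gamma>[OF True], of l q])
        show "Ck (k + n) l (\<zeta> ` ?W) (\<lambda>z. q z j)" if "j < k" for j
          using that Ck_coord by (simp add: q_def)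
        show "q ` \<zeta> ` ?W \<subseteq> \<psi> ` V" using q\<zeta> by auto
      qed
      from Ck_add[OF Ck_coord this]
      have "Ck (k + n) l (\<zeta> ` ?W) (\<lambda>z. z (i + k) + \<Gamma> (q z) i)" .
      then show ?thesis
        by (rule Ck_cong[OF im, rotated]) (use True in \<open>auto simp: inv prod_coord_def \<zeta>\<xi>\<close>)
    next
      case False
      have "Ck (k + n) l (\<zeta> ` ?W) (\<lambda>z. z (i - n))" by (rule Ck_coord)
      then show ?thesis
        by (rule Ck_cong[OF im, rotated]) (use False i \<zeta>k in \<open>auto simp: inv prod_coord_def\<close>)
    qed
  qed
qed

text \<open>In the straightened chart the last \<open>n\<close> coordinates vanish exactly on the
  fibre product, and the first \<open>k\<close> are coordinates of the second component. So the
  fibre product is embedded, and its second projection pulls charts of \<open>B\<close> back to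
  slice charts.\<close>

lemma fibre_product_etale:
  shows "fibre_product_exists A f g B" "smooth_structure (fibre_product A f g B)" "etale (fibre_product A f g B) B snd"
proof -
  let ?P = "fibre_set A f g B"
  have main: "\<exists>k U V \<psi> \<zeta>. w \<in> U \<times> V \<and> (k, (U \<times> V) \<inter> ?P, \<zeta>) \<in> slice_charts (prod_manifold A B) ?P \<and>
      (k, V, \<psi>) \<in> charts B \<and> snd ` ((U \<times> V) \<inter> ?P) = V \<and> (\<forall>v\<in>(U \<times> V) \<inter> ?P. \<zeta> v = \<psi> (snd v))"
    if w: "w \<in> ?P" for w
  proof -
    have w': "fst w \<in> pts A" "snd w \<in> pts B" "f (fst w) = g (snd w)" using w by (auto simp: fibre_set_def)
    from f w'(1) obtain n U \<xi> where U: "fst w \<in> U" "(n, U, \<lambda>y. \<xi> (f y)) \<in> charts A" "(n, f ` U, \<xi>) \<in> charts C" by (rule etale_at)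
    note a = chart_is_chart[OF A U(2)] and c = chart_is_chart[OF C U(3)]
    have "openin (mtop B) {y \<in> pts B. g y \<in> f ` U}"
      by (rule smooth_map_open_vimage[OF B C g openin_topspace is_chart_open[OF c]])
    moreover have "snd w \<in> {y \<in> pts B. g y \<in> f ` U}" using w' U(1) by (auto simp flip: w'(3))
    ultimately obtain k V \<psi> where V: "(k, V, \<psi>) \<in> charts B" "snd w \<in> V" "V \<subseteq> {y \<in> pts B. g y \<in> f ` U}"
      using chart_in_open[OF B, of "snd w" "{y \<in> pts B. g y \<in> f ` U}"] by blast
    note b = chart_is_chart[OF B V(1)]
    have gV: "g ` V \<subseteq> f ` U" using V(3) by blast
    define \<zeta> where "\<zeta> = (\<lambda>(x, y) i. if i < k then \<psi> y i else \<xi> (f x) (i - k) - \<xi> (g y) (i - k))"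
    have ch: "(k + n, U \<times> V, \<zeta>) \<in> charts (prod_manifold A B)"
      unfolding \<zeta>_def by (rule fibre_set_slice_chart[OF U(2,3) V(1) gV])
    have onP: "(x, y) \<in> ?P \<longleftrightarrow> (\<forall>i\<ge>k. \<zeta> (x, y) i = 0)" if "x \<in> U" "y \<in> V" for x y
    proof -
      have "(\<forall>i\<ge>k. \<zeta> (x, y) i = 0) \<longleftrightarrow> (\<forall>i. \<xi> (f x) i = \<xi> (g y) i)"
        unfolding \<zeta>_def by (auto, metis add_diff_cancel_right' le_add2)
      also have "\<dots> \<longleftrightarrow> \<xi> (f x) = \<xi> (g y)" by (simp add: fun_eq_iff)
      also have "\<dots> \<longleftrightarrow> f x = g y"
        by (rule inj_on_eq_iff[OF is_chart_inj[OF c]]) (use gV that in auto)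
      finally show ?thesis using that is_chart_subset[OF a] is_chart_subset[OF b] by (auto simp: fibre_set_def)
    qed
    have "\<zeta> ` ((U \<times> V) \<inter> ?P) = {z \<in> \<zeta> ` (U \<times> V). \<forall>i\<ge>k. z i = 0}"
      using onP by auto
    then have "(k, (U \<times> V) \<inter> ?P, \<zeta>) \<in> slice_charts (prod_manifold A B) ?P"
      unfolding slice_charts_def using ch le_add1[of k n] by blast
    moreover have "snd ` ((U \<times> V) \<inter> ?P) = V"
    proof (intro subset_antisym subsetI)
      fix y assume y: "y \<in> V"
      then obtain x where x: "x \<in> U" "g y = f x" using gV by blast
      then have "(x, y) \<in> (U \<times> V) \<inter> ?P"
        using y is_chart_subset[OF a] is_chart_subset[OF b] by (auto simp: fibre_set_def)
      then show "y \<in> snd ` ((U \<times> V) \<inter> ?P)" by force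
    qed auto
    moreover have "\<forall>v\<in>(U \<times> V) \<inter> ?P. \<zeta> v = \<psi> (snd v)"
    proof clarify
      fix x y assume xy: "(x, y) \<in> ?P" "x \<in> U" "y \<in> V"
      show "\<zeta> (x, y) = \<psi> (snd (x, y))"
      proof
        fix i
        show "\<zeta> (x, y) i = \<psi> (snd (x, y)) i"
          using onP[OF xy(2,3)] xy(1) is_chart_Euclidean[OF b xy(3), of i] by (cases "i < k") (simp_all add: \<zeta>_def)
      qed
    qed
    moreover have "w \<in> U \<times> V" using U(1) V(2) by (simp add: mem_Times_iff)
    ultimately show ?thesis using V(1) by blast
  qed
  have P: "?P \<subseteq> pts (prod_manifold A B)" by (auto simp: fibre_set_def)
  have "w \<in> (\<Union>(k, V, \<phi>)\<in>slice_charts (prod_manifold A B) ?P. V)" if "w \<in> ?P" for w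
  proof -
    from main[OF that] obtain k U V \<psi> \<zeta> where "w \<in> U \<times> V" "(k, (U \<times> V) \<inter> ?P, \<zeta>) \<in> slice_charts (prod_manifold A B) ?P"
      "(k, V, \<psi>) \<in> charts B" "snd ` ((U \<times> V) \<inter> ?P) = V" "\<forall>v\<in>(U \<times> V) \<inter> ?P. \<zeta> v = \<psi> (snd v)"
      by (elim exE conjE)
    then show ?thesis using that by (intro UN_I[of "(k, (U \<times> V) \<inter> ?P, \<zeta>)"]) simp_all
  qed
  then have emb: "embedded_submanifold (prod_manifold A B) ?P" using P unfolding embedded_submanifold_def by blast
  then show "fibre_product_exists A f g B" by (simp add: fibre_product_exists_def)
  note sub = submanifold_atlas[OF smooth_structure_prod[OF A B] emb]
  show S: "smooth_structure (fibre_product A f g B)" unfolding fibre_product_def by (rule sub(1))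
  show "etale (fibre_product A f g B) B snd"
    unfolding etale_def
  proof
    fix w assume "w \<in> pts (fibre_product A f g B)"
    then have w: "w \<in> ?P" by (simp add: fibre_product_def)
    from main[OF w] obtain k U V \<psi> \<zeta> where *: "w \<in> U \<times> V" "(k, (U \<times> V) \<inter> ?P, \<zeta>) \<in> slice_charts (prod_manifold A B) ?P"
      "(k, V, \<psi>) \<in> charts B" "snd ` ((U \<times> V) \<inter> ?P) = V" "\<forall>v\<in>(U \<times> V) \<inter> ?P. \<zeta> v = \<psi> (snd v)"
      by (elim exE conjE)
    have "(k, (U \<times> V) \<inter> ?P, \<zeta>) \<in> charts (fibre_product A f g B)" using sub(2) *(2) unfolding fibre_product_def by blast
    from chart_cong[OF S this, of "\<lambda>v. \<psi> (snd v)"] *(5)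
    have "(k, (U \<times> V) \<inter> ?P, \<lambda>v. \<psi> (snd v)) \<in> charts (fibre_product A f g B)" by blast
    then show "\<exists>n U \<phi>. w \<in> U \<and> (n, U, \<lambda>y. \<phi> (snd y)) \<in> charts (fibre_product A f g B) \<and> (n, snd ` U, \<phi>) \<in> charts B"
      using *(1,3,4) w by (intro exI[of _ k] exI[of _ "(U \<times> V) \<inter> ?P"] exI[of _ \<psi>]) simp
  qed
qed

end


subsection \<open>Etale groupoids\<close>

lemma pts_fibre_product: "pts (fibre_product A f g B) = fibre_set A f g B"
  by (auto simp: fibre_product_def fibre_set_def)

lemma mtop_fibre_product: "mtop (fibre_product A f g B) = subtopology (prod_topology (mtop A) (mtop B)) (fibre_set A f g B)"
  by (simp add: fibre_product_def)

text \<open>Each structure map is compatible with the projections to \<open>M\<close>, hence etale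
  by \<open>etale_lift\<close>; in particular source and target are submersions, and their fibre
  product exists. What has to be supplied is the continuity of the five maps.\<close>

lemma lie_groupoid_etale:
  assumes G: "groupoid G" and G0: "smooth_manifold (G0 G)" and G1: "smooth_manifold (G1 G)" and M: "smooth_structure M"
    and p: "etale (G0 G) M p" and p1: "etale (G1 G) M p1"
    and ps: "\<And>\<gamma>. \<gamma> \<in> pts (G1 G) \<Longrightarrow> p (src G \<gamma>) = p1 \<gamma>" and pt: "\<And>\<gamma>. \<gamma> \<in> pts (G1 G) \<Longrightarrow> p (tgt G \<gamma>) = p1 \<gamma>"
    and src: "continuous_map (mtop (G1 G)) (mtop (G0 G)) (src G)" and tgt: "continuous_map (mtop (G1 G)) (mtop (G0 G)) (tgt G)"
    and unt: "continuous_map (mtop (G0 G)) (mtop (G1 G)) (unt G)" and ivs: "continuous_map (mtop (G1 G)) (mtop (G1 G)) (ivs G)"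
    and mul: "continuous_map (subtopology (prod_topology (mtop (G1 G)) (mtop (G1 G))) (fibre_set (G1 G) (src G) (tgt G) (G1 G)))
        (mtop (G1 G)) (\<lambda>(\<gamma>, \<delta>). mul G \<gamma> \<delta>)"
  shows "lie_groupoid G"
proof -
  have s0: "smooth_structure (G0 G)" and s1: "smooth_structure (G1 G)" using G0 G1 by (auto simp: smooth_manifold_iff)
  note gs = groupoid_simps[OF G]
  have es: "etale (G1 G) (G0 G) (src G)" by (rule etale_lift[OF s1 s0 M p1 p src ps])
  have et: "etale (G1 G) (G0 G) (tgt G)" by (rule etale_lift[OF s1 s0 M p1 p tgt pt])
  have eu: "etale (G0 G) (G1 G) (unt G)"
    by (rule etale_lift[OF s0 s1 M p p1 unt]) (metis gs(3,4) ps)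
  have ei: "etale (G1 G) (G1 G) (ivs G)"
    by (rule etale_lift[OF s1 s1 M p1 p1 ivs]) (metis gs(9,10) ps pt)
  note fp = fibre_product_etale[OF s1 s1 s0 es etale_smooth[OF s1 s0 et]]
  have "etale (fibre_product (G1 G) (src G) (tgt G) (G1 G)) (G1 G) (\<lambda>(\<gamma>, \<delta>). mul G \<gamma> \<delta>)"
  proof (rule etale_lift[OF fp(2) s1 M etale_comp[OF fp(2) s1 M fp(3) p1] p1])
    show "continuous_map (mtop (fibre_product (G1 G) (src G) (tgt G) (G1 G))) (mtop (G1 G)) (\<lambda>(\<gamma>, \<delta>). mul G \<gamma> \<delta>)"
      using mul by (simp add: mtop_fibre_product)
    fix w assume "w \<in> pts (fibre_product (G1 G) (src G) (tgt G) (G1 G))"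
    then obtain \<gamma> \<delta> where w: "w = (\<gamma>, \<delta>)" "\<gamma> \<in> pts (G1 G)" "\<delta> \<in> pts (G1 G)" "src G \<gamma> = tgt G \<delta>"
      by (auto simp: pts_fibre_product fibre_set_def)
    have "p1 (mul G \<gamma> \<delta>) = p (src G (mul G \<gamma> \<delta>))" using ps[OF gs(6)[OF w(2-4)]] by simp
    then show "p1 ((\<lambda>(\<gamma>, \<delta>). mul G \<gamma> \<delta>) w) = p1 (snd w)" using gs(7)[OF w(2-4)] ps w(1,3) by simp
  qed
  from etale_smooth[OF fp(2) s1 this]
  show ?thesis unfolding lie_groupoid_def
    using G G0 G1 etale_submersion[OF s1 s0 es] etale_submersion[OF s1 s0 et] etale_smooth[OF s0 s1 eu] etale_smooth[OF s1 s1 ei] fp(1)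
    by simp
qed

lemma lie_groupoid_manifold_groupoid:
  assumes M: "smooth_manifold M"
  shows "lie_groupoid (manifold_groupoid M)"
proof -
  let ?G = "manifold_groupoid M"
  have s: "smooth_structure M" using M by (simp add: smooth_manifold_iff)
  have G: "groupoid ?G" by (simp add: manifold_groupoid_def groupoid_def)
  have fst: "continuous_map (subtopology (prod_topology (mtop M) (mtop M)) S) (mtop M) (\<lambda>(x, y). x)" for S
  proof -
    have "(\<lambda>(x, y). x) = (fst :: 'a \<times> 'a \<Rightarrow> 'a)" by auto
    then show ?thesis using continuous_map_from_subtopology[OF continuous_map_fst] by simp
  qed
  have e: "etale (G0 ?G) M (\<lambda>x. x)" "etale (G1 ?G) M (\<lambda>x. x)"
    using etale_id[OF s] by (simp_all add: manifold_groupoid_def)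
  have sm: "smooth_manifold (G0 ?G)" "smooth_manifold (G1 ?G)" using M by (simp_all add: manifold_groupoid_def)
  show ?thesis
    by (rule lie_groupoid_etale[OF G sm s e]) (simp_all add: manifold_groupoid_def fst continuous_map_id[unfolded id_def] id_def)
qed


subsection \<open>Pulling back a smooth structure along a local homeomorphism\<close>

text \<open>The smooth structure that makes a local homeomorphism \<open>p\<close> etale: charts of
  \<open>M\<close> are read through \<open>p\<close> on the open sets where \<open>p\<close> is a
  homeomorphism onto its image.\<close>

definition etale_manifold :: "'b manifold \<Rightarrow> 'a topology \<Rightarrow> ('a \<Rightarrow> 'b) \<Rightarrow> 'a manifold"
  where "etale_manifold M T p = manifold_of_atlas T
    {(n, U, \<lambda>x. \<phi> (p x)) | n U \<phi>. openin T U \<and> (n, p ` U, \<phi>) \<in> charts M \<and>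
       homeomorphic_map (subtopology T U) (subtopology (mtop M) (p ` U)) p}"

lemma mtop_etale_manifold [simp]: "mtop (etale_manifold M T p) = T"
  by (simp add: etale_manifold_def)

lemma etale_manifold_etale:
  assumes M: "smooth_structure M"
    and loc: "\<And>x. x \<in> topspace T \<Longrightarrow> \<exists>U. openin T U \<and> x \<in> U \<and> openin (mtop M) (p ` U) \<and>
      homeomorphic_map (subtopology T U) (subtopology (mtop M) (p ` U)) p"
  shows "smooth_structure (etale_manifold M T p)" "etale (etale_manifold M T p) M p"
proof -
  define AA where "AA = {(n, U, \<lambda>x. \<phi> (p x)) | n U \<phi>. openin T U \<and> (n, p ` U, \<phi>) \<in> charts M \<and>
       homeomorphic_map (subtopology T U) (subtopology (mtop M) (p ` U)) p}"
  have chart: "is_chart T (n, U, \<lambda>x. \<phi> (p x))"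
    if "openin T U" "(n, p ` U, \<phi>) \<in> charts M" "homeomorphic_map (subtopology T U) (subtopology (mtop M) (p ` U)) p" for n U \<phi>
  proof -
    have "homeomorphic_map (subtopology (mtop M) (p ` U)) (subtopology (Euclidean_space n) (\<phi> ` p ` U)) \<phi>"
      "openin (Euclidean_space n) (\<phi> ` p ` U)"
      using chart_is_chart[OF M that(2)] by (auto simp: is_chart_def)
    then show ?thesis using homeomorphic_map_compose[OF that(3), of _ \<phi>] that(1)
      by (simp add: is_chart_def image_image o_def)
  qed
  have 1: "is_chart T c" if "c \<in> AA" for c using that chart unfolding AA_def by blast
  have ex: "\<exists>n U \<phi>. x \<in> U \<and> openin T U \<and> (n, p ` U, \<phi>) \<in> charts M \<and>
       homeomorphic_map (subtopology T U) (subtopology (mtop M) (p ` U)) p" if x: "x \<in> topspace T" for x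
  proof -
    obtain U where U: "openin T U" "x \<in> U" "openin (mtop M) (p ` U)"
      "homeomorphic_map (subtopology T U) (subtopology (mtop M) (p ` U)) p" using loc[OF x] by blast
    obtain n V \<phi> where V: "(n, V, \<phi>) \<in> charts M" "p x \<in> V" "V \<subseteq> p ` U"
      using chart_in_open[OF M, of "p x" "p ` U"] U(2,3) by blast
    note Vo = is_chart_open[OF chart_is_chart[OF M V(1)]]
    let ?U = "{y \<in> U. p y \<in> V}"
    have pU: "p ` ?U = V" using V(3) by auto
    have "openin (subtopology T U) {y \<in> topspace (subtopology T U). p y \<in> V}"
      by (rule openin_continuous_map_preimage[OF homeomorphic_imp_continuous_map[OF U(4)]])
         (use Vo V(3) U(3) in \<open>simp add: openin_open_subtopology\<close>)
    then have "openin T {y \<in> topspace (subtopology T U). p y \<in> V}" using U(1) openin_trans_full by blast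
    moreover have "{y \<in> topspace (subtopology T U). p y \<in> V} = ?U" using openin_subset[OF U(1)] by auto
    ultimately have Uo: "openin T ?U" by simp
    have "p ` (topspace (subtopology T U) \<inter> ?U) = topspace (subtopology (mtop M) (p ` U)) \<inter> V"
      using openin_subset[OF U(1)] openin_subset[OF Vo] V(3) by auto
    from homeomorphic_map_subtopologies[OF U(4) this]
    have "homeomorphic_map (subtopology T ?U) (subtopology (mtop M) V) p"
      using V(3) by (simp add: subtopology_subtopology Int_absorb1 Collect_conj_eq Int_assoc[symmetric])
    then show ?thesis using V(1,2) U(2) Uo pU by (intro exI[of _ n] exI[of _ ?U] exI[of _ \<phi>]) simp
  qed
  have 2: "topspace T \<subseteq> (\<Union>(n, U, \<phi>)\<in>AA. U)"
  proof
    fix x assume "x \<in> topspace T"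
    from ex[OF this] obtain n U \<phi> where "x \<in> U" "(n, U, \<lambda>x. \<phi> (p x)) \<in> AA" unfolding AA_def by blast
    then show "x \<in> (\<Union>(n, U, \<phi>)\<in>AA. U)" by (intro UN_I[of "(n, U, \<lambda>x. \<phi> (p x))"]) simp_all
  qed
  have half: "chart_smooth (n, U, \<lambda>x. \<phi> (p x)) (U \<inter> V) m (\<lambda>x. \<psi> (p x))"
    if U: "openin T U" "(n, p ` U, \<phi>) \<in> charts M" "homeomorphic_map (subtopology T U) (subtopology (mtop M) (p ` U)) p"
      and V: "openin T V" "(m, p ` V, \<psi>) \<in> charts M" for n U \<phi> m V \<psi>
    unfolding chart_smooth_def smooth_fun_def prod.case
  proof (intro allI impI)
    fix i k assume i: "i < m"
    have "openin T (U \<inter> V)" using U(1) V(1) by blast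
    then have op: "openin (Euclidean_space n) ((\<lambda>x. \<phi> (p x)) ` (U \<inter> V))"
      using is_chart_image_open[OF chart[OF U], of "U \<inter> V"] by blast
    have inj: "inj_on (\<lambda>x. \<phi> (p x)) U" "inj_on \<phi> (p ` U)"
      using is_chart_inj[OF chart[OF U]] is_chart_inj[OF chart_is_chart[OF M U(2)]] .
    have "chart_smooth (n, p ` U, \<phi>) (p ` (U \<inter> V)) m \<psi>" by (rule chart_change[OF M U(2) V(2)]) blast
    then have "Ck n k (\<phi> ` p ` (U \<inter> V)) (\<lambda>x. \<psi> (inv_into (p ` U) \<phi> x) i)"
      using i unfolding chart_smooth_def smooth_fun_def prod.case by blast
    then show "Ck n k ((\<lambda>x. \<phi> (p x)) ` (U \<inter> V)) (\<lambda>x. \<psi> (p (inv_into U (\<lambda>x. \<phi> (p x)) x)) i)"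
      unfolding image_image
    proof (rule Ck_cong[OF op, rotated])
      fix y assume "y \<in> (\<lambda>x. \<phi> (p x)) ` (U \<inter> V)"
      then obtain v where "v \<in> U" "y = \<phi> (p v)" by blast
      then show "\<psi> (inv_into (p ` U) \<phi> y) i = \<psi> (p (inv_into U (\<lambda>x. \<phi> (p x)) y)) i"
        using inv_into_f_f[OF inj(1)] inv_into_f_f[OF inj(2)] by simp
    qed
  qed
  have 3: "compatible_charts c d" if cd: "c \<in> AA" "d \<in> AA" for c d
  proof -
    obtain n U \<phi> where c: "c = (n, U, \<lambda>x. \<phi> (p x))" "openin T U" "(n, p ` U, \<phi>) \<in> charts M"
      "homeomorphic_map (subtopology T U) (subtopology (mtop M) (p ` U)) p" using cd(1) unfolding AA_def by blast
    obtain m V \<psi> where d: "d = (m, V, \<lambda>x. \<psi> (p x))" "openin T V" "(m, p ` V, \<psi>) \<in> charts M"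
      "homeomorphic_map (subtopology T V) (subtopology (mtop M) (p ` V)) p" using cd(2) unfolding AA_def by blast
    show ?thesis using half[OF c(2-4) d(2,3)] half[OF d(2-4) c(2,3)]
      unfolding c(1) d(1) compatible_charts_iff by (simp add: Int_commute)
  qed
  have eq: "etale_manifold M T p = manifold_of_atlas T AA" by (simp add: etale_manifold_def AA_def)
  note atlas = smooth_structure_manifold_of_atlas[OF 1 2 3]
  show "smooth_structure (etale_manifold M T p)" unfolding eq by (rule atlas(1))
  show "etale (etale_manifold M T p) M p"
    unfolding etale_def
  proof
    fix x assume "x \<in> pts (etale_manifold M T p)"
    then have "x \<in> topspace T" by simp
    from ex[OF this] obtain n U \<phi> where *: "x \<in> U" "openin T U" "(n, p ` U, \<phi>) \<in> charts M"
       "homeomorphic_map (subtopology T U) (subtopology (mtop M) (p ` U)) p" by blast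
    then have "(n, U, \<lambda>x. \<phi> (p x)) \<in> AA" unfolding AA_def by blast
    then have "(n, U, \<lambda>x. \<phi> (p x)) \<in> charts (etale_manifold M T p)" using atlas(2) unfolding eq by blast
    then show "\<exists>n U \<phi>. x \<in> U \<and> (n, U, \<lambda>y. \<phi> (p y)) \<in> charts (etale_manifold M T p) \<and> (n, p ` U, \<phi>) \<in> charts M"
      using *(1,3) by blast
  qed
qed


subsection \<open>Open submanifolds and discrete manifolds\<close>

lemma open_submanifold_etale:
  assumes M: "smooth_structure M" and U: "openin (mtop M) U"
  shows "smooth_structure (open_submanifold M U)" "etale (open_submanifold M U) M (\<lambda>x. x)"
proof -
  have UM: "U \<subseteq> pts M" by (rule openin_subset[OF U])
  have sub: "subtopology (subtopology (mtop M) U) V = subtopology (mtop M) V" if "V \<subseteq> U" for V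
    using that by (simp add: subtopology_subtopology Int_absorb1)
  have is_chart_iff: "is_chart (subtopology (mtop M) U) (n, V, \<phi>) \<longleftrightarrow> is_chart (mtop M) (n, V, \<phi>) \<and> V \<subseteq> U" for n V \<phi>
    using U sub[of V] by (auto simp: is_chart_def openin_open_subtopology)
  show S: "smooth_structure (open_submanifold M U)"
    unfolding smooth_structure_def
  proof (intro conjI ballI allI impI)
    fix c assume "c \<in> charts (open_submanifold M U)"
    then show "is_chart (mtop (open_submanifold M U)) c"
      using chart_is_chart[OF M] by (cases c) (simp add: is_chart_iff)
  next
    show "(\<Union>(n, V, \<phi>)\<in>charts (open_submanifold M U). V) = pts (open_submanifold M U)"
    proof (intro subset_antisym subsetI)
      fix x assume "x \<in> pts (open_submanifold M U)"
      then have "x \<in> U" by simp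
      then obtain n V \<phi> where "(n, V, \<phi>) \<in> charts M" "x \<in> V" "V \<subseteq> U" by (rule chart_in_open[OF M _ U])
      then show "x \<in> (\<Union>(n, V, \<phi>)\<in>charts (open_submanifold M U). V)" by (intro UN_I[of "(n, V, \<phi>)"]) simp_all
    next
      fix x assume "x \<in> (\<Union>(n, V, \<phi>)\<in>charts (open_submanifold M U). V)"
      then obtain n V \<phi> where "(n, V, \<phi>) \<in> charts (open_submanifold M U)" "x \<in> V" by blast
      then show "x \<in> pts (open_submanifold M U)" using UM by auto
    qed
  next
    fix c d assume "c \<in> charts (open_submanifold M U)" "d \<in> charts (open_submanifold M U)"
    then have "c \<in> charts M" "d \<in> charts M" by (auto simp: open_submanifold_def)
    then show "compatible_charts c d" using M unfolding smooth_structure_def by blast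
  next
    fix c assume c: "is_chart (mtop (open_submanifold M U)) c \<and> (\<forall>d\<in>charts (open_submanifold M U). compatible_charts c d)"
    obtain n V \<phi> where cc: "c = (n, V, \<phi>)" by (metis prod_cases3)
    have V: "is_chart (mtop M) (n, V, \<phi>)" "V \<subseteq> U" using c by (auto simp: cc is_chart_iff)
    \<comment> \<open>A chart \<open>d\<close> of \<open>M\<close> may leave \<open>U\<close>, and
      \<open>c\<close> is only known to be compatible with charts inside \<open>U\<close>.
      Restricting \<open>d\<close> to \<open>U\<close> does not change its overlap with
      \<open>V\<close>.\<close>
    have "compatible_charts c d" if d: "d \<in> charts M" for d
    proof -
      obtain m Q \<psi> where dd: "d = (m, Q, \<psi>)" by (metis prod_cases3)
      note d' = chart_is_chart[OF M d[unfolded dd]]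
      have QU: "openin (mtop M) (Q \<inter> U)" and VQ: "openin (mtop M) (V \<inter> Q)"
        using U is_chart_open[OF d'] is_chart_open[OF V(1)] by auto
      have "(m, Q \<inter> U, \<psi>) \<in> charts (open_submanifold M U)"
        using chart_restrict[OF M d[unfolded dd], of "Q \<inter> U"] QU by simp
      then have "compatible_charts (n, V, \<phi>) (m, Q \<inter> U, \<psi>)" using c cc by blast
      moreover have "V \<inter> (Q \<inter> U) = V \<inter> Q" using V(2) by blast
      ultimately have "chart_smooth (n, V, \<phi>) (V \<inter> Q) m \<psi>" "chart_smooth (m, Q \<inter> U, \<psi>) (V \<inter> Q) n \<phi>"
        by (simp_all add: compatible_charts_iff)
      moreover have "V \<inter> Q \<subseteq> Q \<inter> U" using V(2) by blast
      ultimately show ?thesis using chart_smooth_restrict[OF d' _ QU _ VQ] by (simp add: cc dd compatible_charts_iff)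
    qed
    then have "c \<in> charts M" using M V(1) cc unfolding smooth_structure_def by blast
    then show "c \<in> charts (open_submanifold M U)" using V(2) by (simp add: cc)
  qed
  show "etale (open_submanifold M U) M (\<lambda>x. x)"
    unfolding etale_def
  proof
    fix x assume "x \<in> pts (open_submanifold M U)"
    then have "x \<in> U" by simp
    then obtain n V \<phi> where "(n, V, \<phi>) \<in> charts M" "x \<in> V" "V \<subseteq> U" by (rule chart_in_open[OF M _ U])
    then show "\<exists>n V \<phi>. x \<in> V \<and> (n, V, \<lambda>y. \<phi> y) \<in> charts (open_submanifold M U) \<and> (n, (\<lambda>x. x) ` V, \<phi>) \<in> charts M"
      by (intro exI[of _ n] exI[of _ V] exI[of _ \<phi>]) simp
  qed
qed

lemma discrete_manifold_chart:
  shows "smooth_structure (discrete_manifold A)" "a \<in> A \<Longrightarrow> (0, {a}, \<lambda>_ _. 0) \<in> charts (discrete_manifold A)"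
    "mtop (discrete_manifold A) = discrete_topology A"
proof -
  let ?X = "discrete_topology A" and ?AA = "(\<lambda>a. (0, {a}, \<lambda>_ _. 0)) ` A"
  have E0: "topspace (Euclidean_space 0) = {\<lambda>_. 0}" by (auto simp: topspace_Euclidean_space fun_eq_iff)
  have 1: "is_chart ?X c" if "c \<in> ?AA" for c
  proof -
    obtain a where a: "a \<in> A" "c = (0, {a}, \<lambda>_ _. 0)" using \<open>c \<in> ?AA\<close> by blast
    have "homeomorphic_maps (subtopology ?X {a}) (subtopology (Euclidean_space 0) {\<lambda>_. 0}) (\<lambda>_ _. 0) (\<lambda>_. a)"
      unfolding homeomorphic_maps_def using a(1) E0 by (auto simp: continuous_map_in_subtopology)
    then show ?thesis unfolding a(2) is_chart_def using a(1) E0 openin_topspace[of "Euclidean_space 0"]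
      by (auto simp: homeomorphic_map_maps)
  qed
  have 2: "topspace ?X \<subseteq> (\<Union>(n, U, \<phi>)\<in>?AA. U)" by auto
  have 3: "compatible_charts c d" if "c \<in> ?AA" "d \<in> ?AA" for c d
    using that by (auto simp: compatible_charts_iff chart_smooth_def)
  show "smooth_structure (discrete_manifold A)" "a \<in> A \<Longrightarrow> (0, {a}, \<lambda>_ _. 0) \<in> charts (discrete_manifold A)"
    using smooth_structure_manifold_of_atlas[OF 1 2 3] unfolding discrete_manifold_def by blast+
  show "mtop (discrete_manifold A) = ?X" by (simp add: discrete_manifold_def)
qed

lemma smooth_manifold_discrete: "smooth_manifold (discrete_manifold A)"
proof -
  have "paracompact_space (discrete_topology A)"
    unfolding paracompact_space_def
  proof (intro allI impI)
    fix \<U> :: "'a set set" assume U: "(\<forall>U\<in>\<U>. openin (discrete_topology A) U) \<and> \<Union>\<U> = topspace (discrete_topology A)"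
    have "locally_finite_in (discrete_topology A) ((\<lambda>a. {a}) ` A)"
      unfolding locally_finite_in_def
    proof (intro conjI ballI)
      fix a assume "a \<in> topspace (discrete_topology A)"
      moreover have "{U \<in> (\<lambda>a. {a}) ` A. U \<inter> {a} \<noteq> {}} \<subseteq> {{a}}" by auto
      then have "finite {U \<in> (\<lambda>a. {a}) ` A. U \<inter> {a} \<noteq> {}}" by (rule finite_subset) simp
      ultimately show "\<exists>V. openin (discrete_topology A) V \<and> a \<in> V \<and> finite {U \<in> (\<lambda>a. {a}) ` A. U \<inter> V \<noteq> {}}"
        by (intro exI[of _ "{a}"]) simp
    qed auto
    then show "\<exists>\<V>. (\<forall>V\<in>\<V>. openin (discrete_topology A) V \<and> (\<exists>U\<in>\<U>. V \<subseteq> U)) \<and> \<Union>\<V> = topspace (discrete_topology A) \<and>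
        locally_finite_in (discrete_topology A) \<V>"
      using U by (intro exI[of _ "(\<lambda>a. {a}) ` A"]) auto
  qed
  then show ?thesis by (simp add: smooth_manifold_iff discrete_manifold_chart)
qed

lemma etale_discrete: "etale (discrete_manifold A) (discrete_manifold {b}) (\<lambda>_. b)"
  unfolding etale_def
proof
  fix a assume "a \<in> pts (discrete_manifold A)"
  then have "a \<in> A" by (simp add: discrete_manifold_chart)
  then show "\<exists>n U \<phi>. a \<in> U \<and> (n, U, \<lambda>y. \<phi> b) \<in> charts (discrete_manifold A) \<and> (n, (\<lambda>_. b) ` U, \<phi>) \<in> charts (discrete_manifold {b})"
    using discrete_manifold_chart(2)[of a A] discrete_manifold_chart(2)[of b "{b}"]
    by (intro exI[of _ 0] exI[of _ "{a}"] exI[of _ "\<lambda>_ _. 0"]) simp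
qed

text \<open>A continuous map to a discrete space is locally constant, and a chart of dimension 0 has
  no component to be smooth.\<close>

lemma smooth_map_into_discrete:
  assumes M: "smooth_structure M" and f: "continuous_map (mtop M) (discrete_topology A) f"
  shows "smooth_map M (discrete_manifold A) f"
proof (rule smooth_mapI)
  fix x assume x: "x \<in> pts M"
  then have fx: "f x \<in> A" using continuous_map_funspace[OF f] by auto
  have "openin (mtop M) {y \<in> pts M. f y \<in> {f x}}" by (rule openin_continuous_map_preimage[OF f]) (use fx in simp)
  then obtain n U \<phi> where U: "(n, U, \<phi>) \<in> charts M" "x \<in> U" "U \<subseteq> {y \<in> pts M. f y \<in> {f x}}"
    using chart_in_open[OF M, of x "{y \<in> pts M. f y \<in> {f x}}"] x by blast
  then show "\<exists>n U \<phi> m V \<psi>. (n, U, \<phi>) \<in> charts M \<and> (m, V, \<psi>) \<in> charts (discrete_manifold A) \<and>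
      x \<in> U \<and> f ` U \<subseteq> V \<and> chart_smooth (n, U, \<phi>) U m (\<lambda>x. \<psi> (f x))"
    using discrete_manifold_chart(2)[OF fx]
    by (intro exI[of _ n] exI[of _ U] exI[of _ \<phi>] exI[of _ 0] exI[of _ "{f x}"] exI[of _ "\<lambda>_ _. 0"]) (auto simp: chart_smooth_def)
qed

subsection \<open>Groups as Lie groupoids\<close>

lemma lie_groupoid_group_groupoid:
  assumes K: "group K" and c: "inj_on c (carrier K)"
  shows "lie_groupoid (group_groupoid c K)"
proof -
  interpret group K by (rule K)
  let ?G = "group_groupoid c K" and ?pt = "c \<one>\<^bsub>K\<^esub>"
  have d [simp]: "inv_into (carrier K) c (c k) = k" if "k \<in> carrier K" for k using c that by simp
  have sel: "G0 ?G = discrete_manifold {?pt}" "G1 ?G = discrete_manifold (c ` carrier K)" "src ?G = (\<lambda>_. ?pt)" "tgt ?G = (\<lambda>_. ?pt)"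
    "unt ?G = (\<lambda>_. ?pt)" "ivs ?G = (\<lambda>x. c (inv\<^bsub>K\<^esub> (inv_into (carrier K) c x)))"
    "mul ?G = (\<lambda>x y. c (inv_into (carrier K) c x \<otimes>\<^bsub>K\<^esub> inv_into (carrier K) c y))"
    by (simp_all add: group_groupoid_def Let_def)
  have gr: "groupoid ?G"
    unfolding groupoid_def sel by (auto simp: discrete_manifold_chart m_assoc)
  show ?thesis
  proof (rule lie_groupoid_etale[OF gr])
    show "etale (G0 ?G) (discrete_manifold {?pt}) (\<lambda>_. ?pt)" "etale (G1 ?G) (discrete_manifold {?pt}) (\<lambda>_. ?pt)"
      unfolding sel by (rule etale_discrete)+
    show "continuous_map (subtopology (prod_topology (mtop (G1 ?G)) (mtop (G1 ?G))) (fibre_set (G1 ?G) (src ?G) (tgt ?G) (G1 ?G)))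
        (mtop (G1 ?G)) (\<lambda>(\<gamma>, \<delta>). mul ?G \<gamma> \<delta>)"
      unfolding sel discrete_manifold_chart(3) prod_topology_discrete_topology[symmetric] subtopology_discrete_topology
      by auto
  qed (auto simp: sel discrete_manifold_chart smooth_manifold_discrete)
qed


section \<open>The circle as a manifold\<close>

lemma smooth_fun_const: "smooth_fun c S (\<lambda>_. r)"
  by (cases c) (simp add: smooth_fun_def Ck_const)

lemma smooth_fun_add: "smooth_fun c S g \<Longrightarrow> smooth_fun c S h \<Longrightarrow> smooth_fun c S (\<lambda>x. g x + h x)"
  by (cases c) (simp add: smooth_fun_def Ck_add)

lemma smooth_fun_mult: "smooth_fun c S g \<Longrightarrow> smooth_fun c S h \<Longrightarrow> smooth_fun c S (\<lambda>x. g x * h x)"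
  by (cases c) (simp add: smooth_fun_def Ck_mult)

lemma smooth_fun_inverse:
  assumes h: "smooth_fun (n, U, \<phi>) U h" and nz: "\<And>x. x \<in> U \<Longrightarrow> h x \<noteq> 0"
  shows "smooth_fun (n, U, \<phi>) U (\<lambda>x. inverse (h x))"
  unfolding smooth_fun_def prod.case
proof
  fix k
  show "Ck n k (\<phi> ` U) (\<lambda>x. inverse (h (inv_into U \<phi> x)))"
  proof (rule Ck_inverse)
    show "Ck n k (\<phi> ` U) (\<lambda>x. h (inv_into U \<phi> x))" using h by (simp add: smooth_fun_def)
    fix x assume "x \<in> \<phi> ` U"
    then show "h (inv_into U \<phi> x) \<noteq> 0" by (intro nz inv_into_into)
  qed
qed

context
  fixes e :: "complex \<Rightarrow> 'u"
  assumes e: "inj e"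
begin

abbreviation plane_inv :: "'u \<Rightarrow> complex"
  where "plane_inv \<equiv> inv_into UNIV e"

definition plane_coord :: "'u \<Rightarrow> nat \<Rightarrow> real"
  where "plane_coord = (\<lambda>x i. if i = 0 then Re (plane_inv x) else if i = 1 then Im (plane_inv x) else 0)"

lemma mtop_plane: "mtop (plane e) = pullback_topology (range e) plane_inv euclidean"
  by (simp add: plane_def)

lemma pts_plane [simp]: "pts (plane e) = range e"
  by (simp add: mtop_plane topspace_pullback_topology)

lemma plane_inv_e [simp]: "plane_inv (e z) = z"
  using e by simp

lemma openin_plane: "openin (mtop (plane e)) S \<longleftrightarrow> (\<exists>W. open W \<and> S = e ` W)"
proof -
  have "plane_inv -` W \<inter> range e = e ` W" for W using e by auto
  then show ?thesis by (simp add: mtop_plane openin_pullback_topology)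
qed

lemma continuous_map_plane_inv: "continuous_map (mtop (plane e)) euclidean plane_inv"
  unfolding continuous_map_def
proof (intro conjI allI impI)
  fix W :: "complex set" assume W: "openin euclidean W"
  have "{x \<in> pts (plane e). plane_inv x \<in> W} = e ` W" using e by auto
  then show "openin (mtop (plane e)) {x \<in> pts (plane e). plane_inv x \<in> W}" using W by (auto simp: openin_plane)
qed simp

lemma continuous_map_into_plane:
  assumes "continuous_map Y euclidean f"
  shows "continuous_map Y (mtop (plane e)) (\<lambda>y. e (f y))"
  unfolding continuous_map_def
proof (intro conjI allI impI)
  fix S assume "openin (mtop (plane e)) S"
  then obtain W where W: "open W" "S = e ` W" by (auto simp: openin_plane)
  have "{y \<in> topspace Y. e (f y) \<in> S} = {y \<in> topspace Y. f y \<in> W}" using e W(2) by (auto simp: inj_def)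
  then show "openin Y {y \<in> topspace Y. e (f y) \<in> S}" using openin_continuous_map_preimage[OF assms, of W] W(1) by simp
qed simp

lemma plane_subset_Hausdorff: "Hausdorff_space (subtopology (mtop (plane e)) S)"
proof -
  have "Hausdorff_space (mtop (plane e))"
    unfolding Hausdorff_space_def
  proof (intro allI impI)
    fix x y assume xy: "x \<in> pts (plane e) \<and> y \<in> pts (plane e) \<and> x \<noteq> y"
    then obtain z w where zw: "x = e z" "y = e w" "z \<noteq> w" by auto
    obtain U V where "open U" "open V" "z \<in> U" "w \<in> V" "U \<inter> V = {}" using hausdorff[OF zw(3)] by blast
    then show "\<exists>U V. openin (mtop (plane e)) U \<and> openin (mtop (plane e)) V \<and> x \<in> U \<and> y \<in> V \<and> disjnt U V"
      using zw e by (intro exI[of _ "e ` U"] exI[of _ "e ` V"]) (auto simp: openin_plane disjnt_def inj_def)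
  qed
  then show ?thesis by (rule Hausdorff_space_subtopology)
qed

lemma openin_plane_subset:
  "openin (subtopology (mtop (plane e)) (e ` S)) T \<longleftrightarrow> (\<exists>W. open W \<and> T = e ` (W \<inter> S))"
proof -
  have "e ` W \<inter> e ` S = e ` (W \<inter> S)" for W using e by (simp add: image_Int)
  then show ?thesis unfolding openin_subtopology openin_plane by metis
qed

text \<open>Open covers are moved through \<open>e\<close> to families of open sets of complex
  numbers, where paracompactness of a metric space applies. The circle, its arcs and the arrows of
  the double cover are all subsets of this kind.\<close>

lemma plane_subset_paracompact: "paracompact_space (subtopology (mtop (plane e)) (e ` S))"
  unfolding paracompact_space_def
proof (intro allI impI)
  let ?X = "subtopology (mtop (plane e)) (e ` S)"
  have topX: "topspace ?X = e ` S" by auto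
  fix \<U> assume U: "(\<forall>U\<in>\<U>. openin ?X U) \<and> \<Union>\<U> = topspace ?X"
  let ?C = "{W. open W \<and> (\<exists>U\<in>\<U>. e ` (W \<inter> S) \<subseteq> U)}"
  have cover: "S \<subseteq> \<Union>?C"
  proof
    fix z assume "z \<in> S"
    then have "e z \<in> \<Union>\<U>" using U topX by simp
    then obtain Q where Q: "Q \<in> \<U>" "e z \<in> Q" by blast
    then have "openin ?X Q" using U by blast
    then obtain W where W: "open W" "Q = e ` (W \<inter> S)" unfolding openin_plane_subset by blast
    then have "z \<in> W" using Q(2) e by (auto simp: inj_def)
    moreover have "W \<in> ?C" using W Q(1) by blast
    ultimately show "z \<in> \<Union>?C" by blast
  qed
  have opC: "open W" if "W \<in> ?C" for W using that by simp
  obtain C' where C': "S \<subseteq> \<Union>C'" "\<And>W. W \<in> C' \<Longrightarrow> open W \<and> (\<exists>T. T \<in> ?C \<and> W \<subseteq> T)"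
    "\<And>z. z \<in> S \<Longrightarrow> \<exists>V. open V \<and> z \<in> V \<and> finite {W. W \<in> C' \<and> W \<inter> V \<noteq> {}}"
  proof (rule paracompact[OF cover opC])
    fix D assume D: "S \<subseteq> \<Union>D" "\<And>W. W \<in> D \<Longrightarrow> open W \<and> (\<exists>T. T \<in> ?C \<and> W \<subseteq> T)"
      "\<And>z. z \<in> S \<Longrightarrow> \<exists>V. open V \<and> z \<in> V \<and> finite {W. W \<in> D \<and> W \<inter> V \<noteq> {}}"
    show thesis by (rule that[OF D])
  qed
  let ?V = "(\<lambda>W. e ` (W \<inter> S)) ` C'"
  have "\<forall>V\<in>?V. openin ?X V \<and> (\<exists>U\<in>\<U>. V \<subseteq> U)"
  proof
    fix V assume "V \<in> ?V"
    then obtain W where W: "W \<in> C'" "V = e ` (W \<inter> S)" by blast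
    from C'(2)[OF W(1)] obtain Q where Q: "Q \<in> ?C" "W \<subseteq> Q" "open W" by (elim conjE exE)
    from Q(1) obtain R where R: "R \<in> \<U>" "e ` (Q \<inter> S) \<subseteq> R" by blast
    have "V \<subseteq> R" using W(2) Q(2) R(2) by blast
    moreover have "openin ?X V" unfolding openin_plane_subset using W(2) Q(3) by (intro exI[of _ W] conjI)
    ultimately show "openin ?X V \<and> (\<exists>U\<in>\<U>. V \<subseteq> U)" using R(1) by (intro conjI bexI[of _ R])
  qed
  moreover have un: "\<Union>?V = topspace ?X"
  proof -
    have "\<Union>?V = e ` (\<Union>C' \<inter> S)" by blast
    also have "\<Union>C' \<inter> S = S" using C'(1) by blast
    finally show ?thesis using topX by simp
  qed
  moreover have "locally_finite_in ?X ?V"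
    unfolding locally_finite_in_def
  proof (intro conjI ballI)
    fix x assume "x \<in> topspace ?X"
    then obtain z where z: "z \<in> S" "x = e z" using topX by blast
    from C'(3)[OF z(1)] obtain V where V: "open V" "z \<in> V" "finite {W. W \<in> C' \<and> W \<inter> V \<noteq> {}}" by (elim conjE exE)
    have "{U \<in> ?V. U \<inter> e ` (V \<inter> S) \<noteq> {}} \<subseteq> (\<lambda>W. e ` (W \<inter> S)) ` {W. W \<in> C' \<and> W \<inter> V \<noteq> {}}"
    proof
      fix U assume "U \<in> {U \<in> ?V. U \<inter> e ` (V \<inter> S) \<noteq> {}}"
      then obtain W where W: "W \<in> C'" "U = e ` (W \<inter> S)" "U \<inter> e ` (V \<inter> S) \<noteq> {}" by blast
      then have "W \<inter> V \<noteq> {}" using e by (auto simp: inj_def)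
      then show "U \<in> (\<lambda>W. e ` (W \<inter> S)) ` {W. W \<in> C' \<and> W \<inter> V \<noteq> {}}" using W by blast
    qed
    then have "finite {U \<in> ?V. U \<inter> e ` (V \<inter> S) \<noteq> {}}" using V(3) by (meson finite_imageI finite_subset)
    moreover have "openin ?X (e ` (V \<inter> S))" using V(1) unfolding openin_plane_subset by blast
    moreover have "x \<in> e ` (V \<inter> S)" using z V(2) by blast
    ultimately show "\<exists>V. openin ?X V \<and> x \<in> V \<and> finite {U \<in> ?V. U \<inter> V \<noteq> {}}"
      by (intro exI[of _ "e ` (V \<inter> S)"] conjI)
  qed (use un in blast)
  ultimately have "(\<forall>V\<in>?V. openin ?X V \<and> (\<exists>U\<in>\<U>. V \<subseteq> U)) \<and> \<Union>?V = topspace ?X \<and> locally_finite_in ?X ?V"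
    by (intro conjI)
  then show "\<exists>\<V>. (\<forall>V\<in>\<V>. openin ?X V \<and> (\<exists>U\<in>\<U>. V \<subseteq> U)) \<and> \<Union>\<V> = topspace ?X \<and> locally_finite_in ?X \<V>"
    by (rule exI)
qed

lemma plane_chart: "smooth_structure (plane e)" "(2, range e, plane_coord) \<in> charts (plane e)"
proof -
  let ?X = "mtop (plane e)"
  define g where "g = (\<lambda>z::nat \<Rightarrow> real. e (Complex (z 0) (z 1)))"
  have im: "plane_coord ` range e = topspace (Euclidean_space 2)"
  proof (intro subset_antisym subsetI)
    fix z assume z: "z \<in> topspace (Euclidean_space 2)"
    have "plane_coord (e (Complex (z 0) (z 1))) i = z i" for i
      using z by (cases i; cases "i - 1") (auto simp: plane_coord_def topspace_Euclidean_space numeral_2_eq_2)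
    then have "z = plane_coord (e (Complex (z 0) (z 1)))" by (simp add: fun_eq_iff)
    then show "z \<in> plane_coord ` range e" by blast
  qed (auto simp: topspace_Euclidean_space plane_coord_def)
  have top: "subtopology ?X (range e) = ?X" by (metis pts_plane subtopology_topspace)
  have "homeomorphic_maps ?X (Euclidean_space 2) plane_coord g"
    unfolding homeomorphic_maps_def
  proof (intro conjI ballI)
    have "continuous_on UNIV Re" "continuous_on UNIV Im"
      by (rule continuous_on_Re[OF continuous_on_id], rule continuous_on_Im[OF continuous_on_id])
    then have "continuous_map ?X euclideanreal (\<lambda>x. Re (plane_inv x))" "continuous_map ?X euclideanreal (\<lambda>x. Im (plane_inv x))"
      using continuous_map_compose[OF continuous_map_plane_inv, of euclideanreal Re]
        continuous_map_compose[OF continuous_map_plane_inv, of euclideanreal Im]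
      by (auto simp: o_def)
    then show "continuous_map ?X (Euclidean_space 2) plane_coord"
      by (intro continuous_map_into_Euclidean) (auto simp: plane_coord_def topspace_Euclidean_space less_2_cases_iff)
    have c: "continuous_on UNIV (\<lambda>z::nat \<Rightarrow> real. z i)" for i by (rule continuous_on_product_coordinates)
    have "continuous_on UNIV (\<lambda>z::nat \<Rightarrow> real. Complex (z 0) (z 1))"
      using c[of 0] c[of 1] by (simp add: Complex_eq continuous_intros)
    then have "continuous_on {z. \<forall>i\<ge>2. z i = 0} (\<lambda>z::nat \<Rightarrow> real. Complex (z 0) (z 1))"
      by (rule continuous_on_subset) simp
    then show "continuous_map (Euclidean_space 2) ?X g"
      unfolding g_def by (intro continuous_map_into_plane) (simp add: Euclidean_space_eq)
    fix x assume "x \<in> topspace ?X"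
    then show "g (plane_coord x) = x" by (auto simp: g_def plane_coord_def complex_surj)
  next
    fix z assume z: "z \<in> topspace (Euclidean_space 2)"
    show "plane_coord (g z) = z"
    proof
      fix i show "plane_coord (g z) i = z i"
        using z by (cases i; cases "i - 1") (auto simp: g_def plane_coord_def topspace_Euclidean_space numeral_2_eq_2)
    qed
  qed
  then have ch: "is_chart ?X (2, range e, plane_coord)"
    unfolding is_chart_def using im top openin_topspace[of ?X] by (auto simp: homeomorphic_map_maps)
  have eq: "plane e = manifold_of_atlas ?X {(2, range e, plane_coord)}"
    by (simp add: plane_def plane_coord_def)
  have co: "compatible_charts (2, range e, plane_coord) (2, range e, plane_coord)"
    using chart_smooth_coord[OF ch order_refl is_chart_open[OF ch]] by (simp add: compatible_charts_iff)
  have "smooth_structure (manifold_of_atlas ?X {(2, range e, plane_coord)})"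
    "{(2, range e, plane_coord)} \<subseteq> charts (manifold_of_atlas ?X {(2, range e, plane_coord)})"
    using smooth_structure_manifold_of_atlas[of "{(2, range e, plane_coord)}" ?X] ch co by auto
  then show "smooth_structure (plane e)" "(2, range e, plane_coord) \<in> charts (plane e)"
    using eq by auto
qed

text \<open>
  The line of slope \<open>t\<close> through \<open>-c\<close> meets the circle a second time at horizontal distance
  \<open>2 / (1 + t\<^sup>2)\<close>; the second coordinate measures the displacement along this line from the circle.
\<close>

definition circle_coord :: "real \<Rightarrow> 'u \<Rightarrow> nat \<Rightarrow> real"
  where "circle_coord c x i = (let l = 1 + c * Re (plane_inv x); t = Im (plane_inv x) * inverse l
     in if i = 0 then t else if i = 1 then l - 2 * inverse (1 + t * t) else 0)"

text \<open>For \<open>c\<close> equal to 1 or -1 the point \<open>- c\<close> lies on the circle,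
  and \<open>W\<close> omits the vertical line through it, where the slope is infinite. The inverse
  of the coordinates is rational: \<open>lam z\<close> is the signed horizontal distance and
  \<open>z 0 * lam z\<close> the height, so both directions are smooth.\<close>

lemma circle_slice_chart:
  assumes c: "c * c = 1"
  defines "W \<equiv> e ` {z. 1 + c * Re z \<noteq> 0}"
  shows "(2, W, circle_coord c) \<in> charts (plane e)"
    "circle_coord c ` (W \<inter> e ` sphere 0 1) = {x \<in> circle_coord c ` W. \<forall>i\<ge>1. x i = 0}"
proof -
  have "open {z. 1 + c * Re z \<noteq> 0}" by (intro open_Collect_neq continuous_intros)
  then have Wo: "openin (mtop (plane e)) W" unfolding W_def openin_plane by blast
  have ch: "(2, W, plane_coord) \<in> charts (plane e)"
    by (rule chart_restrict[OF plane_chart]) (use Wo in \<open>auto simp: W_def\<close>)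
  note ch' = chart_is_chart[OF plane_chart(1) ch]
  define lam where "lam = (\<lambda>z::nat \<Rightarrow> real. z 1 + 2 * inverse (1 + z 0 * z 0))"
  have nz: "1 + t * t \<noteq> 0" for t :: real using zero_le_square[of t] by linarith
  have lam: "lam (circle_coord c x) = 1 + c * Re (plane_inv x)" for x
    by (simp add: lam_def circle_coord_def Let_def)
  have Wnz: "1 + c * Re (plane_inv x) \<noteq> 0" if "x \<in> W" for x using that by (auto simp: W_def)
  have re: "Re (plane_inv x) = c * (lam (circle_coord c x) - 1)" for x
    using c by (simp add: lam mult.assoc[symmetric])
  have im: "Im (plane_inv x) = circle_coord c x 0 * lam (circle_coord c x)" if "x \<in> W" for x
    using Wnz[OF that] by (simp add: lam) (simp add: circle_coord_def Let_def)
  have WE: "x = e (plane_inv x)" if "x \<in> W" for x using that by (auto simp: W_def)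
  have inj: "inj_on (circle_coord c) W"
  proof (rule inj_onI)
    fix x y assume xy: "x \<in> W" "y \<in> W" "circle_coord c x = circle_coord c y"
    then have "plane_inv x = plane_inv y" using re[of x] re[of y] im[of x] im[of y] by (simp add: complex_eq_iff)
    then show "x = y" using WE xy by metis
  qed
  have E2: "circle_coord c x \<in> topspace (Euclidean_space 2)" for x
    by (auto simp: circle_coord_def Let_def topspace_Euclidean_space)
  have img: "circle_coord c ` W = {z \<in> topspace (Euclidean_space 2). lam z \<in> - {0}}"
  proof (intro subset_antisym subsetI)
    fix z assume "z \<in> circle_coord c ` W"
    then show "z \<in> {z \<in> topspace (Euclidean_space 2). lam z \<in> - {0}}" using E2 lam Wnz by auto
  next
    fix z assume z: "z \<in> {z \<in> topspace (Euclidean_space 2). lam z \<in> - {0}}"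
    define x where "x = e (Complex (c * (lam z - 1)) (z 0 * lam z))"
    have l: "1 + c * Re (plane_inv x) = lam z" using c by (simp add: x_def mult.assoc[symmetric])
    then have xW: "x \<in> W" using z by (auto simp: W_def x_def)
    have t: "Im (plane_inv x) * inverse (lam z) = z 0" using z by (simp add: x_def)
    have "circle_coord c x i = z i" for i
    proof -
      have "circle_coord c x i = (if i = 0 then z 0 else if i = 1 then lam z - 2 * inverse (1 + z 0 * z 0) else 0)"
        unfolding circle_coord_def Let_def l t ..
      also have "\<dots> = (if i = 0 then z 0 else if i = 1 then z 1 else 0)" by (simp add: lam_def)
      also have "\<dots> = z i" using z by (auto simp: topspace_Euclidean_space)
      finally show ?thesis .
    qed
    then show "z \<in> circle_coord c ` W" using xW by (metis ext imageI)
  qed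
  have lamS: "Ck 2 k Q lam" for k Q
    unfolding lam_def by (intro Ck_add Ck_mult Ck_const Ck_coord Ck_inverse nz)
  have "continuous_map (Euclidean_space 2) euclideanreal lam"
    using Ck_imp_continuous[OF lamS[of 0 UNIV]] by simp
  from openin_continuous_map_preimage[OF this, of "- {0}"]
  have op: "openin (Euclidean_space 2) (circle_coord c ` W)"
    unfolding img using open_Compl[OF closed_singleton[of "0 :: real"]] by simp
  show "(2, W, circle_coord c) \<in> charts (plane e)"
  proof (rule chart_transport[OF plane_chart(1) ch inj op])
    have s0: "smooth_fun (2, W, plane_coord) W (\<lambda>x. Re (plane_inv x))"
      using smooth_fun_coord[OF ch' order_refl Wo, of 0] by (simp add: plane_coord_def)
    have s1: "smooth_fun (2, W, plane_coord) W (\<lambda>x. Im (plane_inv x))"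
      using smooth_fun_coord[OF ch' order_refl Wo, of 1] by (simp add: plane_coord_def)
    have sl: "smooth_fun (2, W, plane_coord) W (\<lambda>x. 1 + c * Re (plane_inv x))"
      by (intro smooth_fun_add smooth_fun_mult smooth_fun_const s0)
    have st: "smooth_fun (2, W, plane_coord) W (\<lambda>x. Im (plane_inv x) * inverse (1 + c * Re (plane_inv x)))"
      by (intro smooth_fun_mult s1 smooth_fun_inverse sl Wnz)
    have "smooth_fun (2, W, plane_coord) W (\<lambda>x. circle_coord c x i)" for i
    proof -
      consider "i = 0" | "i = 1" | "i > 1" by linarith
      then show ?thesis
      proof cases
        case 1 then show ?thesis using st by (simp add: circle_coord_def Let_def)
      next
        case 2
        then show ?thesis unfolding circle_coord_def Let_def
          by simp (intro smooth_fun_diff smooth_fun_mult smooth_fun_inverse smooth_fun_add smooth_fun_const s0 s1 Wnz nz)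
      next
        case 3 then show ?thesis using smooth_fun_const[of _ _ 0] by (simp add: circle_coord_def Let_def)
      qed
    qed
    then show "chart_smooth (2, W, plane_coord) W 2 (circle_coord c)" by (simp add: chart_smooth_def)
    show "chart_smooth (2, W, circle_coord c) W 2 plane_coord"
      unfolding chart_smooth_def smooth_fun_def prod.case
    proof (intro allI impI)
      fix i k :: nat assume "i < 2"
      have "Ck 2 k (circle_coord c ` W) (\<lambda>z. if i = 0 then c * (lam z - 1) else z 0 * lam z)"
        by (cases "i = 0") (auto intro!: Ck_mult Ck_diff Ck_const Ck_coord lamS)
      then show "Ck 2 k (circle_coord c ` W) (\<lambda>z. plane_coord (inv_into W (circle_coord c) z) i)"
      proof (rule Ck_cong[OF op, rotated])
        fix z assume "z \<in> circle_coord c ` W"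
        then obtain x where x: "x \<in> W" "z = circle_coord c x" by blast
        then show "(if i = 0 then c * (lam z - 1) else z 0 * lam z) = plane_coord (inv_into W (circle_coord c) z) i"
          using inj re[of x] im[of x] \<open>i < 2\<close> by (simp add: plane_coord_def)
      qed
    qed
  qed
  have on: "(\<forall>i\<ge>1. circle_coord c x i = 0) \<longleftrightarrow> x \<in> e ` sphere 0 1" if x: "x \<in> W" for x
  proof -
    define l where "l = 1 + c * Re (plane_inv x)"
    define y where "y = Im (plane_inv x)"
    have l: "l \<noteq> 0" using Wnz[OF x] by (simp add: l_def)
    \<comment> \<open>Cleared of denominators, the vanishing of the second coordinate reads
      \<open>l * l + y * y = 2 * l\<close>. This is the equation of the unit circle in the
      coordinates \<open>l\<close> and \<open>y\<close> centred at \<open>- c\<close>.\<close>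
    have "(\<forall>i\<ge>1. circle_coord c x i = 0) \<longleftrightarrow> l - 2 * inverse (1 + (y * inverse l) * (y * inverse l)) = 0"
      by (auto simp: circle_coord_def Let_def l_def y_def)
    also have "\<dots> \<longleftrightarrow> l * (1 + (y * inverse l) * (y * inverse l)) = 2"
      using nz[of "y * inverse l"] by (simp add: divide_inverse[symmetric] nonzero_eq_divide_eq)
    also have "l * (1 + (y * inverse l) * (y * inverse l)) = (l * l + y * y) * inverse l"
      using l by (simp add: field_simps)
    also have "\<dots> = 2 \<longleftrightarrow> l * l + y * y = 2 * l" using l by (simp add: divide_inverse[symmetric] nonzero_divide_eq_eq)
    also have "l * l + y * y = 1 + 2 * (c * Re (plane_inv x)) + (c * c) * (Re (plane_inv x))\<^sup>2 + y * y"
      by (simp add: l_def power2_eq_square algebra_simps)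
    also have "\<dots> = 2 * l \<longleftrightarrow> (Re (plane_inv x))\<^sup>2 + (Im (plane_inv x))\<^sup>2 = 1"
      unfolding c by (auto simp: l_def y_def power2_eq_square algebra_simps)
    also have "\<dots> \<longleftrightarrow> norm (plane_inv x) = 1"
      by (simp add: cmod_def)
    also have "\<dots> \<longleftrightarrow> x \<in> e ` sphere 0 1"
      using WE[OF x] by (metis imageE image_eqI mem_sphere_0 plane_inv_e)
    finally show ?thesis .
  qed
  show "circle_coord c ` (W \<inter> e ` sphere 0 1) = {x \<in> circle_coord c ` W. \<forall>i\<ge>1. x i = 0}"
    using on by auto
qed

lemma circle_embedded: "embedded_submanifold (plane e) (e ` sphere 0 1)"
  unfolding embedded_submanifold_def
proof (intro conjI subsetI)
  fix x assume "x \<in> e ` sphere 0 1"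
  then obtain z where z: "norm z = 1" "x = e z" by auto
  have slice: "(1, e ` {z. 1 + c * Re z \<noteq> 0} \<inter> e ` sphere 0 1, circle_coord c) \<in> slice_charts (plane e) (e ` sphere 0 1)"
    if "c * c = 1" for c
    unfolding slice_charts_def using circle_slice_chart[OF that] one_le_numeral[of "num.Bit0 num.One"] by blast
  \<comment> \<open>The chart for \<open>c = 1\<close> misses only the point -1 of the circle, and
    there the one for \<open>c = -1\<close> is used.\<close>
  obtain c :: real where c: "c * c = 1" "1 + c * Re z \<noteq> 0"
  proof (cases "1 + Re z = 0")
    case True then show thesis using that[of "-1"] by simp
  next
    case False then show thesis using that[of 1] by simp
  qed
  then show "x \<in> (\<Union>(k, V, \<phi>)\<in>slice_charts (plane e) (e ` sphere 0 1). V)"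
    using slice[OF c(1)] z
    by (intro UN_I[of "(1, e ` {z. 1 + c * Re z \<noteq> 0} \<inter> e ` sphere 0 1, circle_coord c)"]) auto
qed auto

lemma mtop_circle: "mtop (circle e) = subtopology (mtop (plane e)) (e ` sphere 0 1)"
  by (simp add: circle_def)

lemma pts_circle: "pts (circle e) = e ` sphere 0 1"
  by (auto simp: mtop_circle)

lemma smooth_manifold_circle: "smooth_manifold (circle e)"
  unfolding smooth_manifold_iff mtop_circle
  using plane_subset_Hausdorff plane_subset_paracompact smooth_structure_submanifold[OF plane_chart(1) circle_embedded]
  by (simp add: circle_def)

lemma continuous_map_plane_subset:
  assumes "continuous_on S f"
  shows "continuous_map (subtopology (mtop (plane e)) (e ` S)) (mtop (plane e)) (\<lambda>x. e (f (plane_inv x)))"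
proof (rule continuous_map_into_plane)
  have "continuous_map (subtopology (mtop (plane e)) (e ` S)) (top_of_set S) plane_inv"
    using continuous_map_from_subtopology[OF continuous_map_plane_inv] by (auto simp: continuous_map_in_subtopology)
  from continuous_map_compose[OF this, of euclidean f] assms
  show "continuous_map (subtopology (mtop (plane e)) (e ` S)) euclidean (\<lambda>x. f (plane_inv x))" by (simp add: o_def)
qed

end

section \<open>The double cover of the circle as a Lie groupoid\<close>

text \<open>
  The action groupoid of the antipodal map on the circle. The arrow from \<open>u\<close> to \<open>u\<close> is encoded by \<open>u\<close>,
  and the arrow from \<open>u\<close> to \<open>-u\<close> by \<open>2 u\<close>; so \<open>3 - 2 |w|\<close> is the sign by which the arrow \<open>w\<close> acts.
\<close>

definition two_circles :: "complex set"
  where "two_circles = sphere 0 1 \<union> sphere 0 2"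

definition cover_tgt :: "complex \<Rightarrow> complex"
  where "cover_tgt w = of_real (3 - 2 * norm w) * sgn w"

definition cover_ivs :: "complex \<Rightarrow> complex"
  where "cover_ivs w = of_real (norm w) * cover_tgt w"

text \<open>An arrow of sign \<open>s\<close> has modulus \<open>(3 - s) / 2\<close>. The product
  starts where \<open>w\<close> starts, hence the direction \<open>sgn w\<close>, and its sign is
  the product of the two signs.\<close>

definition cover_mul :: "complex \<Rightarrow> complex \<Rightarrow> complex"
  where "cover_mul v w = of_real ((3 - (3 - 2 * norm v) * (3 - 2 * norm w)) / 2) * sgn w"

definition cover_base :: "complex \<Rightarrow> complex"
  where "cover_base w = (sgn w)\<^sup>2"

lemma sgn_unit [simp]: "norm (u :: complex) = 1 \<Longrightarrow> sgn u = u" "norm (u :: complex) = 1 \<Longrightarrow> sgn (2 * u) = u"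
  by (simp_all add: sgn_eq norm_mult)

lemma two_circlesE:
  assumes "w \<in> two_circles"
  obtains u where "norm u = 1" "w = u" | u where "norm u = 1" "w = 2 * u"
proof -
  consider "norm w = 1" | "norm w = 2" using assms by (auto simp: two_circles_def)
  then show thesis
  proof cases
    case 1 then show thesis using that(1)[of w] by simp
  next
    case 2 then show thesis using that(2)[of "w / 2"] by (simp add: norm_divide)
  qed
qed

lemma two_circles_I [simp]: "norm u = 1 \<Longrightarrow> u \<in> two_circles" "norm u = 1 \<Longrightarrow> 2 * u \<in> two_circles"
  by (simp_all add: two_circles_def norm_mult)

lemma two_circles_nonzero: "w \<in> two_circles \<Longrightarrow> w \<noteq> 0"
  by (auto simp: two_circles_def)

lemma cover_unit:
  assumes "norm u = 1"
  shows "cover_tgt u = u" "cover_tgt (2 * u) = - u" "cover_ivs u = u" "cover_ivs (2 * u) = - (2 * u)"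
    "cover_base u = u\<^sup>2" "cover_base (2 * u) = u\<^sup>2"
    "norm v = 1 \<Longrightarrow> cover_mul v u = u" "norm v = 1 \<Longrightarrow> cover_mul (2 * v) u = 2 * u"
    "norm v = 1 \<Longrightarrow> cover_mul v (2 * u) = 2 * u" "norm v = 1 \<Longrightarrow> cover_mul (2 * v) (2 * u) = u"
  using assms by (simp_all add: cover_tgt_def cover_ivs_def cover_base_def cover_mul_def norm_mult)

text \<open>The rules of \<open>cover_unit\<close> at \<open>- u\<close>, in the form
  \<open>- (2 * u)\<close> that simplification gives to the arrow \<open>2 * (- u)\<close>. Inverses
  of arrows from \<open>u\<close> to \<open>- u\<close> take this form.\<close>

lemma cover_unit_minus:
  assumes "norm u = 1"
  shows "- (2 * u) \<in> two_circles" "cover_tgt (- (2 * u)) = u"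
    "norm v = 1 \<Longrightarrow> cover_mul v (- (2 * u)) = - (2 * u)" "norm v = 1 \<Longrightarrow> cover_mul (2 * v) (- (2 * u)) = - u"
    "norm v = 1 \<Longrightarrow> cover_mul (- (2 * u)) v = 2 * v" "norm v = 1 \<Longrightarrow> cover_mul (- (2 * u)) (2 * v) = v"
  using assms two_circles_I(2)[of "- u"] cover_unit(2)[of "- u"] cover_unit(9,10)[of "- u" v]
    cover_unit(8,10)[of v "- u"]
  by simp_all

lemma cover_continuous:
  "continuous_on two_circles sgn" "continuous_on two_circles cover_tgt" "continuous_on two_circles cover_ivs"
  "continuous_on two_circles cover_base" "continuous_on (two_circles \<times> two_circles) (\<lambda>(v, w). cover_mul v w)"
proof -
  show s: "continuous_on two_circles (sgn :: complex \<Rightarrow> complex)"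
    using continuous_on_sgn[OF continuous_on_id, of two_circles] two_circles_nonzero by simp
  show t: "continuous_on two_circles cover_tgt"
    unfolding cover_tgt_def by (intro continuous_intros s)
  show "continuous_on two_circles cover_ivs"
    unfolding cover_ivs_def by (intro continuous_intros t)
  show "continuous_on two_circles cover_base"
    unfolding cover_base_def by (intro continuous_intros s)
  have "continuous_on (two_circles \<times> two_circles) (\<lambda>p. sgn (snd p) :: complex)"
    by (rule continuous_on_compose2[OF s continuous_on_snd[OF continuous_on_id]]) auto
  then show "continuous_on (two_circles \<times> two_circles) (\<lambda>(v, w). cover_mul v w)"
    unfolding cover_mul_def case_prod_beta by (intro continuous_on_mult) (intro continuous_intros; simp)
qed

text \<open>Near \<open>w\<^sub>0\<close>, the square of the direction is inverted by a rotated branch of the square root.\<close>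

lemma cover_base_local_inverse:
  assumes r: "r > 0" and u: "norm u = 1"
  defines "U \<equiv> {w. norm w = r \<and> 0 < Re (w * cnj u)}" and "V \<equiv> {z \<in> sphere 0 1. z \<noteq> - (u\<^sup>2)}"
  defines "g \<equiv> \<lambda>z. of_real r * u * csqrt (z * (cnj u)\<^sup>2)"
  shows "continuous_on V g" "w \<in> U \<Longrightarrow> cover_base w \<in> V \<and> g (cover_base w) = w" "z \<in> V \<Longrightarrow> g z \<in> U \<and> cover_base (g z) = z"
proof -
  have uu: "u * cnj u = 1" using u by (simp add: complex_norm_square[symmetric])
  have y: "norm (z * (cnj u)\<^sup>2) = 1" "z * (cnj u)\<^sup>2 \<noteq> -1" "(z * (cnj u)\<^sup>2) * u\<^sup>2 = z" if "z \<in> V" for z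
  proof -
    show n: "norm (z * (cnj u)\<^sup>2) = 1" using that u by (simp add: V_def norm_mult norm_power)
    show eq: "(z * (cnj u)\<^sup>2) * u\<^sup>2 = z" using uu by (metis mult.assoc mult.commute mult.right_neutral power_mult_distrib power_one)
    show "z * (cnj u)\<^sup>2 \<noteq> -1"
    proof
      assume "z * (cnj u)\<^sup>2 = -1"
      then have "z = - (u\<^sup>2)" using eq by simp
      then show False using that by (simp add: V_def)
    qed
  qed
  have nonpos: "z * (cnj u)\<^sup>2 \<notin> \<real>\<^sub>\<le>\<^sub>0" if "z \<in> V" for z
  proof
    assume "z * (cnj u)\<^sup>2 \<in> \<real>\<^sub>\<le>\<^sub>0"
    then obtain t where t: "z * (cnj u)\<^sup>2 = of_real t" "t \<le> 0" by (rule nonpos_Reals_cases)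
    then have "t = -1" using y(1)[OF that] by simp
    then show False using y(2)[OF that] t(1) by simp
  qed
  show "continuous_on V g"
    unfolding g_def
    by (intro continuous_intros continuous_on_compose2[OF continuous_on_csqrt]) (use nonpos in auto)
  show "cover_base w \<in> V \<and> g (cover_base w) = w" if w: "w \<in> U"
  proof -
    define s where "s = sgn w"
    have ws: "w = of_real r * s" and s1: "norm s = 1" using w r by (auto simp: U_def s_def sgn_eq norm_divide)
    define v where "v = s * cnj u"
    have "Re (w * cnj u) = r * Re v" by (simp add: ws v_def mult.assoc)
    then have Re: "Re v > 0" using w r by (simp add: U_def zero_less_mult_iff)
    have vv: "v\<^sup>2 = s\<^sup>2 * (cnj u)\<^sup>2" by (simp add: v_def power_mult_distrib)
    have "csqrt (s\<^sup>2 * (cnj u)\<^sup>2) = v" using csqrt_square[of v] Re vv by simp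
    moreover have "u * v = s" using uu by (simp add: v_def mult.assoc mult.left_commute)
    ultimately have "g (s\<^sup>2) = w" by (simp add: g_def ws mult.assoc)
    moreover have "s\<^sup>2 \<noteq> - (u\<^sup>2)"
    proof
      assume "s\<^sup>2 = - (u\<^sup>2)"
      then have "v\<^sup>2 = - ((u * cnj u)\<^sup>2)" by (simp add: vv power_mult_distrib)
      then have "v\<^sup>2 = \<i>\<^sup>2" using uu by simp
      then have "v = \<i> \<or> v = - \<i>" by (simp only: power2_eq_iff)
      then show False using Re by auto
    qed
    ultimately show ?thesis using s1 by (simp add: cover_base_def s_def[symmetric] V_def norm_power)
  qed
  show "g z \<in> U \<and> cover_base (g z) = z" if z: "z \<in> V"
  proof -
    define v where "v = csqrt (z * (cnj u)\<^sup>2)"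
    have v2: "v\<^sup>2 = z * (cnj u)\<^sup>2" by (simp add: v_def)
    have v1: "norm v = 1" using y(1)[OF z] by (simp add: v_def)
    \<comment> \<open>The principal root has nonnegative real part. On the unit circle it is purely
      imaginary only for roots of -1, and this value corresponds to the point removed from
      \<open>V\<close>.\<close>
    have "Re v \<noteq> 0"
    proof
      assume "Re v = 0"
      then have "v = \<i> \<or> v = - \<i>" using v1 by (auto simp: cmod_def complex_eq_iff abs_if split: if_splits)
      then have "v\<^sup>2 = -1" by auto
      then show False using v2 y(2)[OF z] by simp
    qed
    then have Re: "Re v > 0" using Re_csqrt[of "z * (cnj u)\<^sup>2"] by (simp add: v_def)
    have gz: "g z = of_real r * (u * v)" by (simp add: g_def v_def mult.assoc)
    have "norm (g z) = r" using r u v1 by (simp add: gz norm_mult)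
    moreover have "g z * cnj u = of_real r * v" using uu by (simp add: gz mult.assoc mult.left_commute)
    then have "0 < Re (g z * cnj u)" using r Re by simp
    moreover have "sgn (g z) = u * v" using r u v1 by (simp add: gz sgn_eq norm_mult)
    then have "cover_base (g z) = u\<^sup>2 * v\<^sup>2" by (simp add: cover_base_def power_mult_distrib)
    then have "cover_base (g z) = z" using y(3)[OF z] v2 by (simp add: mult.commute)
    ultimately show ?thesis by (simp add: U_def)
  qed
qed

text \<open>Two branches suffice: the principal root, cut at -1, and a rotated one, cut at 1. They
  are indexed by points because cocycles are; each point other than -1 uses the principal
  branch.\<close>

definition branch :: "complex \<Rightarrow> complex \<Rightarrow> complex"
  where "branch x z = (if x = -1 then \<i> * csqrt (- z) else csqrt z)"

definition branch_dom :: "complex \<Rightarrow> complex set"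
  where "branch_dom x = sphere 0 1 - {if x = -1 then 1 else -1}"

lemma branch_square [simp]: "(branch x z)\<^sup>2 = z"
  by (simp add: branch_def power_mult_distrib)

lemma norm_branch: "norm z = 1 \<Longrightarrow> norm (branch x z) = 1"
  by (simp add: branch_def norm_mult)

lemma branch_eq_or_neg: "branch y z = branch x z \<or> branch y z = - branch x z"
proof -
  have "(branch y z)\<^sup>2 = (branch x z)\<^sup>2" by simp
  then show ?thesis by (simp only: power2_eq_iff)
qed

lemma continuous_on_branch: "continuous_on (branch_dom x) (branch x)"
proof -
  have nonpos: "z \<notin> \<real>\<^sub>\<le>\<^sub>0" if "norm z = 1" "z \<noteq> -1" for z :: complex
  proof
    assume "z \<in> \<real>\<^sub>\<le>\<^sub>0"
    then obtain t where "z = of_real t" "t \<le> 0" by (rule nonpos_Reals_cases)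
    then show False using that by simp
  qed
  have "continuous_on (branch_dom x) csqrt" if "x \<noteq> -1"
    by (rule continuous_on_subset[OF continuous_on_csqrt]) (use nonpos that in \<open>auto simp: branch_dom_def\<close>)
  moreover have "continuous_on (branch_dom x) (\<lambda>z. \<i> * csqrt (- z))" if "x = -1"
  proof (intro continuous_intros continuous_on_compose2[OF continuous_on_csqrt])
    have "- z \<notin> \<real>\<^sub>\<le>\<^sub>0" if "z \<in> branch_dom x" for z
      using nonpos[of "- z"] that \<open>x = -1\<close> by (auto simp: branch_dom_def)
    then show "uminus ` branch_dom x \<subseteq> - \<real>\<^sub>\<le>\<^sub>0" by auto
  qed
  ultimately show ?thesis by (cases "x = -1") (simp_all add: branch_def[abs_def])
qed

text \<open>The quotient of \<open>h (cis t)\<close> by \<open>cis (t / 2)\<close> is continuous on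
  the real line and takes only the values 1 and -1, so it is constant. Going from 0 to
  \<open>2 * pi\<close> returns \<open>h\<close> to its value but reverses the sign of the
  half-angle factor.\<close>

lemma no_continuous_square_root_on_circle:
  assumes h: "continuous_on (sphere 0 1) h" and sq: "\<And>z :: complex. norm z = 1 \<Longrightarrow> (h z)\<^sup>2 = z"
  shows False
proof -
  define g where "g = (\<lambda>t. h (cis t) / cis (t / 2))"
  have "(g t)\<^sup>2 = 1" for t
  proof -
    have "(cis (t / 2))\<^sup>2 = cis t" using Complex.DeMoivre[of "t / 2" 2] by simp
    then show ?thesis using sq[of "cis t"] by (simp add: g_def power_divide)
  qed
  then have "g t = 1 \<or> g t = -1" for t by (simp add: power2_eq_1_iff)
  then have "g ` UNIV \<subseteq> {1, -1}" by blast
  then have fin: "finite (g ` UNIV)" by (rule finite_subset) simp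
  have cis: "continuous_on UNIV (\<lambda>t. cis (f t))" if "continuous_on UNIV f" for f
    using that by (simp add: cis_conv_exp continuous_intros)
  have "continuous_on UNIV g"
    unfolding g_def
    by (intro continuous_on_divide continuous_on_compose2[OF h] cis continuous_intros) auto
  from continuous_finite_range_constant[OF connected_UNIV this fin]
  have "g 0 = g (2 * pi)" unfolding constant_on_def by auto
  moreover have "g 0 = h 1" by (simp add: g_def)
  moreover have "g (2 * pi) = - h 1" by (simp add: g_def cis_pi)
  ultimately have "h 1 = 0" by simp
  then show False using sq[of 1] by simp
qed

section \<open>The Lie groupoid structure on the double cover\<close>

context
  fixes e :: "complex \<Rightarrow> 'u"
  assumes e: "inj e"
begin

abbreviation (input) pl :: "complex set \<Rightarrow> 'u topology"
  where "pl S \<equiv> subtopology (mtop (plane e)) (e ` S)"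

abbreviation (input) pinv :: "'u \<Rightarrow> complex"
  where "pinv \<equiv> inv_into UNIV e"

definition cover_proj :: "'u \<Rightarrow> 'u"
  where "cover_proj = (\<lambda>x. e (cover_base (inv_into UNIV e x)))"

text \<open>Objects and arrows carry the topology of the plane, but their smooth structure is pulled
  back from the circle along \<open>cover_proj\<close>, which makes both etale over the circle. The
  unit map is the identity, as the arrow from \<open>u\<close> to itself is encoded by
  \<open>u\<close>.\<close>

definition cover_groupoid :: "'u lie_groupoid"
  where "cover_groupoid =
    \<lparr>G0 = etale_manifold (circle e) (subtopology (mtop (plane e)) (e ` sphere 0 1)) cover_proj,
     G1 = etale_manifold (circle e) (subtopology (mtop (plane e)) (e ` two_circles)) cover_proj,
     src = (\<lambda>x. e (sgn (inv_into UNIV e x))), tgt = (\<lambda>x. e (cover_tgt (inv_into UNIV e x))), unt = (\<lambda>x. x),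
     ivs = (\<lambda>x. e (cover_ivs (inv_into UNIV e x))),
     mul = (\<lambda>x y. e (cover_mul (inv_into UNIV e x) (inv_into UNIV e y)))\<rparr>"

lemma pinv_e [simp]: "pinv (e z) = z"
  using e by simp

lemma topspace_pl [simp]: "topspace (pl S) = e ` S"
  using pts_plane[OF e] by auto

lemma plane_map:
  assumes "continuous_on S f" "f ` S \<subseteq> S'"
  shows "continuous_map (pl S) (pl S') (\<lambda>x. e (f (pinv x)))"
  using continuous_map_plane_subset[OF e assms(1)] assms(2) by (auto simp: continuous_map_in_subtopology)

text \<open>A finite subset of the plane is discrete. This mediates between
  \<open>Z2_groupoid\<close>, whose arrows form a discrete manifold, and the functor to it, which is
  given by a formula in the plane.\<close>

lemma continuous_map_plane_finite:
  assumes f: "continuous_map X (mtop (plane e)) f" and F: "finite F" "f ` topspace X \<subseteq> e ` F"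
  shows "continuous_map X (discrete_topology (e ` F)) f"
  unfolding continuous_map_def
proof (intro conjI allI impI)
  fix Q assume "openin (discrete_topology (e ` F)) Q"
  then have Q: "Q \<subseteq> e ` F" by simp
  define W where "W = - (F - e -` Q)"
  have "finite (F - e -` Q)" using F(1) by (rule finite_Diff)
  then have "open W" unfolding W_def by (intro open_Compl finite_imp_closed)
  then have "openin (mtop (plane e)) (e ` W)" using openin_plane[OF e] by blast
  moreover have "{x \<in> topspace X. f x \<in> Q} = {x \<in> topspace X. f x \<in> e ` W}"
  proof (intro Collect_cong conj_cong refl)
    fix x assume "x \<in> topspace X"
    then obtain a where "a \<in> F" "f x = e a" using F(2) by blast
    then show "f x \<in> Q \<longleftrightarrow> f x \<in> e ` W" using e by (auto simp: W_def inj_def)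
  qed
  ultimately show "openin X {x \<in> topspace X. f x \<in> Q}" using openin_continuous_map_preimage[OF f] by simp
qed (use F(2) in auto)

text \<open>The local inverse is the rotated root of \<open>cover_base_local_inverse\<close>. One
  argument serves the objects, of modulus 1, and the arrows, of modulus 1 or 2.\<close>

lemma cover_proj_local_homeomorphism:
  assumes Y: "Y = sphere 0 1 \<or> Y = two_circles" and x: "x \<in> topspace (pl Y)"
  shows "\<exists>U. openin (pl Y) U \<and> x \<in> U \<and> openin (mtop (circle e)) (cover_proj ` U) \<and>
      homeomorphic_map (subtopology (pl Y) U) (subtopology (mtop (circle e)) (cover_proj ` U)) cover_proj"
proof -
  have Y2: "Y \<subseteq> two_circles" using Y by (auto simp: two_circles_def)
  obtain w0 where w0: "w0 \<in> Y" "x = e w0" using x by auto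
  define r where "r = norm w0"
  define u where "u = sgn w0"
  have "w0 \<noteq> 0" using w0(1) Y2 two_circles_nonzero by blast
  then have r: "r > 0" and u: "norm u = 1" by (simp_all add: r_def u_def norm_sgn)
  have ru: "w0 = of_real r * u" by (simp add: r_def u_def sgn_eq)
  define U where "U = {w. norm w = r \<and> 0 < Re (w * cnj u)}"
  define V where "V = {z \<in> sphere 0 1. z \<noteq> - (u\<^sup>2)}"
  define g where "g = (\<lambda>z. of_real r * u * csqrt (z * (cnj u)\<^sup>2))"
  have inv: "continuous_on V g" "\<And>w. w \<in> U \<Longrightarrow> cover_base w \<in> V \<and> g (cover_base w) = w"
    "\<And>z. z \<in> V \<Longrightarrow> g z \<in> U \<and> cover_base (g z) = z"
    unfolding U_def V_def g_def by (fact cover_base_local_inverse[OF r u])+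
  have r12: "r = 1 \<or> r = 2" using w0(1) Y by (auto simp: r_def two_circles_def)
  have UY: "U \<subseteq> Y" using w0(1) Y by (auto simp: U_def r_def two_circles_def)
  have "w0 * cnj u = of_real r" using u by (simp add: ru mult.assoc complex_norm_square[symmetric])
  then have "Re (w0 * cnj u) = r" by (simp only: Re_complex_of_real)
  then have w0U: "w0 \<in> U" using r unfolding U_def by (intro CollectI conjI) (simp_all only: r_def)
  have fU: "cover_proj ` e ` U = e ` V"
  proof -
    have "cover_base ` U = V"
    proof (intro subset_antisym subsetI)
      fix z assume z: "z \<in> V"
      then show "z \<in> cover_base ` U" using inv(3)[OF z] by (metis imageI)
    qed (use inv(2) in blast)
    then show ?thesis by (auto simp: cover_proj_def image_image)
  qed
  have opU: "openin (pl Y) (e ` U)"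
  proof -
    \<comment> \<open>The bound 1/2 separates the circles of radius 1 and 2, so within
      \<open>Y\<close> this open condition pins the modulus down to \<open>r\<close>.\<close>
    have "open {w :: complex. \<bar>norm w - r\<bar> < 1 / 2 \<and> 0 < Re (w * cnj u)}"
      by (intro open_Collect_conj open_Collect_less continuous_intros)
    moreover have "U = {w. \<bar>norm w - r\<bar> < 1 / 2 \<and> 0 < Re (w * cnj u)} \<inter> Y"
    proof (intro subset_antisym subsetI)
      fix w assume w: "w \<in> {w. \<bar>norm w - r\<bar> < 1 / 2 \<and> 0 < Re (w * cnj u)} \<inter> Y"
      then have "norm w = 1 \<or> norm w = 2" using Y2 by (auto simp: two_circles_def)
      then have "norm w = r" using w r12 by auto
      then show "w \<in> U" using w by (simp add: U_def)
    qed (use UY in \<open>auto simp: U_def\<close>)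
    ultimately show ?thesis unfolding openin_plane_subset[OF e] by blast
  qed
  have opV: "openin (mtop (circle e)) (e ` V)"
    unfolding mtop_circle[OF e] openin_plane_subset[OF e]
    by (intro exI[of _ "- {- (u\<^sup>2)}"] conjI open_Compl closed_singleton) (auto simp: V_def)
  have sub: "subtopology (pl Y) (e ` U) = pl U" "subtopology (mtop (circle e)) (e ` V) = pl V"
    using UY by (auto simp: subtopology_subtopology mtop_circle[OF e] V_def intro!: arg_cong[where f = "subtopology (mtop (plane e))"])
  have "homeomorphic_maps (pl U) (pl V) cover_proj (\<lambda>x. e (g (pinv x)))"
    unfolding homeomorphic_maps_def
  proof (intro conjI ballI)
    have c: "continuous_on U cover_base" using continuous_on_subset[OF cover_continuous(4)] UY Y2 by blast
    show "continuous_map (pl U) (pl V) cover_proj"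
      unfolding cover_proj_def by (rule plane_map[OF c], rule image_subsetI, erule conjunct1[OF inv(2)])
    show "continuous_map (pl V) (pl U) (\<lambda>x. e (g (pinv x)))"
      by (rule plane_map[OF inv(1)], rule image_subsetI, erule conjunct1[OF inv(3)])
    show "e (g (pinv (cover_proj x))) = x" if "x \<in> topspace (pl U)" for x
      using that inv(2) by (auto simp: cover_proj_def)
    show "cover_proj (e (g (pinv y))) = y" if "y \<in> topspace (pl V)" for y
      using that inv(3) by (auto simp: cover_proj_def)
  qed
  then have "homeomorphic_map (subtopology (pl Y) (e ` U)) (subtopology (mtop (circle e)) (e ` V)) cover_proj"
    unfolding sub homeomorphic_map_maps by blast
  then show ?thesis using opU opV w0(2) w0U fU by (intro exI[of _ "e ` U"]) simp
qed

lemma circle_structure: "smooth_structure (circle e)"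
  using smooth_manifold_circle[OF e] by (simp add: smooth_manifold_iff)

lemma cover_simps [simp]:
  "G0 cover_groupoid = etale_manifold (circle e) (pl (sphere 0 1)) cover_proj"
  "G1 cover_groupoid = etale_manifold (circle e) (pl two_circles) cover_proj"
  "src cover_groupoid = (\<lambda>x. e (sgn (pinv x)))" "tgt cover_groupoid = (\<lambda>x. e (cover_tgt (pinv x)))"
  "unt cover_groupoid = (\<lambda>x. x)" "ivs cover_groupoid = (\<lambda>x. e (cover_ivs (pinv x)))"
  "mul cover_groupoid = (\<lambda>x y. e (cover_mul (pinv x) (pinv y)))"
  by (simp_all add: cover_groupoid_def)

lemma cover_etale:
  "smooth_structure (G0 cover_groupoid)" "etale (G0 cover_groupoid) (circle e) cover_proj"
  "smooth_structure (G1 cover_groupoid)" "etale (G1 cover_groupoid) (circle e) cover_proj"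
  unfolding cover_simps
  by (intro etale_manifold_etale[OF circle_structure] cover_proj_local_homeomorphism; simp)+

lemma cover_groupoid_groupoid: "groupoid cover_groupoid"
  unfolding groupoid_def cover_simps mtop_etale_manifold topspace_pl
  by (intro conjI ballI impI; elim imageE two_circlesE;
      simp add: cover_unit cover_unit_minus inj_eq[OF e] inj_image_mem_iff[OF e])

lemma lie_groupoid_cover: "lie_groupoid cover_groupoid"
proof (rule lie_groupoid_etale[OF cover_groupoid_groupoid _ _ circle_structure cover_etale(2,4)])
  show "smooth_manifold (G0 cover_groupoid)" "smooth_manifold (G1 cover_groupoid)"
    using cover_etale(1,3) plane_subset_Hausdorff[OF e] plane_subset_paracompact[OF e]
    by (simp_all add: smooth_manifold_iff)
  show "continuous_map (mtop (G1 cover_groupoid)) (mtop (G0 cover_groupoid)) (src cover_groupoid)"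
    unfolding cover_simps mtop_etale_manifold
    by (rule plane_map[OF cover_continuous(1)]) (auto elim!: two_circlesE)
  show "continuous_map (mtop (G1 cover_groupoid)) (mtop (G0 cover_groupoid)) (tgt cover_groupoid)"
    unfolding cover_simps mtop_etale_manifold
    by (rule plane_map[OF cover_continuous(2)]) (auto elim!: two_circlesE simp: cover_unit)
  show "continuous_map (mtop (G0 cover_groupoid)) (mtop (G1 cover_groupoid)) (unt cover_groupoid)"
    unfolding cover_simps mtop_etale_manifold
    by (auto simp: continuous_map_in_subtopology two_circles_def continuous_map_from_subtopology continuous_map_id[unfolded id_def])
  show "continuous_map (mtop (G1 cover_groupoid)) (mtop (G1 cover_groupoid)) (ivs cover_groupoid)"
    unfolding cover_simps mtop_etale_manifold
    by (rule plane_map[OF cover_continuous(3)]) (auto elim!: two_circlesE simp: cover_unit cover_unit_minus)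
  show "cover_proj (src cover_groupoid \<gamma>) = cover_proj \<gamma>" "cover_proj (tgt cover_groupoid \<gamma>) = cover_proj \<gamma>"
    if "\<gamma> \<in> pts (G1 cover_groupoid)" for \<gamma>
    using that by (auto simp: cover_proj_def cover_unit elim!: two_circlesE)
  let ?S = "fibre_set (G1 cover_groupoid) (src cover_groupoid) (tgt cover_groupoid) (G1 cover_groupoid)"
  let ?P = "subtopology (prod_topology (pl two_circles) (pl two_circles)) ?S"
  have "continuous_map (pl two_circles) euclidean pinv"
    by (rule continuous_map_from_subtopology[OF continuous_map_plane_inv[OF e]])
  then have "continuous_map (prod_topology (pl two_circles) (pl two_circles)) (prod_topology euclidean euclidean) (\<lambda>w. (pinv (fst w), pinv (snd w)))"
    using continuous_map_compose[OF continuous_map_fst, of "pl two_circles" euclidean pinv "pl two_circles"]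
      continuous_map_compose[OF continuous_map_snd, of "pl two_circles" euclidean pinv "pl two_circles"]
    by (simp add: continuous_map_pairwise o_def del: prod_topology_euclidean)
  then have "continuous_map ?P euclidean (\<lambda>w. (pinv (fst w), pinv (snd w)))"
    by (simp add: continuous_map_from_subtopology)
  then have "continuous_map ?P (top_of_set (two_circles \<times> two_circles)) (\<lambda>w. (pinv (fst w), pinv (snd w)))"
    by (auto simp: continuous_map_in_subtopology fibre_set_def)
  from continuous_map_compose[OF this, of euclidean "\<lambda>(v, w). cover_mul v w"] cover_continuous(5)
  have "continuous_map ?P euclidean (\<lambda>w. cover_mul (pinv (fst w)) (pinv (snd w)))" by (simp add: o_def)
  from continuous_map_into_plane[OF e this]
  have "continuous_map ?P (mtop (plane e)) (\<lambda>(\<gamma>, \<delta>). mul cover_groupoid \<gamma> \<delta>)"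
    by (simp add: case_prod_beta')
  moreover have "(\<lambda>(\<gamma>, \<delta>). mul cover_groupoid \<gamma> \<delta>) ` topspace ?P \<subseteq> e ` two_circles"
  proof clarify
    fix \<gamma> \<delta> assume "(\<gamma>, \<delta>) \<in> topspace ?P"
    then have "(\<gamma>, \<delta>) \<in> ?S" by simp
    then have "mul cover_groupoid \<gamma> \<delta> \<in> pts (G1 cover_groupoid)"
      using groupoid_mul(1)[OF cover_groupoid_groupoid] by (simp only: fibre_set_def mem_Collect_eq prod.case)
    then show "mul cover_groupoid \<gamma> \<delta> \<in> e ` two_circles" by simp
  qed
  ultimately show "continuous_map (subtopology (prod_topology (mtop (G1 cover_groupoid)) (mtop (G1 cover_groupoid))) ?S)
      (mtop (G1 cover_groupoid)) (\<lambda>(\<gamma>, \<delta>). mul cover_groupoid \<gamma> \<delta>)"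
    unfolding cover_simps(2) mtop_etale_manifold by (auto simp: continuous_map_in_subtopology)
qed

end

section \<open>Two morphisms from the circle to the group of order two\<close>

lemma manifold_groupoid_simps [simp]:
  "G0 (manifold_groupoid M) = M" "G1 (manifold_groupoid M) = M" "src (manifold_groupoid M) x = x"
  "tgt (manifold_groupoid M) x = x" "unt (manifold_groupoid M) x = x" "mul (manifold_groupoid M) x y = x"
  by (simp_all add: manifold_groupoid_def)

context
  fixes e :: "complex \<Rightarrow> 'u"
  assumes e: "inj e"
begin

lemmas inj_e [simp] = e

lemma e_eq [simp]: "e a = e b \<longleftrightarrow> a = b"
  by (rule inj_eq[OF e])

lemma Z2_simps [simp]:
  "G0 (Z2_groupoid e) = discrete_manifold {e 0}" "G1 (Z2_groupoid e) = discrete_manifold (e ` {0, 1})"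
  "src (Z2_groupoid e) x = e 0" "tgt (Z2_groupoid e) x = e 0" "unt (Z2_groupoid e) x = e 0"
  "mul (Z2_groupoid e) (e 0) (e 0) = e 0" "mul (Z2_groupoid e) (e 0) (e 1) = e 1"
  "mul (Z2_groupoid e) (e 1) (e 0) = e 1" "mul (Z2_groupoid e) (e 1) (e 1) = e 0"
proof -
  let ?c = "e \<circ> of_int" and ?K = "carrier (integer_mod_group 2)"
  have K: "?K = {0, 1}" by (auto simp: carrier_integer_mod_group)
  have "inj_on ?c ?K" by (simp add: K)
  then have "inv_into ?K ?c (?c k) = k" if "k \<in> ?K" for k using that by (rule inv_into_f_f)
  from this[of 0] this[of 1] have d: "inv_into ?K ?c (e 0) = 0" "inv_into ?K ?c (e 1) = 1" by (simp_all add: K)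
  show "G0 (Z2_groupoid e) = discrete_manifold {e 0}" "G1 (Z2_groupoid e) = discrete_manifold (e ` {0, 1})"
    "src (Z2_groupoid e) x = e 0" "tgt (Z2_groupoid e) x = e 0" "unt (Z2_groupoid e) x = e 0"
    "mul (Z2_groupoid e) (e 0) (e 0) = e 0" "mul (Z2_groupoid e) (e 0) (e 1) = e 1"
    "mul (Z2_groupoid e) (e 1) (e 0) = e 1" "mul (Z2_groupoid e) (e 1) (e 1) = e 0"
    using K d[unfolded K] by (simp_all add: Z2_groupoid_def group_groupoid_def Let_def)
qed

lemma lie_groupoid_Z2: "lie_groupoid (Z2_groupoid e)"
  unfolding Z2_groupoid_def
  by (rule lie_groupoid_group_groupoid[OF group_integer_mod_group]) (simp add: inj_on_def)

definition trivial_functor :: "'u gfunctor"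
  where "trivial_functor = (\<lambda>_. e 0, \<lambda>_. e 0)"

definition cover_functor :: "'u gfunctor"
  where "cover_functor = (cover_proj e, cover_proj e)"

text \<open>The functor p. The number \<open>norm w - 1\<close> is 0 for an arrow from
  \<open>u\<close> to \<open>u\<close> and 1 for an arrow from \<open>u\<close> to
  \<open>- u\<close>, which is the element of \<int>/2 by which the arrow acts.\<close>

definition deck_functor :: "'u gfunctor"
  where "deck_functor = (\<lambda>_. e 0, \<lambda>x. e (of_real (norm (plane_inv e x) - 1)))"

text \<open>Both components are the same map: arcs have only identity arrows, and in the double
  cover an identity arrow is encoded by its object.\<close>

definition branch_functor :: "complex \<Rightarrow> 'u gfunctor"
  where "branch_functor x = (\<lambda>y. e (branch x (plane_inv e y)), \<lambda>y. e (branch x (plane_inv e y)))"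

lemma smooth_functor_trivial:
  assumes "lie_groupoid G"
  shows "smooth_functor G (Z2_groupoid e) trivial_functor"
  using lie_groupoidD(2,3)[OF assms]
  by (simp add: smooth_functor_def trivial_functor_def smooth_map_into_discrete)

lemma smooth_functor_deck: "smooth_functor (cover_groupoid e) (Z2_groupoid e) deck_functor"
proof -
  note s = lie_groupoidD(2,3)[OF lie_groupoid_cover[OF e]]
  have "continuous_on two_circles (\<lambda>w. of_real (norm w - 1) :: complex)" by (intro continuous_intros)
  from continuous_map_plane_subset[OF e this]
  have "continuous_map (mtop (G1 (cover_groupoid e))) (mtop (plane e)) (snd deck_functor)"
    by (simp add: deck_functor_def)
  moreover have "snd deck_functor ` topspace (mtop (G1 (cover_groupoid e))) \<subseteq> e ` {0, 1}"
    by (auto simp: deck_functor_def two_circles_def)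
  ultimately have "continuous_map (mtop (G1 (cover_groupoid e))) (discrete_topology (e ` {0, 1})) (snd deck_functor)"
    by (intro continuous_map_plane_finite[OF e]) simp_all
  from smooth_map_into_discrete[OF s(2) this]
  have 1: "smooth_map (G1 (cover_groupoid e)) (G1 (Z2_groupoid e)) (snd deck_functor)" by simp
  have 2: "smooth_map (G0 (cover_groupoid e)) (G0 (Z2_groupoid e)) (fst deck_functor)"
    unfolding Z2_simps by (rule smooth_map_into_discrete[OF s(1)]) (simp add: deck_functor_def)
  have 3: "snd deck_functor (mul (cover_groupoid e) \<gamma> \<delta>) = mul (Z2_groupoid e) (snd deck_functor \<gamma>) (snd deck_functor \<delta>)"
    if "\<gamma> \<in> pts (G1 (cover_groupoid e))" "\<delta> \<in> pts (G1 (cover_groupoid e))" for \<gamma> \<delta>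
    using that by (auto simp: deck_functor_def cover_unit norm_mult elim!: two_circlesE)
  have 4: "snd deck_functor (unt (cover_groupoid e) x) = e 0" if "x \<in> pts (G0 (cover_groupoid e))" for x
    using that by (auto simp: deck_functor_def)
  show ?thesis
    unfolding smooth_functor_def using 1 2 3 4 by (simp add: deck_functor_def del: cover_simps)
qed

lemma cover_proj_src_tgt:
  assumes "\<gamma> \<in> pts (G1 (cover_groupoid e))"
  shows "cover_proj e (src (cover_groupoid e) \<gamma>) = cover_proj e \<gamma>" "cover_proj e (tgt (cover_groupoid e) \<gamma>) = cover_proj e \<gamma>"
  using assms by (auto simp: cover_proj_def cover_unit elim!: two_circlesE)

lemma smooth_functor_cover: "smooth_functor (cover_groupoid e) (manifold_groupoid (circle e)) cover_functor"
proof -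
  have "cover_proj e (mul (cover_groupoid e) \<gamma> \<delta>) = cover_proj e \<gamma>"
    if "\<gamma> \<in> pts (G1 (cover_groupoid e))" "\<delta> \<in> pts (G1 (cover_groupoid e))"
      "src (cover_groupoid e) \<gamma> = tgt (cover_groupoid e) \<delta>" for \<gamma> \<delta>
    using cover_proj_src_tgt(2)[OF groupoid_mul(1)[OF cover_groupoid_groupoid[OF e] that]]
      cover_proj_src_tgt(2)[OF that(1)] groupoid_mul(3)[OF cover_groupoid_groupoid[OF e] that]
    by (simp del: cover_simps)
  then show ?thesis
    unfolding smooth_functor_def
    using etale_smooth[OF _ circle_structure[OF e], OF cover_etale(1,2)[OF e]]
      etale_smooth[OF _ circle_structure[OF e], OF cover_etale(3,4)[OF e]] cover_proj_src_tgt
    by (simp add: cover_functor_def del: cover_simps(1-4,6,7))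
qed

text \<open>The objects over a point of the circle are a square root \<open>u\<close> and
  \<open>- u\<close>, and there is exactly one arrow between any two of them; this is the bijection
  in the first condition. Both fibre products exist because one of their maps is etale. The
  comparison map is then a bijective etale map, hence a diffeomorphism, and the second projection is
  etale, hence a submersion.\<close>

lemma lie_equivalence_cover: "lie_equivalence (cover_groupoid e) (manifold_groupoid (circle e)) cover_functor"
proof -
  let ?H = "cover_groupoid e" and ?C = "circle e" and ?p = "cover_proj e"
  let ?GG = "prod_manifold (G0 ?H) (G0 ?H)" and ?FF = "map_prod ?p ?p" and ?st = "\<lambda>h. (h, h)"
  let ?k = "\<lambda>\<gamma>. ((src ?H \<gamma>, tgt ?H \<gamma>), ?p \<gamma>)"
  note C = circle_structure[OF e] and c = cover_etale[OF e]
  note LH = lie_groupoidD[OF lie_groupoid_cover[OF e]]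
  have GG: "smooth_structure ?GG" "smooth_structure (prod_manifold ?C ?C)"
    by (rule smooth_structure_prod[OF c(1) c(1)], rule smooth_structure_prod[OF C C])
  note fp = fibre_product_etale[OF GG(1) C GG(2) etale_map_prod[OF c(1) C c(1) C c(2) c(2)]
      smooth_map_Pair[OF C C C smooth_map_id[OF C] smooth_map_id[OF C]]]
  let ?E = "fibre_product ?GG ?FF ?st ?C"
  have kpts: "?k \<gamma> \<in> fibre_set ?GG ?FF ?st ?C" if g: "\<gamma> \<in> pts (G1 ?H)" for \<gamma>
    using continuous_map_funspace[OF etale_continuous[OF c(3) C c(4)]] cover_proj_src_tgt[OF g]
      groupoid_simps[OF LH(1)] g
    by (auto simp: fibre_set_def simp del: cover_simps)
  have "continuous_map (mtop (G1 ?H)) (prod_topology (mtop ?GG) (mtop ?C)) ?k"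
    using smooth_map_continuous[OF c(3) c(1) LH(4)] smooth_map_continuous[OF c(3) c(1) LH(5)] etale_continuous[OF c(3) C c(4)]
    unfolding mtop_prod_manifold by (intro continuous_map_pairedI)
  then have "continuous_map (mtop (G1 ?H)) (mtop ?E) ?k"
    using kpts by (auto simp: fibre_product_def continuous_map_in_subtopology)
  then have et: "etale (G1 ?H) ?E ?k"
    by (rule etale_lift[OF c(3) fp(2) C c(4) fp(3)]) simp
  have "bij_betw ?k (pts (G1 ?H)) (pts ?E)"
    unfolding bij_betw_def fibre_product_def
  proof
    show "inj_on ?k (pts (G1 ?H))"
      by (auto simp: inj_on_def cover_unit elim!: two_circlesE)
    show "?k ` pts (G1 ?H) = pts (submanifold (prod_manifold ?GG ?C) (fibre_set ?GG ?FF ?st ?C))"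
      unfolding fibre_product_def[symmetric] pts_fibre_product
    proof (intro subset_antisym image_subsetI kpts subsetI)
      fix p assume p: "p \<in> fibre_set ?GG ?FF ?st ?C"
      then obtain u v z where uvz: "p = ((e u, e v), e z)" "norm u = 1" "norm v = 1" "norm z = 1"
        and base: "u\<^sup>2 = z" "v\<^sup>2 = z"
        by (auto simp: fibre_set_def pts_circle cover_proj_def cover_unit)
      then have "u\<^sup>2 = v\<^sup>2" by simp
      then consider "v = u" | "v = - u" by (auto simp: power2_eq_iff)
      then show "p \<in> ?k ` pts (G1 ?H)"
      proof cases
        case 1
        then show ?thesis using uvz base by (intro image_eqI[of _ _ "e u"]) (auto simp: cover_proj_def cover_unit)
      next
        case 2
        then show ?thesis using uvz base by (intro image_eqI[of _ _ "e (2 * u)"]) (auto simp: cover_proj_def cover_unit)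
      qed
    qed
  qed
  then have 1: "diffeomorphism (G1 ?H) ?E ?k" by (rule etale_bij_diffeomorphism[OF c(3) fp(2) et])
  note fp2 = fibre_product_etale[OF c(1) C C c(2) smooth_map_id[OF C]]
  let ?E2 = "fibre_product (G0 ?H) ?p (\<lambda>x. x) ?C"
  have snd_eq: "(\<lambda>(x, h). h) = (snd :: 'u \<times> 'u \<Rightarrow> 'u)" by auto
  have 2: "submersion ?E2 ?C snd" by (rule etale_submersion[OF fp2(2) C fp2(3)])
  have "snd ` pts ?E2 = pts ?C"
  proof (intro subset_antisym subsetI)
    fix y assume "y \<in> pts ?C"
    then obtain z where z: "y = e z" "norm z = 1" by (auto simp: pts_circle)
    have "(e (csqrt z), y) \<in> pts ?E2"
      using z by (auto simp: pts_fibre_product fibre_set_def pts_circle cover_proj_def cover_unit)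
    then show "y \<in> snd ` pts ?E2" by force
  qed (auto simp: fibre_product_def fibre_set_def)
  then show ?thesis
    using 1 2 fp(1) fp2(1) smooth_functor_cover
    unfolding lie_equivalence_def Let_def manifold_groupoid_simps
    by (simp add: cover_functor_def snd_eq del: cover_simps)
qed

section \<open>Restriction to arcs, where the square root has a branch\<close>

lemma openin_branch_dom: "openin (mtop (circle e)) (e ` branch_dom x)"
  unfolding mtop_circle[OF e] openin_plane_subset[OF e]
  by (intro exI[of _ "- {if x = -1 then 1 else -1}"] conjI open_Compl closed_singleton) (auto simp: branch_dom_def)

abbreviation (input) arc :: "complex \<Rightarrow> 'u lie_groupoid"
  where "arc x \<equiv> manifold_groupoid (open_submanifold (circle e) (e ` branch_dom x))"

lemma mtop_arc: "mtop (open_submanifold (circle e) (e ` branch_dom x)) = pl e (branch_dom x)"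
  by (auto simp: mtop_circle subtopology_subtopology branch_dom_def intro!: arg_cong[where f = "subtopology (mtop (plane e))"])

lemma lie_groupoid_arc: "lie_groupoid (arc x)"
proof (rule lie_groupoid_manifold_groupoid)
  show "smooth_manifold (open_submanifold (circle e) (e ` branch_dom x))"
    using open_submanifold_etale(1)[OF circle_structure[OF e] openin_branch_dom]
      plane_subset_Hausdorff[OF e] plane_subset_paracompact[OF e]
    by (simp add: smooth_manifold_iff mtop_arc del: open_submanifold_simps)
qed

lemma pts_arc: "pts (open_submanifold (circle e) (e ` branch_dom x)) = e ` branch_dom x"
  unfolding mtop_arc by (rule topspace_pl[OF e])

lemma cover_proj_branch: "norm z = 1 \<Longrightarrow> cover_proj e (e (branch x z)) = e z"
  by (simp add: cover_proj_def cover_unit norm_branch)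

lemma branch_domD: "z \<in> branch_dom x \<Longrightarrow> norm z = 1"
  by (simp add: branch_dom_def)

text \<open>A branch is a continuous section of \<open>cover_proj\<close>, that is, a continuous map
  over the circle between manifolds etale over it; hence it is smooth.\<close>

lemma smooth_functor_branch: "smooth_functor (arc x) (cover_groupoid e) (branch_functor x)"
proof -
  let ?U = "open_submanifold (circle e) (e ` branch_dom x)" and ?b = "\<lambda>y. e (branch x (plane_inv e y))"
  note C = circle_structure[OF e] and c = cover_etale[OF e] and U = open_submanifold_etale[OF circle_structure[OF e] openin_branch_dom]
  have eq: "cover_proj e (?b y) = y" if "y \<in> pts ?U" for y
    using that by (auto simp: pts_arc cover_proj_branch branch_domD simp del: open_submanifold_simps)
  have "continuous_map (pl e (branch_dom x)) (pl e S) ?b" if "sphere 0 1 \<subseteq> S" for S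
    by (rule plane_map[OF e continuous_on_branch]) (use that norm_branch branch_domD in force)
  then have "continuous_map (mtop ?U) (mtop (G0 (cover_groupoid e))) ?b" "continuous_map (mtop ?U) (mtop (G1 (cover_groupoid e))) ?b"
    unfolding mtop_arc by (simp_all add: two_circles_def)
  from etale_smooth[OF U(1) c(1) etale_lift[OF U(1) c(1) C U(2) c(2) this(1) eq]]
    etale_smooth[OF U(1) c(3) etale_lift[OF U(1) c(3) C U(2) c(4) this(2) eq]]
  have "smooth_map ?U (G0 (cover_groupoid e)) ?b" "smooth_map ?U (G1 (cover_groupoid e)) ?b" by auto
  then show ?thesis
    unfolding smooth_functor_def branch_functor_def manifold_groupoid_simps pts_arc fst_conv snd_conv
    by (auto simp: cover_unit norm_branch branch_domD)
qed

text \<open>Squaring undoes the branch, which gives the first equality. The branch takes values of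
  modulus 1 only, and these \<open>deck_functor\<close> sends to the neutral element, which gives
  the second.\<close>

lemma branch_functor_lifts_arc:
  "Cmp Gp (gp_arrow (cover_groupoid e) (manifold_groupoid (circle e)) cover_functor)
     (gp_arrow (arc x) (cover_groupoid e) (branch_functor x)) =
   gp_arrow (arc x) (manifold_groupoid (circle e)) (id, id)" (is ?lift)
  and deck_functor_trivial_on_arc:
  "Cmp Gp (gp_arrow (cover_groupoid e) (Z2_groupoid e) deck_functor)
     (gp_arrow (arc x) (cover_groupoid e) (branch_functor x)) =
   gp_arrow (arc x) (Z2_groupoid e) trivial_functor" (is ?triv)
proof -
  note H = lie_groupoid_cover[OF e] and U = lie_groupoid_arc[of x] and b = smooth_functor_branch[of x]
  have S: "lie_groupoid (manifold_groupoid (circle e))" by (rule lie_groupoid_manifold_groupoid[OF smooth_manifold_circle[OF e]])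
  have 1: "smooth_functor (arc x) (manifold_groupoid (circle e)) (fst cover_functor \<circ> fst (branch_functor x), snd cover_functor \<circ> snd (branch_functor x))"
    by (rule smooth_functor_comp[OF U H S b smooth_functor_cover])
  show ?lift
    unfolding Gp_Cmp[OF U H S b smooth_functor_cover] gp_arrow_eq_iff[OF U S 1]
    by (rule isomorphic_functors_if_eq[OF U S 1])
      (auto simp: pts_arc cover_functor_def branch_functor_def cover_proj_branch branch_domD simp del: open_submanifold_simps)
  have 2: "smooth_functor (arc x) (Z2_groupoid e) (fst deck_functor \<circ> fst (branch_functor x), snd deck_functor \<circ> snd (branch_functor x))"
    by (rule smooth_functor_comp[OF U H lie_groupoid_Z2 b smooth_functor_deck])
  show ?triv
    unfolding Gp_Cmp[OF U H lie_groupoid_Z2 b smooth_functor_deck] gp_arrow_eq_iff[OF U lie_groupoid_Z2 2]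
    by (rule isomorphic_functors_if_eq[OF U lie_groupoid_Z2 2])
      (auto simp: pts_arc deck_functor_def branch_functor_def trivial_functor_def norm_branch branch_domD simp del: open_submanifold_simps)
qed

lemma arc_inclusion: "smooth_functor (arc x) (manifold_groupoid (circle e)) (id, id)"
  and trivial_on_arc: "Cmp Gp (gp_arrow (manifold_groupoid (circle e)) (Z2_groupoid e) trivial_functor)
     (gp_arrow (arc x) (manifold_groupoid (circle e)) (id, id)) = gp_arrow (arc x) (Z2_groupoid e) trivial_functor"
proof -
  note U = lie_groupoid_arc[of x]
  have S: "lie_groupoid (manifold_groupoid (circle e))" by (rule lie_groupoid_manifold_groupoid[OF smooth_manifold_circle[OF e]])
  show i: "smooth_functor (arc x) (manifold_groupoid (circle e)) (id, id)"
    using etale_smooth[OF _ circle_structure[OF e], OF open_submanifold_etale[OF circle_structure[OF e] openin_branch_dom]]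
    by (simp add: smooth_functor_def id_def)
  show "Cmp Gp (gp_arrow (manifold_groupoid (circle e)) (Z2_groupoid e) trivial_functor)
     (gp_arrow (arc x) (manifold_groupoid (circle e)) (id, id)) = gp_arrow (arc x) (Z2_groupoid e) trivial_functor"
    unfolding Gp_Cmp[OF U S lie_groupoid_Z2 i smooth_functor_trivial[OF S]] by (simp add: trivial_functor_def o_def)
qed

end

text \<open>The hypothesis on \<open>L\<close> admits test categories of one type only, and
  \<open>E\<close> may have another. The zigzag category has the right type, so its localization
  functor factors through \<open>P\<close>; being universal for test categories of every type, it
  passes the equality on to \<open>\<Phi>\<close>.\<close>

lemma localization_kernel:
  fixes C :: "('o, 'a) category"
  assumes L: "is_localization TYPE(('o, ('o, 'a) zigzag set) category) C W L P"
    and C: "is_category C" "W \<subseteq> Arr C"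
    and E: "is_category E" "is_functor C E \<Phi>" "\<forall>w\<in>W. invertible_arrow E (snd \<Phi> w)"
    and ab: "a \<in> Arr C" "b \<in> Arr C" "snd P a = snd P b"
  shows "snd \<Phi> a = snd \<Phi> b"
proof -
  let ?E = "zigzag_category C W" and ?Z = "zigzag_functor C W"
  have "is_localization TYPE(('o, ('o, 'a) zigzag set) category) C W ?E ?Z" by (rule is_localization_zigzag[OF C])
  then have "is_category ?E \<and> is_functor C ?E ?Z \<and> (\<forall>w\<in>W. invertible_arrow ?E (snd ?Z w))"
    by (simp add: is_localization_def)
  from L[unfolded is_localization_def, THEN conjunct2, THEN conjunct2, THEN conjunct2, THEN spec, THEN spec, THEN mp, OF this]
  obtain \<Psi> where "functor_eq C (functor_comp \<Psi> P) ?Z" by (elim exE conjE)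
  then have "snd ?Z a = snd ?Z b" using ab by (simp add: functor_eq_def functor_comp_def) metis
  moreover have "functor_eq C (functor_comp (zigzag_lift C E \<Phi>) ?Z) \<Phi>" by (rule zigzag_lift_comp[OF C E])
  ultimately show ?thesis using ab(1,2) by (simp add: functor_eq_def functor_comp_def) metis
qed

lemma gp_equivalences_subset: "gp_equivalences \<subseteq> Arr Gp"
proof
  fix a :: "'u gp_arrow" assume "a \<in> gp_equivalences"
  then obtain G H F where "a = gp_arrow G H F" "lie_groupoid G" "lie_groupoid H" "lie_equivalence G H F"
    unfolding gp_equivalences_def by blast
  then show "a \<in> Arr Gp" using Gp_ArrI[of G H F] by (simp add: lie_equivalence_def)
qed

section \<open>The tautological cocycle and its two images\<close>

context
  fixes e :: "complex \<Rightarrow> 'u"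
  assumes e: "inj e"
begin

lemmas e_simps [simp] = e e_eq[OF e] Z2_simps[OF e] cover_simps[OF e]

text \<open>A linear formula with value \<open>u\<close> at \<open>v = u\<close> and
  \<open>2 * u\<close> at \<open>v = - u\<close>, the codes of the arrows from \<open>u\<close> to
  \<open>v\<close>. It makes the transition arrows visibly continuous, although two branches may
  agree on one part of an overlap and be opposite on another.\<close>

definition arrow_between :: "complex \<Rightarrow> complex \<Rightarrow> complex"
  where "arrow_between u v = (3 * u - v) / 2"

lemma arrow_between: "arrow_between u u = u" "arrow_between u (- u) = 2 * u" "arrow_between (- u) u = - (2 * u)"
  by (simp_all add: arrow_between_def field_simps)

definition branch_cocycle :: "(complex, 'u) cocycle"
  where "branch_cocycle = (branch_dom, \<lambda>x z. e (branch x z), \<lambda>x y z. e (arrow_between (branch x z) (branch y z)))"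

lemma branch_cocycle: "cocycle (top_of_set (sphere 0 1)) (cover_groupoid e) branch_cocycle"
  unfolding branch_cocycle_def cocycle_def prod.case
proof (intro conjI ballI)
  let ?X = "top_of_set (sphere 0 1) :: complex topology"
  have sub: "subtopology ?X S = top_of_set S" if "S \<subseteq> branch_dom x" for S x
  proof -
    have "S \<subseteq> sphere 0 1" using that by (auto simp: branch_dom_def)
    then show ?thesis by (simp add: subtopology_subtopology Int_absorb1)
  qed
  have cont: "continuous_on (branch_dom x \<inter> S) (branch x)" for x S
    by (rule continuous_on_subset[OF continuous_on_branch]) blast
  have two: "arrow_between (branch x z) (branch y z) \<in> two_circles" if "norm z = 1" for x y z
    using branch_eq_or_neg[of y z x] that by (auto simp: arrow_between norm_branch)
  fix x assume x: "x \<in> topspace ?X"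
  have "branch_dom x = sphere 0 1 \<inter> - {if x = -1 then 1 else -1}" by (auto simp: branch_dom_def)
  then show "openin ?X (branch_dom x)" by (metis openin_open_Int open_Compl closed_singleton)
  show "x \<in> branch_dom x" using x by (auto simp: branch_dom_def)
  have "continuous_map (top_of_set (branch_dom x)) (mtop (plane e)) (\<lambda>z. e (branch x z))"
    using continuous_on_branch by (intro continuous_map_into_plane[OF e]) simp
  then show "continuous_map (subtopology ?X (branch_dom x)) (mtop (G0 (cover_groupoid e))) (\<lambda>z. e (branch x z))"
    using norm_branch branch_domD[OF e] by (auto simp: sub[OF order_refl] continuous_map_in_subtopology)
  fix y
  let ?S = "branch_dom x \<inter> branch_dom y"
  have "continuous_on ?S (\<lambda>z. arrow_between (branch x z) (branch y z))"
    unfolding arrow_between_def using cont[of x "branch_dom y"] cont[of y "branch_dom x"]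
    by (intro continuous_intros) (simp_all add: Int_commute)
  then have "continuous_map (top_of_set ?S) (mtop (plane e)) (\<lambda>z. e (arrow_between (branch x z) (branch y z)))"
    by (intro continuous_map_into_plane[OF e]) simp
  then show "continuous_map (subtopology ?X ?S) (mtop (G1 (cover_groupoid e))) (\<lambda>z. e (arrow_between (branch x z) (branch y z)))"
    using two branch_domD[OF e] by (auto simp: sub[OF Int_lower1] continuous_map_in_subtopology)
  show "src (cover_groupoid e) (e (arrow_between (branch x z) (branch y z))) = e (branch x z)"
    "tgt (cover_groupoid e) (e (arrow_between (branch x z) (branch y z))) = e (branch y z)" if "z \<in> ?S" for z
    using branch_eq_or_neg[of y z x] that by (auto simp: arrow_between norm_branch cover_unit branch_domD[OF e])
  show "mul (cover_groupoid e) (e (arrow_between (branch y z) (branch w z))) (e (arrow_between (branch x z) (branch y z))) =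
      e (arrow_between (branch x z) (branch w z))" if "z \<in> branch_dom x \<inter> branch_dom y \<inter> branch_dom w" for w z
    using branch_eq_or_neg[of y z x] branch_eq_or_neg[of w z x] that
    by (auto simp: arrow_between norm_branch cover_unit cover_unit_minus branch_domD[OF e])
qed

text \<open>
  A coboundary between the two images of the cocycle would choose the sign of the square root
  consistently around the circle.
\<close>

lemma deck_functor_coh_rel:
  "coh_rel (top_of_set (sphere 0 1 :: complex set)) (cover_groupoid e) (Z2_groupoid e) (deck_functor e) \<noteq>
   coh_rel (top_of_set (sphere 0 1)) (cover_groupoid e) (Z2_groupoid e) (trivial_functor e)"
proof
  let ?X = "top_of_set (sphere 0 1) :: complex topology" and ?H = "cover_groupoid e" and ?Z = "Z2_groupoid e"
  assume eq: "coh_rel ?X ?H ?Z (deck_functor e) = coh_rel ?X ?H ?Z (trivial_functor e)"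
  note H = lie_groupoid_cover[OF e] and Z = lie_groupoid_Z2[OF e] and deck = smooth_functor_deck[OF e]
  have "cocycle ?X ?Z (map_cocycle (deck_functor e) branch_cocycle)"
    by (rule map_cocycle_cocycle[OF H Z deck branch_cocycle])
  then have "(map_cocycle (deck_functor e) branch_cocycle, map_cocycle (deck_functor e) branch_cocycle) \<in> cohomologous ?X ?Z"
    by (rule cohomologous_refl[OF Z])
  then have "(branch_cocycle, map_cocycle (deck_functor e) branch_cocycle) \<in> coh_rel ?X ?H ?Z (deck_functor e)"
    using branch_cocycle unfolding coh_rel_def mem_Collect_eq prod.case by blast
  then have "(map_cocycle (trivial_functor e) branch_cocycle, map_cocycle (deck_functor e) branch_cocycle) \<in> cohomologous ?X ?Z"
    unfolding eq unfolding coh_rel_def mem_Collect_eq prod.case by blast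
  then obtain V \<kappa> where
    "coboundary ?X ?Z (map_cocycle (trivial_functor e) branch_cocycle) (map_cocycle (deck_functor e) branch_cocycle) V \<kappa>"
    unfolding cohomologous_def mem_Collect_eq prod.case by blast
  note cob = coboundaryD[OF this[unfolded map_cocycle_def branch_cocycle_def prod.case]]
  \<comment> \<open>The \<int>/2-valued function \<open>\<kappa>\<close>, written as a sign.\<close>
  define s where "s = (\<lambda>x z. if \<kappa> x z = e 0 then 1 else - 1 :: complex)"
  have V: "z \<in> sphere 0 1" if "x \<in> sphere 0 1" "z \<in> V x" for x z
    using openin_subset[OF cob(1)[of x]] that by auto
  \<comment> \<open>The coboundary equation says that \<open>\<kappa> x z\<close> and
    \<open>\<kappa> y z\<close> differ exactly when the roots \<open>branch x z\<close> and
    \<open>branch y z\<close> are opposite; so the signed roots agree.\<close>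
  have glue: "s y z * branch y z = s x z * branch x z"
    if "x \<in> sphere 0 1" "y \<in> sphere 0 1" "z \<in> V x" "z \<in> V y" for x y z
  proof -
    have "mul ?Z (\<kappa> y z) (e 0) = mul ?Z (snd (deck_functor e) (e (arrow_between (branch x z) (branch y z)))) (\<kappa> x z)"
      using cob(9)[of x y z] that by (simp add: trivial_functor_def)
    moreover have "\<kappa> x z \<in> e ` {0, 1}" "\<kappa> y z \<in> e ` {0, 1}"
      using cob(8)[of x z] cob(8)[of y z] that by (simp_all add: discrete_manifold_chart)
    moreover have "norm z = 1" using V[OF that(1,3)] by simp
    ultimately show ?thesis
      using branch_eq_or_neg[of y z x] by (auto simp: s_def arrow_between deck_functor_def norm_branch norm_mult)
  qed
  \<comment> \<open>Since the cover is indexed by points, the diagonal choice is defined everywhere.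
    By \<open>glue\<close> it equals \<open>s x z * branch x z\<close> on all of \<open>V x\<close>,
    which is continuous there.\<close>
  define h where "h = (\<lambda>z. s z z * branch z z)"
  have "continuous (at x within sphere 0 1) h" if x: "x \<in> sphere 0 1" for x
  proof -
    have Vx: "openin ?X (V x)" "x \<in> V x" "V x \<subseteq> branch_dom x" using cob(1-3)[of x] x by auto
    obtain T where T: "open T" "V x = sphere 0 1 \<inter> T" using Vx(1) by (auto simp: openin_open)
    have "continuous_map (subtopology ?X (V x)) (discrete_topology (e ` {0, 1})) (\<kappa> x)"
      using cob(5)[of x] x by (simp add: discrete_manifold_chart)
    moreover have "continuous_map (discrete_topology (e ` {0, 1})) euclidean (\<lambda>u. if u = e 0 then 1 else - 1 :: complex)"
      by simp
    ultimately have "continuous_map (subtopology ?X (V x)) euclidean (s x)"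
      unfolding s_def by (rule continuous_map_compose[unfolded o_def])
    moreover have "subtopology ?X (V x) = top_of_set (V x)" by (simp add: subtopology_subtopology T(2))
    ultimately have "continuous_on (V x) (s x)" by simp
    then have "continuous_on (V x) (\<lambda>z. s x z * branch x z)"
      by (intro continuous_on_mult continuous_on_subset[OF continuous_on_branch Vx(3)])
    moreover have "h z = s x z * branch x z" if "z \<in> V x" for z
      unfolding h_def using glue[OF x _ that, of z] cob(2)[of z] V[OF x that] by simp
    ultimately have "continuous_on (V x) h" by (simp cong: continuous_on_cong)
    then have "continuous (at x within V x) h" using Vx(2) by (simp add: continuous_on_eq_continuous_within)
    moreover have "at x within V x = at x within sphere 0 1"
      by (rule at_within_nhd[of _ T]) (use T Vx(2) in auto)
    ultimately show ?thesis by simp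
  qed
  then have "continuous_on (sphere 0 1) h" by (simp add: continuous_on_eq_continuous_within)
  moreover have "(h z)\<^sup>2 = z" if "norm z = 1" for z by (simp add: h_def power_mult_distrib s_def)
  ultimately show False by (rule no_continuous_square_root_on_circle)
qed

end

theorem lemma3p41:
  fixes e :: "complex \<Rightarrow> 'u"
    and L :: "('u lie_groupoid, ('u lie_groupoid, 'u gp_arrow) zigzag set) category"
    and P :: "('u lie_groupoid, 'u gp_arrow,
               'u lie_groupoid, ('u lie_groupoid, 'u gp_arrow) zigzag set) cfunctor"
  assumes "inj e"
    and "is_localization
           TYPE(('u lie_groupoid, ('u lie_groupoid, 'u gp_arrow) zigzag set) category)
           Gp gp_equivalences L P"
  shows "\<exists>U1 U2 f g.
    openin (mtop (circle e)) U1 \<and> openin (mtop (circle e)) U2 \<and> U1 \<union> U2 = pts (circle e) \<and>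
    is_hom L (fst P (manifold_groupoid (circle e))) (fst P (Z2_groupoid e)) f \<and>
    is_hom L (fst P (manifold_groupoid (circle e))) (fst P (Z2_groupoid e)) g \<and>
    restrict_arrow L P (circle e) U1 f = restrict_arrow L P (circle e) U1 g \<and>
    restrict_arrow L P (circle e) U2 f = restrict_arrow L P (circle e) U2 g \<and>
    f \<noteq> g"
proof -
  note e = assms(1)
  let ?S = "manifold_groupoid (circle e)" and ?H = "cover_groupoid e" and ?Z = "Z2_groupoid e"
  let ?arc = "\<lambda>x. manifold_groupoid (open_submanifold (circle e) (e ` branch_dom x))"
  note loc = assms(2)[unfolded is_localization_def]
  note L = conjunct1[OF loc] conjunct1[OF conjunct2[OF loc]] bspec[OF conjunct1[OF conjunct2[OF conjunct2[OF loc]]]]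
  have Pcmp: "snd P (Cmp Gp b a) = Cmp L (snd P b) (snd P a)" if "a \<in> Arr Gp" "b \<in> Arr Gp" "Cod Gp a = Dom Gp b" for a b
    using L(2) that by (simp add: is_functor_def)
  have Phom: "is_hom L (fst P G) (fst P K) (snd P (gp_arrow G K F))" if "gp_arrow G K F \<in> Arr Gp" for G K F
  proof -
    have "is_hom L (fst P (Dom Gp a)) (fst P (Cod Gp a)) (snd P a)" if "a \<in> Arr Gp" for a
      using L(2) that by (simp add: is_functor_def)
    from this[OF that] show ?thesis by simp
  qed
  have S: "lie_groupoid ?S" by (rule lie_groupoid_manifold_groupoid[OF smooth_manifold_circle[OF e]])
  note H = lie_groupoid_cover[OF e] and Z = lie_groupoid_Z2[OF e]
  define CST where "CST = gp_arrow ?S ?Z (trivial_functor e)"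
  define Q where "Q = gp_arrow ?H ?S (cover_functor e)"
  define PR where "PR = gp_arrow ?H ?Z (deck_functor e)"
  have arr: "CST \<in> Arr Gp" "Q \<in> Arr Gp" "PR \<in> Arr Gp"
    unfolding CST_def Q_def PR_def
    by (rule Gp_ArrI[OF S Z smooth_functor_trivial[OF e S]], rule Gp_ArrI[OF H S smooth_functor_cover[OF e]],
        rule Gp_ArrI[OF H Z smooth_functor_deck[OF e]])
  have "Q \<in> gp_equivalences"
    unfolding Q_def gp_equivalences_def using H S lie_equivalence_cover[OF e] by blast
  from L(3)[OF this] obtain b where b: "inverse_arrows L (snd P Q) b" unfolding invertible_arrow_def ..
  define f where "f = snd P CST"
  \<comment> \<open>p composed with the inverse of q: \<open>b\<close> inverts the image of the
    squaring equivalence.\<close>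
  define g where "g = Cmp L (snd P PR) b"
  have hom: "is_hom L (fst P ?S) (fst P ?Z) (snd P CST)" "is_hom L (fst P ?H) (fst P ?S) (snd P Q)" "is_hom L (fst P ?H) (fst P ?Z) (snd P PR)"
    using Phom arr unfolding CST_def Q_def PR_def by blast+
  then have hb: "is_hom L (fst P ?S) (fst P ?H) b" and bQ: "Cmp L b (snd P Q) = Ide L (fst P ?H)"
    using b by (auto simp: inverse_arrows_def is_hom_def)
  have catD: "Cmp L a (Ide L (Dom L a)) = a" "Cmp L (Ide L (Cod L a)) a = a" if "a \<in> Arr L" for a
    using L(1) that by (auto simp: is_category_def)
  have ass: "Cmp L c (Cmp L b' a) = Cmp L (Cmp L c b') a"
    if "is_hom L A B a" "is_hom L B C b'" "is_hom L C D c" for A B C D a b' c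
    using L(1) that by (auto simp: is_category_def is_hom_def)
  have gQ: "Cmp L g (snd P Q) = snd P PR"
    unfolding g_def ass[OF hom(2) hb hom(3), symmetric] bQ using catD(1)[of "snd P PR"] hom(3) by (simp add: is_hom_def)
  have hg: "is_hom L (fst P ?S) (fst P ?Z) g"
    using L(1) hb hom(3) by (auto simp: g_def is_category_def is_hom_def)
  have restr: "restrict_arrow L P (circle e) (e ` branch_dom x) f = restrict_arrow L P (circle e) (e ` branch_dom x) g" for x
  proof -
    let ?\<iota> = "gp_arrow (?arc x) ?S (id, id)" and ?B = "gp_arrow (?arc x) ?H (branch_functor e x)"
    have A: "?\<iota> \<in> Arr Gp" "?B \<in> Arr Gp"
      by (rule Gp_ArrI[OF lie_groupoid_arc[OF e] S arc_inclusion[OF e]],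
          rule Gp_ArrI[OF lie_groupoid_arc[OF e] H smooth_functor_branch[OF e]])
    have cod: "Cod Gp ?\<iota> = Dom Gp CST" "Cod Gp ?B = Dom Gp Q" "Cod Gp ?B = Dom Gp PR"
      by (simp_all add: CST_def Q_def PR_def)
    \<comment> \<open>The inclusion of the arc is q after the branch functor, so q cancels against
      its inverse inside \<open>g\<close>. What remains is p after the branch functor, which is
      trivial.\<close>
    have "Cmp L g (snd P ?\<iota>) = Cmp L g (Cmp L (snd P Q) (snd P ?B))"
      using branch_functor_lifts_arc[OF e, of x] Pcmp[OF A(2) arr(2) cod(2)] by (simp add: Q_def)
    also have "\<dots> = Cmp L (snd P PR) (snd P ?B)"
      using ass[OF Phom[OF A(2)] hom(2) hg] gQ by simp
    also have "\<dots> = snd P (gp_arrow (?arc x) ?Z (trivial_functor e))"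
      using deck_functor_trivial_on_arc[OF e, of x] Pcmp[OF A(2) arr(3) cod(3)] by (simp add: PR_def)
    also have "\<dots> = Cmp L f (snd P ?\<iota>)"
      using trivial_on_arc[OF e, of x] Pcmp[OF A(1) arr(1) cod(1)] by (simp add: CST_def f_def)
    finally show ?thesis by (simp add: restrict_arrow_def)
  qed
  have neq: "f \<noteq> g"
  proof
    let ?X = "top_of_set (sphere 0 1) :: complex topology"
    assume "f = g"
    \<comment> \<open>Composed with q, both arrows become images of smooth functors on the double
      cover, the trivial one and p, and the cohomology functor applies to these.\<close>
    then have "snd P (Cmp Gp CST Q) = snd P PR"
      using gQ Pcmp[OF arr(2,1)] by (simp add: f_def CST_def Q_def)
    moreover have t: "Cmp Gp CST Q = gp_arrow ?H ?Z (trivial_functor e)"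
      unfolding CST_def Q_def Gp_Cmp[OF H S Z smooth_functor_cover[OF e] smooth_functor_trivial[OF e S]]
      by (simp add: trivial_functor_def[OF e] o_def)
    ultimately have "snd P (gp_arrow ?H ?Z (trivial_functor e)) = snd P PR" by simp
    from localization_kernel[OF assms(2) Gp_is_category gp_equivalences_subset coh_category_is_category
        coh_functor_is_functor _ Gp_ArrI[OF H Z smooth_functor_trivial[OF e H]] arr(3) this, of ?X]
    have "snd (coh_functor ?X) (gp_arrow ?H ?Z (trivial_functor e)) = snd (coh_functor ?X) PR"
      using coh_functor_inverts_equivalences by blast
    then show False
      using deck_functor_coh_rel[OF e]
      by (simp add: PR_def coh_functor_arrow[OF H Z smooth_functor_trivial[OF e H]] coh_functor_arrow[OF H Z smooth_functor_deck[OF e]])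
  qed
  \<comment> \<open>The domain with index 1 omits only -1, the one with index -1 omits only
    1.\<close>
  have un: "e ` branch_dom 1 \<union> e ` branch_dom (- 1) = pts (circle e)"
    by (auto simp: pts_circle[OF e] branch_dom_def)
  show ?thesis
    by (rule exI[of _ "e ` branch_dom 1"], rule exI[of _ "e ` branch_dom (- 1)"], rule exI[of _ f], rule exI[of _ g])
      (intro conjI openin_branch_dom[OF e] un restr hom(1)[folded f_def] hg neq)
qed

end
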